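(* There is a constant $\alpha>0$ such that, unless every problem in $\mathcal{NP}$ can be solved in quasi-polynomial time, there is no polynomial-time algorithm for the minimum crossing spanning tree problem that achieves an additive $O(\log^\alpha m)$ approximation for the degree bounds; i.e., no polynomial-time algorithm that, on every instance admitting a spanning tree satisfying all degree bounds, outputs a spanning tree $T$ with $|T\cap E_i|\le b_i+O(\log^\alpha m)$ for all $i\in[m]$. This holds even when there are no costs (all costs zero).
   Context: The minimum crossing spanning tree problem: given an undirected graph $G=(V,E)$, edge costs $c:E\to\mathbb{R}_{\ge0}$, and $m$ degree constraints given by pairs $(E_i,b_i)$ with $E_i\subseteq E$ arbitrary edge subsets and $b_i\in\mathbb{N}$, find a minimum-cost spanning tree $T$ with $|T\cap E_i|\le b_i$ for all $i\in[m]$. *)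

theory Defs
  imports Complex_Main "HOL-Library.Landau_Symbols"
begin

section \<open>Deterministic multi-tape Turing machines\<close>

datatype move = MoveLeft | Stay | MoveRight

text \<open>
  States and tape symbols are initial segments of the natural numbers. State 0 is the start
  state and state 1 the halting state. Symbol 0 is the blank; the bits \<open>False\<close> and
  \<open>True\<close> are written as the symbols 1 and 2. Tapes are infinite in both directions.
  The function \<open>trans\<close> takes the state and the list of scanned symbols and returns the
  new state and, for each tape, the symbol to write and the head move.
\<close>

record tm =
  ntapes :: nat
  nstates :: nat
  nsyms :: nat
  trans :: "nat \<Rightarrow> nat list \<Rightarrow> nat \<times> (nat \<times> move) list"

text \<open>
  A machine is a finite object: only the finitely many values of \<open>trans\<close> constrained
  here are ever used in a run.
\<close>

definition wf_tm :: "tm \<Rightarrow> bool" where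
  "wf_tm M \<longleftrightarrow>
     2 \<le> ntapes M \<and> 2 \<le> nstates M \<and> 3 \<le> nsyms M \<and>
     (\<forall>q<nstates M. \<forall>ss. length ss = ntapes M \<and> (\<forall>s\<in>set ss. s < nsyms M) \<longrightarrow>
        (case trans M q ss of (q', as) \<Rightarrow>
           q' < nstates M \<and> length as = ntapes M \<and> (\<forall>(s, d)\<in>set as. s < nsyms M)))"

type_synonym tape = "(int \<Rightarrow> nat) \<times> int"
type_synonym config = "nat \<times> tape list"

fun offset :: "move \<Rightarrow> int" where
  "offset MoveLeft = -1"
| "offset Stay = 0"
| "offset MoveRight = 1"

fun act :: "nat \<times> move \<Rightarrow> tape \<Rightarrow> tape" where
  "act (s, d) (t, h) = (t(h := s), h + offset d)"

fun step :: "tm \<Rightarrow> config \<Rightarrow> config" where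
  "step M (q, ts) =
     (if q = 1 then (q, ts)
      else (case trans M q (map (\<lambda>(t, h). t h) ts) of (q', as) \<Rightarrow> (q', map2 act as ts)))"

definition bit_tape :: "bool list \<Rightarrow> int \<Rightarrow> nat" where
  "bit_tape x i =
     (if 0 \<le> i \<and> i < int (length x) then (if x ! nat i then 2 else 1) else 0)"

text \<open>The input is on tape 0, the output is read off tape 1.\<close>

definition init_config :: "tm \<Rightarrow> bool list \<Rightarrow> config" where
  "init_config M x = (0, (bit_tape x, 0) # replicate (ntapes M - 1) (\<lambda>_. 0, 0))"

definition run :: "tm \<Rightarrow> bool list \<Rightarrow> nat \<Rightarrow> config" where
  "run M x t = (step M ^^ t) (init_config M x)"

definition computes_within ::
    "tm \<Rightarrow> (bool list \<Rightarrow> bool list) \<Rightarrow> (nat \<Rightarrow> real) \<Rightarrow> bool" where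
  "computes_within M f T \<longleftrightarrow>
     (\<forall>x. \<exists>t. real t \<le> T (length x) \<and>
        fst (run M x t) = 1 \<and> fst (snd (run M x t) ! 1) = bit_tape (f x))"


section \<open>Complexity classes\<close>

definition poly_time :: "(bool list \<Rightarrow> bool list) \<Rightarrow> bool" where
  "poly_time f \<longleftrightarrow>
     (\<exists>M c k. wf_tm M \<and> computes_within M f (\<lambda>n. c * real n ^ k + c))"

text \<open>Quasi-polynomial means \<open>2 ^ polylog n\<close>. Note that \<open>log 2 0 = 0\<close>.\<close>

definition quasi_poly_time :: "(bool list \<Rightarrow> bool list) \<Rightarrow> bool" where
  "quasi_poly_time f \<longleftrightarrow>
     (\<exists>M c k. wf_tm M \<and> computes_within M f (\<lambda>n. 2 powr (c * log 2 (real n) ^ k + c)))"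

definition decider :: "bool list set \<Rightarrow> bool list \<Rightarrow> bool list" where
  "decider L x = [x \<in> L]"

definition QP :: "bool list set set" where
  "QP = {L. quasi_poly_time (decider L)}"

text \<open>
  Structured data are written over the four tokens 0, 1, opening and closing bracket, each
  coded by two bits.
\<close>

definition enc_bits :: "bool list \<Rightarrow> bool list" where
  "enc_bits w = [True, False] @ concat (map (\<lambda>b. [False, b]) w) @ [True, True]"

definition enc_list :: "('a \<Rightarrow> bool list) \<Rightarrow> 'a list \<Rightarrow> bool list" where
  "enc_list enc xs = [True, False] @ concat (map enc xs) @ [True, True]"

text \<open>The class NP, via polynomial-time verification of certificates of polynomial length.\<close>

definition NP :: "bool list set set" where
  "NP = {L. \<exists>V c k. poly_time (decider V) \<and>
          (\<forall>x. x \<in> L \<longleftrightarrow>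
             (\<exists>w. length w \<le> c * length x ^ k + c \<and> enc_bits x @ enc_bits w \<in> V))}"


section \<open>Minimum crossing spanning tree\<close>

text \<open>
  Edges are two-element sets of vertices. The entry \<open>(F, b)\<close> at position \<open>i\<close> of
  \<open>constraints\<close> is the \<open>i\<close>-th degree constraint, so the number \<open>m\<close> of
  constraints is the length of this list.
\<close>

record 'v mcst =
  verts :: "'v set"
  edges :: "'v set set"
  cost :: "'v set \<Rightarrow> real"
  constraints :: "('v set set \<times> nat) list"

definition wf_mcst :: "'v mcst \<Rightarrow> bool" where
  "wf_mcst I \<longleftrightarrow>
     finite (verts I) \<and> verts I \<noteq> {} \<and>
     (\<forall>e\<in>edges I. e \<subseteq> verts I \<and> card e = 2) \<and>
     (\<forall>e\<in>edges I. 0 \<le> cost I e) \<and>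
     (\<forall>(F, b)\<in>set (constraints I). F \<subseteq> edges I)"

definition connected_on :: "'v set \<Rightarrow> 'v set set \<Rightarrow> bool" where
  "connected_on V T \<longleftrightarrow> (\<forall>u\<in>V. \<forall>v\<in>V. (u, v) \<in> {(a, b). {a, b} \<in> T}\<^sup>*)"

definition is_cycle :: "'v set set \<Rightarrow> 'v list \<Rightarrow> bool" where
  "is_cycle T vs \<longleftrightarrow>
     3 \<le> length vs \<and> distinct vs \<and>
     (\<forall>i<length vs. {vs ! i, vs ! (Suc i mod length vs)} \<in> T)"

definition spanning_tree :: "'v mcst \<Rightarrow> 'v set set \<Rightarrow> bool" where
  "spanning_tree I T \<longleftrightarrow>
     T \<subseteq> edges I \<and> connected_on (verts I) T \<and> (\<nexists>vs. is_cycle T vs)"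

text \<open>All degree bounds hold up to an additive violation of \<open>r\<close>.\<close>

definition meets_bounds :: "'v mcst \<Rightarrow> 'v set set \<Rightarrow> real \<Rightarrow> bool" where
  "meets_bounds I T r \<longleftrightarrow>
     (\<forall>(F, b)\<in>set (constraints I). real (card (T \<inter> F)) \<le> real b + r)"

definition feasible :: "'v mcst \<Rightarrow> bool" where
  "feasible I \<longleftrightarrow> (\<exists>T. spanning_tree I T \<and> meets_bounds I T 0)"

definition zero_cost :: "'v mcst \<Rightarrow> bool" where
  "zero_cost I \<longleftrightarrow> (\<forall>e\<in>edges I. cost I e = 0)"


section \<open>Encoding of instances and solutions\<close>

fun binary :: "nat \<Rightarrow> bool list" where
  "binary n = (if n = 0 then [] else odd n # binary (n div 2))"

declare binary.simps [simp del]

definition enc_nat :: "nat \<Rightarrow> bool list" where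
  "enc_nat n = enc_bits (binary n)"

text \<open>Only used for nonnegative rationals, written as a reduced fraction.\<close>

definition enc_rat :: "rat \<Rightarrow> bool list" where
  "enc_rat r = (case quotient_of r of (p, q) \<Rightarrow> enc_nat (nat p) @ enc_nat (nat q))"

definition enc_edge :: "nat set \<Rightarrow> bool list" where
  "enc_edge e = enc_nat (Min e) @ enc_nat (Max e)"

definition lists_set :: "'a list \<Rightarrow> 'a set \<Rightarrow> bool" where
  "lists_set xs A \<longleftrightarrow> distinct xs \<and> set xs = A"

text \<open>
  An instance has several encodings, one for each order in which its vertices and edges are
  listed. Costs are written in binary, so only instances with rational costs have an encoding.
\<close>

definition encodes_instance :: "bool list \<Rightarrow> nat mcst \<Rightarrow> bool" where
  "encodes_instance x I \<longleftrightarrow>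
     (\<exists>vs es c Fs.
        lists_set vs (verts I) \<and> lists_set es (edges I) \<and>
        (\<forall>e\<in>edges I. cost I e = real_of_rat (c e)) \<and>
        list_all2 (\<lambda>(fs, b) (F, b'). lists_set fs F \<and> b = b') Fs (constraints I) \<and>
        x = enc_list enc_nat vs @
            enc_list (\<lambda>e. enc_edge e @ enc_rat (c e)) es @
            enc_list (\<lambda>(fs, b). enc_list enc_edge fs @ enc_nat b) Fs)"

definition encodes_edges :: "bool list \<Rightarrow> nat set set \<Rightarrow> bool" where
  "encodes_edges y T \<longleftrightarrow> (\<exists>ts. lists_set ts T \<and> y = enc_list enc_edge ts)"


section \<open>Approximation of the degree bounds\<close>

text \<open>
  The function \<open>f\<close> solves the instances satisfying \<open>K\<close> with additive violation
  \<open>g m\<close> of the degree bounds. Nothing is required of its output on other instances.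
\<close>

definition additive_approx ::
    "(nat mcst \<Rightarrow> bool) \<Rightarrow> (bool list \<Rightarrow> bool list) \<Rightarrow> (nat \<Rightarrow> real) \<Rightarrow> bool" where
  "additive_approx K f g \<longleftrightarrow>
     (\<forall>I x. wf_mcst I \<and> K I \<and> feasible I \<and> encodes_instance x I \<longrightarrow>
        (\<exists>T. encodes_edges (f x) T \<and> spanning_tree I T \<and>
             meets_bounds I T (g (length (constraints I)))))"

definition has_poly_time_approx :: "(nat mcst \<Rightarrow> bool) \<Rightarrow> (nat \<Rightarrow> real) \<Rightarrow> bool" where
  "has_poly_time_approx K h \<longleftrightarrow>
     (\<exists>f g. poly_time f \<and> g \<in> O(h) \<and> additive_approx K f g)"

end

theory Submission
  imports Defs
begin

text \<open>
  A machine for a language in NP is rewritten as a program over finitely many stacks, and the runs of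
  length \<open>2 ^ w\<close> of that program, on all choices of certificate bits, are described by a set of
  clauses in the style of Cook and Levin. Here \<open>2 ^ w\<close> exceeds the polynomial running time, so
  that \<open>w\<close> is logarithmic in the input length. Clauses are addressed by bit strings of length \<open>L = O(w)\<close>.

  A variable \<open>s\<close> becomes a triangle on a common vertex \<open>0\<close> and \<open>a\<^sub>s\<close>, \<open>b\<^sub>s\<close>. A spanning tree contains
  \<open>{0, a\<^sub>s}\<close> or \<open>{0, b\<^sub>s}\<close>, so the edges missing from the tree form a partial assignment. To amplify
  the gap, take \<open>k\<close> disjoint copies of the formula and, for every \<open>k\<close>-tuple of clauses, with the
  \<open>j\<close>-th clause read in the \<open>j\<close>-th copy, require that at least \<open>k\<close> of the literals hold. If
  the violation is below \<open>k\<close> then every tuple contains a true literal, and hence some copy satisfies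
  all its clauses. There are \<open>m = 2 ^ (L * k)\<close> constraints. With \<open>k\<close> a large multiple of \<open>w\<close> this gives
  \<open>k > C * sqrt (ln m)\<close> while \<open>m\<close> is quasi-polynomial in the input length. So an approximation algorithm
  with violation \<open>O(sqrt (ln m))\<close> can be run on this instance to decide the language.

  The decider is itself a stack program, which writes the instance, simulates the approximation algorithm
  and then tests every tuple against the edges occurring in its output. The test is sound for any output whatsoever.
\<close>

text \<open>The formula itself needs no gap. If it is unsatisfiable, every assignment leaves a false
  clause in each of the \<open>k\<close> independent copies, and the tuple of these clauses has no
  true literal; a satisfying assignment makes at least \<open>k\<close> literals true in every
  tuple. The additive gap is thus the number of copies, bought with \<open>2 ^ (L * k)\<close>
  tuples. As \<open>L\<close> is proportional to \<open>w\<close> and \<open>k = D * w\<close>,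
  \<open>ln m\<close> is of order \<open>k ^ 2 / D\<close>: this is where the exponent 1/2 comes
  from, and why a large \<open>D\<close> beats any constant. The price dictates the tableau: clauses
  need addresses of \<open>O(w)\<close> bits and boundedly many literals. Keeping stacks as pointers
  into an append-only heap achieves this, since a step concerns one node and every other stack
  merely keeps its pointer. Stack programs serve twice, as the computation described by the clauses
  and as the language of the decider. The final test reads the value of a variable off a single
  edge, the one from the hub to the first vertex of its triangle. Any output string therefore yields
  a total assignment, and a passed test exhibits a satisfied copy.\<close>

text \<open>
  Programs work on infinitely many stacks of positive numbers. The symbol 0 is read from an empty
  stack, and pushing 0 has no effect. A program is its own control state: \<open>Case\<close> continues with
  a program depending on the symbol read.
\<close>

datatype cmd =
    Push nat nat
  | Pop nat
  | Case nat "nat \<Rightarrow> cmd list"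
  | While nat "nat \<Rightarrow> bool" "cmd list"

type_synonym store = "nat \<Rightarrow> nat list"

definition top0 :: "nat list \<Rightarrow> nat" where
  "top0 xs = (case xs of [] \<Rightarrow> 0 | x # _ \<Rightarrow> x)"

lemma top0_simps [simp]: "top0 [] = 0" "top0 (x # xs) = x"
  by (auto simp: top0_def)

datatype sop = Keep | Drop | Add nat

fun apply_sop :: "sop \<Rightarrow> nat list \<Rightarrow> nat list" where
  "apply_sop Keep xs = xs"
| "apply_sop Drop xs = tl xs"
| "apply_sop (Add a) xs = a # xs"

fun cidx :: "cmd list \<Rightarrow> nat" where
  "cidx [] = 0"
| "cidx (Push i a # c) = i"
| "cidx (Pop i # c) = i"
| "cidx (Case i f # c) = i"
| "cidx (While i P p # c) = i"

text \<open>Making \<open>Push i 0\<close> a no-op lets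
  \<open>Case i (\<lambda>s. [Push j s])\<close> transfer a top symbol without a test for the empty
  stack; several programs below rely on it.\<close>

fun cact :: "cmd list \<Rightarrow> nat \<Rightarrow> sop \<times> cmd list" where
  "cact [] s = (Keep, [])"
| "cact (Push i a # c) s = (if a = 0 then Keep else Add a, c)"
| "cact (Pop i # c) s = (Drop, c)"
| "cact (Case i f # c) s = (Keep, f s @ c)"
| "cact (While i P p # c) s = (Keep, if P s then p @ While i P p # c else c)"

definition sstep :: "cmd list \<times> store \<Rightarrow> cmd list \<times> store" where
  "sstep z = (case z of (c, \<sigma>) \<Rightarrow>
     let i = cidx c; r = cact c (top0 (\<sigma> i)) in (snd r, \<sigma>(i := apply_sop (fst r) (\<sigma> i))))"

lemma sstep_simps [simp]:
  "sstep ([], \<sigma>) = ([], \<sigma>)"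
  "sstep (Push i a # c, \<sigma>) = (c, \<sigma>(i := (if a = 0 then \<sigma> i else a # \<sigma> i)))"
  "sstep (Pop i # c, \<sigma>) = (c, \<sigma>(i := tl (\<sigma> i)))"
  "sstep (Case i f # c, \<sigma>) = (f (top0 (\<sigma> i)) @ c, \<sigma>)"
  "sstep (While i P p # c, \<sigma>) = (if P (top0 (\<sigma> i)) then p @ While i P p # c else c, \<sigma>)"
  by (auto simp: sstep_def Let_def)

lemma sstep_nil_iter [simp]: "(sstep ^^ n) ([], \<sigma>) = ([], \<sigma>)"
  by (induction n) auto

text \<open>The continuation \<open>k\<close> is universally quantified, so a program may run as a
  prefix of any control list. Sequential composition is then concatenation, and a loop can be
  unfolded in place.\<close>

definition exec :: "cmd list \<Rightarrow> nat \<Rightarrow> store \<Rightarrow> store \<Rightarrow> bool" where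
  "exec p n \<sigma> \<sigma>' \<longleftrightarrow> (\<forall>k. (sstep ^^ n) (p @ k, \<sigma>) = (k, \<sigma>'))"

definition ex :: "cmd list \<Rightarrow> nat \<Rightarrow> store \<Rightarrow> store \<Rightarrow> bool" where
  "ex p B \<sigma> \<sigma>' \<longleftrightarrow> (\<exists>n\<le>B. exec p n \<sigma> \<sigma>')"

lemma exec_append:
  assumes "exec p n \<sigma> \<sigma>1" "exec q m \<sigma>1 \<sigma>2"
  shows "exec (p @ q) (n + m) \<sigma> \<sigma>2"
proof -
  have "(sstep ^^ (m + n)) ((p @ q) @ k, \<sigma>) = (k, \<sigma>2)" for k
    using assms by (simp add: exec_def funpow_add)
  then show ?thesis by (simp add: exec_def add.commute)
qed

lemma exec_step:
  assumes "\<And>k. sstep (p @ k, \<sigma>) = (q @ k, \<sigma>1)" "exec q n \<sigma>1 \<sigma>2"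
  shows "exec p (Suc n) \<sigma> \<sigma>2"
  using assms by (simp add: exec_def funpow_Suc_right del: funpow.simps)

lemma ex_mono: "ex p B \<sigma> \<sigma>' \<Longrightarrow> B \<le> B' \<Longrightarrow> ex p B' \<sigma> \<sigma>'"
  by (meson ex_def order_trans)

lemma ex_append: "ex p B \<sigma> \<sigma>1 \<Longrightarrow> ex q B' \<sigma>1 \<sigma>2 \<Longrightarrow> ex (p @ q) (B + B') \<sigma> \<sigma>2"
  unfolding ex_def by (meson add_mono exec_append)

lemma ex_step:
  assumes "\<And>k. sstep (p @ k, \<sigma>) = (q @ k, \<sigma>1)" "ex q B \<sigma>1 \<sigma>2"
  shows "ex p (Suc B) \<sigma> \<sigma>2"
  using assms exec_step unfolding ex_def by (metis Suc_le_mono)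

lemma ex_Nil [simp]: "ex [] B \<sigma> \<sigma>' \<longleftrightarrow> \<sigma>' = \<sigma>"
proof
  assume "ex [] B \<sigma> \<sigma>'"
  then obtain n where "exec [] n \<sigma> \<sigma>'" by (auto simp: ex_def)
  then have "(sstep ^^ n) ([], \<sigma>) = ([], \<sigma>')" unfolding exec_def by (metis append_Nil)
  then show "\<sigma>' = \<sigma>" by simp
qed (auto simp: ex_def exec_def intro!: exI[of _ 0])

lemma ex_Push: "ex c B (\<sigma>(i := (if a = 0 then \<sigma> i else a # \<sigma> i))) \<sigma>' \<Longrightarrow> ex (Push i a # c) (Suc B) \<sigma> \<sigma>'"
  by (rule ex_step) auto

lemma ex_Pop: "ex c B (\<sigma>(i := tl (\<sigma> i))) \<sigma>' \<Longrightarrow> ex (Pop i # c) (Suc B) \<sigma> \<sigma>'"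
  by (rule ex_step) auto

lemma ex_Case: "ex (f (top0 (\<sigma> i)) @ c) B \<sigma> \<sigma>' \<Longrightarrow> ex (Case i f # c) (Suc B) \<sigma> \<sigma>'"
  by (rule ex_step) auto

lemma ex_While_False: "\<not> P (top0 (\<sigma> i)) \<Longrightarrow> ex [While i P p] (Suc B) \<sigma> \<sigma>"
  by (rule ex_step[where q = "[]"]) auto

lemma ex_While_True:
  assumes "P (top0 (\<sigma> i))" "ex p B \<sigma> \<sigma>1" "ex [While i P p] B' \<sigma>1 \<sigma>2"
  shows "ex [While i P p] (Suc (B + B')) \<sigma> \<sigma>2"
  using assms(1) by (intro ex_step[OF _ ex_append[OF assms(2,3)]]) auto

text \<open>The family \<open>s\<close> acts as a loop invariant that fixes the whole store after
  \<open>j\<close> rounds, so one induction delivers both effect and time.\<close>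

lemma ex_While_iter:
  assumes "\<And>j. j < m \<Longrightarrow> P (top0 (s j i)) \<and> ex p B (s j) (s (Suc j))" "\<not> P (top0 (s m i))"
  shows "ex [While i P p] (m * Suc B + 1) (s 0) (s m)"
  using assms
proof (induction m arbitrary: s)
  case 0
  then show ?case by (auto intro: ex_While_False)
next
  case (Suc m)
  have "ex [While i P p] (m * Suc B + 1) (s (Suc 0)) (s (Suc m))"
    using Suc.IH[of "\<lambda>j. s (Suc j)"] Suc.prems by auto
  moreover have "P (top0 (s 0 i))" "ex p B (s 0) (s (Suc 0))"
    using Suc.prems(1)[of 0] by auto
  ultimately show ?case
    using ex_While_True[of P "s 0" i p B "s (Suc 0)"] by (metis add.assoc add_Suc mult_Suc)
qed

text \<open>Indices and pushed symbols are bounded; stack 1 is reserved for the output of the compiled machine.\<close>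

inductive wfp :: "nat \<Rightarrow> nat \<Rightarrow> cmd list \<Rightarrow> bool" for K S where
  wfp_Nil: "wfp K S []"
| wfp_Push: "i < K \<Longrightarrow> i \<noteq> 1 \<Longrightarrow> a < S \<Longrightarrow> wfp K S c \<Longrightarrow> wfp K S (Push i a # c)"
| wfp_Pop: "i < K \<Longrightarrow> i \<noteq> 1 \<Longrightarrow> wfp K S c \<Longrightarrow> wfp K S (Pop i # c)"
| wfp_Case: "i < K \<Longrightarrow> i \<noteq> 1 \<Longrightarrow> (\<And>s. s < S \<Longrightarrow> wfp K S (f s)) \<Longrightarrow> wfp K S c \<Longrightarrow> wfp K S (Case i f # c)"
| wfp_While: "i < K \<Longrightarrow> i \<noteq> 1 \<Longrightarrow> wfp K S p \<Longrightarrow> wfp K S c \<Longrightarrow> wfp K S (While i P p # c)"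

lemma wfp_simps [simp]:
  "wfp K S []"
  "wfp K S (Push i a # c) \<longleftrightarrow> i < K \<and> i \<noteq> 1 \<and> a < S \<and> wfp K S c"
  "wfp K S (Pop i # c) \<longleftrightarrow> i < K \<and> i \<noteq> 1 \<and> wfp K S c"
  "wfp K S (Case i f # c) \<longleftrightarrow> i < K \<and> i \<noteq> 1 \<and> (\<forall>s<S. wfp K S (f s)) \<and> wfp K S c"
  "wfp K S (While i P p # c) \<longleftrightarrow> i < K \<and> i \<noteq> 1 \<and> wfp K S p \<and> wfp K S c"
  by (auto intro: wfp.intros elim: wfp.cases)

lemma wfp_append [simp]: "wfp K S (p @ q) \<longleftrightarrow> wfp K S p \<and> wfp K S q"
proof
  assume "wfp K S (p @ q)"
  then show "wfp K S p \<and> wfp K S q"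
  proof (induction p)
    case (Cons a p)
    then show ?case by (cases a) auto
  qed auto
next
  assume *: "wfp K S p \<and> wfp K S q"
  then have "wfp K S p" by simp
  then show "wfp K S (p @ q)" using conjunct2[OF *] by induction auto
qed

section \<open>Finitely many control states\<close>

definition good_states :: "nat \<Rightarrow> nat \<Rightarrow> cmd list set \<Rightarrow> bool" where
  "good_states K S R \<longleftrightarrow> finite R \<and> [] \<in> R \<and>
     (\<forall>r\<in>R. r \<noteq> [] \<longrightarrow> cidx r < K \<and> cidx r \<noteq> 1 \<and>
        (\<forall>s<S. snd (cact r s) \<in> R \<and> (\<forall>a. fst (cact r s) = Add a \<longrightarrow> a < S \<and> a \<noteq> 0)))"

lemma cidx_append [simp]: "r \<noteq> [] \<Longrightarrow> cidx (r @ k) = cidx r"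
  by (cases r rule: cidx.cases) auto

lemma cact_append [simp]: "r \<noteq> [] \<Longrightarrow> cact (r @ k) s = (fst (cact r s), snd (cact r s) @ k)"
  by (cases r rule: cidx.cases) auto

text \<open>What remains to be executed of a compound program is a remainder of a component followed
  by a fixed continuation. So finitely many control lists occur, although a loop puts its own body
  in front of itself. They become the states of a Turing machine and also the state variables of the
  tableau.\<close>

lemma good_states_exist: "wfp K S p \<Longrightarrow> \<exists>R. good_states K S R \<and> p \<in> R"
proof (induction rule: wfp.induct)
  case wfp_Nil
  then show ?case by (intro exI[of _ "{[]}"]) (auto simp: good_states_def)
next
  case (wfp_Push i a c)
  then obtain R where "good_states K S R" "c \<in> R" by auto
  then show ?case using wfp_Push by (intro exI[of _ "insert (Push i a # c) R"]) (auto simp: good_states_def)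
next
  case (wfp_Pop i c)
  then obtain R where "good_states K S R" "c \<in> R" by auto
  then show ?case using wfp_Pop by (intro exI[of _ "insert (Pop i # c) R"]) (auto simp: good_states_def)
next
  case (wfp_Case i f c)
  then obtain R where R: "good_states K S R" "c \<in> R" by auto
  obtain R' where R': "\<And>s. s < S \<Longrightarrow> good_states K S (R' s) \<and> f s \<in> R' s"
    using wfp_Case by metis
  let ?Q = "insert (Case i f # c) (R \<union> (\<Union>s<S. (\<lambda>r. r @ c) ` R' s))"
  have "good_states K S ?Q"
    unfolding good_states_def
  proof (intro conjI ballI impI)
    show "finite ?Q" using R R' by (auto simp: good_states_def)
    show "[] \<in> ?Q" using R by (auto simp: good_states_def)
    fix r assume "r \<in> ?Q" "r \<noteq> []"
    then consider "r = Case i f # c" | "r \<in> R" | s r' where "s < S" "r' \<in> R' s" "r = r' @ c" "r' \<noteq> []"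
      using R by fastforce
    then have "cidx r < K \<and> cidx r \<noteq> 1 \<and> (\<forall>s<S. snd (cact r s) \<in> ?Q \<and> (\<forall>a. fst (cact r s) = Add a \<longrightarrow> a < S \<and> a \<noteq> 0))"
    proof cases
      case 1
      have "f s @ c \<in> ?Q" if "s < S" for s using R'[OF that] that by blast
      then show ?thesis using wfp_Case(1,2) unfolding 1 by (simp del: insert_iff Un_iff UN_iff)
    next
      case 2
      then show ?thesis using R \<open>r \<noteq> []\<close> by (auto simp: good_states_def)
    next
      case 3
      have in_Q: "r @ c \<in> ?Q" if "r \<in> R' s" for r using that 3 by blast
      have "cidx r' < K \<and> cidx r' \<noteq> 1 \<and>
          (\<forall>t<S. snd (cact r' t) \<in> R' s \<and> (\<forall>a. fst (cact r' t) = Add a \<longrightarrow> a < S \<and> a \<noteq> 0))"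
        using R'[OF 3(1)] 3(2,4) by (auto simp: good_states_def)
      then show ?thesis using in_Q 3(3,4) by (simp del: insert_iff Un_iff UN_iff)
    qed
    then show "cidx r < K" "cidx r \<noteq> 1" "\<forall>s<S. snd (cact r s) \<in> ?Q \<and> (\<forall>a. fst (cact r s) = Add a \<longrightarrow> a < S \<and> a \<noteq> 0)" by auto
  qed
  then show ?case by blast
next
  case (wfp_While i p c P)
  then obtain R R' where R: "good_states K S R" "c \<in> R" and R': "good_states K S R'" "p \<in> R'" by auto
  let ?w = "While i P p # c"
  let ?Q = "insert ?w (R \<union> (\<lambda>r. r @ ?w) ` R')"
  have "good_states K S ?Q"
    unfolding good_states_def
  proof (intro conjI ballI impI)
    show "finite ?Q" using R R' by (auto simp: good_states_def)
    show "[] \<in> ?Q" using R by (auto simp: good_states_def)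
    fix r assume "r \<in> ?Q" "r \<noteq> []"
    then consider "r = ?w" | "r \<in> R" | r' where "r' \<in> R'" "r = r' @ ?w" "r' \<noteq> []"
      by fastforce
    then have "cidx r < K \<and> cidx r \<noteq> 1 \<and> (\<forall>s<S. snd (cact r s) \<in> ?Q \<and> (\<forall>a. fst (cact r s) = Add a \<longrightarrow> a < S \<and> a \<noteq> 0))"
    proof cases
      case 1
      then show ?thesis using wfp_While R R' by auto
    next
      case 2
      then show ?thesis using R \<open>r \<noteq> []\<close> by (auto simp: good_states_def)
    next
      case 3
      then show ?thesis using R' by (auto simp: good_states_def)
    qed
    then show "cidx r < K" "cidx r \<noteq> 1" "\<forall>s<S. snd (cact r s) \<in> ?Q \<and> (\<forall>a. fst (cact r s) = Add a \<longrightarrow> a < S \<and> a \<noteq> 0)" by auto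
  qed
  then show ?case by blast
qed

section \<open>Compilation of stack programs into Turing machines\<close>

declare step.simps [simp del]

text \<open>The head stands on the top of the stack, the rest of the stack extends to the right and
  all other cells are blank, so an empty stack scans the symbol 0.\<close>

definition tape_of :: "nat list \<Rightarrow> int \<Rightarrow> tape" where
  "tape_of xs h = (\<lambda>p. if h \<le> p \<and> p < h + int (length xs) then xs ! nat (p - h) else 0, h)"

lemma tape_of_top [simp]: "fst (tape_of xs h) h = top0 xs"
  by (cases xs) (auto simp: tape_of_def)

lemma tape_of_snd [simp]: "snd (tape_of xs h) = h"
  by (auto simp: tape_of_def)

lemma tape_of_write_same: "act (top0 xs, Stay) (tape_of xs h) = tape_of xs h"
  by (cases xs) (auto simp: tape_of_def fun_eq_iff)

lemma tape_of_Drop: "act (0, MoveRight) (tape_of xs h) = tape_of (tl xs) (h + 1)"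
proof (cases xs)
  case (Cons a list)
  have "nat (p - h) = Suc (nat (p - (h + 1)))" if "h < p" for p using that by auto
  then show ?thesis using Cons by (auto simp: tape_of_def fun_eq_iff nth_Cons')
qed (auto simp: tape_of_def)

lemma tape_of_Add1: "act (top0 xs, MoveLeft) (tape_of xs h) = (fst (tape_of xs h), h - 1)"
  by (cases xs) (auto simp: tape_of_def fun_eq_iff)

lemma tape_of_Add2: "act (a, Stay) (fst (tape_of xs h), h - 1) = tape_of (a # xs) (h - 1)"
proof -
  have "nat (p - (h - 1)) = Suc (nat (p - h))" if "h \<le> p" for p using that by auto
  then show ?thesis by (auto simp: tape_of_def fun_eq_iff nth_Cons')
qed

text \<open>Tape 1 must keep its head at 0, because the output convention fixes the absolute
  position of the answer bit.\<close>

definition rep :: "nat \<Rightarrow> nat \<Rightarrow> store \<Rightarrow> tape list \<Rightarrow> bool" where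
  "rep K S \<sigma> ts \<longleftrightarrow> length ts = K \<and>
     (\<forall>i<K. (\<exists>h. ts ! i = tape_of (\<sigma> i) h \<and> (i = 1 \<longrightarrow> h = 0)) \<and> (\<forall>a\<in>set (\<sigma> i). a < S))"

text \<open>\<open>Some (c, Some (i, a))\<close> is the middle of a push: the head of tape
  \<open>i\<close> has moved left and \<open>a\<close> is still to be written. \<open>None\<close>
  is the halting state.\<close>

type_synonym tstate = "(cmd list \<times> (nat \<times> nat) option) option"

definition tm_states :: "nat \<Rightarrow> nat \<Rightarrow> cmd list set \<Rightarrow> tstate set" where
  "tm_states K S R = insert None (Some ` (R \<times> insert None (Some ` (({..<K} - {1}) \<times> {..<S}))))"

definition stays :: "nat list \<Rightarrow> (nat \<times> move) list" where
  "stays ss = map (\<lambda>s. (s, Stay)) ss"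

text \<open>The exhausted program copies the top of stack 2 to tape 1, which turns the result symbol
  into the output, and halts.\<close>

fun ttrans :: "tstate \<Rightarrow> nat list \<Rightarrow> tstate \<times> (nat \<times> move) list" where
  "ttrans None ss = (None, stays ss)"
| "ttrans (Some (c, Some (i, a))) ss = (Some (c, None), (stays ss)[i := (a, Stay)])"
| "ttrans (Some (c, None)) ss =
     (if c = [] then (None, (stays ss)[1 := (ss ! 2, Stay)])
      else let i = cidx c; c' = snd (cact c (ss ! i)) in
       (case fst (cact c (ss ! i)) of
          Keep \<Rightarrow> (Some (c', None), stays ss)
        | Drop \<Rightarrow> (Some (c', None), (stays ss)[i := (0, MoveRight)])
        | Add a \<Rightarrow> (Some (c', Some (i, a)), (stays ss)[i := (ss ! i, MoveLeft)])))"

lemma length_stays [simp]: "length (stays ss) = length ss"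
  by (simp add: stays_def)

lemma snd_ttrans_length [simp]: "length (snd (ttrans q ss)) = length ss"
  by (induction q ss rule: ttrans.induct) (auto simp: Let_def split: sop.split)

lemma ttrans_closed:
  assumes "good_states K S R" "q \<in> tm_states K S R" "length ss = K" "\<forall>s\<in>set ss. s < S" "3 \<le> K"
  shows "fst (ttrans q ss) \<in> tm_states K S R \<and> (\<forall>(s, d)\<in>set (snd (ttrans q ss)). s < S)"
proof -
  have *: "\<forall>(s, d)\<in>set ((stays ss)[i := (a, m)]). s < S" if "a < S" for i a m
    using set_update_subset_insert[of "stays ss" i "(a, m)"] assms(4) that by (auto simp: stays_def)
  have st: "\<forall>(s, d)\<in>set (stays ss). s < S" using assms(4) by (auto simp: stays_def)
  have n: "ss ! i < S" if "i < K" for i using assms(3,4) that by auto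
  have z: "0 < S" using n[of 0] assms(5) by auto
  consider "q = None" | c i a where "q = Some (c, Some (i, a))" "c \<in> R" "i < K" "i \<noteq> 1" "a < S"
    | "q = Some ([], None)" | c where "q = Some (c, None)" "c \<in> R" "c \<noteq> []"
    using assms(2) by (auto simp: tm_states_def)
  then show ?thesis
  proof cases
    case 4
    let ?i = "cidx c"
    let ?r = "cact c (ss ! ?i)"
    have i: "?i < K" "?i \<noteq> 1" and c': "snd ?r \<in> R" and a: "\<And>a. fst ?r = Add a \<Longrightarrow> a < S"
      using assms(1) 4 n by (auto simp: good_states_def)
    show ?thesis
    proof (cases "fst ?r")
      case (Add a')
      then show ?thesis using 4 i c' a[OF Add] *[of "ss ! ?i" ?i MoveLeft] n[OF i(1)]
        by (auto simp: Let_def tm_states_def)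
    qed (use 4 i c' st *[of 0 ?i MoveRight] z in \<open>auto simp: Let_def tm_states_def\<close>)
  next
    case 3
    then show ?thesis using *[of "ss ! 2" 1 Stay] n[of 2] assms(5) by (simp add: tm_states_def)
  qed (use st * in \<open>auto simp: tm_states_def\<close>)
qed

definition stack_tm :: "nat \<Rightarrow> nat \<Rightarrow> cmd list set \<Rightarrow> (tstate \<Rightarrow> nat) \<Rightarrow> tm" where
  "stack_tm K S R h = \<lparr>ntapes = K, nstates = card (tm_states K S R), nsyms = S,
     trans = (\<lambda>q ss. let r = ttrans (inv_into (tm_states K S R) h q) ss in (h (fst r), snd r))\<rparr>"

text \<open>The machine model prescribes 0 as start state and 1 as halting state, so the numbering
  of states has to meet two given values.\<close>

lemma bij_fix_two:
  fixes A :: "'a set"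
  assumes "finite A" "a \<in> A" "b \<in> A" "a \<noteq> b"
  shows "\<exists>h. bij_betw h A {0..<card A} \<and> h a = 0 \<and> h b = (1::nat)"
proof -
  have c: "card (A - {a, b}) = card A - 2"
    using assms by (simp add: card_Diff_subset)
  have c2: "2 \<le> card A"
    using assms card_mono[of A "{a, b}"] by auto
  obtain g where g: "bij_betw g (A - {a, b}) {0..<card A - 2}"
    using ex_bij_betw_finite_nat[of "A - {a, b}"] assms c by auto
  define h where "h x = (if x = a then 0 else if x = b then 1 else g x + 2)" for x
  have "bij_betw (\<lambda>x. x + 2) {0..<card A - 2} {2..<card A}"
    by (rule bij_betw_byWitness[where f' = "\<lambda>x. x - 2"]) (use c2 in auto)
  from bij_betw_trans[OF g this] have "bij_betw (\<lambda>x. g x + 2) (A - {a, b}) {2..<card A}"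
    by (simp add: comp_def)
  then have "bij_betw h (A - {a, b}) {2..<card A}"
    by (rule bij_betw_cong[THEN iffD1, rotated]) (auto simp: h_def)
  moreover have "bij_betw h {a, b} {0, 1}" using assms by (auto simp: bij_betw_def h_def)
  ultimately have "bij_betw h ((A - {a, b}) \<union> {a, b}) ({2..<card A} \<union> {0, 1})"
    by (rule bij_betw_combine) auto
  moreover have "(A - {a, b}) \<union> {a, b} = A" "{2..<card A} \<union> {0, 1} = {0..<card A}" using assms c2 by auto
  ultimately show ?thesis using assms(4) by (intro exI[of _ h]) (auto simp: h_def)
qed

context
  fixes K S :: nat and R :: "cmd list set" and h :: "tstate \<Rightarrow> nat"
  assumes K: "3 \<le> K" and S: "3 \<le> S" and good: "good_states K S R"
    and h: "bij_betw h (tm_states K S R) {0..<card (tm_states K S R)}" and hN: "h None = 1"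
begin

lemma finite_tm_states: "finite (tm_states K S R)"
  using good by (auto simp: tm_states_def good_states_def)

lemma wf_stack_tm: 
  assumes "c \<in> R" shows "wf_tm (stack_tm K S R h)"
proof -
  let ?Q = "tm_states K S R"
  have "{None, Some (c, None)} \<subseteq> ?Q" using assms by (auto simp: tm_states_def)
  from card_mono[OF finite_tm_states this] have "2 \<le> card ?Q" by simp
  moreover have "inv_into ?Q h q \<in> ?Q" if "q < card ?Q" for q
    using h that by (metis bij_betw_imp_surj_on inv_into_into atLeast0LessThan lessThan_iff)
  moreover have "h r < card ?Q" if "r \<in> ?Q" for r
    using h that by (auto simp: bij_betw_def)
  moreover have "\<forall>z\<in>set (snd (ttrans q ss)). fst z < S" "fst (ttrans q ss) \<in> ?Q"
    if "q \<in> ?Q" "length ss = K" "\<forall>s\<in>set ss. s < S" for q ss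
    using ttrans_closed[OF good that K] by auto
  ultimately have "\<forall>q<card ?Q. \<forall>ss. length ss = K \<and> (\<forall>s\<in>set ss. s < S) \<longrightarrow>
      h (fst (ttrans (inv_into ?Q h q) ss)) < card ?Q \<and> (\<forall>z\<in>set (snd (ttrans (inv_into ?Q h q) ss)). fst z < S)"
    by (metis (no_types, lifting))
  then show ?thesis
    using K S \<open>2 \<le> card ?Q\<close> by (simp add: wf_tm_def stack_tm_def Let_def case_prod_beta)
qed

lemma step_stack_tm:
  assumes "q \<in> tm_states K S R" "q \<noteq> None"
  shows "step (stack_tm K S R h) (h q, ts) =
    (h (fst (ttrans q (map (\<lambda>(t, p). t p) ts))), map2 act (snd (ttrans q (map (\<lambda>(t, p). t p) ts))) ts)"
proof -
  have "None \<in> tm_states K S R" by (simp add: tm_states_def)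
  then have "h q \<noteq> 1" using h hN assms by (metis bij_betw_imp_inj_on inj_on_def)
  moreover have "inv_into (tm_states K S R) h (h q) = q"
    using h assms by (simp add: bij_betw_inv_into_left)
  ultimately show ?thesis by (simp add: stack_tm_def Let_def step.simps)
qed

lemma scanned:
  assumes "rep K S \<sigma> ts"
  shows "map (\<lambda>(t, p). t p) ts = map (\<lambda>i. top0 (\<sigma> i)) [0..<K]"
proof (rule nth_equalityI)
  fix i assume "i < length (map (\<lambda>(t, p). t p) ts)"
  then have "i < K" using assms by (auto simp: rep_def)
  then obtain p where "ts ! i = tape_of (\<sigma> i) p" using assms by (auto simp: rep_def)
  then have "(case ts ! i of (t, p) \<Rightarrow> t p) = top0 (\<sigma> i)"
    by (metis (mono_tags, lifting) case_prod_beta tape_of_snd tape_of_top)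
  then show "map (\<lambda>(t, p). t p) ts ! i = map (\<lambda>i. top0 (\<sigma> i)) [0..<K] ! i"
    using \<open>i < K\<close> assms by (simp add: rep_def)
qed (use assms in \<open>auto simp: rep_def\<close>)

lemma map2_stays:
  assumes "rep K S \<sigma> ts"
  shows "map2 act (stays (map (\<lambda>i. top0 (\<sigma> i)) [0..<K])) ts = ts"
proof (rule nth_equalityI)
  fix i assume "i < length (map2 act (stays (map (\<lambda>i. top0 (\<sigma> i)) [0..<K])) ts)"
  then have "i < K" by (auto simp: rep_def)
  then obtain p where "ts ! i = tape_of (\<sigma> i) p" using assms by (auto simp: rep_def)
  then show "map2 act (stays (map (\<lambda>i. top0 (\<sigma> i)) [0..<K])) ts ! i = ts ! i"
    using \<open>i < K\<close> assms by (simp add: rep_def stays_def tape_of_write_same)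
qed (use assms in \<open>auto simp: rep_def\<close>)

lemma map2_stays_update:
  assumes "rep K S \<sigma> ts" "i < K"
  shows "map2 act ((stays (map (\<lambda>i. top0 (\<sigma> i)) [0..<K]))[i := z]) ts = ts[i := act z (ts ! i)]"
proof -
  have "map2 act (xs[i := z]) ts = (map2 act xs ts)[i := act z (ts ! i)]" if "length xs = length ts" "i < length ts" for xs
    using that by (intro nth_equalityI) (auto simp: nth_list_update)
  then show ?thesis using assms map2_stays[OF assms(1)] by (simp add: rep_def)
qed

lemma rep_update:
  assumes "rep K S \<sigma> ts" "i < K" "i \<noteq> 1" "\<forall>a\<in>set xs. a < S"
  shows "rep K S (\<sigma>(i := xs)) (ts[i := tape_of xs p])"
  using assms by (auto simp: rep_def nth_list_update)

text \<open>Only \<open>Add\<close> takes two machine steps, a move to the left and a write; this is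
  the factor 2 in the time of the compiled machine.\<close>

lemma sim_step:
  assumes rep: "rep K S \<sigma> ts" and c: "c \<in> R"
  shows "\<exists>n\<le>2. \<exists>ts'. (step (stack_tm K S R h) ^^ n) (h (Some (c, None)), ts) =
      (h (Some (fst (sstep (c, \<sigma>)), None)), ts') \<and> rep K S (snd (sstep (c, \<sigma>))) ts' \<and> fst (sstep (c, \<sigma>)) \<in> R"
proof (cases "c = []")
  case True
  then show ?thesis using assms by (intro exI[of _ "0::nat"]) auto
next
  case False
  let ?M = "stack_tm K S R h"
  define i where "i = cidx c"
  define r where "r = cact c (top0 (\<sigma> i))"
  have i: "i < K" "i \<noteq> 1" using good c False by (auto simp: good_states_def i_def)
  have \<sigma>i: "\<forall>a\<in>set (\<sigma> i). a < S" using rep i by (auto simp: rep_def)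
  have "top0 (\<sigma> i) < S" using \<sigma>i S by (cases "\<sigma> i") auto
  then have c': "snd r \<in> R" and a: "\<And>a. fst r = Add a \<Longrightarrow> a < S \<and> a \<noteq> 0"
    using good c False by (auto simp: good_states_def i_def r_def)
  obtain p where p: "ts ! i = tape_of (\<sigma> i) p" using rep i by (auto simp: rep_def)
  have len: "length ts = K" using rep by (simp add: rep_def)
  have ss: "sstep (c, \<sigma>) = (snd r, \<sigma>(i := apply_sop (fst r) (\<sigma> i)))"
    by (simp add: sstep_def Let_def i_def r_def)
  have cQ: "Some (c, None) \<in> tm_states K S R" using c by (auto simp: tm_states_def)
  note st = step_stack_tm[OF cQ option.distinct(2), of ts, unfolded scanned[OF rep]]
  show ?thesis
  proof (cases "fst r")
    case Keep
    have "step ?M (h (Some (c, None)), ts) = (h (Some (snd r, None)), ts)"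
      using st False i Keep map2_stays[OF rep] by (simp add: Let_def i_def[symmetric] r_def[symmetric])
    then show ?thesis using ss Keep rep c' by (intro exI[of _ "1::nat"]) auto
  next
    case Drop
    have "step ?M (h (Some (c, None)), ts) = (h (Some (snd r, None)), ts[i := tape_of (tl (\<sigma> i)) (p + 1)])"
      using st False i Drop map2_stays_update[OF rep i(1)] p tape_of_Drop
      by (simp add: Let_def i_def[symmetric] r_def[symmetric])
    moreover have "rep K S (\<sigma>(i := tl (\<sigma> i))) (ts[i := tape_of (tl (\<sigma> i)) (p + 1)])"
      by (rule rep_update[OF rep i]) (use \<sigma>i in \<open>metis list.set_sel(2) tl_Nil\<close>)
    ultimately show ?thesis using ss Drop c' by (intro exI[of _ "1::nat"]) auto
  next
    case (Add a')
    let ?ts1 = "ts[i := (fst (tape_of (\<sigma> i) p), p - 1)]"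
    let ?q1 = "Some (snd r, Some (i, a'))"
    have 1: "step ?M (h (Some (c, None)), ts) = (h ?q1, ?ts1)"
      using st False i Add map2_stays_update[OF rep i(1)] p tape_of_Add1
      by (simp add: Let_def i_def[symmetric] r_def[symmetric])
    have "?q1 \<in> tm_states K S R" using c' i a[OF Add] by (auto simp: tm_states_def)
    moreover have "map (\<lambda>(t, p). t p) ?ts1 = (map (\<lambda>(t, p). t p) ts)[i := fst (tape_of (\<sigma> i) p) (p - 1)]"
      by (simp add: map_update)
    \<comment> \<open>The symbol \<open>v\<close> scanned after the move is arbitrary, as the write
      replaces it.\<close>
    moreover have "map2 act ((stays ((map (\<lambda>i. top0 (\<sigma> i)) [0..<K])[i := v]))[i := (a', Stay)]) ?ts1
        = ts[i := tape_of (a' # \<sigma> i) (p - 1)]" for v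
    proof -
      have "(stays ((map (\<lambda>i. top0 (\<sigma> i)) [0..<K])[i := v]))[i := (a', Stay)]
        = (stays (map (\<lambda>i. top0 (\<sigma> i)) [0..<K]))[i := (a', Stay)]"
        by (simp add: stays_def map_update)
      moreover have "map2 act (xs[i := z]) (ts[i := t]) = (map2 act (xs[i := z]) ts)[i := act z t]"
        if "length xs = length ts" for xs z t
      proof (rule nth_equalityI)
        fix j assume "j < length (map2 act (xs[i := z]) (ts[i := t]))"
        then show "map2 act (xs[i := z]) (ts[i := t]) ! j = (map2 act (xs[i := z]) ts)[i := act z t] ! j"
          using that by (cases "j = i") auto
      qed (use that in auto)
      ultimately show ?thesis using map2_stays_update[OF rep i(1)] len i tape_of_Add2 by simp
    qed
    ultimately have 2: "step ?M (h ?q1, ?ts1) = (h (Some (snd r, None)), ts[i := tape_of (a' # \<sigma> i) (p - 1)])"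
      using step_stack_tm[of ?q1 ?ts1] scanned[OF rep] by simp
    have "rep K S (\<sigma>(i := a' # \<sigma> i)) (ts[i := tape_of (a' # \<sigma> i) (p - 1)])"
      by (rule rep_update[OF rep i]) (use \<sigma>i a[OF Add] in auto)
    moreover have "(step ?M ^^ 2) (h (Some (c, None)), ts) = (h (Some (snd r, None)), ts[i := tape_of (a' # \<sigma> i) (p - 1)])"
      using 1 2 by (simp add: numeral_2_eq_2)
    ultimately show ?thesis using ss Add c' by (intro exI[of _ "2::nat"]) auto
  qed
qed

lemma sim_steps:
  assumes "rep K S \<sigma> ts" "c \<in> R"
  shows "\<exists>m\<le>2 * n. \<exists>ts'. (step (stack_tm K S R h) ^^ m) (h (Some (c, None)), ts) =
      (h (Some (fst ((sstep ^^ n) (c, \<sigma>)), None)), ts') \<and> rep K S (snd ((sstep ^^ n) (c, \<sigma>))) ts'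
      \<and> fst ((sstep ^^ n) (c, \<sigma>)) \<in> R"
proof (induction n)
  case 0
  then show ?case using assms by auto
next
  case (Suc n)
  let ?z = "(sstep ^^ n) (c, \<sigma>)"
  from Suc obtain m ts' where m: "m \<le> 2 * n" "(step (stack_tm K S R h) ^^ m) (h (Some (c, None)), ts) = (h (Some (fst ?z, None)), ts')"
    "rep K S (snd ?z) ts'" "fst ?z \<in> R" by auto
  from sim_step[OF m(3,4)] obtain m' ts'' where m': "m' \<le> 2"
    "(step (stack_tm K S R h) ^^ m') (h (Some (fst ?z, None)), ts') = (h (Some (fst (sstep ?z), None)), ts'')"
    "rep K S (snd (sstep ?z)) ts''" "fst (sstep ?z) \<in> R" by auto
  have "(step (stack_tm K S R h) ^^ (m' + m)) (h (Some (c, None)), ts) = (h (Some (fst (sstep ?z), None)), ts'')"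
    using m m' by (simp add: funpow_add)
  then show ?case using m m' by (intro exI[of _ "m' + m"]) auto
qed

end

definition bsym :: "bool \<Rightarrow> nat" where
  "bsym b = (if b then 2 else 1)"

definition sinit :: "bool list \<Rightarrow> store" where
  "sinit x = (\<lambda>_. [])(0 := map bsym x)"

lemma rep_init:
  assumes "ntapes M = K" "3 \<le> K" "3 \<le> S"
  shows "rep K S (sinit x) (snd (init_config M x))"
proof -
  have "(bit_tape x, 0) = tape_of (map bsym x) 0"
    by (auto simp: bit_tape_def tape_of_def bsym_def fun_eq_iff)
  moreover have "(\<lambda>_. 0, 0) = tape_of [] 0" by (auto simp: tape_of_def)
  ultimately show ?thesis
    using assms unfolding rep_def init_config_def sinit_def
    by (auto simp: nth_Cons' bsym_def)
qed

text \<open>The bound is twice the program time plus one final step that writes the answer. The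
  condition \<open>\<sigma>' 1 = []\<close> keeps tape 1 blank until then, so this single write
  yields the whole output.\<close>

theorem compile_program:
  assumes wf: "wfp K S p" and K: "3 \<le> K" and S: "3 \<le> S"
    and run: "\<And>x. \<exists>\<sigma>'. ex p (T (length x)) (sinit x) \<sigma>' \<and> \<sigma>' 1 = [] \<and> top0 (\<sigma>' 2) = bsym (x \<in> L)"
  shows "\<exists>M. wf_tm M \<and> computes_within M (decider L) (\<lambda>n. real (2 * T n + 1))"
proof (cases "p = []")
  case True
  \<comment> \<open>The assumption on runs is contradictory here: the empty program leaves stack 2
    empty, but the answer is a nonzero symbol.\<close>
  then show ?thesis using run[of "[]"] by (auto simp: sinit_def bsym_def split: if_splits)
next
  case False
  obtain R where R: "good_states K S R" "p \<in> R" using good_states_exist[OF wf] by auto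
  have "finite (tm_states K S R)" using R by (auto simp: tm_states_def good_states_def)
  then obtain h where h: "bij_betw h (tm_states K S R) {0..<card (tm_states K S R)}" "h (Some (p, None)) = 0" "h None = 1"
    using bij_fix_two[of "tm_states K S R" "Some (p, None)" None] R by (auto simp: tm_states_def)
  note ctx = K S R(1) h(1,3)
  let ?M = "stack_tm K S R h"
  have "wf_tm ?M" by (rule wf_stack_tm[OF ctx R(2)])
  moreover have "computes_within ?M (decider L) (\<lambda>n. real (2 * T n + 1))"
    unfolding computes_within_def
  proof
    fix x
    obtain \<sigma>' where ex: "ex p (T (length x)) (sinit x) \<sigma>'" "\<sigma>' 1 = []" "top0 (\<sigma>' 2) = bsym (x \<in> L)" using run by blast
    then obtain n where n: "n \<le> T (length x)" "(sstep ^^ n) (p, sinit x) = ([], \<sigma>')"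
      unfolding ex_def exec_def by (metis append_Nil2)
    have r0: "rep K S (sinit x) (snd (init_config ?M x))" by (rule rep_init) (use K S in \<open>auto simp: stack_tm_def\<close>)
    from sim_steps[OF ctx r0 R(2), of n] obtain m ts' where m: "m \<le> 2 * n"
      "(step ?M ^^ m) (0, snd (init_config ?M x)) = (h (Some ([], None)), ts')" "rep K S \<sigma>' ts'" "[] \<in> R"
      using n h by auto
    have q: "Some ([], None) \<in> tm_states K S R" using m by (auto simp: tm_states_def)
    have "step ?M (h (Some ([], None)), ts') = (1, ts'[1 := act (top0 (\<sigma>' 2), Stay) (ts' ! 1)])"
      using step_stack_tm[OF ctx q, of ts'] scanned[OF ctx m(3)] map2_stays_update[OF ctx m(3)] K h by (simp add: numeral_2_eq_2)
    then have "run ?M x (Suc m) = (1, ts'[1 := act (top0 (\<sigma>' 2), Stay) (ts' ! 1)])"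
      using m by (simp add: run_def init_config_def)
    moreover have "ts' ! 1 = tape_of [] 0" "length ts' = K" 
    proof -
      show "length ts' = K" using m(3) by (simp add: rep_def)
      have "1 < K" using K by simp
      then have "\<exists>h. ts' ! 1 = tape_of (\<sigma>' 1) h \<and> (1 = (1::nat) \<longrightarrow> h = 0)"
        using m(3) unfolding rep_def by blast
      then show "ts' ! 1 = tape_of [] 0" using ex by simp
    qed
    moreover have "fst (act (bsym (x \<in> L), Stay) (tape_of [] 0)) = bit_tape (decider L x)"
      by (auto simp: tape_of_def bit_tape_def decider_def bsym_def fun_eq_iff)
    ultimately show "\<exists>t. real t \<le> real (2 * T (length x) + 1) \<and> fst (run ?M x t) = 1 \<and>
        fst (snd (run ?M x t) ! 1) = bit_tape (decider L x)"
      using m n K ex by (intro exI[of _ "Suc m"]) auto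
  qed
  ultimately show ?thesis by blast
qed

section \<open>Macros for moving, translating and copying stacks\<close>

definition pushes :: "nat \<Rightarrow> nat list \<Rightarrow> cmd list" where
  "pushes j xs = map (Push j) xs"

lemma pushes_simps [simp]: "pushes j [] = []" "pushes j (a # xs) = Push j a # pushes j xs"
  by (auto simp: pushes_def)

lemma wfp_pushes [simp]: "wfp K S (pushes j xs) \<longleftrightarrow> xs = [] \<or> (j < K \<and> j \<noteq> 1 \<and> (\<forall>a\<in>set xs. a < S))"
  by (induction xs) auto

lemma ex_pushes: "0 \<notin> set xs \<Longrightarrow> length xs \<le> B \<Longrightarrow> ex (pushes j xs) B \<sigma> (\<sigma>(j := rev xs @ \<sigma> j))"
proof (induction xs arbitrary: \<sigma> B)
  case (Cons a xs)
  have "ex (pushes j xs) (B - 1) (\<sigma>(j := a # \<sigma> j)) ((\<sigma>(j := a # \<sigma> j))(j := rev xs @ (\<sigma>(j := a # \<sigma> j)) j))"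
    by (rule Cons.IH) (use Cons in auto)
  then have "ex (pushes j (a # xs)) (Suc (B - 1)) \<sigma> ((\<sigma>(j := a # \<sigma> j))(j := rev xs @ (\<sigma>(j := a # \<sigma> j)) j))"
    unfolding pushes_simps by (intro ex_Push) (use Cons.prems in simp)
  moreover have "Suc (B - 1) = B" using Cons.prems by simp
  moreover have "(\<sigma>(j := a # \<sigma> j))(j := rev xs @ (\<sigma>(j := a # \<sigma> j)) j) = \<sigma>(j := rev (a # xs) @ \<sigma> j)" by simp
  ultimately show ?case by metis
qed auto

text \<open>One loop covers reversal, translation, duplication and unary arithmetic, as each popped
  symbol is replaced by words on two stacks.\<close>

definition consume :: "nat \<Rightarrow> nat \<Rightarrow> (nat \<Rightarrow> nat list) \<Rightarrow> nat \<Rightarrow> (nat \<Rightarrow> nat list) \<Rightarrow> cmd list" where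
  "consume i j e k e' = [While i (\<lambda>a. a \<noteq> 0) [Case i (\<lambda>a. Pop i # pushes j (e a) @ pushes k (e' a))]]"

lemma ex_consume:
  assumes "\<sigma> i = xs" "0 \<notin> set xs" "i \<noteq> j" "i \<noteq> k" "j \<noteq> k"
    "\<And>a. a \<in> set xs \<Longrightarrow> 0 \<notin> set (e a) \<and> 0 \<notin> set (e' a) \<and> length (e a) + length (e' a) \<le> b"
  shows "ex (consume i j e k e') (length xs * (b + 3) + 1) \<sigma>
    (\<sigma>(i := [], j := rev (concat (map e xs)) @ \<sigma> j, k := rev (concat (map e' xs)) @ \<sigma> k))"
  using assms
proof (induction xs arbitrary: \<sigma>)
  case Nil
  then have eq: "\<sigma>(i := [], j := rev (concat (map e [])) @ \<sigma> j, k := rev (concat (map e' [])) @ \<sigma> k) = \<sigma>" by auto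
  show ?case unfolding eq consume_def by (rule ex_mono[OF ex_While_False[where B = 0]]) (use Nil in auto)
next
  case (Cons a xs)
  let ?\<sigma>1 = "\<sigma>(i := xs, j := rev (e a) @ \<sigma> j, k := rev (e' a) @ \<sigma> k)"
  have b: "length (e a) + length (e' a) \<le> b" "0 \<notin> set (e a)" "0 \<notin> set (e' a)" using Cons.prems by auto
  have "ex (pushes j (e a) @ pushes k (e' a)) (length (e a) + length (e' a)) (\<sigma>(i := xs)) ?\<sigma>1"
    using ex_append[OF ex_pushes[OF b(2) order_refl, of j "\<sigma>(i := xs)"] ex_pushes[OF b(3) order_refl, of k]]
      Cons.prems by (simp add: fun_upd_twist)
  then have 1: "ex [Case i (\<lambda>a. Pop i # pushes j (e a) @ pushes k (e' a))] (Suc (Suc (length (e a) + length (e' a)))) \<sigma> ?\<sigma>1"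
    using Cons.prems by (intro ex_Case) (auto intro!: ex_Pop)
  have "ex (consume i j e k e') (length xs * (b + 3) + 1) ?\<sigma>1
      (?\<sigma>1(i := [], j := rev (concat (map e xs)) @ ?\<sigma>1 j, k := rev (concat (map e' xs)) @ ?\<sigma>1 k))"
    by (rule Cons.IH) (use Cons.prems in auto)
  then have 2: "ex [While i (\<lambda>a. a \<noteq> 0) [Case i (\<lambda>a. Pop i # pushes j (e a) @ pushes k (e' a))]] (length xs * (b + 3) + 1) ?\<sigma>1
      (?\<sigma>1(i := [], j := rev (concat (map e xs)) @ ?\<sigma>1 j, k := rev (concat (map e' xs)) @ ?\<sigma>1 k))"
    by (simp add: consume_def)
  have 3: "?\<sigma>1(i := [], j := rev (concat (map e xs)) @ ?\<sigma>1 j, k := rev (concat (map e' xs)) @ ?\<sigma>1 k)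
     = \<sigma>(i := [], j := rev (concat (map e (a # xs))) @ \<sigma> j, k := rev (concat (map e' (a # xs))) @ \<sigma> k)"
    using Cons.prems by (auto simp: fun_eq_iff)
  have "top0 (\<sigma> i) \<noteq> 0" using Cons.prems by simp
  from ex_While_True[where P = "\<lambda>a. a \<noteq> 0", OF this 1 2] show ?case
    unfolding 3 consume_def by (rule ex_mono) (use b in auto)
qed

lemma wfp_consume [simp]:
  "wfp K S (consume i j e k e') \<longleftrightarrow> i < K \<and> i \<noteq> 1 \<and> (\<forall>a<S. wfp K S (pushes j (e a)) \<and> wfp K S (pushes k (e' a)))"
  by (auto simp: consume_def)

definition conv :: "nat \<Rightarrow> nat \<Rightarrow> (nat \<Rightarrow> nat list) \<Rightarrow> cmd list" where
  "conv i j e = consume i j e 0 (\<lambda>_. [])"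

lemma wfp_conv [simp]: "wfp K S (conv i j e) \<longleftrightarrow> i < K \<and> i \<noteq> 1 \<and> (\<forall>a<S. wfp K S (pushes j (e a)))"
  by (simp add: conv_def)

lemma ex_conv:
  assumes "\<sigma> i = xs" "0 \<notin> set xs" "i \<noteq> j"
    "\<And>a. a \<in> set xs \<Longrightarrow> 0 \<notin> set (e a) \<and> length (e a) \<le> b"
  shows "ex (conv i j e) (length xs * (b + 3) + 1) \<sigma> (\<sigma>(i := [], j := rev (concat (map e xs)) @ \<sigma> j))"
proof -
  \<comment> \<open>The second target of \<open>consume\<close> receives only empty words, so the 0
    written in \<open>conv\<close> may be exchanged for a stack different from \<open>i\<close> and
    \<open>j\<close>, as \<open>ex_consume\<close> requires.\<close>
  obtain k where k: "k \<noteq> i" "k \<noteq> j" using infinite_UNIV_nat ex_new_if_finite[of "{i, j}"] by auto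
  have "consume i j e k (\<lambda>_. []) = conv i j e" by (simp add: conv_def consume_def)
  moreover have "\<sigma>(i := [], j := A, k := rev (concat (map (\<lambda>_. []) xs)) @ \<sigma> k) = \<sigma>(i := [], j := A)" for A
    using k by (simp add: fun_eq_iff)
  ultimately show ?thesis using ex_consume[of \<sigma> i xs j k e "\<lambda>_. []" b] assms k by simp
qed

abbreviation pour :: "nat \<Rightarrow> nat \<Rightarrow> cmd list" where
  "pour i j \<equiv> conv i j (\<lambda>a. [a])"

lemma ex_pour:
  assumes "\<sigma> i = xs" "0 \<notin> set xs" "i \<noteq> j"
  shows "ex (pour i j) (4 * length xs + 1) \<sigma> (\<sigma>(i := [], j := rev xs @ \<sigma> j))"
proof -
  have "ex (pour i j) (length xs * (1 + 3) + 1) \<sigma> (\<sigma>(i := [], j := rev (concat (map (\<lambda>a. [a]) xs)) @ \<sigma> j))"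
    by (rule ex_conv) (use assms in \<open>auto intro: gr0I\<close>)
  then show ?thesis by (simp add: mult.commute)
qed

text \<open>Two reversals restore the order, and the second one feeds the original and the copy at
  once.\<close>

definition copy :: "nat \<Rightarrow> nat \<Rightarrow> nat \<Rightarrow> cmd list" where
  "copy i j t = pour i t @ consume t i (\<lambda>a. [a]) j (\<lambda>a. [a])"

lemma ex_copy:
  assumes "\<sigma> i = xs" "0 \<notin> set xs" "i \<noteq> j" "i \<noteq> t" "j \<noteq> t" "\<sigma> t = []"
  shows "ex (copy i j t) (9 * length xs + 2) \<sigma> (\<sigma>(j := xs @ \<sigma> j))"
proof -
  let ?\<sigma>1 = "\<sigma>(i := [], t := rev xs @ \<sigma> t)"
  have 1: "ex (pour i t) (4 * length xs + 1) \<sigma> ?\<sigma>1" by (rule ex_pour) (use assms in auto)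
  have "ex (consume t i (\<lambda>a. [a]) j (\<lambda>a. [a])) (length (rev xs) * (2 + 3) + 1) ?\<sigma>1
     (?\<sigma>1(t := [], i := rev (concat (map (\<lambda>a. [a]) (rev xs))) @ ?\<sigma>1 i, j := rev (concat (map (\<lambda>a. [a]) (rev xs))) @ ?\<sigma>1 j))"
    by (rule ex_consume) (use assms in \<open>auto intro: gr0I\<close>)
  moreover have "?\<sigma>1(t := [], i := rev (concat (map (\<lambda>a. [a]) (rev xs))) @ ?\<sigma>1 i, j := rev (concat (map (\<lambda>a. [a]) (rev xs))) @ ?\<sigma>1 j)
     = \<sigma>(j := xs @ \<sigma> j)"
    using assms by (auto simp: fun_eq_iff)
  ultimately have "ex (consume t i (\<lambda>a. [a]) j (\<lambda>a. [a])) (5 * length xs + 1) ?\<sigma>1 (\<sigma>(j := xs @ \<sigma> j))"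
    by (simp add: mult.commute)
  from ex_append[OF 1 this] show ?thesis by (simp add: copy_def)
qed

lemma wfp_copy [simp]: "i < K \<Longrightarrow> i \<noteq> 1 \<Longrightarrow> j < K \<Longrightarrow> j \<noteq> 1 \<Longrightarrow> t < K \<Longrightarrow> t \<noteq> 1 \<Longrightarrow> wfp K S (copy i j t)"
  by (simp add: copy_def)

section \<open>Simulating Turing machines\<close>

definition nth0 :: "nat list \<Rightarrow> nat \<Rightarrow> nat" where
  "nth0 xs i = (if i < length xs then xs ! i else 0)"

lemma nth0_simps [simp]: "nth0 [] i = 0" "nth0 (x # xs) 0 = x" "nth0 (x # xs) (Suc i) = nth0 xs i"
  by (auto simp: nth0_def)

lemma nth0_tl: "nth0 (tl xs) i = nth0 xs (Suc i)"
  by (cases xs) auto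

lemma nth0_0: "nth0 xs 0 = top0 xs"
  by (cases xs) auto

text \<open>A tape is kept on two stacks, with the symbol s stored as s + 1.\<close>

definition tape_rel :: "tape \<Rightarrow> nat list \<Rightarrow> nat list \<Rightarrow> bool" where
  "tape_rel T l r \<longleftrightarrow> 0 \<notin> set l \<and> 0 \<notin> set r \<and>
     (\<forall>i. fst T (snd T + int i) = nth0 r i - 1 \<and> fst T (snd T - 1 - int i) = nth0 l i - 1)"

text \<open>An exhausted right stack reads as blank by itself, since \<open>0 - 1 = 0\<close>. In a
  left move the newly scanned cell has to be put on the right stack, so a missing left neighbour
  becomes the stored blank 1.\<close>

definition wr :: "nat \<Rightarrow> nat \<Rightarrow> nat \<times> move \<Rightarrow> cmd list" where
  "wr l r a = (case a of (s, d) \<Rightarrow> Pop r #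
     (case d of
        Stay \<Rightarrow> [Push r (Suc s)]
      | MoveRight \<Rightarrow> [Push l (Suc s)]
      | MoveLeft \<Rightarrow> [Push r (Suc s), Case l (\<lambda>a. [Push r (if a = 0 then 1 else a)]), Pop l]))"

lemma tape_rel_act:
  assumes "tape_rel T l r" "l' \<noteq> r'" "\<sigma> l' = l" "\<sigma> r' = r"
  shows "\<exists>\<sigma>'. ex (wr l' r' a) 5 \<sigma> \<sigma>' \<and> tape_rel (act a T) (\<sigma>' l') (\<sigma>' r') \<and>
    (\<forall>i. i \<noteq> l' \<and> i \<noteq> r' \<longrightarrow> \<sigma>' i = \<sigma> i) \<and> (\<forall>i. length (\<sigma>' i) \<le> 2 + (length (\<sigma> i)))"
proof -
  obtain s d where a: "a = (s, d)" by (cases a)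
  obtain t h where T: "T = (t, h)" by (cases T)
  have r: "0 \<notin> set l" "0 \<notin> set r" "\<And>i. t (h + int i) = nth0 r i - 1" "\<And>i. t (h - 1 - int i) = nth0 l i - 1"
    using assms(1) by (auto simp: tape_rel_def T)
  have r0: "0 \<notin> set (tl r)" using r(2) by (cases r) auto
  have l0: "0 \<notin> set (tl l)" using r(1) by (cases l) auto
  show ?thesis
  proof (cases d)
    case MoveRight
    let ?\<sigma> = "\<sigma>(r' := tl r, l' := Suc s # l)"
    have "ex (wr l' r' a) 5 \<sigma> ?\<sigma>"
      unfolding wr_def a MoveRight prod.case move.case
      by (rule ex_mono[of _ "Suc (Suc 0)"], rule ex_Pop, rule ex_Push) (use assms in auto)
    moreover have "tape_rel (act a T) (Suc s # l) (tl r)"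
      unfolding tape_rel_def
    proof (intro conjI allI)
      fix i
      have "t (h + int (Suc i)) = nth0 r (Suc i) - 1" by (rule r)
      then show "fst (act a T) (snd (act a T) + int i) = nth0 (tl r) i - 1"
        by (simp add: a T MoveRight nth0_tl algebra_simps)
      show "fst (act a T) (snd (act a T) - 1 - int i) = nth0 (Suc s # l) i - 1"
        using r(4)[of "i - 1"] by (cases i) (auto simp: a T MoveRight algebra_simps)
    qed (use r r0 in auto)
    ultimately show ?thesis using assms by (intro exI[of _ ?\<sigma>]) auto
  next
    case Stay
    let ?\<sigma> = "\<sigma>(r' := Suc s # tl r)"
    have "ex (wr l' r' a) 5 \<sigma> ?\<sigma>"
      unfolding wr_def a Stay prod.case move.case
      by (rule ex_mono[of _ "Suc (Suc 0)"], rule ex_Pop, rule ex_Push) (use assms in auto)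
    moreover have "tape_rel (act a T) l (Suc s # tl r)"
      unfolding tape_rel_def
    proof (intro conjI allI)
      fix i
      show "fst (act a T) (snd (act a T) + int i) = nth0 (Suc s # tl r) i - 1"
        using r(3)[of i] by (cases i) (auto simp: a T Stay nth0_tl)
      show "fst (act a T) (snd (act a T) - 1 - int i) = nth0 l i - 1"
        using r(4)[of i] by (auto simp: a T Stay)
    qed (use r r0 in auto)
    ultimately show ?thesis using assms by (intro exI[of _ ?\<sigma>]) auto
  next
    case MoveLeft
    let ?b = "if top0 l = 0 then 1 else top0 l"
    let ?\<sigma> = "\<sigma>(r' := ?b # Suc s # tl r, l' := tl l)"
    have "ex (wr l' r' a) 5 \<sigma> ?\<sigma>"
      unfolding wr_def a MoveLeft prod.case move.case
      by (rule ex_mono[of _ "Suc (Suc (Suc (Suc (Suc 0))))"], rule ex_Pop, rule ex_Push, rule ex_Case, simp only: append_Cons append_Nil, rule ex_Push, rule ex_Pop)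
        (use assms in \<open>auto simp: fun_eq_iff\<close>)
    moreover have "tape_rel (act a T) (tl l) (?b # Suc s # tl r)"
      unfolding tape_rel_def
    proof (intro conjI allI)
      fix i
      show "fst (act a T) (snd (act a T) + int i) = nth0 (?b # Suc s # tl r) i - 1"
      proof (cases i)
        case 0
        then show ?thesis using r(4)[of 0] by (auto simp: a T MoveLeft nth0_0)
      next
        case (Suc j)
        then show ?thesis using r(3)[of j] by (cases j) (auto simp: a T MoveLeft nth0_tl ac_simps)
      qed
      have "t (h - 1 - int (Suc i)) = nth0 l (Suc i) - 1" by (rule r)
      then show "fst (act a T) (snd (act a T) - 1 - int i) = nth0 (tl l) i - 1"
        by (simp add: a T MoveLeft nth0_tl algebra_simps)
    qed (use r r0 l0 in auto)
    ultimately show ?thesis using assms by (intro exI[of _ ?\<sigma>]) auto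
  qed
qed

text \<open>Tape \<open>\<tau>\<close> occupies stack \<open>b + 2 * \<tau>\<close> (cells left of
  the head) and stack \<open>b + 2 * \<tau> + 1\<close> (the scanned cell and those to its
  right).\<close>

fun wrs :: "nat \<Rightarrow> nat \<Rightarrow> (nat \<times> move) list \<Rightarrow> cmd list" where
  "wrs b \<tau> [] = []"
| "wrs b \<tau> (a # as) = wr (b + 2 * \<tau>) (b + 2 * \<tau> + 1) a @ wrs b (Suc \<tau>) as"

text \<open>Nested case distinctions gather the scanned symbols in the control state, so
  \<open>f\<close> can consult the transition function while the program is being built.\<close>

fun rd :: "nat \<Rightarrow> nat list \<Rightarrow> nat list \<Rightarrow> (nat list \<Rightarrow> cmd list) \<Rightarrow> cmd list" where
  "rd b [] acc f = f acc"
| "rd b (\<tau> # \<tau>s) acc f = [Case (b + 2 * \<tau> + 1) (\<lambda>a. rd b \<tau>s (acc @ [a - 1]) f)]"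

lemma ex_rd:
  assumes "ex (f (acc @ map (\<lambda>\<tau>. top0 (\<sigma> (b + 2 * \<tau> + 1)) - 1) \<tau>s)) B \<sigma> \<sigma>'"
  shows "ex (rd b \<tau>s acc f) (B + length \<tau>s) \<sigma> \<sigma>'"
  using assms by (induction \<tau>s arbitrary: acc) (auto intro!: ex_Case)

lemma ex_wrs:
  assumes "length as = length ts" "\<And>j. j < length ts \<Longrightarrow> tape_rel (ts ! j) (\<sigma> (b + 2 * (\<tau> + j))) (\<sigma> (b + 2 * (\<tau> + j) + 1))"
  shows "\<exists>\<sigma>'. ex (wrs b \<tau> as) (5 * length ts) \<sigma> \<sigma>' \<and>
    (\<forall>j<length ts. tape_rel (act (as ! j) (ts ! j)) (\<sigma>' (b + 2 * (\<tau> + j))) (\<sigma>' (b + 2 * (\<tau> + j) + 1))) \<and>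
    (\<forall>i. i < b + 2 * \<tau> \<or> b + 2 * (\<tau> + length ts) \<le> i \<longrightarrow> \<sigma>' i = \<sigma> i) \<and> (\<forall>i. length (\<sigma>' i) \<le> 2 + (length (\<sigma> i)))"
  using assms
proof (induction as ts arbitrary: \<sigma> \<tau> rule: list_induct2)
  case Nil
  then show ?case by auto
next
  case (Cons a as t ts)
  from Cons.prems[of 0] have "tape_rel t (\<sigma> (b + 2 * \<tau>)) (\<sigma> (b + 2 * \<tau> + 1))" by simp
  from tape_rel_act[OF this _ refl refl, of a] obtain \<sigma>1 where
    1: "ex (wr (b + 2 * \<tau>) (b + 2 * \<tau> + 1) a) 5 \<sigma> \<sigma>1" "tape_rel (act a t) (\<sigma>1 (b + 2 * \<tau>)) (\<sigma>1 (b + 2 * \<tau> + 1))"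
    "\<And>i. i \<noteq> b + 2 * \<tau> \<Longrightarrow> i \<noteq> b + 2 * \<tau> + 1 \<Longrightarrow> \<sigma>1 i = \<sigma> i" "\<And>i. length (\<sigma>1 i) \<le> 2 + (length (\<sigma> i))" by auto
  have "tape_rel (ts ! j) (\<sigma>1 (b + 2 * (Suc \<tau> + j))) (\<sigma>1 (b + 2 * (Suc \<tau> + j) + 1))" if "j < length ts" for j
    using Cons.prems[of "Suc j"] that 1(3) by simp
  from Cons.IH[OF this] obtain \<sigma>2 where
    2: "ex (wrs b (Suc \<tau>) as) (5 * length ts) \<sigma>1 \<sigma>2"
    "\<And>j. j < length ts \<Longrightarrow> tape_rel (act (as ! j) (ts ! j)) (\<sigma>2 (b + 2 * (Suc \<tau> + j))) (\<sigma>2 (b + 2 * (Suc \<tau> + j) + 1))"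
    "\<And>i. i < b + 2 * (Suc \<tau>) \<or> b + 2 * (Suc \<tau> + length ts) \<le> i \<Longrightarrow> \<sigma>2 i = \<sigma>1 i" "\<And>i. length (\<sigma>2 i) \<le> 2 + (length (\<sigma>1 i))"
    by blast
  have len: "length (\<sigma>2 i) \<le> 2 + (length (\<sigma> i))" for i
  proof (cases "i < b + 2 * (Suc \<tau>)")
    case True
    then show ?thesis using 1(4)[of i] 2(3)[of i] by simp
  next
    case False
    then show ?thesis using 1(3)[of i] 2(4)[of i] by simp
  qed
  have "tape_rel (act ((a # as) ! j) ((t # ts) ! j)) (\<sigma>2 (b + 2 * (\<tau> + j))) (\<sigma>2 (b + 2 * (\<tau> + j) + 1))"
    if "j < length (t # ts)" for j
    using that 1(2) 2(2)[of "j - 1"] 2(3)[of "b + 2 * \<tau>"] 2(3)[of "b + 2 * \<tau> + 1"] by (cases j) auto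
  moreover have "\<sigma>2 i = \<sigma> i" if "i < b + 2 * \<tau> \<or> b + 2 * (\<tau> + length (t # ts)) \<le> i" for i
    using that 2(3)[of i] 1(3)[of i] by auto
  ultimately show ?case using ex_append[OF 1(1) 2(1)] len by (intro exI[of _ \<sigma>2]) auto
qed

text \<open>State \<open>q\<close> is kept as \<open>q + 1\<close> on the stack after the tapes. The
  range test succeeds throughout a simulation; it keeps the program well formed for arbitrary
  symbols, where \<open>trans\<close> is unconstrained.\<close>

definition simbody :: "tm \<Rightarrow> nat \<Rightarrow> cmd list" where
  "simbody M b = [Case (b + 2 * ntapes M) (\<lambda>q. Pop (b + 2 * ntapes M) # rd b [0..<ntapes M] []
     (\<lambda>ss. if q - 1 < nstates M \<and> (\<forall>s\<in>set ss. s < nsyms M)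
           then wrs b 0 (snd (trans M (q - 1) ss)) @ [Push (b + 2 * ntapes M) (Suc (fst (trans M (q - 1) ss)))]
           else []))]"

definition trel :: "tm \<Rightarrow> nat \<Rightarrow> store \<Rightarrow> config \<Rightarrow> bool" where
  "trel M b \<sigma> z \<longleftrightarrow> \<sigma> (b + 2 * ntapes M) = [Suc (fst z)] \<and> length (snd z) = ntapes M \<and> fst z < nstates M \<and>
     (\<forall>j<ntapes M. tape_rel (snd z ! j) (\<sigma> (b + 2 * j)) (\<sigma> (b + 2 * j + 1)) \<and> (\<forall>p. fst (snd z ! j) p < nsyms M))"

lemma ex_simbody:
  assumes wf: "wf_tm M" and rel: "trel M b \<sigma> (q, ts)" and q: "q \<noteq> 1"
  shows "\<exists>\<sigma>'. ex (simbody M b) (6 * ntapes M + 3) \<sigma> \<sigma>' \<and> trel M b \<sigma>' (step M (q, ts)) \<and>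
    (\<forall>i. i < b \<or> b + 2 * ntapes M < i \<longrightarrow> \<sigma>' i = \<sigma> i) \<and> (\<forall>i. length (\<sigma>' i) \<le> 2 + (length (\<sigma> i)))"
proof -
  let ?K = "ntapes M"
  let ?Q = "b + 2 * ?K"
  define ss where "ss = map (\<lambda>(t, h). t h) ts"
  obtain q' as where tr: "trans M q ss = (q', as)" by fastforce
  have rel': "\<sigma> ?Q = [Suc q]" "length ts = ?K" "q < nstates M"
    "\<And>j. j < ?K \<Longrightarrow> tape_rel (ts ! j) (\<sigma> (b + 2 * j)) (\<sigma> (b + 2 * j + 1))"
    "\<And>j p. j < ?K \<Longrightarrow> fst (ts ! j) p < nsyms M"
    using rel by (auto simp: trel_def)
  have top: "top0 (\<sigma> ?Q) = Suc q" using rel' by simp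
  have ss_lt: "\<forall>s\<in>set ss. s < nsyms M"
  proof
    fix s assume "s \<in> set ss"
    then obtain j where "j < ?K" "s = fst (ts ! j) (snd (ts ! j))"
      using rel'(2) by (auto simp: ss_def in_set_conv_nth case_prod_beta)
    then show "s < nsyms M" using rel'(5) by auto
  qed
  have wf': "q' < nstates M" "length as = ?K" "\<forall>(s, d)\<in>set as. s < nsyms M"
    using wf rel'(2,3) ss_lt tr unfolding wf_tm_def by (auto simp: ss_def dest!: spec[of _ q] spec[of _ ss])
  have step: "step M (q, ts) = (q', map2 act as ts)"
    using q tr by (simp add: step.simps ss_def)
  let ?\<sigma>1 = "\<sigma>(?Q := [])"
  have "ss = map (\<lambda>\<tau>. top0 (?\<sigma>1 (b + 2 * \<tau> + 1)) - 1) [0..<?K]"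
  proof (rule nth_equalityI)
    fix j assume "j < length ss"
    then have j: "j < ?K" using rel' by (simp add: ss_def)
    from rel'(4)[OF j] have "fst (ts ! j) (snd (ts ! j) + int 0) = nth0 (\<sigma> (b + 2 * j + 1)) 0 - 1"
      unfolding tape_rel_def by blast
    then have "ss ! j = top0 (\<sigma> (b + 2 * j + 1)) - 1"
      using j rel' by (simp add: ss_def nth0_0 case_prod_beta)
    moreover have "b + 2 * j + 1 \<noteq> ?Q" using j by presburger
    ultimately show "ss ! j = map (\<lambda>\<tau>. top0 (?\<sigma>1 (b + 2 * \<tau> + 1)) - 1) [0..<?K] ! j"
      using j by simp
  qed (use rel' in \<open>simp add: ss_def\<close>)
  note ss = this
  have "tape_rel (ts ! j) (?\<sigma>1 (b + 2 * (0 + j))) (?\<sigma>1 (b + 2 * (0 + j) + 1))" if "j < length ts" for j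
  proof -
    have "b + 2 * j \<noteq> ?Q" "b + 2 * j + 1 \<noteq> ?Q" using that rel'(2) by presburger+
    then show ?thesis using rel'(4)[of j] that rel'(2) by simp
  qed
  from ex_wrs[of as ts ?\<sigma>1 b 0, OF _ this] obtain \<sigma>2 where 2: "ex (wrs b 0 as) (5 * ?K) ?\<sigma>1 \<sigma>2"
    "\<forall>j<?K. tape_rel (act (as ! j) (ts ! j)) (\<sigma>2 (b + 2 * j)) (\<sigma>2 (b + 2 * j + 1))"
    "\<forall>i. i < b \<or> ?Q \<le> i \<longrightarrow> \<sigma>2 i = ?\<sigma>1 i" "\<forall>i. length (\<sigma>2 i) \<le> 2 + (length (?\<sigma>1 i))"
    using wf' rel' by auto
  note 2 = 2(1) 2(2-)[rule_format]
  let ?\<sigma>3 = "\<sigma>2(?Q := [Suc q'])"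
  have "ex [Push ?Q (Suc q')] 1 \<sigma>2 ?\<sigma>3"
    unfolding One_nat_def by (rule ex_Push) (use 2(3)[of ?Q] in auto)
  from ex_append[OF 2(1) this] have "ex (wrs b 0 as @ [Push ?Q (Suc q')]) (5 * ?K + 1) ?\<sigma>1 ?\<sigma>3" .
  then have "ex (rd b [0..<?K] []
     (\<lambda>ss. if Suc q - 1 < nstates M \<and> (\<forall>s\<in>set ss. s < nsyms M)
           then wrs b 0 (snd (trans M (Suc q - 1) ss)) @ [Push (b + 2 * ?K) (Suc (fst (trans M (Suc q - 1) ss)))]
           else [])) (5 * ?K + 1 + length [0..<?K]) ?\<sigma>1 ?\<sigma>3"
    by (intro ex_rd) (use ss[symmetric] rel' ss_lt tr in \<open>simp\<close>)
  then have "ex (simbody M b) (Suc (Suc (5 * ?K + 1 + length [0..<?K]))) \<sigma> ?\<sigma>3"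
    unfolding simbody_def
    by (intro ex_Case, unfold top append_Nil2 append_Cons, intro ex_Pop) (use rel'(1) in simp)
  then have "ex (simbody M b) (6 * ?K + 3) \<sigma> ?\<sigma>3" by (rule ex_mono) simp
  moreover have "trel M b ?\<sigma>3 (step M (q, ts))"
    unfolding trel_def step
  proof (intro conjI allI impI)
    fix j assume j: "j < ?K"
    have "b + 2 * j \<noteq> ?Q" "b + 2 * j + 1 \<noteq> ?Q" using j by presburger+
    then show "tape_rel (snd (q', map2 act as ts) ! j) (?\<sigma>3 (b + 2 * j)) (?\<sigma>3 (b + 2 * j + 1))"
      using 2(2)[OF j] j wf' rel' by simp
    fix p
    obtain s d where sd: "as ! j = (s, d)" by fastforce
    then have "(s, d) \<in> set as" using j wf' by (metis nth_mem)
    then have "s < nsyms M" using wf' by auto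
    moreover obtain t h where "ts ! j = (t, h)" by fastforce
    ultimately show "fst (snd (q', map2 act as ts) ! j) p < nsyms M"
      using j wf' rel' rel'(5)[OF j] sd by simp
  qed (use wf' rel' in auto)
  moreover have "\<forall>i. i < b \<or> ?Q < i \<longrightarrow> ?\<sigma>3 i = \<sigma> i" using 2(3) by auto
  moreover have "length (?\<sigma>3 i) \<le> 2 + (length (\<sigma> i))" for i
    using 2(4)[of i] by (cases "i = ?Q") auto
  ultimately show ?thesis by blast
qed

text \<open>A halted machine repeats its configuration, so the loop may stop before \<open>t\<close>
  rounds; its test against 2 recognises the halting state 1 in stored form. Stacks grow by at most 2
  per step, which later bounds the size of the output.\<close>

lemma ex_simloop:
  assumes "wf_tm M" "trel M b \<sigma> z" "fst ((step M ^^ t) z) = 1"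
  shows "\<exists>\<sigma>'. ex [While (b + 2 * ntapes M) (\<lambda>q. q \<noteq> 2) (simbody M b)] (t * (6 * ntapes M + 4) + 1) \<sigma> \<sigma>' \<and>
    trel M b \<sigma>' ((step M ^^ t) z) \<and>
    (\<forall>i. i < b \<or> b + 2 * ntapes M < i \<longrightarrow> \<sigma>' i = \<sigma> i) \<and> (\<forall>i. length (\<sigma>' i) \<le> 2 * t + length (\<sigma> i))"
  using assms(2,3)
proof (induction t arbitrary: \<sigma> z)
  case 0
  then have "top0 (\<sigma> (b + 2 * ntapes M)) = 2" by (auto simp: trel_def)
  then show ?case using 0 by (auto intro!: exI[of _ \<sigma>] ex_While_False)
next
  case (Suc t)
  obtain q ts where z: "z = (q, ts)" by (cases z)
  have top: "top0 (\<sigma> (b + 2 * ntapes M)) = Suc q" using Suc.prems by (auto simp: trel_def z)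
  show ?case
  proof (cases "q = 1")
    case True
    have "(step M ^^ n) (q, ts) = (q, ts)" for n
      using True by (induction n) (auto simp: step.simps)
    then have id: "(step M ^^ Suc t) z = z" using True z by blast
    have "ex [While (b + 2 * ntapes M) (\<lambda>q. q \<noteq> 2) (simbody M b)] (Suc t * (6 * ntapes M + 4) + 1) \<sigma> \<sigma>"
      by (rule ex_mono[OF ex_While_False[where B = 0]]) (use top True in auto)
    then show ?thesis using Suc.prems(1) unfolding id by auto
  next
    case False
    from ex_simbody[OF assms(1) Suc.prems(1)[unfolded z] False] obtain \<sigma>1 where
      1: "ex (simbody M b) (6 * ntapes M + 3) \<sigma> \<sigma>1" "trel M b \<sigma>1 (step M (q, ts))"
      "\<forall>i. i < b \<or> b + 2 * ntapes M < i \<longrightarrow> \<sigma>1 i = \<sigma> i" "\<forall>i. length (\<sigma>1 i) \<le> 2 + (length (\<sigma> i))" by blast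
    have st: "(step M ^^ t) (step M (q, ts)) = (step M ^^ Suc t) z" by (simp add: z funpow_swap1)
    from Suc.IH[OF 1(2)] Suc.prems(2) st obtain \<sigma>2 where
      2: "ex [While (b + 2 * ntapes M) (\<lambda>q. q \<noteq> 2) (simbody M b)] (t * (6 * ntapes M + 4) + 1) \<sigma>1 \<sigma>2"
      "trel M b \<sigma>2 ((step M ^^ Suc t) z)" "\<forall>i. i < b \<or> b + 2 * ntapes M < i \<longrightarrow> \<sigma>2 i = \<sigma>1 i"
      "\<forall>i. length (\<sigma>2 i) \<le> 2 * t + length (\<sigma>1 i)" by auto
    have "ex [While (b + 2 * ntapes M) (\<lambda>q. q \<noteq> 2) (simbody M b)] (Suc (6 * ntapes M + 3 + (t * (6 * ntapes M + 4) + 1))) \<sigma> \<sigma>2"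
      by (rule ex_While_True[OF _ 1(1) 2(1)]) (use top False in auto)
    moreover have "length (\<sigma>2 i) \<le> 2 * Suc t + length (\<sigma> i)" for i
      using 1(4)[rule_format, of i] 2(4)[rule_format, of i] by simp
    ultimately show ?thesis using 1 2 by (intro exI[of _ \<sigma>2]) (auto simp: algebra_simps)
  qed
qed

lemma bsym_nonzero [simp]: "bsym b \<noteq> 0" "0 < bsym b" "0 \<notin> bsym ` A"
  by (auto simp: bsym_def)

text \<open>The two stacks show a finite window of the tape. Outside it all cells are blank and
  inside it the nonblank cells are exactly the output bits, so removing blanks recovers the output
  wherever the head has stopped.\<close>

lemma filter_tape_output:
  assumes "tape_rel (bit_tape z, h) l r"
  shows "filter (\<lambda>a. a \<noteq> 0) (map (\<lambda>a. a - 1) (rev l @ r)) = map bsym z" and "length z \<le> length l + length r"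
proof -
  define w where "w = map (\<lambda>a. a - 1) (rev l @ r)"
  define lo where "lo = h - int (length l)"
  have bt: "bit_tape z (h + int i) = nth0 r i - 1" "bit_tape z (h - 1 - int i) = nth0 l i - 1" for i
    using assms by (auto simp: tape_rel_def)
  have w: "w ! i = bit_tape z (lo + int i)" if "i < length w" for i
  proof (cases "i < length l")
    case True
    then have e: "h - 1 - int (length l - 1 - i) = lo + int i" by (simp add: lo_def)
    show ?thesis using True bt(2)[of "length l - 1 - i", unfolded e] by (simp add: w_def nth_append rev_nth nth0_def)
  next
    case False
    then have e: "h + int (i - length l) = lo + int i" by (simp add: lo_def)
    show ?thesis using False that bt(1)[of "i - length l", unfolded e] by (simp add: w_def nth_append nth0_def)
  qed
  have out: "bit_tape z p = 0" if "p < lo \<or> lo + int (length w) \<le> p" for p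
  proof (cases "p < lo")
    case True
    then have "p = h - 1 - int (nat (h - 1 - p))" by (simp add: lo_def)
    moreover have "length l \<le> nat (h - 1 - p)" using True by (simp add: lo_def)
    then have "nth0 l (nat (h - 1 - p)) = 0" by (simp add: nth0_def)
    ultimately show ?thesis using bt(2) by (metis diff_0_eq_0)
  next
    case False
    then have "lo + int (length w) \<le> p" using that by simp
    then have "p = h + int (nat (p - h))" "nth0 r (nat (p - h)) = 0" by (auto simp: lo_def w_def nth0_def)
    then show ?thesis using bt(1) by (metis diff_0_eq_0)
  qed
  show "filter (\<lambda>a. a \<noteq> 0) w = map bsym z" and "length z \<le> length l + length r"
  proof (atomize (full), cases "z = []")
    case True
    then have "\<forall>a\<in>set w. a = 0" using w by (auto simp: in_set_conv_nth bit_tape_def)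
    then show "filter (\<lambda>a. a \<noteq> 0) w = map bsym z \<and> length z \<le> length l + length r" using True by (simp add: filter_empty_conv)
  next
    case False
    \<comment> \<open>The first and the last output cell are not blank and hence lie inside the
      window, which places the whole output there.\<close>
    have "bit_tape z 0 \<noteq> 0" "bit_tape z (int (length z - 1)) \<noteq> 0" using False by (auto simp: bit_tape_def)
    then have lo: "lo \<le> 0" "int (length z) \<le> lo + int (length w)" using out[of 0] out[of "int (length z - 1)"] by force+
    define a where "a = nat (- lo)"
    have a: "lo = - int a" "length z + a \<le> length w" using lo by (auto simp: a_def)
    have "w = replicate a 0 @ map bsym z @ replicate (length w - a - length z) 0"
    proof (rule nth_equalityI)
      fix i assume i: "i < length w"
      have "w ! i = bit_tape z (int i - int a)" using w[OF i] a by (simp add: add.commute)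
      also have "\<dots> = (replicate a 0 @ map bsym z @ replicate (length w - a - length z) 0) ! i"
        using i a by (auto simp: nth_append bit_tape_def bsym_def nat_diff_distrib)
      finally show "w ! i = (replicate a 0 @ map bsym z @ replicate (length w - a - length z) 0) ! i" .
    qed (use a in auto)
    moreover have "filter (\<lambda>a. a \<noteq> 0) (map bsym z) = map bsym z" by (auto simp: filter_id_conv bsym_def)
    moreover have "filter (\<lambda>a. a \<noteq> 0) (replicate n 0) = ([]::nat list)" for n by simp
    ultimately have "filter (\<lambda>a. a \<noteq> 0) w = map bsym z" by (metis append_Nil append_Nil2 filter_append)
    moreover have "length z \<le> length l + length r" using a(2) by (simp add: w_def)
    ultimately show "filter (\<lambda>a. a \<noteq> 0) w = map bsym z \<and> length z \<le> length l + length r" by simp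
  qed
qed

text \<open>The input is expected on stack \<open>b + 1\<close> in stored form. After the run the
  halves of tape 1 are joined and blanks are dropped; the detour over \<open>t\<close> undoes the
  reversal.\<close>

definition sim :: "tm \<Rightarrow> nat \<Rightarrow> nat \<Rightarrow> nat \<Rightarrow> cmd list" where
  "sim M b out t = Push (b + 2 * ntapes M) 1 # [While (b + 2 * ntapes M) (\<lambda>q. q \<noteq> 2) (simbody M b)] @
     pour (b + 2) (b + 3) @ conv (b + 3) t (\<lambda>a. if a - 1 = 0 then [] else [a - 1]) @ pour t out"

lemma ex_sim:
  assumes wf: "wf_tm M" and halt: "fst (run M y t) = 1" "fst (snd (run M y t) ! 1) = bit_tape z"
    and blk: "\<And>i. b \<le> i \<Longrightarrow> i \<le> b + 2 * ntapes M \<Longrightarrow> \<sigma> i = (if i = b + 1 then map (\<lambda>x. Suc (bsym x)) y else [])"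
    and out: "out < b" "tmp < b" "tmp \<noteq> out" "\<sigma> tmp = []"
  shows "\<exists>\<sigma>'. ex (sim M b out tmp) ((t + length y + 1) * (6 * ntapes M + 50)) \<sigma> \<sigma>' \<and> \<sigma>' out = map bsym z @ \<sigma> out \<and>
    (\<forall>i. i < b \<and> i \<noteq> out \<or> b + 2 * ntapes M < i \<longrightarrow> \<sigma>' i = \<sigma> i) \<and> length z \<le> 4 * t + length y"
proof -
  let ?K = "ntapes M"
  let ?Q = "b + 2 * ?K"
  have K: "2 \<le> ?K" "2 \<le> nstates M" "3 \<le> nsyms M" using wf by (auto simp: wf_tm_def)
  let ?\<sigma>0 = "\<sigma>(?Q := [1])"
  have "trel M b ?\<sigma>0 (init_config M y)"
    unfolding trel_def
  proof (intro conjI allI impI)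
    fix j assume j: "j < ?K"
    have n: "b + 2 * j \<noteq> ?Q" "b + 2 * j + 1 \<noteq> ?Q" using j by presburger+
    show "tape_rel (snd (init_config M y) ! j) (?\<sigma>0 (b + 2 * j)) (?\<sigma>0 (b + 2 * j + 1))"
    proof (cases j)
      case 0
      then show ?thesis using n blk[of b] blk[of "b + 1"] K
        by (auto simp: init_config_def tape_rel_def bit_tape_def nth0_def bsym_def)
    next
      case (Suc i)
      then show ?thesis using n j blk[of "b + 2 * j"] blk[of "b + 2 * j + 1"] K
        by (auto simp: init_config_def tape_rel_def)
    qed
    fix p show "fst (snd (init_config M y) ! j) p < nsyms M"
      using j K by (cases j) (auto simp: init_config_def bit_tape_def)
  qed (use K in \<open>auto simp: init_config_def\<close>)
  from ex_simloop[OF wf this, of t] halt obtain \<sigma>1 where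
    1: "ex [While ?Q (\<lambda>q. q \<noteq> 2) (simbody M b)] (t * (6 * ?K + 4) + 1) ?\<sigma>0 \<sigma>1"
    "trel M b \<sigma>1 (run M y t)" "\<And>i. i < b \<or> ?Q < i \<Longrightarrow> \<sigma>1 i = ?\<sigma>0 i" "\<And>i. length (\<sigma>1 i) \<le> 2 * t + length (?\<sigma>0 i)"
    unfolding run_def by blast
  obtain h where h: "snd (run M y t) ! 1 = (bit_tape z, h)" using halt(2) by (metis prod.collapse)
  define l r where "l = \<sigma>1 (b + 2)" and "r = \<sigma>1 (b + 3)"
  have "tape_rel (snd (run M y t) ! 1) (\<sigma>1 (b + 2 * 1)) (\<sigma>1 (b + 2 * 1 + 1))"
    using 1(2) K unfolding trel_def by (metis Suc_1 Suc_le_eq)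
  moreover have "b + 2 * 1 + 1 = b + 3" by simp
  ultimately have lr: "tape_rel (bit_tape z, h) l r" using h by (simp add: l_def r_def numeral_3_eq_3)
  have nz: "0 \<notin> set l" "0 \<notin> set r" using lr by (auto simp: tape_rel_def)
  have "length (?\<sigma>0 (b + 2)) = 0 \<and> length (?\<sigma>0 (b + 3)) = 0" using blk[of "b + 2"] blk[of "b + 3"] K by auto
  then have len: "length l \<le> 2 * t" "length r \<le> 2 * t" using 1(4)[of "b + 2"] 1(4)[of "b + 3"] by (auto simp: l_def r_def)
  let ?\<sigma>2 = "\<sigma>1(b + 2 := [], b + 3 := rev l @ r)"
  have 2: "ex (pour (b + 2) (b + 3)) (4 * length l + 1) \<sigma>1 ?\<sigma>2"
    using ex_pour[of \<sigma>1 "b + 2" l "b + 3"] nz by (simp add: l_def r_def)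
  let ?e = "\<lambda>a. if a - 1 = 0 then [] else [a - 1::nat]"
  have f: "concat (map ?e xs) = filter (\<lambda>a. a \<noteq> 0) (map (\<lambda>a. a - 1) xs)" for xs by (induction xs) auto
  have tmp: "?\<sigma>2 tmp = []" using out 1(3)[of tmp] by auto
  let ?\<sigma>3 = "?\<sigma>2(b + 3 := [], tmp := rev (map bsym z))"
  have "ex (conv (b + 3) tmp ?e) (length (rev l @ r) * (1 + 3) + 1) ?\<sigma>2 (?\<sigma>2(b + 3 := [], tmp := rev (concat (map ?e (rev l @ r))) @ ?\<sigma>2 tmp))"
    by (rule ex_conv) (use nz out in auto)
  then have 3: "ex (conv (b + 3) tmp ?e) (4 * (length l + length r) + 1) ?\<sigma>2 ?\<sigma>3"
    unfolding f filter_tape_output(1)[OF lr] tmp by (simp add: mult.commute)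
  let ?\<sigma>4 = "?\<sigma>3(tmp := [], out := map bsym z @ ?\<sigma>3 out)"
  have 4: "ex (pour tmp out) (4 * length z + 1) ?\<sigma>3 ?\<sigma>4"
    using ex_pour[of ?\<sigma>3 tmp "rev (map bsym z)" out] out by simp
  have "ex (sim M b out tmp) (Suc (t * (6 * ?K + 4) + 1 + (4 * length l + 1 + (4 * (length l + length r) + 1 + (4 * length z + 1))))) \<sigma> ?\<sigma>4"
    unfolding sim_def
    by (rule ex_Push, rule ex_append[OF _ ex_append[OF 2 ex_append[OF 3 4]]]) (use 1(1) blk[of ?Q] K in \<open>auto\<close>)
  moreover have "Suc (t * (6 * ?K + 4) + 1 + (4 * length l + 1 + (4 * (length l + length r) + 1 + (4 * length z + 1)))) \<le> (t + length y + 1) * (6 * ?K + 50)"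
  proof -
    have "Suc (t * (6 * ?K + 4) + 1 + (4 * length l + 1 + (4 * (length l + length r) + 1 + (4 * length z + 1))))
       \<le> t * (6 * ?K + 4) + 40 * t + 6" using len filter_tape_output(2)[OF lr] by simp
    also have "\<dots> \<le> (t + length y + 1) * (6 * ?K + 50)" by (simp add: algebra_simps)
    finally show ?thesis .
  qed
  ultimately have "ex (sim M b out tmp) ((t + length y + 1) * (6 * ?K + 50)) \<sigma> ?\<sigma>4" by (rule ex_mono)
  moreover have "?\<sigma>4 out = map bsym z @ \<sigma> out" using out 1(3)[of out] by auto
  moreover have "\<forall>i. i < b \<and> i \<noteq> out \<or> ?Q < i \<longrightarrow> ?\<sigma>4 i = \<sigma> i"
    using out 1(3) K by auto
  moreover have "length z \<le> 4 * t + length y" using len filter_tape_output(2)[OF lr] by simp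
  ultimately show ?thesis by blast
qed

lemma wfp_wr: "l < K \<Longrightarrow> l \<noteq> 1 \<Longrightarrow> r < K \<Longrightarrow> r \<noteq> 1 \<Longrightarrow> Suc (fst a) < S \<Longrightarrow> 1 < S \<Longrightarrow> wfp K S (wr l r a)"
  by (cases a; cases "snd a") (auto simp: wr_def)

lemma wfp_wrs:
  "b + 2 * (\<tau> + length as) \<le> K \<Longrightarrow> 2 \<le> b \<Longrightarrow> \<forall>a\<in>set as. Suc (fst a) < S \<Longrightarrow> 1 < S \<Longrightarrow> wfp K S (wrs b \<tau> as)"
  by (induction as arbitrary: \<tau>) (auto intro!: wfp_wr)

lemma wfp_rd:
  assumes "2 \<le> b" "\<forall>\<tau>\<in>set \<tau>s. b + 2 * \<tau> + 1 < K" "\<And>ss. length ss = length acc + length \<tau>s \<Longrightarrow> wfp K S (f ss)"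
  shows "wfp K S (rd b \<tau>s acc f)"
  using assms by (induction \<tau>s arbitrary: acc) auto

lemma wfp_sim:
  assumes "wf_tm M" "b + 2 * ntapes M < K" "4 \<le> b" "nstates M + nsyms M < S" "out < b" "out \<noteq> 1" "t < b" "t \<noteq> 1"
  shows "wfp K S (sim M b out t)"
proof -
  have M: "2 \<le> ntapes M" "2 \<le> nstates M" "3 \<le> nsyms M" using assms by (auto simp: wf_tm_def)
  have "wfp K S (simbody M b)"
  proof -
    have "wfp K S (rd b [0..<ntapes M] []
     (\<lambda>ss. if q - 1 < nstates M \<and> (\<forall>s\<in>set ss. s < nsyms M)
           then wrs b 0 (snd (trans M (q - 1) ss)) @ [Push (b + 2 * ntapes M) (Suc (fst (trans M (q - 1) ss)))]
           else []))" for q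
    proof (rule wfp_rd)
      fix ss :: "nat list" assume len: "length ss = length [] + length [0..<ntapes M]"
      show "wfp K S (if q - 1 < nstates M \<and> (\<forall>s\<in>set ss. s < nsyms M)
           then wrs b 0 (snd (trans M (q - 1) ss)) @ [Push (b + 2 * ntapes M) (Suc (fst (trans M (q - 1) ss)))]
           else [])"
      proof (cases "q - 1 < nstates M \<and> (\<forall>s\<in>set ss. s < nsyms M)")
        case True
        obtain q' as where tr: "trans M (q - 1) ss = (q', as)" by fastforce
        have "q' < nstates M" "length as = ntapes M" "\<forall>(s, d)\<in>set as. s < nsyms M"
          using assms(1) True len tr unfolding wf_tm_def by (auto dest!: spec[of _ "q - 1"] spec[of _ ss])
        then show ?thesis using True tr assms M by (auto intro!: wfp_wrs)
      next
        case False
        then show ?thesis by auto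
      qed
    qed (use assms in auto)
    then show ?thesis using assms by (simp add: simbody_def)
  qed
  then show ?thesis using assms M by (auto simp: sim_def)
qed

section \<open>Fixed-width binary numbers\<close>

text \<open>Least significant bit first and modulo \<open>2 ^ n\<close>: incrementing then works
  from the top of a stack and wraps around to zero.\<close>

fun bits :: "nat \<Rightarrow> nat \<Rightarrow> bool list" where
  "bits 0 i = []"
| "bits (Suc n) i = odd i # bits n (i div 2)"

fun unbits :: "bool list \<Rightarrow> nat" where
  "unbits [] = 0"
| "unbits (b # bs) = (if b then 1 else 0) + 2 * unbits bs"

lemma length_bits [simp]: "length (bits n i) = n"
  by (induction n arbitrary: i) auto

lemma unbits_bits [simp]: "i < 2 ^ n \<Longrightarrow> unbits (bits n i) = i"
proof (induction n arbitrary: i)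
  case (Suc n)
  then have "unbits (bits n (i div 2)) = i div 2" by auto
  then show ?case by simp
qed simp

lemma bits_unbits: "bits (length s) (unbits s) = s"
  by (induction s) auto

lemma unbits_less: "unbits s < 2 ^ length s"
  by (induction s) auto

lemma bits_inj: "i < 2 ^ n \<Longrightarrow> j < 2 ^ n \<Longrightarrow> bits n i = bits n j \<longleftrightarrow> i = j"
  by (metis unbits_bits)

lemma bits_Suc_snoc: "i < 2 ^ n \<Longrightarrow> bits (Suc n) i = bits n i @ [False]"
proof (induction n arbitrary: i)
  case (Suc n)
  then have "bits (Suc n) (i div 2) = bits n (i div 2) @ [False]" by auto
  then show ?case by (simp only: bits.simps append_Cons)
qed simp

lemma bits_zero: "bits n 0 = replicate n False"
  by (induction n) auto

lemma bits_pow: "bits (Suc n) (2 ^ n) = replicate n False @ [True]"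
  by (induction n) auto

section \<open>The tableau as a family of clauses\<close>

text \<open>Symbolic fields of a variable name: the numbers 0, \<open>t\<close>,
  \<open>t + 1\<close> and \<open>2 ^ w\<close> with two tag bits, or one of two nodes over which
  the clause ranges. A schema is a clause in these symbols; there are finitely many of them,
  whatever the input length.\<close>

datatype fref = RZ bool bool | RT bool bool | RT1 bool bool | RL bool bool | RN | RM

type_synonym slit = "bool \<times> nat \<times> fref \<times> fref"
type_synonym lit = "bool \<times> bool list"

text \<open>One bit more than \<open>w\<close>, since times run up to \<open>2 ^ w\<close>
  inclusive; the last two bits are the tag.\<close>

definition fld :: "nat \<Rightarrow> nat \<Rightarrow> bool \<Rightarrow> bool \<Rightarrow> bool list" where
  "fld w j a b = bits (Suc w) j @ [a, b]"

lemma length_fld [simp]: "length (fld w j a b) = w + 3"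
  by (simp add: fld_def)

lemma fld_take: "take (Suc w) (fld w j a b) = bits (Suc w) j"
  and fld_tags: "fld w j a b ! Suc w = a" "fld w j a b ! Suc (Suc w) = b"
  by (simp_all add: fld_def nth_append del: bits.simps)

fun ev :: "nat \<Rightarrow> nat \<Rightarrow> bool list \<Rightarrow> bool list \<Rightarrow> fref \<Rightarrow> bool list" where
  "ev w t n m (RZ a b) = fld w 0 a b"
| "ev w t n m (RT a b) = fld w t a b"
| "ev w t n m (RT1 a b) = fld w (t + 1) a b"
| "ev w t n m (RL a b) = fld w (2 ^ w) a b"
| "ev w t n m RN = n"
| "ev w t n m RM = m"

definition lit_name :: "nat \<Rightarrow> nat \<Rightarrow> bool list \<Rightarrow> bool list \<Rightarrow> bool list" where
  "lit_name \<kappa> k f g = bits \<kappa> k @ f @ g"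

definition inst :: "nat \<Rightarrow> nat \<Rightarrow> nat \<Rightarrow> bool list \<Rightarrow> bool list \<Rightarrow> slit list \<Rightarrow> lit list" where
  "inst \<kappa> w t n m sch = map (\<lambda>(g, k, r, r'). (g, lit_name \<kappa> k (ev w t n m r) (ev w t n m r'))) sch"

definition holds :: "(bool list \<Rightarrow> bool) \<Rightarrow> lit \<Rightarrow> bool" where
  "holds A l \<longleftrightarrow> A (snd l) = fst l"

lemma inst_holds:
  "(\<exists>l\<in>set (inst \<kappa> w t n m sch). holds A l) \<longleftrightarrow>
    (\<exists>(g, k, r, r')\<in>set sch. A (lit_name \<kappa> k (ev w t n m r) (ev w t n m r')) = g)"
  unfolding inst_def holds_def by (auto simp: case_prod_beta)

definition ix :: "cmd list list \<Rightarrow> cmd list \<Rightarrow> nat" where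
  "ix Q c = length (takeWhile (\<lambda>d. d \<noteq> c) Q)"

lemma ix_less: "c \<in> set Q \<Longrightarrow> ix Q c < length Q"
  unfolding ix_def by (induction Q) auto

lemma nth_ix: "c \<in> set Q \<Longrightarrow> Q ! ix Q c = c"
  unfolding ix_def by (induction Q) auto

text \<open>After the control states, the kinds stand for the pointer of stack \<open>i\<close>, the
  symbol \<open>s\<close> of a node, and the successor relation between nodes.\<close>

definition kP :: "cmd list list \<Rightarrow> nat \<Rightarrow> nat" where "kP Q i = length Q + i"
definition kY :: "cmd list list \<Rightarrow> nat \<Rightarrow> nat \<Rightarrow> nat" where "kY Q K s = length Q + K + s"
definition kX :: "cmd list list \<Rightarrow> nat \<Rightarrow> nat \<Rightarrow> nat" where "kX Q K S = length Q + K + S"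

text \<open>The number of kinds doubles as the number of bits used for a kind. By
  \<open>k < 2 ^ k\<close> this is enough, and it does not depend on the input.\<close>

definition kwidth :: "cmd list list \<Rightarrow> nat \<Rightarrow> nat \<Rightarrow> nat" where "kwidth Q K S = length Q + K + S + 1"

lemma kinds_less:
  "c \<in> set Q \<Longrightarrow> ix Q c < kwidth Q K S" "i < K \<Longrightarrow> kP Q i < kwidth Q K S"
  "s < S \<Longrightarrow> kY Q K s < kwidth Q K S" "kX Q K S < kwidth Q K S"
  using ix_less[of c Q] by (auto simp: kwidth_def kP_def kY_def kX_def)

abbreviation "Z00 \<equiv> RZ False False"
abbreviation "T00 \<equiv> RT False False"
abbreviation "U00 \<equiv> RT1 False False"

text \<open>Clauses are implications: the negated literals \<open>pre\<close> say that control is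
  \<open>c\<close>, the scanned stack points to \<open>n\<close>, and \<open>n\<close> carries
  \<open>s\<close>. A push points the stack to the node of time \<open>t + 1\<close>, labels it and
  links it to \<open>n\<close>; a pop needs the second node \<open>m\<close> to speak of the
  successor of \<open>n\<close>.\<close>

definition step_schemas :: "cmd list list \<Rightarrow> nat \<Rightarrow> nat \<Rightarrow> cmd list \<Rightarrow> nat \<Rightarrow> slit list list" where
  "step_schemas Q K S c s =
     (let i = cidx c; r = cact c s;
          pre = [(False, ix Q c, T00, Z00), (False, kP Q i, T00, RN), (False, kY Q K s, RN, Z00)]
      in (pre @ [(True, ix Q (snd r), U00, Z00)]) #
        (case fst r of
           Keep \<Rightarrow> [pre @ [(True, kP Q i, U00, RN)]]
         | Drop \<Rightarrow> [pre @ [(False, kX Q K S, RN, RM), (True, kP Q i, U00, RM)]]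
         | Add b \<Rightarrow> [pre @ [(True, kP Q i, U00, U00)], pre @ [(True, kY Q K b, U00, Z00)],
                     pre @ [(True, kX Q K S, U00, RN)]]))"

text \<open>
  Stacks are linked lists in an append-only heap. A node is a number with a two-bit tag: 00 for
  the node allocated at that time, 01 and 10 for the cells of the choice stack and of the input,
  11 for the empty stack. The variables say that the machine is in state c at time t, that
  stack i points to node n at time t, that node n carries symbol s, and that node m follows n.
\<close>

definition run_schemas :: "cmd list list \<Rightarrow> nat \<Rightarrow> nat \<Rightarrow> slit list list" where
  "run_schemas Q K S = concat (map (\<lambda>c. concat (map (step_schemas Q K S c) [0..<S])) Q)"

text \<open>Copying its pointer preserves the whole content of an untouched stack, because heap
  nodes never change.\<close>

definition frame_schemas :: "cmd list list \<Rightarrow> nat \<Rightarrow> slit list list" where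
  "frame_schemas Q K =
     concat (map (\<lambda>c. map (\<lambda>i. [(False, ix Q c, T00, Z00), (False, kP Q i, T00, RN), (True, kP Q i, U00, RN)])
       (filter (\<lambda>i. i \<noteq> cidx c) [0..<K])) Q)"

definition final_schemas :: "cmd list list \<Rightarrow> slit list list" where
  "final_schemas Q = map (\<lambda>c. [(False, ix Q c, RL False False, Z00)]) (filter (\<lambda>c. c \<noteq> []) Q)"

text \<open>The tag \<open>(i \<noteq> 2, i \<noteq> 0)\<close> is 10 (input) for stack 0, 01
  (choices) for stack 2, and 11 (empty) for all other stacks.\<close>

definition ptr_schemas :: "cmd list list \<Rightarrow> nat \<Rightarrow> slit list list" where
  "ptr_schemas Q K = map (\<lambda>i. [(True, kP Q i, Z00, RZ (i \<noteq> 2) (i \<noteq> 0))]) [0..<K]"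

text \<open>The only clause with two positive literals is the one that lets a choice cell carry 1 or
  2; all nondeterminism sits there, and every other clause is Horn. The symbol \<open>u\<close> of
  the input cell is 0 beyond the end, so such a cell behaves like the empty stack.\<close>

definition heap_schemas :: "cmd list list \<Rightarrow> nat \<Rightarrow> nat \<Rightarrow> cmd list \<Rightarrow> nat \<Rightarrow> slit list list" where
  "heap_schemas Q K S p u =
     [[(True, ix Q p, Z00, Z00)],
      [(True, kY Q K 1, RT False True, Z00), (True, kY Q K 2, RT False True, Z00)],
      [(True, kX Q K S, RT False True, RT1 False True)],
      [(True, kY Q K u, RT True False, Z00)],
      [(True, kX Q K S, RT True False, RT1 True False)],
      [(True, kY Q K 0, RZ True True, Z00)],
      [(True, kX Q K S, RZ True True, RZ True True)]]"

definition schemas :: "cmd list list \<Rightarrow> nat \<Rightarrow> nat \<Rightarrow> cmd list \<Rightarrow> nat \<Rightarrow> slit list list" where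
  "schemas Q K S p u =
     heap_schemas Q K S p u @ run_schemas Q K S @ frame_schemas Q K @ final_schemas Q @ ptr_schemas Q K"

lemma schemas_cases:
  assumes "sch \<in> set (schemas Q K S p u)"
  obtains (step) c s where "c \<in> set Q" "s < S" "sch \<in> set (step_schemas Q K S c s)"
    | (frame) c i where "c \<in> set Q" "i < K" "i \<noteq> cidx c"
        "sch = [(False, ix Q c, T00, Z00), (False, kP Q i, T00, RN), (True, kP Q i, U00, RN)]"
    | (final) c where "c \<in> set Q" "c \<noteq> []" "sch = [(False, ix Q c, RL False False, Z00)]"
    | (ptr) i where "i < K" "sch = [(True, kP Q i, Z00, RZ (i \<noteq> 2) (i \<noteq> 0))]"
    | (heap) "sch \<in> set (heap_schemas Q K S p u)"
proof -
  consider "sch \<in> set (run_schemas Q K S)" | "sch \<in> set (frame_schemas Q K)" | "sch \<in> set (final_schemas Q)"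
    | "sch \<in> set (ptr_schemas Q K)" | "sch \<in> set (heap_schemas Q K S p u)"
    using assms unfolding schemas_def set_append by blast
  then show ?thesis
  proof cases
    case 1
    then show ?thesis using step by (auto simp: run_schemas_def)
  next
    case 2
    then show ?thesis using frame by (auto simp: frame_schemas_def)
  next
    case 3
    then show ?thesis using final by (auto simp: final_schemas_def)
  next
    case 4
    then show ?thesis using ptr by (auto simp: ptr_schemas_def)
  next
    case 5
    then show ?thesis using heap by blast
  qed
qed

definition sinit2 :: "bool list \<Rightarrow> bool list \<Rightarrow> store" where
  "sinit2 x us = (\<lambda>_. [])(0 := map bsym x, 2 := map bsym us)"

definition tableau_sat :: "cmd list list \<Rightarrow> nat \<Rightarrow> nat \<Rightarrow> cmd list \<Rightarrow> nat \<Rightarrow> bool list \<Rightarrow> (bool list \<Rightarrow> bool) \<Rightarrow> bool" where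
  "tableau_sat Q K S p w x A \<longleftrightarrow> (\<forall>t<2 ^ w. \<forall>n m. length n = w + 3 \<longrightarrow> length m = w + 3 \<longrightarrow>
     (\<forall>sch\<in>set (schemas Q K S p (nth0 (map bsym x) t)). \<exists>l\<in>set (inst (kwidth Q K S) w t n m sch). holds A l))"

lemma good_states_closed:
  assumes "good_states K S R" "3 \<le> K" "c \<in> R" "s < S"
  shows "snd (cact c s) \<in> R \<and> cidx c < K \<and> (\<forall>a. fst (cact c s) = Add a \<longrightarrow> a < S)"
  using assms by (cases "c = []") (auto simp: good_states_def)

text \<open>Polarity and kind alone separate the literals of a schema, so they stay distinct under
  every substitution for the fields, even when times or nodes coincide. The degree bounds count
  edges and depend on this.\<close>

lemma schema_literals_distinct:
  assumes "sch \<in> set (schemas Q K S p u)" "set Q = R" "good_states K S R" "p \<in> R" "u < S" "3 \<le> S" "3 \<le> K"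
  shows "sch \<noteq> []" "distinct (map (\<lambda>(g, k, r, r'). (g, k)) sch)" "\<forall>(g, k, r, r')\<in>set sch. k < kwidth Q K S"
proof -
  have cl: "snd (cact c s) \<in> R" "cidx c < K" "\<And>a. fst (cact c s) = Add a \<Longrightarrow> a < S" if "c \<in> R" "s < S" for c s
    using good_states_closed[OF assms(3,7) that] by auto
  have "sch \<noteq> [] \<and> distinct (map (\<lambda>(g, k, r, r'). (g, k)) sch) \<and> (\<forall>(g, k, r, r')\<in>set sch. k < kwidth Q K S)"
    using assms(1)
  proof (cases rule: schemas_cases)
    case (step c s)
    note c = cl[OF step(1)[unfolded assms(2)] step(2)]
    have *: "ix Q c < kwidth Q K S" "ix Q (snd (cact c s)) < kwidth Q K S" "kP Q (cidx c) < kwidth Q K S"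
      "kY Q K s < kwidth Q K S" "kX Q K S < kwidth Q K S" "\<And>a. fst (cact c s) = Add a \<Longrightarrow> kY Q K a < kwidth Q K S"
      using kinds_less step c assms(2) by auto
    have **: "ix Q c < kP Q (cidx c)" "kP Q (cidx c) < kY Q K s" "kY Q K s < kX Q K S"
      using ix_less[OF step(1)] c(2) step(2) by (auto simp: kP_def kY_def kX_def)
    obtain a c' where r: "cact c s = (a, c')" by fastforce
    note ** = ** **(1)[THEN less_imp_neq] **(2)[THEN less_imp_neq] **(3)[THEN less_imp_neq]
       less_trans[OF **(1,2), THEN less_imp_neq] less_trans[OF **(2,3), THEN less_imp_neq]
       less_trans[OF less_trans[OF **(1,2)] **(3), THEN less_imp_neq]
    show ?thesis
    proof (cases a)
      case Keep
      then show ?thesis using step(3) *(1-5) unfolding step_schemas_def Let_def r by (auto simp: **(4-))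
    next
      case Drop
      then show ?thesis using step(3) *(1-5) unfolding step_schemas_def Let_def r by (auto simp: **(4-))
    next
      case (Add b)
      then have "kY Q K b < kwidth Q K S" using *(6) r by simp
      then show ?thesis using step(3) *(1-5) Add unfolding step_schemas_def Let_def r by (auto simp: **(4-))
    qed
  next
    case (frame c i)
    then show ?thesis using kinds_less(1)[OF frame(1)] kinds_less(2)[OF frame(2)] ix_less[OF frame(1)] by (auto simp: kP_def)
  next
    case (final c)
    then show ?thesis using kinds_less(1)[OF final(1)] by auto
  next
    case (ptr i)
    then show ?thesis using kinds_less(2)[OF ptr(1)] by auto
  next
    case heap
    have k: "ix Q p < kwidth Q K S" using kinds_less(1) assms(2,4) by blast
    have y: "kY Q K 0 < kwidth Q K S" "kY Q K 1 < kwidth Q K S" "kY Q K 2 < kwidth Q K S" "kY Q K u < kwidth Q K S"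
      using kinds_less(3) assms(5,6) by simp_all
    have ne: "kY Q K 1 \<noteq> kY Q K 2" by (simp add: kY_def)
    from heap consider "sch = [(True, kY Q K 1, RT False True, Z00), (True, kY Q K 2, RT False True, Z00)]"
      | k r r' where "sch = [(True, k, r, r')]" "k < kwidth Q K S"
      using k y kinds_less(4)[of Q K S] unfolding heap_schemas_def set_simps by blast
    then show ?thesis using y ne by cases simp_all
  qed
  then show "sch \<noteq> []" "distinct (map (\<lambda>(g, k, r, r'). (g, k)) sch)" "\<forall>(g, k, r, r')\<in>set sch. k < kwidth Q K S" by auto
qed

lemma top0_drop: "top0 (drop t xs) = nth0 xs t"
  by (induction xs arbitrary: t) (auto simp: drop_Cons' nth0_def nth_Cons')

lemma tl_drop': "tl (drop t xs) = drop (Suc t) xs"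
  by (simp add: drop_Suc tl_drop)

context
  fixes Q :: "cmd list list" and K S :: nat and p :: "cmd list" and w :: nat and x :: "bool list"
  assumes good: "good_states K S (set Q)" and p: "p \<in> set Q" and K: "3 \<le> K" and S: "3 \<le> S"
begin

abbreviation "nm \<equiv> lit_name (kwidth Q K S)"
abbreviation "N \<equiv> (2::nat) ^ w"
abbreviation "fl \<equiv> fld w"
abbreviation "zz \<equiv> fld w 0 False False"

lemma closed:
  assumes "c \<in> set Q" "s < S"
  shows "snd (cact c s) \<in> set Q" "cidx c < K" "fst (cact c s) = Add a \<Longrightarrow> a < S"
  using good_states_closed[OF good K assms] by auto

definition cfg :: "bool list \<Rightarrow> nat \<Rightarrow> cmd list \<times> store" where
  "cfg us t = (sstep ^^ t) (p, sinit2 x us)"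

lemma cfg_0: "cfg us 0 = (p, sinit2 x us)" by (simp add: cfg_def)

lemma cfg_Suc: "cfg us (Suc t) = (let (c, \<sigma>) = cfg us t; i = cidx c; r = cact c (top0 (\<sigma> i)) in
    (snd r, \<sigma>(i := apply_sop (fst r) (\<sigma> i))))"
  by (simp add: cfg_def sstep_def Let_def case_prod_beta)

lemma cfg_invar: "fst (cfg us t) \<in> set Q \<and> (\<forall>i. \<forall>a\<in>set (snd (cfg us t) i). a < S)"
proof (induction t)
  case 0
  then show ?case using p S by (auto simp: cfg_0 sinit2_def bsym_def)
next
  case (Suc t)
  obtain c \<sigma> where c: "cfg us t = (c, \<sigma>)" by fastforce
  have \<sigma>: "\<forall>i. \<forall>a\<in>set (\<sigma> i). a < S" and cQ: "c \<in> set Q" using Suc c by auto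
  then have t: "top0 (\<sigma> (cidx c)) < S" using S by (cases "\<sigma> (cidx c)") (auto, metis list.set_intros(1))
  have "set (tl (\<sigma> i)) \<subseteq> set (\<sigma> i)" for i by (cases "\<sigma> i") auto
  then show ?case using closed[OF cQ t] \<sigma> c
    by (cases "fst (cact c (top0 (\<sigma> (cidx c))))") (auto simp: cfg_Suc Let_def)
qed

subsection \<open>Soundness\<close>

context
  fixes A :: "bool list \<Rightarrow> bool"
  assumes sat: "tableau_sat Q K S p w x A"
begin

text \<open>Node \<open>n\<close> represents a stack only in its topmost \<open>d\<close> cells.
  Depth \<open>N - t\<close> suffices at time \<open>t\<close>, as a step removes at most one cell,
  and no more is available, since the clauses describe only \<open>N\<close> cells of the input and
  the choices.\<close>

fun prepr :: "nat \<Rightarrow> bool list \<Rightarrow> nat list \<Rightarrow> bool" where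
  "prepr 0 n xs \<longleftrightarrow> length n = w + 3"
| "prepr (Suc d) n xs \<longleftrightarrow> length n = w + 3 \<and> A (nm (kY Q K (top0 xs)) n zz) \<and>
     (\<exists>m. A (nm (kX Q K S) n m) \<and> prepr d m (tl xs))"

lemma prepr_length: "prepr d n xs \<Longrightarrow> length n = w + 3"
  by (cases d) auto

lemma prepr_mono: "prepr (Suc d) n xs \<Longrightarrow> prepr d n xs"
  by (induction d arbitrary: n xs) auto

lemma satD:
  assumes "t < N" "length n = w + 3" "length m = w + 3" "sch \<in> set (schemas Q K S p (nth0 (map bsym x) t))"
  shows "\<exists>(g, k, r, r')\<in>set sch. A (nm k (ev w t n m r) (ev w t n m r')) = g"
proof -
  have "\<exists>l\<in>set (inst (kwidth Q K S) w t n m sch). holds A l"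
    using sat[unfolded tableau_sat_def, rule_format, OF assms] .
  then show ?thesis by (simp only: inst_holds)
qed

lemma prepr_nil: "prepr d (fl 0 True True) []"
proof (induction d)
  case (Suc d)
  have "A (nm (kY Q K 0) (fl 0 True True) zz)"
    using satD[of 0 zz zz "[(True, kY Q K 0, RZ True True, Z00)]"] by (auto simp: schemas_def heap_schemas_def ptr_schemas_def)
  moreover have "A (nm (kX Q K S) (fl 0 True True) (fl 0 True True))"
    using satD[of 0 zz zz "[(True, kX Q K S, RZ True True, RZ True True)]"] by (auto simp: schemas_def heap_schemas_def ptr_schemas_def)
  ultimately show ?case using Suc by auto
qed simp

lemma prepr_input: "j + d \<le> N \<Longrightarrow> prepr d (fl j True False) (drop j (map bsym x))"
proof (induction d arbitrary: j)
  case (Suc d)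
  let ?u = "nth0 (map bsym x) j"
  have "A (nm (kY Q K ?u) (fl j True False) zz)"
    using satD[of j zz zz "[(True, kY Q K ?u, RT True False, Z00)]"] Suc.prems by (auto simp: schemas_def heap_schemas_def ptr_schemas_def)
  moreover have "A (nm (kX Q K S) (fl j True False) (fl (Suc j) True False))"
    using satD[of j zz zz "[(True, kX Q K S, RT True False, RT1 True False)]"] Suc.prems by (auto simp: schemas_def heap_schemas_def ptr_schemas_def)
  ultimately show ?case using Suc by (auto simp: top0_drop tl_drop')
qed simp

text \<open>If both symbols are true at a cell, 2 is read; either way the symbol read is one that
  holds there, which is all that the simulation needs.\<close>

definition choices :: "bool list" where
  "choices = map (\<lambda>t. A (nm (kY Q K 2) (fl t False True) zz)) [0..<N]"

lemma prepr_choice: "j + d \<le> N \<Longrightarrow> prepr d (fl j False True) (drop j (map bsym choices))"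
proof (induction d arbitrary: j)
  case (Suc d)
  have "A (nm (kY Q K 1) (fl j False True) zz) \<or> A (nm (kY Q K 2) (fl j False True) zz)"
    using satD[of j zz zz "[(True, kY Q K 1, RT False True, Z00), (True, kY Q K 2, RT False True, Z00)]"] Suc.prems
    by (auto simp: schemas_def heap_schemas_def ptr_schemas_def)
  then have "A (nm (kY Q K (nth0 (map bsym choices) j)) (fl j False True) zz)"
    using Suc.prems by (auto simp: nth0_def choices_def bsym_def)
  moreover have "A (nm (kX Q K S) (fl j False True) (fl (Suc j) False True))"
    using satD[of j zz zz "[(True, kX Q K S, RT False True, RT1 False True)]"] Suc.prems by (auto simp: schemas_def heap_schemas_def ptr_schemas_def)
  ultimately show ?case using Suc by (auto simp: top0_drop tl_drop')
qed simp

text \<open>The clauses propagate positive facts along the run fixed by \<open>choices\<close>. Only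
  the truth of the listed variables is asserted, so an assignment that also makes spurious variables
  true does no harm.\<close>

lemma tableau_run:
  "t \<le> N \<Longrightarrow> A (nm (ix Q (fst (cfg choices t))) (fl t False False) zz) \<and>
     (\<forall>i<K. \<exists>n. A (nm (kP Q i) (fl t False False) n) \<and> prepr (N - t) n (snd (cfg choices t) i))"
proof (induction t)
  case 0
  have "A (nm (ix Q p) zz zz)"
    using satD[of 0 zz zz "[(True, ix Q p, Z00, Z00)]"] by (auto simp: schemas_def heap_schemas_def ptr_schemas_def)
  moreover have "A (nm (kP Q i) zz (fl 0 (i \<noteq> 2) (i \<noteq> 0)))" if "i < K" for i
    using satD[of 0 zz zz "[(True, kP Q i, Z00, RZ (i \<noteq> 2) (i \<noteq> 0))]"] that by (auto simp: schemas_def heap_schemas_def ptr_schemas_def)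
  moreover have "prepr N (fl 0 (i \<noteq> 2) (i \<noteq> 0)) (sinit2 x choices i)" for i
    using prepr_nil[of N] prepr_input[of 0 N] prepr_choice[of 0 N] by (auto simp: sinit2_def)
  ultimately show ?case by (auto simp: cfg_0)
next
  case (Suc t)
  obtain c \<sigma> where c: "cfg choices t = (c, \<sigma>)" by fastforce
  have t: "t < N" using Suc by simp
  define d where "d = N - Suc t"
  have d: "N - t = Suc d" using t by (simp add: d_def)
  have cQ: "c \<in> set Q" and \<sigma>: "\<forall>i. \<forall>a\<in>set (\<sigma> i). a < S" using cfg_invar[of choices t] c by auto
  define i where "i = cidx c"
  define s where "s = top0 (\<sigma> i)"
  obtain a c' where r: "cact c s = (a, c')" by fastforce
  have s: "s < S" using \<sigma> S by (cases "\<sigma> i") (auto simp: s_def, metis list.set_intros(1))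
  have i: "i < K" using closed[OF cQ s] by (simp add: i_def)
  have next_cfg: "cfg choices (Suc t) = (c', \<sigma>(i := apply_sop a (\<sigma> i)))"
    using c r by (simp add: cfg_Suc Let_def i_def s_def)
  have St: "A (nm (ix Q c) (fl t False False) zz)" using Suc c by auto
  have Pt: "\<exists>n. A (nm (kP Q j) (fl t False False) n) \<and> prepr (Suc d) n (\<sigma> j)" if "j < K" for j
    using Suc c that d by auto
  obtain n where n: "A (nm (kP Q i) (fl t False False) n)" "prepr (Suc d) n (\<sigma> i)" using Pt i by blast
  obtain m where m: "A (nm (kY Q K s) n zz)" "A (nm (kX Q K S) n m)" "prepr d m (tl (\<sigma> i))"
    using n(2) by (auto simp: s_def)
  have len: "length n = w + 3" "length m = w + 3" using n m prepr_length by blast+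
  have mem: "sch \<in> set (schemas Q K S p u)" if "sch \<in> set (step_schemas Q K S c s)" for sch u
    using that cQ s unfolding schemas_def run_schemas_def by auto
  let ?pre = "[(False, ix Q c, T00, Z00), (False, kP Q i, T00, RN), (False, kY Q K s, RN, Z00)]"
  have step: "A (nm k (ev w t n m r) (ev w t n m r'))" if "?pre @ [(True, k, r, r')] \<in> set (step_schemas Q K S c s)" for k r r'
    using satD[OF t len mem[OF that]] St n m by auto
  have "A (nm (ix Q c') (fl (Suc t) False False) zz)"
    using step[of "ix Q c'" U00 Z00] r by (auto simp: step_schemas_def Let_def i_def)
  moreover have "\<exists>n. A (nm (kP Q j) (fl (Suc t) False False) n) \<and> prepr d n ((\<sigma>(i := apply_sop a (\<sigma> i))) j)" if j: "j < K" for j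
  proof (cases "j = i")
    case False
    obtain n' where n': "A (nm (kP Q j) (fl t False False) n')" "prepr (Suc d) n' (\<sigma> j)" using Pt j by blast
    have "[(False, ix Q c, T00, Z00), (False, kP Q j, T00, RN), (True, kP Q j, U00, RN)] \<in> set (schemas Q K S p u)" for u
      using cQ j False unfolding schemas_def frame_schemas_def i_def by force
    from satD[OF t prepr_length[OF n'(2)] len(2) this] St n'
    have "A (nm (kP Q j) (fl (Suc t) False False) n')" by auto
    then show ?thesis using prepr_mono[OF n'(2)] False by auto
  next
    case True
    show ?thesis
    proof (cases a)
      case Keep
      then have "A (nm (kP Q i) (fl (Suc t) False False) n)"
        using step[of "kP Q i" U00 RN] r by (auto simp: step_schemas_def Let_def i_def)
      then show ?thesis using prepr_mono[OF n(2)] True Keep by auto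
    next
      case Drop
      then have "?pre @ [(False, kX Q K S, RN, RM), (True, kP Q i, U00, RM)] \<in> set (step_schemas Q K S c s)"
        using r by (auto simp: step_schemas_def Let_def i_def)
      from satD[OF t len mem[OF this]] St n m
      have "A (nm (kP Q i) (fl (Suc t) False False) m)" by auto
      then show ?thesis using m True Drop by auto
    next
      case (Add b)
      have "A (nm (kP Q i) (fl (Suc t) False False) (fl (Suc t) False False))"
        using step[of "kP Q i" U00 U00] r Add by (auto simp: step_schemas_def Let_def i_def)
      moreover have "A (nm (kY Q K b) (fl (Suc t) False False) zz)"
        using step[of "kY Q K b" U00 Z00] r Add by (auto simp: step_schemas_def Let_def i_def)
      moreover have "A (nm (kX Q K S) (fl (Suc t) False False) n)"
        using step[of "kX Q K S" U00 RN] r Add by (auto simp: step_schemas_def Let_def i_def)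
      moreover have "prepr d (fl (Suc t) False False) (b # \<sigma> i)"
      proof (cases d)
        case (Suc d')
        \<comment> \<open>\<open>n\<close> represents the old stack to depth \<open>Suc d\<close>,
          two more than is needed below the pushed cell.\<close>
        then have "prepr d' n (\<sigma> i)" using prepr_mono[OF prepr_mono] n(2) by blast
        then show ?thesis using calculation Suc by auto
      qed simp
      ultimately show ?thesis using True Add by auto
    qed
  qed
  ultimately show ?case using next_cfg by (simp add: d_def)
qed

lemma tableau_sound: "\<exists>us. length us = N \<and> fst ((sstep ^^ N) (p, sinit2 x us)) = []"
proof (intro exI conjI)
  let ?c = "fst (cfg choices N)"
  show "length choices = N" by (simp add: choices_def)
  have "?c = []"
  proof (rule ccontr)
    assume "?c \<noteq> []"
    then have "[(False, ix Q ?c, RL False False, Z00)] \<in> set (schemas Q K S p u)" for u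
      using cfg_invar[of choices N] unfolding schemas_def final_schemas_def by auto
    from satD[OF _ _ _ this, of 0 zz zz] tableau_run[of N] show False by auto
  qed
  then show "fst ((sstep ^^ N) (p, sinit2 x choices)) = []" by (simp add: cfg_def)
qed

end

subsection \<open>Completeness\<close>

context
  fixes us :: "bool list"
  assumes halt: "fst ((sstep ^^ N) (p, sinit2 x us)) = []" and us: "length us = N"
begin

definition num :: "bool list \<Rightarrow> nat" where "num n = unbits (take (Suc w) n)"

text \<open>Intended meaning of a node, given for every bit string because the clauses range over
  all of them. A 00 node with number \<open>j > 0\<close> denotes the stack accessed by the step
  leading to time \<open>j\<close>, as it stands after that step, whatever the operation
  was.\<close>

definition content :: "bool list \<Rightarrow> nat list" where
  "content n = (let j = num n; a = n ! Suc w; b = n ! Suc (Suc w) in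
     if a then (if b then [] else drop j (map bsym x))
     else if b then drop j (map bsym us)
     else if j = 0 then [] else snd (cfg us j) (cidx (fst (cfg us (j - 1)))))"

text \<open>A pointer variable holds for every node whose content equals the stack, not just for one
  canonical node. The clauses thereby turn into equations between contents, true for all
  substitutions of \<open>n\<close> and \<open>m\<close>.\<close>

definition asg :: "bool list \<Rightarrow> bool" where
  "asg v = (let \<kappa> = kwidth Q K S; k = unbits (take \<kappa> v); f = take (w + 3) (drop \<kappa> v); g = drop (\<kappa> + w + 3) v in
     if k < length Q then Q ! k = fst (cfg us (num f))
     else if k < length Q + K then content g = snd (cfg us (num f)) (k - length Q)
     else if k < length Q + K + S then top0 (content f) = k - length Q - K
     else content g = tl (content f))"

lemma kw: "k < kwidth Q K S \<Longrightarrow> k < 2 ^ kwidth Q K S"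
  by (erule order.strict_trans[OF _ less_exp])

lemma num_fl: "j < 2 ^ Suc w \<Longrightarrow> num (fl j a b) = j"
  unfolding num_def fld_take by (rule unbits_bits)

lemma N2: "t \<le> N \<Longrightarrow> t < 2 ^ Suc w"
  by (rule le_less_trans[of _ N]) auto

lemma content_fl: "j < 2 ^ Suc w \<Longrightarrow> content (fl j a b) =
    (if a then (if b then [] else drop j (map bsym x)) else if b then drop j (map bsym us)
     else if j = 0 then [] else snd (cfg us j) (cidx (fst (cfg us (j - 1)))))"
  unfolding content_def Let_def num_fl fld_tags by (rule refl)

lemma asg_nm:
  assumes "k < kwidth Q K S" "length f = w + 3"
  shows "asg (nm k f g) = (
     if k < length Q then Q ! k = fst (cfg us (num f))
     else if k < length Q + K then content g = snd (cfg us (num f)) (k - length Q)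
     else if k < length Q + K + S then top0 (content f) = k - length Q - K
     else content g = tl (content f))"
  using assms kw[OF assms(1)] by (simp add: asg_def lit_name_def Let_def)

lemma asg_S: "c \<in> set Q \<Longrightarrow> t \<le> N \<Longrightarrow> asg (nm (ix Q c) (fl t False False) g) \<longleftrightarrow> c = fst (cfg us t)"
  using ix_less[of c Q] nth_ix[of c Q] by (simp add: asg_nm kinds_less num_fl[OF N2])

lemma asg_P: "i < K \<Longrightarrow> t \<le> N \<Longrightarrow> asg (nm (kP Q i) (fl t False False) g) \<longleftrightarrow> content g = snd (cfg us t) i"
  by (subst asg_nm) (auto simp: kinds_less num_fl[OF N2], auto simp: kP_def)

lemma asg_Y: "s < S \<Longrightarrow> length f = w + 3 \<Longrightarrow> asg (nm (kY Q K s) f g) \<longleftrightarrow> top0 (content f) = s"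
  by (subst asg_nm) (auto simp: kinds_less, auto simp: kY_def)

lemma asg_X: "length f = w + 3 \<Longrightarrow> asg (nm (kX Q K S) f g) \<longleftrightarrow> content g = tl (content f)"
  by (subst asg_nm) (auto simp: kinds_less, auto simp: kX_def)

lemma step_sat:
  assumes "t < N" "length n = w + 3" "length m = w + 3" "c \<in> set Q" "s < S" "sch \<in> set (step_schemas Q K S c s)"
  shows "\<exists>(g, k, r, r')\<in>set sch. asg (nm k (ev w t n m r) (ev w t n m r')) = g"
proof -
  let ?i = "cidx c"
  obtain a c' where r: "cact c s = (a, c')" by fastforce
  have c': "c' \<in> set Q" "?i < K" "\<And>b. a = Add b \<Longrightarrow> b < S" using closed[OF assms(4,5)] r by auto
  have t: "t \<le> N" "Suc t \<le> N" using assms by auto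
  let ?pre = "[(False, ix Q c, T00, Z00), (False, kP Q ?i, T00, RN), (False, kY Q K s, RN, Z00)]"
  let ?ok = "\<lambda>(g, k, r, r'). asg (nm k (ev w t n m r) (ev w t n m r')) = g"
  show ?thesis
  proof (cases "c = fst (cfg us t) \<and> content n = snd (cfg us t) ?i \<and> top0 (content n) = s")
    case False
    then have "Bex (set ?pre) ?ok"
      using asg_S[OF assms(4) t(1)] asg_P[OF c'(2) t(1)] asg_Y[OF assms(5,2)] by simp
    moreover have "set ?pre \<subseteq> set sch"
      using assms(6) unfolding step_schemas_def Let_def by (auto split: sop.splits)
    ultimately show ?thesis by blast
  next
    case True
    then have s': "fst (cfg us t) = c" "top0 (snd (cfg us t) ?i) = s" and n: "content n = snd (cfg us t) ?i" by auto
    have nc: "fst (cfg us (Suc t)) = c'" "snd (cfg us (Suc t)) ?i = apply_sop a (content n)"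
      using r n by (simp_all add: cfg_Suc Let_def case_prod_beta s')
    have U: "content (fl (Suc t) False False) = apply_sop a (content n)"
      using N2[OF t(2)] nc(2) s'(1) by (simp add: content_fl)
    have S1: "asg (nm (ix Q c') (fl (Suc t) False False) zz)" using asg_S[OF c'(1) t(2)] nc by simp
    have P1: "asg (nm (kP Q ?i) (fl (Suc t) False False) g) \<longleftrightarrow> content g = apply_sop a (content n)" for g
      using asg_P[OF c'(2) t(2)] nc by simp
    from assms(6) consider "sch = ?pre @ [(True, ix Q c', U00, Z00)]"
      | "a = Keep" "sch = ?pre @ [(True, kP Q ?i, U00, RN)]"
      | "a = Drop" "sch = ?pre @ [(False, kX Q K S, RN, RM), (True, kP Q ?i, U00, RM)]"
      | b where "a = Add b" "sch = ?pre @ [(True, kP Q ?i, U00, U00)]"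
      | b where "a = Add b" "sch = ?pre @ [(True, kY Q K b, U00, Z00)]"
      | b where "a = Add b" "sch = ?pre @ [(True, kX Q K S, U00, RN)]"
      unfolding step_schemas_def Let_def r by (cases a) auto
    then show ?thesis
    proof cases
      case 1
      then show ?thesis using S1 by simp
    next
      case 2
      then show ?thesis using P1[of n] by simp
    next
      case 3
      then show ?thesis using P1[of m] asg_X[OF assms(2), of m] by auto
    next
      case 4
      then show ?thesis using P1[of "fl (Suc t) False False"] U by simp
    next
      case 5
      then show ?thesis using asg_Y[OF c'(3)[OF 5(1)], of "fl (Suc t) False False" zz] U by simp
    next
      case 6
      then show ?thesis using asg_X[of "fl (Suc t) False False" n] U by simp
    qed
  qed
qed

lemma tableau_complete: "tableau_sat Q K S p w x asg"
  unfolding tableau_sat_def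
proof (intro allI impI ballI)
  fix t :: nat and n m :: "bool list" and sch
  assume t: "t < N" and len: "length n = w + 3" "length m = w + 3"
    and sch: "sch \<in> set (schemas Q K S p (nth0 (map bsym x) t))"
  have u: "nth0 (map bsym x) t < S" using S by (auto simp: nth0_def bsym_def)
  have t': "t \<le> N" "Suc t \<le> N" "0 \<le> N" using t by auto
  note n2 = N2[OF t'(1)] N2[OF t'(2)] N2[OF t'(3)]
  have "\<exists>(g, k, r, r')\<in>set sch. asg (nm k (ev w t n m r) (ev w t n m r')) = g"
    using sch
  proof (cases rule: schemas_cases)
    case (step c s)
    then show ?thesis using step_sat[OF t len] by blast
  next
    case (frame c i)
    have "snd (cfg us (Suc t)) i = snd (cfg us t) i" if "c = fst (cfg us t)"
      using frame that by (simp add: cfg_Suc Let_def case_prod_beta)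
    then show ?thesis using frame asg_S[OF frame(1) t'(1)] asg_P[OF frame(2) t'(1)] asg_P[OF frame(2) t'(2)] by auto
  next
    case (final c)
    then show ?thesis using asg_S[OF final(1), of N zz] halt by (auto simp: cfg_def)
  next
    case (ptr i)
    then show ?thesis using asg_P[OF ptr(1), of 0] n2 by (auto simp: cfg_0 content_fl sinit2_def)
  next
    case heap
    have c: "content (fl t False True) = drop t (map bsym us)" "content (fl (Suc t) False True) = drop (Suc t) (map bsym us)"
      "content (fl t True False) = drop t (map bsym x)" "content (fl (Suc t) True False) = drop (Suc t) (map bsym x)"
      "content (fl 0 True True) = []"
      using n2 by (simp_all add: content_fl)
    \<comment> \<open>Here \<open>length us = 2 ^ w\<close> matters: every choice cell mentioned by
      the clauses carries a bit.\<close>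
    have us': "top0 (drop t (map bsym us)) = 1 \<or> top0 (drop t (map bsym us)) = 2"
      using t us by (simp add: top0_drop nth0_def bsym_def)
    have Y: "asg (nm (kY Q K a) (fl j b b') zz) \<longleftrightarrow> top0 (content (fl j b b')) = a" if "a < S" for a j b b'
      using asg_Y[OF that] by simp
    have X: "asg (nm (kX Q K S) (fl j b b') g) \<longleftrightarrow> content g = tl (content (fl j b b'))" for j b b' g
      using asg_X by simp
    consider "sch = [(True, ix Q p, Z00, Z00)]"
      | "sch = [(True, kY Q K 1, RT False True, Z00), (True, kY Q K 2, RT False True, Z00)]"
      | "sch = [(True, kX Q K S, RT False True, RT1 False True)]"
      | "sch = [(True, kY Q K (nth0 (map bsym x) t), RT True False, Z00)]"
      | "sch = [(True, kX Q K S, RT True False, RT1 True False)]"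
      | "sch = [(True, kY Q K 0, RZ True True, Z00)]"
      | "sch = [(True, kX Q K S, RZ True True, RZ True True)]"
      using heap unfolding heap_schemas_def set_simps by blast
    then show ?thesis
    proof cases
      case 1
      then show ?thesis using asg_S[OF p, of 0 zz] by (simp add: cfg_0)
    next
      case 2
      then show ?thesis using Y[of 1 t False True] Y[of 2 t False True] S us' c(1) by auto
    next
      case 3
      then show ?thesis using X[of t False True "fl (Suc t) False True"] c by (simp add: tl_drop')
    next
      case 4
      then show ?thesis using Y[OF u, of t True False] c by (simp add: top0_drop)
    next
      case 5
      then show ?thesis using X[of t True False "fl (Suc t) True False"] c by (simp add: tl_drop')
    next
      case 6
      then show ?thesis using Y[of 0 0 True True] c S by simp
    next
      case 7
      then show ?thesis using X[of 0 True True "fl 0 True True"] c by simp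
    qed
  qed
  then show "\<exists>l\<in>set (inst (kwidth Q K S) w t n m sch). holds asg l"
    by (simp only: inst_holds)
qed

end

end

section \<open>The triangle graph\<close>

lemma unbits_append: "unbits (s @ r) = unbits s + 2 ^ length s * unbits r"
  by (induction s) (auto simp: algebra_simps)

lemma binary_0 [simp]: "binary 0 = []"
  by (subst binary.simps) simp

text \<open>The final \<open>True\<close> is the most significant bit, so no zeros are lost and the
  binary expansion is the string itself. Vertex numbers built this way can be written and searched
  for as strings, without arithmetic.\<close>

lemma binary_unbits: "binary (unbits (s @ [True])) = s @ [True]"
proof (induction s)
  case Nil
  then show ?case by (simp add: binary.simps)
next
  case (Cons b s)
  have "unbits (s @ [True]) > 0" by (simp add: unbits_append)
  then show ?case using Cons by (subst binary.simps) auto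
qed

text \<open>Every variable s owns a triangle formed by the hub 0 and the two vertices below.\<close>

definition va :: "bool list \<Rightarrow> nat" where "va s = unbits (s @ [True])"
definition vb :: "bool list \<Rightarrow> nat" where "vb s = unbits (s @ [False, True])"

lemma binary_va: "binary (va s) = s @ [True]"
  by (simp add: va_def binary_unbits)

lemma binary_vb: "binary (vb s) = s @ [False, True]"
  using binary_unbits[of "s @ [False]"] by (simp add: vb_def)

lemma va_vb_simps [simp]:
  "va s = va r \<longleftrightarrow> s = r" "vb s = vb r \<longleftrightarrow> s = r" "0 < va s" "0 < vb s" "va s \<noteq> 0" "vb s \<noteq> 0" "va s < vb s" "va s \<noteq> vb s"
proof -
  show "va s = va r \<longleftrightarrow> s = r" by (metis binary_va append_same_eq)
  show "vb s = vb r \<longleftrightarrow> s = r" by (metis binary_vb append_same_eq)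
qed (auto simp: va_def vb_def unbits_append)

lemma va_neq_vb: "length s = length r \<Longrightarrow> va s \<noteq> vb r"
  using binary_va[of s] binary_vb[of r] by (metis append_eq_append_conv length_append_singleton append_Cons append_Nil append_assoc last_snoc butlast_snoc length_butlast length_append n_not_Suc_n)

definition names :: "nat \<Rightarrow> bool list set" where "names W = {s. length s = W}"

lemma names_bits: "names W = bits W ` {0..<2 ^ W}"
proof
  show "names W \<subseteq> bits W ` {0..<2 ^ W}"
  proof
    fix s assume "s \<in> names W"
    then have "s = bits W (unbits s)" "unbits s < 2 ^ W" using bits_unbits[of s] unbits_less[of s] by (auto simp: names_def)
    then show "s \<in> bits W ` {0..<2 ^ W}" by auto
  qed
qed (auto simp: names_def)

lemma finite_names [simp]: "finite (names W)"
  by (simp add: names_bits)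

text \<open>The edge whose absence from a spanning tree makes the literal true.\<close>

definition ledge :: "lit \<Rightarrow> nat set" where
  "ledge l = {0, if fst l then va (snd l) else vb (snd l)}"

definition tri_edges :: "nat \<Rightarrow> nat set set" where
  "tri_edges W = (\<Union>s\<in>names W. {{0, va s}, {0, vb s}, {va s, vb s}})"

definition tri_mcst :: "nat \<Rightarrow> nat \<Rightarrow> lit list list \<Rightarrow> nat mcst" where
  "tri_mcst W k LS = \<lparr>verts = insert 0 (va ` names W \<union> vb ` names W), edges = tri_edges W, cost = (\<lambda>_. 0),
     constraints = map (\<lambda>ls. (ledge ` set ls, length ls - k)) LS\<rparr>"

text \<open>\<open>k \<le> length ls\<close> makes the truncated subtraction in the degree bound
  exact, and distinctness of the literals makes the number of their edges equal to
  \<open>length ls\<close>.\<close>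

definition good_lits :: "nat \<Rightarrow> nat \<Rightarrow> lit list \<Rightarrow> bool" where
  "good_lits W k ls \<longleftrightarrow> distinct ls \<and> snd ` set ls \<subseteq> names W \<and> k \<le> length ls"

lemma ledge_in: "good_lits W k ls \<Longrightarrow> l \<in> set ls \<Longrightarrow> ledge l \<in> tri_edges W"
  by (auto simp: good_lits_def tri_edges_def ledge_def image_subset_iff)

lemma ledge_inj: "length (snd l) = length (snd r) \<Longrightarrow> ledge l = ledge r \<Longrightarrow> l = r"
  using va_neq_vb[of "snd l" "snd r"] va_neq_vb[of "snd r" "snd l"]
  by (cases l; cases r) (auto simp: ledge_def doubleton_eq_iff split: if_splits)

lemma ledge_inj_on: "good_lits W k ls \<Longrightarrow> inj_on ledge (set ls)"
  by (rule inj_onI, rule ledge_inj) (auto simp: good_lits_def names_def)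

lemma wf_tri_mcst: "\<forall>ls\<in>set LS. good_lits W k ls \<Longrightarrow> wf_mcst (tri_mcst W k LS)"
  unfolding wf_mcst_def tri_mcst_def using ledge_in
  by (auto simp: tri_edges_def split: if_splits)

text \<open>The two vertices of a triangle reach the rest of the graph only through the hub; without
  both hub edges they would be cut off.\<close>

lemma spanning_tree_omits_one:
  assumes T: "spanning_tree (tri_mcst W k LS) T" and s: "s \<in> names W"
  shows "{0, va s} \<in> T \<or> {0, vb s} \<in> T"
proof (rule ccontr)
  assume "\<not> ({0, va s} \<in> T \<or> {0, vb s} \<in> T)"
  then have n: "{0, va s} \<notin> T" "{0, vb s} \<notin> T" by auto
  have sub: "T \<subseteq> tri_edges W" using T by (simp add: spanning_tree_def tri_mcst_def)
  have "(va s, 0) \<in> {(a, b). {a, b} \<in> T}\<^sup>*"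
    using T s unfolding spanning_tree_def connected_on_def by (auto simp: tri_mcst_def)
  moreover have "y \<in> {va s, vb s}" if "(va s, y) \<in> {(a, b). {a, b} \<in> T}\<^sup>*" for y
    using that
  proof (induction rule: rtrancl_induct)
    case (step y z)
    then have e: "{y, z} \<in> T" "y = va s \<or> y = vb s" by auto
    then obtain r where r: "r \<in> names W" "{y, z} \<in> {{0, va r}, {0, vb r}, {va r, vb r}}"
      using sub by (auto simp: tri_edges_def)
    have "length s = length r" using r s by (simp add: names_def)
    then show ?case using r e n va_neq_vb[of s r] va_neq_vb[of r s]
      by (auto simp: doubleton_eq_iff insert_commute)
  qed auto
  ultimately have "0 \<in> {va s, vb s}" by blast
  then show False by (metis insertE singletonD va_vb_simps(5,6))
qed

text \<open>The bound is \<open>length ls - k\<close>, so with violation below \<open>k\<close> some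
  literal edge is missing from the tree. A variable counts as true when its edge to
  \<open>va s\<close> is missing; a missing edge to \<open>vb s\<close> forces the edge to
  \<open>va s\<close> into the tree and so makes the variable false.\<close>

lemma violation_small_satisfies:
  assumes T: "spanning_tree (tri_mcst W k LS) T" and b: "meets_bounds (tri_mcst W k LS) T r" "r < real k"
    and ls: "ls \<in> set LS" "good_lits W k ls"
  shows "\<exists>l\<in>set ls. holds (\<lambda>s. {0, va s} \<notin> T) l"
proof -
  let ?F = "ledge ` set ls"
  have "real (card (T \<inter> ?F)) \<le> real (length ls - k) + r"
    using b(1) ls(1) by (auto simp: meets_bounds_def tri_mcst_def)
  then have "real (card (T \<inter> ?F)) < real (length ls)" using b(2) ls(2) by (simp add: good_lits_def of_nat_diff)
  moreover have "card ?F = length ls"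
    using card_image[OF ledge_inj_on[OF ls(2)]] ls(2) by (simp add: good_lits_def distinct_card)
  ultimately have "\<not> ?F \<subseteq> T" by (metis Int_absorb1 of_nat_less_iff less_irrefl)
  then obtain l where l: "l \<in> set ls" "ledge l \<notin> T" by auto
  have "snd l \<in> names W" using ls(2) l(1) by (auto simp: good_lits_def)
  then have "holds (\<lambda>s. {0, va s} \<notin> T) l"
    using spanning_tree_omits_one[OF T] l(2) by (auto simp: holds_def ledge_def split: if_splits)
  then show ?thesis using l by blast
qed

definition asg_tree :: "nat \<Rightarrow> (bool list \<Rightarrow> bool) \<Rightarrow> nat set set" where
  "asg_tree W A = (\<Union>s\<in>names W. {{va s, vb s}, if A s then {0, vb s} else {0, va s}})"

lemma cycle_neighbours:
  assumes "is_cycle T vs" "v \<in> set vs"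
  shows "\<exists>a\<in>set vs. \<exists>b\<in>set vs. a \<noteq> b \<and> {v, a} \<in> T \<and> {v, b} \<in> T"
proof -
  let ?n = "length vs"
  obtain i where i: "i < ?n" "vs ! i = v" using assms(2) by (auto simp: in_set_conv_nth)
  have n: "3 \<le> ?n" "distinct vs" and e: "\<And>i. i < ?n \<Longrightarrow> {vs ! i, vs ! (Suc i mod ?n)} \<in> T"
    using assms(1) by (auto simp: is_cycle_def)
  define j where "j = (if i = 0 then ?n - 1 else i - 1)"
  have j: "j < ?n" "Suc j mod ?n = i" using i n by (auto simp: j_def)
  have "Suc i mod ?n \<noteq> j"
    using i n by (cases "Suc i = ?n") (auto simp: j_def)
  moreover have "Suc i mod ?n < ?n" using n by (intro mod_less_divisor) linarith
  ultimately have "vs ! (Suc i mod ?n) \<noteq> vs ! j" using n j by (simp add: nth_eq_iff_index_eq)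
  moreover have "{v, vs ! (Suc i mod ?n)} \<in> T" using e[OF i(1)] i by simp
  moreover have "{v, vs ! j} \<in> T" using e[OF j(1)] i j by (simp add: insert_commute)
  moreover have "vs ! (Suc i mod ?n) \<in> set vs" using n by (intro nth_mem mod_less_divisor) linarith
  moreover have "vs ! j \<in> set vs" using j by simp
  ultimately show ?thesis by blast
qed

lemma asg_tree_mem:
  assumes "s \<in> names W"
  shows "{0, va s} \<in> asg_tree W A \<longleftrightarrow> \<not> A s" "{0, vb s} \<in> asg_tree W A \<longleftrightarrow> A s"
proof -
  have "length s = length r" if "r \<in> names W" for r using that assms by (simp add: names_def)
  then have d: "va s \<noteq> vb r" "vb s \<noteq> va r" if "r \<in> names W" for r
    using that va_neq_vb by metis+
  show "{0, va s} \<in> asg_tree W A \<longleftrightarrow> \<not> A s"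
    using assms d by (auto simp: asg_tree_def doubleton_eq_iff split: if_splits)
  show "{0, vb s} \<in> asg_tree W A \<longleftrightarrow> A s"
    using assms d by (auto simp: asg_tree_def doubleton_eq_iff split: if_splits)
qed

text \<open>Each triangle contributes a path from the hub over \<open>near s\<close> to
  \<open>far s\<close>. Acyclicity is shown by peeling leaves: a cycle vertex has two neighbours on
  the cycle, which excludes every \<open>far s\<close>, then every \<open>near s\<close>, and leaves
  only the hub.\<close>

lemma asg_tree_spanning: "spanning_tree (tri_mcst W k LS) (asg_tree W A)"
proof -
  let ?T = "asg_tree W A"
  let ?V = "insert 0 (va ` names W \<union> vb ` names W)"
  let ?R = "{(a, b). {a, b} \<in> ?T}"
  define far near where "far s = (if A s then va s else vb s)" and "near s = (if A s then vb s else va s)" for s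
  have T: "?T = (\<Union>s\<in>names W. {{far s, near s}, {0, near s}})"
    unfolding asg_tree_def far_def near_def by (auto simp: insert_commute)
  have d: "va s \<noteq> vb r" if "s \<in> names W" "r \<in> names W" for s r
    using that va_neq_vb by (simp add: names_def)
  have eq: "far s = far r \<longleftrightarrow> s = r" "near s = near r \<longleftrightarrow> s = r" "far s \<noteq> near r" "far s \<noteq> 0" "near s \<noteq> 0"
    if "s \<in> names W" "r \<in> names W" for s r
    using d[OF that] d[OF that(2,1)] by (auto simp: far_def near_def)
  have "?T \<subseteq> tri_edges W" by (auto simp: asg_tree_def tri_edges_def split: if_splits)
  moreover have "connected_on ?V ?T"
  proof -
    have sym: "sym (?R\<^sup>*)" by (rule sym_rtrancl) (auto simp: sym_def insert_commute)
    have to0: "(v, 0) \<in> ?R\<^sup>*" if "v \<in> ?V" for v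
    proof -
      have "(near s, 0) \<in> ?R" "(far s, near s) \<in> ?R" if "s \<in> names W" for s
        using that by (auto simp: T insert_commute)
      then have "(near s, 0) \<in> ?R\<^sup>*" "(far s, 0) \<in> ?R\<^sup>*" if "s \<in> names W" for s
        using that by (blast, meson converse_rtrancl_into_rtrancl r_into_rtrancl)
      moreover have "v = 0 \<or> (\<exists>s\<in>names W. v = near s \<or> v = far s)"
        using that by (auto simp: near_def far_def)
      ultimately show ?thesis by auto
    qed
    show ?thesis unfolding connected_on_def using to0 sym by (meson rtrancl_trans symD)
  qed
  moreover have "\<nexists>vs. is_cycle ?T vs"
  proof
    assume "\<exists>vs. is_cycle ?T vs"
    then obtain vs where vs: "is_cycle ?T vs" by blast
    have nb: "z = near s" if "{far s, z} \<in> ?T" "s \<in> names W" for s z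
    proof -
      from that obtain r where r: "r \<in> names W" "{far s, z} = {far r, near r} \<or> {far s, z} = {0, near r}" by (auto simp: T)
      then show ?thesis using eq[OF that(2) r(1)] by (auto simp: doubleton_eq_iff)
    qed
    have nb': "z = 0 \<or> z = far s" if "{near s, z} \<in> ?T" "s \<in> names W" for s z
    proof -
      from that obtain r where r: "r \<in> names W" "{near s, z} = {far r, near r} \<or> {near s, z} = {0, near r}" by (auto simp: T)
      then show ?thesis using eq[OF that(2) r(1)] eq[OF r(1) that(2)] by (auto simp: doubleton_eq_iff)
    qed
    have far: "far s \<notin> set vs" if "s \<in> names W" for s
      using cycle_neighbours[OF vs, of "far s"] nb[OF _ that] by metis
    have near: "near s \<notin> set vs" if "s \<in> names W" for s
      using cycle_neighbours[OF vs, of "near s"] nb'[OF _ that] far[OF that] by metis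
    have "v = 0" if v: "v \<in> set vs" for v
    proof -
      obtain b where "{v, b} \<in> ?T" using cycle_neighbours[OF vs v] by blast
      then obtain s where "s \<in> names W" "{v, b} = {far s, near s} \<or> {v, b} = {0, near s}" by (auto simp: T)
      then have "v = far s \<or> v = near s \<or> v = 0" unfolding doubleton_eq_iff by metis
      then show ?thesis using far near v \<open>s \<in> names W\<close> by metis
    qed
    then have "set vs \<subseteq> {0}" by blast
    then have "card (set vs) \<le> card {0::nat}" by (rule card_mono[rotated]) simp
    moreover have "3 \<le> card (set vs)" using vs by (simp add: is_cycle_def distinct_card)
    ultimately show False by simp
  qed
  ultimately show ?thesis by (simp add: spanning_tree_def tri_mcst_def)
qed

text \<open>The tree of an assignment contains exactly the edges of the false literals, and at most
  \<open>length ls - k\<close> literals are false.\<close>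

lemma satisfied_feasible:
  assumes "\<forall>ls\<in>set LS. good_lits W k ls \<and> k \<le> length (filter (holds A) ls)"
  shows "feasible (tri_mcst W k LS)"
proof -
  have "meets_bounds (tri_mcst W k LS) (asg_tree W A) 0"
    unfolding meets_bounds_def
  proof safe
    fix F b assume "(F, b) \<in> set (constraints (tri_mcst W k LS))"
    then obtain ls where ls: "ls \<in> set LS" "F = ledge ` set ls" "b = length ls - k" by (auto simp: tri_mcst_def)
    have g: "good_lits W k ls" "k \<le> length (filter (holds A) ls)" using assms ls by auto
    have "ledge l \<in> asg_tree W A \<longleftrightarrow> \<not> holds A l" if "l \<in> set ls" for l
      using asg_tree_mem[of "snd l" W A] that g(1) by (auto simp: good_lits_def ledge_def holds_def)
    then have "asg_tree W A \<inter> F = ledge ` set (filter (\<lambda>l. \<not> holds A l) ls)"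
      unfolding ls by auto
    moreover have "card (ledge ` set (filter (\<lambda>l. \<not> holds A l) ls)) \<le> length (filter (\<lambda>l. \<not> holds A l) ls)"
      using card_image_le card_length le_trans by (metis List.finite_set)
    ultimately have "card (asg_tree W A \<inter> F) \<le> b"
      using sum_length_filter_compl[of "holds A" ls] g(2) ls(3) by simp
    then show "real (card (asg_tree W A \<inter> F)) \<le> real b + 0" by simp
  qed
  then show ?thesis using asg_tree_spanning unfolding feasible_def by blast
qed

section \<open>Encodings\<close>

text \<open>Any order gives a legal encoding; the one chosen here and for the edges is the order in
  which a binary counter runs through the names.\<close>

definition enc_vs :: "nat \<Rightarrow> nat list" where
  "enc_vs W = 0 # concat (map (\<lambda>i. [va (bits W i), vb (bits W i)]) [0..<2 ^ W])"

definition enc_es :: "nat \<Rightarrow> nat set list" where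
  "enc_es W = concat (map (\<lambda>i. [{0, va (bits W i)}, {0, vb (bits W i)}, {va (bits W i), vb (bits W i)}]) [0..<2 ^ W])"

definition enc_tri :: "nat \<Rightarrow> nat \<Rightarrow> lit list list \<Rightarrow> bool list" where
  "enc_tri W k LS = enc_list enc_nat (enc_vs W) @
     enc_list (\<lambda>e. enc_edge e @ enc_rat 0) (enc_es W) @
     enc_list (\<lambda>(fs, b). enc_list enc_edge fs @ enc_nat b) (map (\<lambda>ls. (map ledge ls, length ls - k)) LS)"

lemma distinct_concat_map:
  assumes "distinct xs" "\<And>x. x \<in> set xs \<Longrightarrow> distinct (f x)" "\<And>x y. x \<in> set xs \<Longrightarrow> y \<in> set xs \<Longrightarrow> x \<noteq> y \<Longrightarrow> set (f x) \<inter> set (f y) = {}"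
  shows "distinct (concat (map f xs))"
  using assms by (induction xs) auto

lemma encodes_tri:
  assumes "\<forall>ls\<in>set LS. good_lits W k ls"
  shows "encodes_instance (enc_tri W k LS) (tri_mcst W k LS)"
proof -
  have b: "bits W i \<in> names W" for i by (simp add: names_def)
  have d: "va (bits W i) \<noteq> vb (bits W j)" for i j by (rule va_neq_vb) simp
  have inj: "bits W i = bits W j \<longleftrightarrow> i = j" if "i < 2 ^ W" "j < 2 ^ W" for i j using that by (rule bits_inj)
  have "lists_set (enc_vs W) (verts (tri_mcst W k LS))"
    unfolding lists_set_def
  proof
    have "distinct (concat (map (\<lambda>i. [va (bits W i), vb (bits W i)]) [0..<2 ^ W]))"
      by (rule distinct_concat_map) (use d inj in \<open>auto dest: d[THEN notE, OF sym]\<close>)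
    then show "distinct (enc_vs W)" by (auto simp: enc_vs_def)
    show "set (enc_vs W) = verts (tri_mcst W k LS)"
      by (auto simp: enc_vs_def tri_mcst_def names_bits)
  qed
  moreover have "lists_set (enc_es W) (edges (tri_mcst W k LS))"
    unfolding lists_set_def
  proof
    show "distinct (enc_es W)"
      unfolding enc_es_def
      by (rule distinct_concat_map) (use d inj in \<open>auto simp: doubleton_eq_iff dest: d[THEN notE, OF sym]\<close>)
    show "set (enc_es W) = edges (tri_mcst W k LS)"
      by (auto simp: enc_es_def tri_mcst_def tri_edges_def names_bits)
  qed
  moreover have "\<forall>e\<in>edges (tri_mcst W k LS). cost (tri_mcst W k LS) e = real_of_rat 0" by (simp add: tri_mcst_def)
  moreover have "list_all2 (\<lambda>(fs, b) (F, b'). lists_set fs F \<and> b = b')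
      (map (\<lambda>ls. (map ledge ls, length ls - k)) LS) (constraints (tri_mcst W k LS))"
    using assms ledge_inj_on
    by (auto simp: tri_mcst_def list_all2_map1 list_all2_map2 lists_set_def distinct_map good_lits_def intro!: list_all2_refl list.rel_refl_strong)
  ultimately show ?thesis
    unfolding encodes_instance_def enc_tri_def by (intro exI[of _ "enc_vs W"] exI[of _ "enc_es W"] exI[of _ "\<lambda>_. 0"] exI) auto
qed

section \<open>Searching encodings\<close>

text \<open>Tokens take two bits, so only matches at even offsets are meaningful; an unaligned match
  could be spurious.\<close>

definition occ :: "'a list \<Rightarrow> 'a list \<Rightarrow> bool" where
  "occ pat z \<longleftrightarrow> (\<exists>u v. z = u @ pat @ v \<and> even (length u))"

fun tok :: "bool list \<Rightarrow> (bool \<times> bool) list" where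
  "tok (a # b # r) = (a, b) # tok r"
| "tok _ = []"

lemma tok_append: "even (length u) \<Longrightarrow> tok (u @ v) = tok u @ tok v"
  by (induction u rule: tok.induct) auto

abbreviation "tO \<equiv> (True, False)"
abbreviation "tC \<equiv> (True, True)"
abbreviation "tD b \<equiv> (False, b :: bool)"

definition ntok :: "bool list \<Rightarrow> (bool \<times> bool) list" where
  "ntok w = tO # map tD w @ [tC]"

lemma tok_enc_bits: "tok (enc_bits w @ v) = ntok w @ tok v"
  by (induction w) (auto simp: enc_bits_def ntok_def)

lemma even_enc_bits: "even (length (enc_bits w))"
  by (induction w) (auto simp: enc_bits_def)

lemma ntok_skip: "u @ tO # z = map tD w @ tC # y \<Longrightarrow> \<exists>u'. u' @ tO # z = y"
proof (induction w arbitrary: u)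
  case Nil
  then show ?case by (cases u) auto
next
  case (Cons b w)
  then show ?case by (cases u) auto
qed

text \<open>Among number codes, an opening token followed at once by a closing one is the complete
  code of 0. This anchors the search pattern, which starts with the hub.\<close>

lemma ntok_empty:
  "u @ [tO, tC] @ z = concat (map ntok ns) @ [tC] \<Longrightarrow> \<exists>ns1 ns2. ns = ns1 @ [] # ns2 \<and> z = concat (map ntok ns2) @ [tC]"
proof (induction ns arbitrary: u)
  case Nil
  then show ?case by (cases u) auto
next
  case (Cons w ns)
  show ?case
  proof (cases u)
    case Nil
    then have "w = [] \<and> z = concat (map ntok ns) @ [tC]" using Cons.prems by (cases w) (auto simp: ntok_def[of "[]"] ntok_def[of "_ # _"])
    then show ?thesis by (rule_tac x = "[]" in exI, rule_tac x = ns in exI) simp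
  next
    case (Cons a u')
    then have "u' @ tO # (tC # z) = map tD w @ tC # (concat (map ntok ns) @ [tC])"
      using Cons.prems by (simp add: ntok_def[of w])
    from ntok_skip[OF this] obtain u'' where "u'' @ [tO, tC] @ z = concat (map ntok ns) @ [tC]" by auto
    from Cons.IH[OF this] obtain ns1 ns2 where "ns = ns1 @ [] # ns2" "z = concat (map ntok ns2) @ [tC]" by blast
    then show ?thesis by (intro exI[of _ "w # ns1"] exI[of _ ns2]) auto
  qed
qed

lemma ntok_prefix: "map tD u @ tC # y = map tD w @ tC # y' \<Longrightarrow> u = w"
proof (induction u arbitrary: w)
  case Nil
  then show ?case by (cases w) auto
next
  case (Cons a u)
  then show ?case by (cases w) auto
qed

text \<open>In the flattened list the borders between edges are lost. An empty string can only be a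
  first component, so it shows where an edge begins.\<close>

lemma flat_pairs:
  assumes "ns1 @ [] # u # ns3 = concat (map (\<lambda>(a, b). [a, b]) ps)" "\<forall>(a, b)\<in>set ps. b \<noteq> []"
  shows "([], u) \<in> set ps"
  using assms
proof (induction ps arbitrary: ns1)
  case (Cons p ps)
  obtain a b where p: "p = (a, b)" by (cases p)
  show ?case
  proof (cases ns1)
    case Nil
    then show ?thesis using Cons.prems p by auto
  next
    case (Cons c ns)
    then show ?thesis using Cons.prems p Cons.IH[of "tl ns"] by (cases ns) auto
  qed
qed simp

definition epair :: "nat set \<Rightarrow> bool list \<times> bool list" where
  "epair e = (binary (Min e), binary (Max e))"

lemma binary_inj: "binary m = binary n \<Longrightarrow> m = n"
proof (induction m arbitrary: n rule: less_induct)
  case (less m)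
  show ?case
  proof (cases "m = 0 \<or> n = 0")
    case True
    then show ?thesis using less.prems by (subst (asm) (1 2) binary.simps) (auto split: if_splits)
  next
    case False
    then have "odd m = odd n" "binary (m div 2) = binary (n div 2)"
      using less.prems by (subst (asm) (1 2) binary.simps, auto)+
    then show ?thesis using less.IH[of "m div 2"] False by (metis div_less_dividend neq0_conv one_less_numeral_iff parity_cases semiring_norm(76) odd_iff_mod_2_eq_one even_iff_mod_2_eq_zero div_mult_mod_eq)
  qed
qed

text \<open>The hub 0 is never the larger end of an edge. Together with the alignment of tokens this
  forces a match of the pattern to coincide with one listed edge, so plain substring search decides
  membership.\<close>

lemma occ_edge_iff:
  assumes "set ts \<subseteq> tri_edges W" "s \<in> names W"
  shows "occ (enc_edge {0, va s}) (enc_list enc_edge ts) \<longleftrightarrow> {0, va s} \<in> set ts"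
proof
  have pat: "enc_edge {0, va s} = enc_bits [] @ enc_bits (s @ [True])"
    by (simp add: enc_edge_def enc_nat_def binary_va)
  assume "occ (enc_edge {0, va s}) (enc_list enc_edge ts)"
  then obtain u v where uv: "enc_list enc_edge ts = u @ enc_edge {0, va s} @ v" "even (length u)"
    by (auto simp: occ_def)
  have "tok (concat (map enc_edge ts) @ [True, True]) = concat (map ntok (concat (map (\<lambda>(a, b). [a, b]) (map epair ts)))) @ [tC]"
    by (induction ts) (auto simp: enc_edge_def enc_nat_def tok_enc_bits epair_def)
  then have "tok (enc_list enc_edge ts) = tO # concat (map ntok (concat (map (\<lambda>(a, b). [a, b]) (map epair ts)))) @ [tC]"
    by (simp add: enc_list_def)
  moreover have "tok (enc_list enc_edge ts) = tok u @ ntok [] @ ntok (s @ [True]) @ tok v"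
    unfolding uv pat by (simp add: tok_append[OF uv(2)] tok_enc_bits)
  ultimately have eq: "tok u @ [tO, tC] @ (ntok (s @ [True]) @ tok v) = tO # concat (map ntok (concat (map (\<lambda>(a, b). [a, b]) (map epair ts)))) @ [tC]"
    (is "_ = tO # concat (map ntok ?ns) @ [tC]") by (simp add: ntok_def)
  then obtain u' where "u' @ [tO, tC] @ (ntok (s @ [True]) @ tok v) = concat (map ntok ?ns) @ [tC]"
  proof (cases "tok u")
    case Nil
    \<comment> \<open>The match cannot start at the opening bracket of the edge list itself: a
      closing token would follow, with more tokens behind it.\<close>
    then have "tC # ntok (s @ [True]) @ tok v = concat (map ntok ?ns) @ [tC]" using eq by simp
    moreover have "tC # ntok a @ y = concat (map ntok ns) @ [tC] \<Longrightarrow> False" for a y ns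
      by (cases ns) (auto simp: ntok_def)
    ultimately have False by blast
    then show ?thesis ..
  next
    case (Cons a u')
    have "a # (u' @ [tO, tC] @ (ntok (s @ [True]) @ tok v)) = tO # concat (map ntok ?ns) @ [tC]"
      using eq unfolding Cons by (simp only: append_Cons)
    then show ?thesis by (intro that[of u']) (simp only: list.inject)
  qed
  from ntok_empty[OF this] obtain ns1 ns2 where ns: "?ns = ns1 @ [] # ns2" "ntok (s @ [True]) @ tok v = concat (map ntok ns2) @ [tC]" by blast
  then obtain w ns3 where w: "ns2 = w # ns3" by (cases ns2) (auto simp: ntok_def)
  have "map tD (s @ [True]) @ tC # tok v = map tD w @ tC # (concat (map ntok ns3) @ [tC])"
    using ns(2) w by (simp add: ntok_def)
  from ntok_prefix[OF this] have "w = s @ [True]" by simp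
  then have "ns1 @ [] # (s @ [True]) # ns3 = ?ns" using ns w by simp
  moreover have mx: "Max e \<noteq> 0 \<and> finite e" if "e \<in> tri_edges W" for e using that by (auto simp: tri_edges_def)
  have "binary n \<noteq> []" if "n \<noteq> 0" for n using that by (subst binary.simps) simp
  then have "\<forall>(a, b)\<in>set (map epair ts). b \<noteq> []" using mx assms(1) by (auto simp: epair_def)
  ultimately have "([], s @ [True]) \<in> set (map epair ts)" by (rule flat_pairs)
  then obtain e where e: "e \<in> set ts" "binary (Min e) = []" "binary (Max e) = s @ [True]" by (auto simp: epair_def)
  have "Min e = 0" using e(2) binary_inj[of "Min e" 0] by simp
  moreover have "Max e = va s" using e(3) binary_va[of s] binary_inj by metis
  moreover have "e \<in> tri_edges W" using e(1) assms(1) by blast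
  then have "\<exists>a b. e = {a, b}" by (auto simp: tri_edges_def)
  ultimately have "e = {0, va s}" by (auto simp: min_def max_def split: if_splits)
  then show "{0, va s} \<in> set ts" using e by simp
next
  assume "{0, va s} \<in> set ts"
  then obtain ts1 ts2 where "ts = ts1 @ {0, va s} # ts2" by (meson split_list)
  then have "enc_list enc_edge ts = ([True, False] @ concat (map enc_edge ts1)) @ enc_edge {0, va s} @ (concat (map enc_edge ts2) @ [True, True])"
    by (simp add: enc_list_def)
  moreover have "even (length ([True, False] @ concat (map enc_edge ts1)))"
    using even_enc_bits by (induction ts1) (auto simp: enc_edge_def enc_nat_def)
  ultimately show "occ (enc_edge {0, va s}) (enc_list enc_edge ts)" unfolding occ_def by blast
qed

section \<open>Amplification by disjoint copies\<close>

text \<open>A one-hot copy number is two unary runs around a mark, hence easily written from unary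
  counters. It costs a factor \<open>2 ^ k\<close> in the number of names, which remains polynomial
  in the input length because \<open>k\<close> is logarithmic.\<close>

definition onehot :: "nat \<Rightarrow> nat \<Rightarrow> bool list" where
  "onehot k j = replicate j False @ True # replicate (k - 1 - j) False"

lemma length_onehot [simp]: "j < k \<Longrightarrow> length (onehot k j) = k"
  by (simp add: onehot_def)

lemma onehot_inj: "j < k \<Longrightarrow> j' < k \<Longrightarrow> onehot k j = onehot k j' \<Longrightarrow> j = j'"
proof (rule ccontr)
  assume "j < k" "j' < k" "onehot k j = onehot k j'" "j \<noteq> j'"
  moreover have "onehot k j ! j" by (simp add: onehot_def nth_append)
  ultimately show False by (auto simp: onehot_def nth_append nth_Cons' split: if_splits)
qed

definition copy_lits :: "nat \<Rightarrow> nat \<Rightarrow> lit list \<Rightarrow> lit list" where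
  "copy_lits k j c = map (\<lambda>(g, v). (g, onehot k j @ v)) c"

definition tuple_lits :: "nat \<Rightarrow> ('b \<Rightarrow> lit list) \<Rightarrow> 'b list \<Rightarrow> lit list" where
  "tuple_lits k cl \<tau> = concat (map (\<lambda>j. copy_lits k j (cl (\<tau> ! j))) [0..<k])"

text \<open>The prefixes keep the copies apart even when a tuple repeats a clause, and each of the
  \<open>k\<close> clauses contributes at least one literal.\<close>

lemma good_tuple_lits:
  assumes "\<And>\<beta>. \<beta> \<in> set \<tau> \<Longrightarrow> cl \<beta> \<noteq> [] \<and> distinct (cl \<beta>) \<and> (\<forall>l\<in>set (cl \<beta>). length (snd l) = n)" "length \<tau> = k"
  shows "good_lits (k + n) k (tuple_lits k cl \<tau>)"
proof -
  have c: "cl (\<tau> ! j) \<noteq> [] \<and> distinct (cl (\<tau> ! j)) \<and> (\<forall>l\<in>set (cl (\<tau> ! j)). length (snd l) = n)" if "j < k" for j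
    by (rule assms(1)) (use assms(2) that in simp)
  have "distinct (tuple_lits k cl \<tau>)"
    unfolding tuple_lits_def
  proof (rule distinct_concat_map)
    fix j assume "j \<in> set [0..<k]"
    then show "distinct (copy_lits k j (cl (\<tau> ! j)))"
      using c[of j] by (auto simp: copy_lits_def distinct_map inj_on_def)
  next
    fix i j assume "i \<in> set [0..<k]" "j \<in> set [0..<k]" "i \<noteq> j"
    then show "set (copy_lits k i (cl (\<tau> ! i))) \<inter> set (copy_lits k j (cl (\<tau> ! j))) = {}"
      using onehot_inj[of i k j] by (auto simp: copy_lits_def append_eq_append_conv)
  qed simp
  moreover have "snd ` set (tuple_lits k cl \<tau>) \<subseteq> names (k + n)"
    using c by (fastforce simp: tuple_lits_def copy_lits_def names_def)
  moreover have "k \<le> length (tuple_lits k cl \<tau>)"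
  proof -
    have "m \<le> length (concat (map (\<lambda>j. copy_lits k j (cl (\<tau> ! j))) [0..<m]))" if "m \<le> k" for m
      using that
    proof (induction m)
      case (Suc m)
      have "1 \<le> length (cl (\<tau> ! m))" using c[of m] Suc.prems by (cases "cl (\<tau> ! m)") auto
      then show ?case using Suc by (simp add: copy_lits_def)
    qed simp
    then show ?thesis by (simp add: tuple_lits_def)
  qed
  ultimately show ?thesis by (simp add: good_lits_def)
qed

text \<open>The same assignment is used in all copies; \<open>drop k\<close> strips the copy number
  from a name.\<close>

lemma tuple_lits_satisfied:
  assumes "\<And>\<beta>. \<beta> \<in> set \<tau> \<Longrightarrow> \<exists>l\<in>set (cl \<beta>). holds A l" "length \<tau> = k"
  shows "k \<le> length (filter (holds (\<lambda>s. A (drop k s))) (tuple_lits k cl \<tau>))"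
proof -
  let ?A = "\<lambda>s. A (drop k s)"
  have "m \<le> length (filter (holds ?A) (concat (map (\<lambda>j. copy_lits k j (cl (\<tau> ! j))) [0..<m])))" if "m \<le> k" for m
    using that
  proof (induction m)
    case (Suc m)
    then have "\<tau> ! m \<in> set \<tau>" using assms(2) by simp
    then obtain l where l: "l \<in> set (cl (\<tau> ! m))" "holds A l" using assms(1) by blast
    have "(\<lambda>(g, v). (g, onehot k m @ v)) l \<in> set (copy_lits k m (cl (\<tau> ! m)))"
      using l(1) by (simp add: copy_lits_def)
    moreover have "holds ?A ((\<lambda>(g, v). (g, onehot k m @ v)) l)"
      using l(2) Suc.prems by (cases l) (simp add: holds_def)
    ultimately have "(\<lambda>(g, v). (g, onehot k m @ v)) l \<in> set (filter (holds ?A) (copy_lits k m (cl (\<tau> ! m))))" by simp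
    then have "1 \<le> length (filter (holds ?A) (copy_lits k m (cl (\<tau> ! m))))"
      by (metis One_nat_def Suc_leI length_pos_if_in_set)
    then show ?case using Suc by simp
  qed simp
  then show ?thesis by (simp add: tuple_lits_def)
qed

text \<open>If every copy had a false clause, the tuple choosing such a clause \<open>f j\<close>
  for copy \<open>j\<close> would contain no true literal. Ranging over all tuples is exactly what
  makes this choice available.\<close>

lemma tuple_lits_some_copy:
  assumes "\<And>\<tau>. length \<tau> = k \<Longrightarrow> set \<tau> \<subseteq> B \<Longrightarrow> \<exists>l\<in>set (tuple_lits k cl \<tau>). holds A l"
  shows "\<exists>j<k. \<forall>\<beta>\<in>B. \<exists>l\<in>set (cl \<beta>). holds (\<lambda>v. A (onehot k j @ v)) l"
proof (rule ccontr)
  assume "\<not> ?thesis"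
  then have "\<forall>j<k. \<exists>\<beta>\<in>B. \<forall>l\<in>set (cl \<beta>). \<not> holds (\<lambda>v. A (onehot k j @ v)) l" by blast
  then obtain f where f: "\<And>j. j < k \<Longrightarrow> f j \<in> B \<and> (\<forall>l\<in>set (cl (f j)). \<not> holds (\<lambda>v. A (onehot k j @ v)) l)" by metis
  have "\<exists>l\<in>set (tuple_lits k cl (map f [0..<k])). holds A l"
    by (rule assms) (use f in auto)
  then obtain j l where "j < k" "l \<in> set (copy_lits k j (cl (f j)))" "holds A l"
    by (auto simp: tuple_lits_def)
  then show False using f[of j] by (force simp: copy_lits_def holds_def)
qed

section \<open>Polynomial bounds\<close>

text \<open>The base \<open>Suc n\<close> is at least 1, so exponents may be raised freely when two
  bounds are combined, also at \<open>n = 0\<close>.\<close>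

definition polyb :: "(nat \<Rightarrow> nat) \<Rightarrow> bool" where
  "polyb f \<longleftrightarrow> (\<exists>C D. \<forall>n. f n \<le> C * Suc n ^ D)"

lemma polyb_const [intro, simp]: "polyb (\<lambda>_. c)"
  unfolding polyb_def by (rule exI[of _ c], rule exI[of _ 0]) simp

lemma polyb_id [intro, simp]: "polyb (\<lambda>n. n)"
  unfolding polyb_def by (rule exI[of _ 1], rule exI[of _ 1]) simp

lemma polyb_add [intro]:
  assumes "polyb f" "polyb g" shows "polyb (\<lambda>n. f n + g n)"
proof -
  obtain C D C' D' where b: "\<And>n. f n \<le> C * Suc n ^ D" "\<And>n. g n \<le> C' * Suc n ^ D'"
    using assms unfolding polyb_def by metis
  have "f n + g n \<le> (C + C') * Suc n ^ (D + D')" for n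
  proof -
    have "Suc n ^ D \<le> Suc n ^ (D + D')" "Suc n ^ D' \<le> Suc n ^ (D + D')" by (auto intro: power_increasing)
    then have "C * Suc n ^ D \<le> C * Suc n ^ (D + D')" "C' * Suc n ^ D' \<le> C' * Suc n ^ (D + D')" by auto
    then show ?thesis using add_mono[OF b(1)[of n] b(2)[of n]] unfolding distrib_right by linarith
  qed
  then show ?thesis unfolding polyb_def by blast
qed

lemma polyb_mult [intro]:
  assumes "polyb f" "polyb g" shows "polyb (\<lambda>n. f n * g n)"
proof -
  obtain C D C' D' where b: "\<And>n. f n \<le> C * Suc n ^ D" "\<And>n. g n \<le> C' * Suc n ^ D'"
    using assms unfolding polyb_def by metis
  have "f n * g n \<le> (C * C') * Suc n ^ (D + D')" for n
    using mult_mono[OF b(1)[of n] b(2)[of n]] by (simp add: power_add ac_simps)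
  then show ?thesis unfolding polyb_def by blast
qed

lemma polyb_Suc [intro]: "polyb f \<Longrightarrow> polyb (\<lambda>n. Suc (f n))"
  using polyb_add[of f "\<lambda>_. 1"] by simp

lemma polyb_power [intro]: "polyb f \<Longrightarrow> polyb (\<lambda>n. f n ^ d)"
  by (induction d) auto

text \<open>The constant in a running time may be any real number, so its absolute value is rounded
  up; monotonicity in the input length is built in through \<open>m\<close>.\<close>

lemma real_poly_bound:
  fixes c :: real
  assumes "real t \<le> c * real n ^ k + c" "n \<le> m"
  shows "t \<le> 2 * nat \<lceil>\<bar>c\<bar>\<rceil> * Suc m ^ k"
proof -
  have "c * real n ^ k + c \<le> \<bar>c\<bar> * real n ^ k + \<bar>c\<bar>" by (intro add_mono mult_right_mono) auto
  also have "\<dots> \<le> \<bar>c\<bar> * real (Suc m) ^ k + \<bar>c\<bar> * real (Suc m) ^ k"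
    using assms(2) by (intro add_mono mult_left_mono power_mono) (auto simp: mult_le_cancel_left1)
  also have "\<dots> \<le> 2 * real (nat \<lceil>\<bar>c\<bar>\<rceil>) * real (Suc m) ^ k"
    by (simp add: mult_right_mono real_nat_ceiling_ge)
  finally have "real t \<le> real (2 * nat \<lceil>\<bar>c\<bar>\<rceil> * Suc m ^ k)" using assms by simp
  then show ?thesis by (simp only: of_nat_le_iff)
qed

lemma le_pow2_length_binary: "n < 2 ^ length (binary n)"
proof (induction n rule: less_induct)
  case (less n)
  show ?case
  proof (cases "n = 0")
    case False
    then have "n div 2 < 2 ^ length (binary (n div 2))" using less by simp
    moreover have "length (binary n) = Suc (length (binary (n div 2)))" using False by (subst binary.simps) simp
    ultimately show ?thesis by auto
  qed simp
qed

lemma length_binary_le: "n \<noteq> 0 \<Longrightarrow> 2 ^ length (binary n) \<le> 2 * n"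
proof (induction n rule: less_induct)
  case (less n)
  have l: "length (binary n) = Suc (length (binary (n div 2)))" using less.prems by (subst binary.simps) simp
  show ?case
  proof (cases "n div 2 = 0")
    case True
    then show ?thesis using l less.prems by simp
  next
    case False
    then have "2 ^ length (binary (n div 2)) \<le> 2 * (n div 2)" using less.IH[of "n div 2"] less.prems by simp
    then show ?thesis using l by simp
  qed
qed

section \<open>Guessing and verifying a certificate\<close>

abbreviation (input) nonz :: "nat \<Rightarrow> bool" where "nonz \<equiv> \<lambda>a. a \<noteq> 0"

abbreviation ones :: "nat \<Rightarrow> nat list" where "ones n \<equiv> replicate n 1"

lemma concat_map_ones: "concat (map (\<lambda>_. ones c) xs) = ones (length xs * c)"
  by (induction xs) (auto simp: replicate_add)

definition times :: "nat \<Rightarrow> nat \<Rightarrow> nat \<Rightarrow> nat \<Rightarrow> cmd list" where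
  "times i x b t = [While i nonz (Pop i # pour x t @ consume t x (\<lambda>a. [a]) b (\<lambda>_. [1]))]"

lemma ex_times:
  assumes "\<sigma> i = ones m" "\<sigma> x = xs" "0 \<notin> set xs" "\<sigma> t = []" "distinct [i, x, b, t]"
  shows "ex (times i x b t) (m * (9 * length xs + 4) + 1) \<sigma> (\<sigma>(i := [], b := ones (m * length xs) @ \<sigma> b))"
proof -
  let ?n = "length xs"
  let ?s = "\<lambda>j. \<sigma>(i := ones (m - j), b := ones (j * ?n) @ \<sigma> b)"
  have body: "ex (Pop i # pour x t @ consume t x (\<lambda>a. [a]) b (\<lambda>_. [1])) (9 * ?n + 3) (?s j) (?s (Suc j))" if "j < m" for j
  proof -
    let ?\<sigma>1 = "(?s j)(i := ones (m - Suc j))"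
    let ?\<sigma>2 = "?\<sigma>1(x := [], t := rev xs @ ?\<sigma>1 t)"
    have 1: "ex (pour x t) (4 * ?n + 1) ?\<sigma>1 ?\<sigma>2" by (rule ex_pour) (use assms in auto)
    have 2: "ex (consume t x (\<lambda>a. [a]) b (\<lambda>_. [1])) (length (rev xs) * (2 + 3) + 1) ?\<sigma>2
      (?\<sigma>2(t := [], x := rev (concat (map (\<lambda>a. [a]) (rev xs))) @ ?\<sigma>2 x, b := rev (concat (map (\<lambda>_. [1]) (rev xs))) @ ?\<sigma>2 b))"
      by (rule ex_consume) (use assms in \<open>auto intro: gr0I\<close>)
    have cm: "rev (concat (map (\<lambda>_. [1]) (rev xs))) = ones ?n" using concat_map_ones[of 1 "rev xs"] by simp
    have 3: "?\<sigma>2(t := [], x := rev (concat (map (\<lambda>a. [a]) (rev xs))) @ ?\<sigma>2 x, b := rev (concat (map (\<lambda>_. [1]) (rev xs))) @ ?\<sigma>2 b)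
       = ?s (Suc j)"
      unfolding cm using assms by (auto simp: fun_eq_iff replicate_add)
    have "tl (ones (m - j)) = ones (m - Suc j)" using that by (metis Suc_diff_Suc list.sel(3) replicate_Suc)
    then have p: "(?s j)(i := tl ((?s j) i)) = ?\<sigma>1" using assms by (auto simp: fun_eq_iff)
    have "ex (Pop i # pour x t @ consume t x (\<lambda>a. [a]) b (\<lambda>_. [1])) (Suc (4 * ?n + 1 + (length (rev xs) * (2 + 3) + 1))) (?s j) (?s (Suc j))"
      by (rule ex_Pop, unfold p) (use ex_append[OF 1 2] 3 in simp)
    then show ?thesis by (rule ex_mono) simp
  qed
  have "ex (times i x b t) (m * Suc (9 * ?n + 3) + 1) (?s 0) (?s m)"
    unfolding times_def
  proof (rule ex_While_iter[where s = ?s])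
    fix j assume j: "j < m"
    then have "top0 (ones (m - j)) = 1" by (metis Suc_diff_Suc replicate_Suc top0_simps(2))
    then show "nonz (top0 (?s j i)) \<and> ex (Pop i # pour x t @ consume t x (\<lambda>a. [a]) b (\<lambda>_. [1])) (9 * ?n + 3) (?s j) (?s (Suc j))"
      using body[OF j] assms by simp
  qed (use assms in auto)
  moreover have "?s 0 = \<sigma>" "?s m = \<sigma>(i := [], b := ones (m * ?n) @ \<sigma> b)" using assms by (auto simp: fun_eq_iff)
  ultimately show ?thesis by (simp only: mult_Suc_right ac_simps) (simp add: algebra_simps)
qed

primrec upow :: "nat \<Rightarrow> cmd list" where
  "upow 0 = [Push 3 1]"
| "upow (Suc d) = upow d @ times 3 0 4 5 @ pour 4 3"

lemma ex_upow:
  assumes "\<sigma> 0 = xs" "0 \<notin> set xs" "\<sigma> 3 = []" "\<sigma> 4 = []" "\<sigma> 5 = []"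
  shows "ex (upow d) (d * (20 * Suc (length xs) ^ Suc d) + 1) \<sigma> (\<sigma>(3 := ones (length xs ^ d)))"
proof (induction d)
  case 0
  then show ?case using assms by (auto intro!: ex_Push simp: fun_eq_iff)
next
  case (Suc d)
  let ?n = "length xs"
  let ?\<sigma>1 = "\<sigma>(3 := ones (?n ^ d))"
  let ?\<sigma>2 = "?\<sigma>1(3 := [], 4 := ones (?n ^ d * ?n) @ ?\<sigma>1 4)"
  have 2: "ex (times 3 0 4 5) (?n ^ d * (9 * ?n + 4) + 1) ?\<sigma>1 ?\<sigma>2"
    by (rule ex_times) (use assms in auto)
  have 3: "ex (pour 4 3) (4 * length (ones (?n ^ d * ?n)) + 1) ?\<sigma>2 (?\<sigma>2(4 := [], 3 := rev (ones (?n ^ d * ?n)) @ ?\<sigma>2 3))"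
    by (rule ex_pour) (use assms in auto)
  have e: "?\<sigma>2(4 := [], 3 := rev (ones (?n ^ d * ?n)) @ ?\<sigma>2 3) = \<sigma>(3 := ones (?n ^ Suc d))"
    using assms by (auto simp: fun_eq_iff ac_simps)
  have "ex (upow (Suc d)) (d * (20 * Suc ?n ^ Suc d) + 1 + (?n ^ d * (9 * ?n + 4) + 1 + (4 * length (ones (?n ^ d * ?n)) + 1))) \<sigma> (\<sigma>(3 := ones (?n ^ Suc d)))"
    unfolding upow.simps by (rule ex_append[OF Suc ex_append[OF 2 3[unfolded e]]])
  moreover have "d * (20 * Suc ?n ^ Suc d) + 1 + (?n ^ d * (9 * ?n + 4) + 1 + (4 * length (ones (?n ^ d * ?n)) + 1)) \<le> Suc d * (20 * Suc ?n ^ Suc (Suc d)) + 1"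
  proof -
    have a: "Suc ?n ^ Suc d \<le> Suc ?n ^ Suc (Suc d)" by (rule power_increasing) auto
    have b: "?n ^ d * (13 * ?n + 4) \<le> Suc ?n ^ d * (18 * Suc ?n)" by (intro mult_mono power_mono) auto
    have b': "Suc ?n ^ d * (18 * Suc ?n) = 18 * Suc ?n ^ Suc d" by (simp only: power_Suc ac_simps)
    have c: "1 \<le> Suc ?n ^ Suc d" by (rule one_le_power) simp
    have "d * (20 * Suc ?n ^ Suc d) + 1 + (?n ^ d * (9 * ?n + 4) + 1 + (4 * length (ones (?n ^ d * ?n)) + 1))
       = d * (20 * Suc ?n ^ Suc d) + ?n ^ d * (13 * ?n + 4) + 3" by (simp add: algebra_simps)
    also have "\<dots> \<le> d * (20 * Suc ?n ^ Suc d) + 18 * Suc ?n ^ Suc d + 3" using b unfolding b' by linarith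
    also have "\<dots> \<le> d * (20 * Suc ?n ^ Suc d) + 20 * Suc ?n ^ Suc d + 1" using c by linarith
    also have "\<dots> = Suc d * (20 * Suc ?n ^ Suc d) + 1" by (simp add: algebra_simps)
    also have "\<dots> \<le> Suc d * (20 * Suc ?n ^ Suc (Suc d)) + 1" using a by (intro add_mono mult_left_mono) auto
    finally show ?thesis .
  qed
  ultimately show ?case by (rule ex_mono)
qed

text \<open>This is the bound on the certificate length from the definition of NP, computed in unary
  so that it can serve as fuel for guessing.\<close>

definition upoly :: "nat \<Rightarrow> nat \<Rightarrow> cmd list" where
  "upoly c d = upow d @ conv 3 4 (\<lambda>_. ones c) @ pushes 4 (ones c) @ pour 4 3"

lemma ex_upoly:
  assumes "\<sigma> 0 = xs" "0 \<notin> set xs" "\<sigma> 3 = []" "\<sigma> 4 = []" "\<sigma> 5 = []"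
  shows "ex (upoly c d) ((20 * d + 5 * c + 10) * Suc (length xs) ^ Suc d + 5 * c + 10) \<sigma> (\<sigma>(3 := ones (c * length xs ^ d + c)))"
proof -
  let ?n = "length xs"
  let ?p = "c * ?n ^ d + c"
  let ?\<sigma>1 = "\<sigma>(3 := ones (?n ^ d))"
  let ?\<sigma>2 = "\<sigma>(4 := ones (c * ?n ^ d))"
  let ?\<sigma>3 = "\<sigma>(4 := ones ?p)"
  have 1: "ex (upow d) (d * (20 * Suc ?n ^ Suc d) + 1) \<sigma> ?\<sigma>1" by (rule ex_upow) (use assms in auto)
  have 2: "ex (conv 3 4 (\<lambda>_. ones c)) (length (ones (?n ^ d)) * (c + 3) + 1) ?\<sigma>1 (?\<sigma>1(3 := [], 4 := rev (concat (map (\<lambda>_. ones c) (ones (?n ^ d)))) @ ?\<sigma>1 4))"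
    by (rule ex_conv) (use assms in auto)
  have e2: "?\<sigma>1(3 := [], 4 := rev (concat (map (\<lambda>_. ones c) (ones (?n ^ d)))) @ ?\<sigma>1 4) = ?\<sigma>2"
    using assms by (simp only: concat_map_ones) (auto simp: fun_eq_iff ac_simps)
  have "ex (pushes 4 (ones c)) c ?\<sigma>2 (?\<sigma>2(4 := rev (ones c) @ ?\<sigma>2 4))" by (rule ex_pushes) auto
  moreover have "?\<sigma>2(4 := rev (ones c) @ ?\<sigma>2 4) = ?\<sigma>3" by (auto simp: fun_eq_iff replicate_add[symmetric] ac_simps)
  ultimately have 3: "ex (pushes 4 (ones c)) c ?\<sigma>2 ?\<sigma>3" by simp
  have 4: "ex (pour 4 3) (4 * length (ones ?p) + 1) ?\<sigma>3 (?\<sigma>3(4 := [], 3 := rev (ones ?p) @ ?\<sigma>3 3))"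
    by (rule ex_pour) auto
  have e4: "?\<sigma>3(4 := [], 3 := rev (ones ?p) @ ?\<sigma>3 3) = \<sigma>(3 := ones ?p)" using assms by (auto simp: fun_eq_iff)
  from ex_append[OF 1 ex_append[OF 2[unfolded e2] ex_append[OF 3 4[unfolded e4]]]]
  have "ex (upoly c d) (d * (20 * Suc ?n ^ Suc d) + 1 + (length (ones (?n ^ d)) * (c + 3) + 1 + (c + (4 * length (ones ?p) + 1)))) \<sigma> (\<sigma>(3 := ones ?p))"
    by (simp add: upoly_def)
  moreover have "d * (20 * Suc ?n ^ Suc d) + 1 + (length (ones (?n ^ d)) * (c + 3) + 1 + (c + (4 * length (ones ?p) + 1)))
     \<le> (20 * d + 5 * c + 10) * Suc ?n ^ Suc d + 5 * c + 10"
  proof -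
    have "?n ^ d \<le> Suc ?n ^ d" by (rule power_mono) auto
    also have "\<dots> \<le> Suc ?n ^ Suc d" by (rule power_increasing) auto
    finally have "(5 * c + 3) * ?n ^ d \<le> (5 * c + 10) * Suc ?n ^ Suc d" by (intro mult_mono) auto
    then show ?thesis by (simp add: algebra_simps)
  qed
  ultimately show ?thesis by (rule ex_mono)
qed

text \<open>Choices are read in pairs: a symbol 2 announces one more certificate bit, anything else
  ends the guess. So certificates of every length up to the fuel can be produced.\<close>

fun guess :: "nat \<Rightarrow> nat list \<Rightarrow> nat list \<Rightarrow> nat list \<times> nat list" where
  "guess 0 ch acc = (ch, acc)"
| "guess (Suc n) ch acc =
     (if top0 ch = 2 then guess n (tl (tl ch)) ((if top0 (tl ch) = 2 then 2 else 1) # acc) else (ch, acc))"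

lemma guess_result: "\<exists>ws. snd (guess n ch (map bsym a)) = map bsym (ws @ a) \<and> length ws \<le> n"
proof (induction n arbitrary: ch a)
  case (Suc n)
  let ?b = "top0 (tl ch) = 2"
  obtain ws where ws: "snd (guess n (tl (tl ch)) (map bsym (?b # a))) = map bsym (ws @ ?b # a)" "length ws \<le> n"
    using Suc by blast
  have b: "(if ?b then 2 else 1) # map bsym a = map bsym (?b # a)" by (simp add: bsym_def)
  show ?case
  proof (cases "top0 ch = 2")
    case True
    then have "snd (guess (Suc n) ch (map bsym a)) = map bsym ((ws @ [?b]) @ a)"
      unfolding guess.simps b using ws(1) by simp
    then show ?thesis using ws(2) by (intro exI[of _ "ws @ [?b]"]) simp
  next
    case False
    then show ?thesis by (intro exI[of _ "[]"]) simp
  qed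
qed auto

lemma map_bsym_inv: "map (\<lambda>s. s = 2) (map bsym r) = r"
  by (induction r) (auto simp: bsym_def)

lemma guess_any:
  assumes "length ws \<le> n"
  shows "snd (guess n (map bsym (concat (map (\<lambda>b. [True, b]) ws) @ False # r)) acc) = map bsym (rev ws) @ acc"
  using assms
proof (induction n arbitrary: ws acc)
  case (Suc n)
  show ?case
  proof (cases ws)
    case (Cons b ws')
    then show ?thesis using Suc.IH[of ws' "bsym b # acc"] Suc.prems by (auto simp: bsym_def)
  qed (simp add: bsym_def)
qed simp

definition guess_prog :: "cmd list" where
  "guess_prog = [While 3 nonz [Pop 3, Case 2 (\<lambda>s. if s = 2
     then [Pop 2, Case 2 (\<lambda>b. [Push 6 (if b = 2 then 2 else 1)]), Pop 2]
     else conv 3 4 (\<lambda>_. []))]]"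

lemma ex_guess_prog:
  "\<sigma> 3 = ones n \<Longrightarrow> ex guess_prog (20 * n + 1) \<sigma> (\<sigma>(3 := [], 2 := fst (guess n (\<sigma> 2) (\<sigma> 6)), 6 := snd (guess n (\<sigma> 2) (\<sigma> 6))))"
proof (induction n arbitrary: \<sigma>)
  case 0
  then have eq: "\<sigma>(3 := [], 2 := fst (guess 0 (\<sigma> 2) (\<sigma> 6)), 6 := snd (guess 0 (\<sigma> 2) (\<sigma> 6))) = \<sigma>" by auto
  show ?case unfolding eq guess_prog_def by (rule ex_mono[OF ex_While_False[where B = 0]]) (use 0 in auto)
next
  case (Suc n)
  let ?body = "[Pop 3, Case 2 (\<lambda>s. if s = 2
     then [Pop 2, Case 2 (\<lambda>b. [Push 6 (if b = 2 then 2 else 1)]), Pop 2]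
     else conv 3 4 (\<lambda>_. []))]"
  have top: "nonz (top0 (\<sigma> 3))" using Suc.prems by simp
  have tl: "\<sigma>(3 := tl (\<sigma> 3)) = \<sigma>(3 := ones n)" using Suc.prems by simp
  show ?case
  proof (cases "top0 (\<sigma> 2) = 2")
    case True
    let ?\<sigma>1 = "\<sigma>(3 := ones n, 2 := tl (tl (\<sigma> 2)), 6 := (if top0 (tl (\<sigma> 2)) = 2 then 2 else 1) # \<sigma> 6)"
    have 1: "ex ?body 6 \<sigma> ?\<sigma>1"
      by (rule ex_mono[of _ "Suc (Suc (Suc (Suc (Suc (Suc 0)))))"], rule ex_Pop, rule ex_Case)
        (use True tl in \<open>auto intro!: ex_Pop ex_Case ex_Push simp: fun_eq_iff\<close>)
    have 2: "ex [While 3 nonz ?body] (20 * n + 1) ?\<sigma>1 (?\<sigma>1(3 := [], 2 := fst (guess n (?\<sigma>1 2) (?\<sigma>1 6)), 6 := snd (guess n (?\<sigma>1 2) (?\<sigma>1 6))))"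
      by (rule Suc.IH[of ?\<sigma>1, unfolded guess_prog_def]) simp
    have e: "?\<sigma>1(3 := [], 2 := fst (guess n (?\<sigma>1 2) (?\<sigma>1 6)), 6 := snd (guess n (?\<sigma>1 2) (?\<sigma>1 6)))
       = \<sigma>(3 := [], 2 := fst (guess (Suc n) (\<sigma> 2) (\<sigma> 6)), 6 := snd (guess (Suc n) (\<sigma> 2) (\<sigma> 6)))"
      using True by (auto simp: fun_eq_iff)
    have "ex [While 3 nonz ?body] (Suc (6 + (20 * n + 1))) \<sigma> (\<sigma>(3 := [], 2 := fst (guess (Suc n) (\<sigma> 2) (\<sigma> 6)), 6 := snd (guess (Suc n) (\<sigma> 2) (\<sigma> 6))))"
      using ex_While_True[where P = nonz, OF top 1 2] e by simp
    then show ?thesis unfolding guess_prog_def by (rule ex_mono) simp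
  next
    case False
    let ?\<sigma>1 = "\<sigma>(3 := [])"
    have "ex (conv 3 4 (\<lambda>_. [])) (length (ones n) * (0 + 3) + 1) (\<sigma>(3 := ones n)) ((\<sigma>(3 := ones n))(3 := [], 4 := rev (concat (map (\<lambda>_. []) (ones n))) @ (\<sigma>(3 := ones n)) 4))"
      by (rule ex_conv) auto
    moreover have "(\<sigma>(3 := ones n))(3 := [], 4 := rev (concat (map (\<lambda>_. []) (ones n))) @ (\<sigma>(3 := ones n)) 4) = ?\<sigma>1" by auto
    ultimately have "ex (conv 3 4 (\<lambda>_. [])) (3 * n + 1) (\<sigma>(3 := ones n)) ?\<sigma>1" by (simp add: mult.commute)
    then have 1: "ex ?body (Suc (Suc (3 * n + 1))) \<sigma> ?\<sigma>1"
      by (intro ex_Pop, unfold tl, intro ex_Case) (use False in simp)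
    have 2: "ex [While 3 nonz ?body] (Suc 0) ?\<sigma>1 ?\<sigma>1" by (rule ex_While_False) simp
    have e: "?\<sigma>1 = \<sigma>(3 := [], 2 := fst (guess (Suc n) (\<sigma> 2) (\<sigma> 6)), 6 := snd (guess (Suc n) (\<sigma> 2) (\<sigma> 6)))"
      using False by (auto simp: fun_eq_iff)
    show ?thesis unfolding guess_prog_def e[symmetric]
      by (rule ex_mono[OF ex_While_True[where P = nonz, OF top 1 2]]) simp
  qed
qed

text \<open>The word is written from its end to its beginning, in the symbols 2 and 3 that stand for
  bits on a simulated tape. Stack 11 is the right half of tape 0 for a machine simulated from stack
  10 on.\<close>

definition enc_input :: "cmd list" where
  "enc_input = pushes 11 [3, 3] @ conv 6 11 (\<lambda>a. [if a = 2 then 3 else 2, 2]) @ pushes 11 [2, 3, 3, 3] @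
     pour 0 5 @ conv 5 11 (\<lambda>a. [if a = 2 then 3 else 2, 2]) @ pushes 11 [2, 3]"

abbreviation esym :: "bool \<Rightarrow> nat" where "esym b \<equiv> Suc (bsym b)"

lemma conv_enc: "rev (concat (map (\<lambda>a. [if a = 2 then 3 else 2, 2]) (map bsym v))) = map esym (concat (map (\<lambda>b. [False, b]) (rev v)))"
  by (induction v) (auto simp: bsym_def)

lemma ex_enc_input:
  assumes "\<sigma> 0 = map bsym x" "\<sigma> 5 = []" "\<sigma> 6 = map bsym v" "\<sigma> 11 = []"
  shows "ex enc_input (9 * length x + 5 * length v + 11) \<sigma>
    (\<sigma>(0 := [], 6 := [], 11 := map esym (enc_bits x @ enc_bits (rev v))))"
proof -
  let ?\<sigma>1 = "\<sigma>(11 := [3, 3])"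
  let ?w = "map esym (concat (map (\<lambda>b. [False, b]) (rev v)) @ [True, True])"
  let ?\<sigma>2 = "\<sigma>(6 := [], 11 := ?w)"
  let ?w3 = "map esym ([True, True] @ enc_bits (rev v))"
  let ?\<sigma>3 = "\<sigma>(6 := [], 11 := ?w3)"
  let ?\<sigma>4 = "\<sigma>(6 := [], 11 := ?w3, 0 := [], 5 := rev (map bsym x))"
  let ?w5 = "map esym (concat (map (\<lambda>b. [False, b]) x) @ [True, True] @ enc_bits (rev v))"
  let ?\<sigma>5 = "\<sigma>(6 := [], 0 := [], 11 := ?w5)"
  have 1: "ex (pushes 11 [3, 3]) 2 \<sigma> ?\<sigma>1" using ex_pushes[of "[3, 3]" 2 11 \<sigma>] assms by simp
  have "ex (conv 6 11 (\<lambda>a. [if a = 2 then 3 else 2, 2])) (length (map bsym v) * (2 + 3) + 1) ?\<sigma>1 (?\<sigma>1(6 := [], 11 := rev (concat (map (\<lambda>a. [if a = 2 then 3 else 2, 2]) (map bsym v))) @ ?\<sigma>1 11))"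
    by (rule ex_conv) (use assms in auto)
  moreover have "?\<sigma>1(6 := [], 11 := rev (concat (map (\<lambda>a. [if a = 2 then 3 else 2, 2]) (map bsym v))) @ ?\<sigma>1 11) = ?\<sigma>2"
    unfolding conv_enc by (auto simp: fun_eq_iff bsym_def)
  ultimately have 2: "ex (conv 6 11 (\<lambda>a. [if a = 2 then 3 else 2, 2])) (5 * length v + 1) ?\<sigma>1 ?\<sigma>2" by (simp add: mult.commute)
  have "ex (pushes 11 [2, 3, 3, 3]) 4 ?\<sigma>2 (?\<sigma>2(11 := rev [2, 3, 3, 3] @ ?\<sigma>2 11))" by (rule ex_pushes) auto
  moreover have "?\<sigma>2(11 := rev [2, 3, 3, 3] @ ?\<sigma>2 11) = ?\<sigma>3" by (auto simp: fun_eq_iff bsym_def enc_bits_def)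
  ultimately have 3: "ex (pushes 11 [2, 3, 3, 3]) 4 ?\<sigma>2 ?\<sigma>3" by simp
  have "ex (pour 0 5) (4 * length (map bsym x) + 1) ?\<sigma>3 (?\<sigma>3(0 := [], 5 := rev (map bsym x) @ ?\<sigma>3 5))"
    by (rule ex_pour) (use assms in auto)
  moreover have "?\<sigma>3(0 := [], 5 := rev (map bsym x) @ ?\<sigma>3 5) = ?\<sigma>4" using assms by (auto simp: fun_eq_iff)
  ultimately have 4: "ex (pour 0 5) (4 * length x + 1) ?\<sigma>3 ?\<sigma>4" by simp
  have "ex (conv 5 11 (\<lambda>a. [if a = 2 then 3 else 2, 2])) (length (rev (map bsym x)) * (2 + 3) + 1) ?\<sigma>4 (?\<sigma>4(5 := [], 11 := rev (concat (map (\<lambda>a. [if a = 2 then 3 else 2, 2]) (rev (map bsym x)))) @ ?\<sigma>4 11))"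
    by (rule ex_conv) auto
  moreover have "?\<sigma>4(5 := [], 11 := rev (concat (map (\<lambda>a. [if a = 2 then 3 else 2, 2]) (rev (map bsym x)))) @ ?\<sigma>4 11) = ?\<sigma>5"
    unfolding rev_map conv_enc rev_rev_ident using assms by (auto simp: fun_eq_iff)
  ultimately have 5: "ex (conv 5 11 (\<lambda>a. [if a = 2 then 3 else 2, 2])) (5 * length x + 1) ?\<sigma>4 ?\<sigma>5" by (simp add: mult.commute)
  have "ex (pushes 11 [2, 3]) 2 ?\<sigma>5 (?\<sigma>5(11 := rev [2, 3] @ ?\<sigma>5 11))" by (rule ex_pushes) auto
  moreover have "?\<sigma>5(11 := rev [2, 3] @ ?\<sigma>5 11) = \<sigma>(0 := [], 6 := [], 11 := map esym (enc_bits x @ enc_bits (rev v)))"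
    by (auto simp: fun_eq_iff bsym_def enc_bits_def)
  ultimately have 6: "ex (pushes 11 [2, 3]) 2 ?\<sigma>5 (\<sigma>(0 := [], 6 := [], 11 := map esym (enc_bits x @ enc_bits (rev v))))" by simp
  show ?thesis unfolding enc_input_def
    by (rule ex_mono[OF ex_append[OF 1 ex_append[OF 2 ex_append[OF 3 ex_append[OF 4 ex_append[OF 5 6]]]]]]) simp
qed

definition verify_prog :: "tm \<Rightarrow> nat \<Rightarrow> nat \<Rightarrow> cmd list" where
  "verify_prog M c d = upoly c d @ guess_prog @ enc_input @ sim M 10 7 8"

text \<open>A rejected certificate leads into an infinite loop, so halting alone signals acceptance
  and the tableau has to inspect only the last control state.\<close>

definition np_prog :: "tm \<Rightarrow> nat \<Rightarrow> nat \<Rightarrow> cmd list" where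
  "np_prog M c d = verify_prog M c d @ [Case 7 (\<lambda>s. if s = 2 then [] else [Push 9 1, While 9 nonz []])]"

lemma ex_verify_prog:
  assumes wf: "wf_tm M" and V: "computes_within M (decider V) (\<lambda>n. a * real n ^ e + a)"
  shows "\<exists>B. polyb B \<and> (\<forall>x us. \<exists>\<sigma>'. ex (verify_prog M c d) (B (length x)) (sinit2 x us) \<sigma>' \<and> \<sigma>' 9 = [] \<and>
    \<sigma>' 7 = [bsym (enc_bits x @ enc_bits (rev (map (\<lambda>s. s = 2) (snd (guess (c * length x ^ d + c) (map bsym us) [])))) \<in> V)])"
proof -
  define p where "p n = c * n ^ d + c" for n
  define q where "q n = 2 * n + 2 * p n + 8" for n
  define T where "T n = 2 * nat \<lceil>\<bar>a\<bar>\<rceil> * Suc (q n) ^ e" for n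
  define B where "B n = (20 * d + 5 * c + 10) * Suc n ^ Suc d + 5 * c + 10 + (20 * p n + 1 + (9 * n + 5 * p n + 11 + (T n + q n + 1) * (6 * ntapes M + 50)))" for n
  have "polyb p" unfolding p_def by (intro polyb_add polyb_mult polyb_power polyb_const polyb_id)
  then have "polyb q" unfolding q_def by (intro polyb_add polyb_mult polyb_const polyb_id)
  then have "polyb T" unfolding T_def by (intro polyb_mult polyb_power polyb_Suc polyb_const)
  then have "polyb B" unfolding B_def using \<open>polyb p\<close> \<open>polyb q\<close>
    by (intro polyb_add polyb_mult polyb_power polyb_Suc polyb_const polyb_id)
  moreover have "\<exists>\<sigma>'. ex (verify_prog M c d) (B (length x)) (sinit2 x us) \<sigma>' \<and> \<sigma>' 9 = [] \<and>
    \<sigma>' 7 = [bsym (enc_bits x @ enc_bits (rev (map (\<lambda>s. s = 2) (snd (guess (c * length x ^ d + c) (map bsym us) [])))) \<in> V)]" for x us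
  proof -
    let ?\<sigma> = "sinit2 x us"
    let ?n = "length x"
    let ?g = "guess (p ?n) (map bsym us) []"
    obtain ws where ws: "snd ?g = map bsym ws" "length ws \<le> p ?n" using guess_result[of "p ?n" "map bsym us" "[]"] by auto
    have ws_eq: "ws = map (\<lambda>s. s = 2) (snd ?g)" unfolding ws by (induction ws) (auto simp: bsym_def)
    let ?z = "enc_bits x @ enc_bits (rev ws)"
    let ?\<sigma>1 = "?\<sigma>(3 := ones (p ?n))"
    have 1: "ex (upoly c d) ((20 * d + 5 * c + 10) * Suc (length (map bsym x)) ^ Suc d + 5 * c + 10) ?\<sigma> (?\<sigma>(3 := ones (c * length (map bsym x) ^ d + c)))"
      by (rule ex_upoly) (auto simp: sinit2_def)
    let ?\<sigma>2 = "?\<sigma>(2 := fst ?g, 6 := map bsym ws)"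
    have "ex guess_prog (20 * p ?n + 1) ?\<sigma>1 (?\<sigma>1(3 := [], 2 := fst (guess (p ?n) (?\<sigma>1 2) (?\<sigma>1 6)), 6 := snd (guess (p ?n) (?\<sigma>1 2) (?\<sigma>1 6))))"
      by (rule ex_guess_prog) simp
    moreover have "?\<sigma>1(3 := [], 2 := fst (guess (p ?n) (?\<sigma>1 2) (?\<sigma>1 6)), 6 := snd (guess (p ?n) (?\<sigma>1 2) (?\<sigma>1 6))) = ?\<sigma>2"
      using ws by (auto simp: fun_eq_iff sinit2_def)
    ultimately have 2: "ex guess_prog (20 * p ?n + 1) ?\<sigma>1 ?\<sigma>2" by simp
    let ?\<sigma>3 = "?\<sigma>2(0 := [], 6 := [], 11 := map esym ?z)"
    have 3: "ex enc_input (9 * length x + 5 * length ws + 11) ?\<sigma>2 ?\<sigma>3"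
      by (rule ex_enc_input) (auto simp: sinit2_def)
    obtain t where t: "real t \<le> a * real (length ?z) ^ e + a" "fst (run M ?z t) = 1" "fst (snd (run M ?z t) ! 1) = bit_tape (decider V ?z)"
      using V unfolding computes_within_def by blast
    have lb: "length (enc_bits r) = 2 * length r + 4" for r by (induction r) (auto simp: enc_bits_def)
    have z: "length ?z \<le> q ?n" using ws(2) by (simp add: lb q_def)
    have tT: "t \<le> T ?n" using real_poly_bound[OF t(1) z] by (simp add: T_def)
    have "\<exists>\<sigma>'. ex (sim M 10 7 8) ((t + length ?z + 1) * (6 * ntapes M + 50)) ?\<sigma>3 \<sigma>' \<and> \<sigma>' 7 = map bsym (decider V ?z) @ ?\<sigma>3 7 \<and>
      (\<forall>i. i < 10 \<and> i \<noteq> 7 \<or> 10 + 2 * ntapes M < i \<longrightarrow> \<sigma>' i = ?\<sigma>3 i) \<and> length (decider V ?z) \<le> 4 * t + length ?z"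
      by (rule ex_sim[OF wf t(2,3)]) (auto simp: sinit2_def)
    then obtain \<sigma>' where s: "ex (sim M 10 7 8) ((t + length ?z + 1) * (6 * ntapes M + 50)) ?\<sigma>3 \<sigma>'"
      "\<sigma>' 7 = map bsym (decider V ?z) @ ?\<sigma>3 7" "\<forall>i. i < 10 \<and> i \<noteq> 7 \<or> 10 + 2 * ntapes M < i \<longrightarrow> \<sigma>' i = ?\<sigma>3 i" by blast
    have s7: "\<sigma>' 7 = [bsym (?z \<in> V)]" using s(2) by (simp add: decider_def sinit2_def)
    have "\<sigma>' 9 = ?\<sigma>3 9" using s(3) by (auto dest: spec[of _ 9])
    then have s9: "\<sigma>' 9 = []" by (simp add: sinit2_def)
    have u1: "ex (upoly c d) ((20 * d + 5 * c + 10) * Suc ?n ^ Suc d + 5 * c + 10) ?\<sigma> ?\<sigma>1" using 1 by (simp add: p_def)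
    have "ex (verify_prog M c d) ((20 * d + 5 * c + 10) * Suc ?n ^ Suc d + 5 * c + 10 + (20 * p ?n + 1 + (9 * length x + 5 * length ws + 11 + (t + length ?z + 1) * (6 * ntapes M + 50)))) ?\<sigma> \<sigma>'"
      unfolding verify_prog_def by (rule ex_append[OF u1 ex_append[OF 2 ex_append[OF 3 s(1)]]])
    moreover have "(t + length ?z + 1) * (6 * ntapes M + 50) \<le> (T ?n + q ?n + 1) * (6 * ntapes M + 50)"
      using tT z by (intro mult_right_mono add_mono) auto
    ultimately have "ex (verify_prog M c d) (B ?n) ?\<sigma> \<sigma>'"
      by (elim ex_mono) (use ws(2) in \<open>unfold B_def, linarith\<close>)
    then show ?thesis using s7 s9 ws_eq by (auto simp: p_def)
  qed
  ultimately show ?thesis by blast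
qed

lemma halted_mono:
  assumes "fst ((sstep ^^ n) z) = []" "n \<le> m" shows "fst ((sstep ^^ m) z) = []"
proof -
  obtain \<sigma> where "(sstep ^^ n) z = ([], \<sigma>)" using assms by (metis prod.collapse)
  moreover have "(sstep ^^ m) z = (sstep ^^ (m - n)) ((sstep ^^ n) z)"
    using assms(2) by (metis comp_apply funpow_add le_add_diff_inverse2)
  ultimately show ?thesis by simp
qed

text \<open>Every \<open>N\<close> above the bound works, because a halted program stays halted;
  this permits rounding the run length up to a power of two.\<close>

lemma np_prog_correct:
  assumes wf: "wf_tm M" and V: "computes_within M (decider V) (\<lambda>n. a * real n ^ e + a)"
    and L: "\<And>x. x \<in> L \<longleftrightarrow> (\<exists>w. length w \<le> c * length x ^ d + c \<and> enc_bits x @ enc_bits w \<in> V)"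
  shows "\<exists>B. polyb B \<and> (\<forall>x N. B (length x) \<le> N \<longrightarrow>
    (x \<in> L \<longleftrightarrow> (\<exists>us. length us = N \<and> fst ((sstep ^^ N) (np_prog M c d, sinit2 x us)) = [])))"
proof -
  obtain B where B: "polyb B" "\<And>x us. \<exists>\<sigma>'. ex (verify_prog M c d) (B (length x)) (sinit2 x us) \<sigma>' \<and> \<sigma>' 9 = [] \<and>
    \<sigma>' 7 = [bsym (enc_bits x @ enc_bits (rev (map (\<lambda>s. s = 2) (snd (guess (c * length x ^ d + c) (map bsym us) [])))) \<in> V)]"
    using ex_verify_prog[OF wf V] by metis
  define p where "p n = c * n ^ d + c" for n
  \<comment> \<open>The summand \<open>2 * p n + 1\<close> leaves room on the choice stack for a
    longest certificate, two symbols per bit, and its stop symbol.\<close>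
  define B' where "B' n = B n + 1 + (2 * p n + 1)" for n
  have "polyb B'" unfolding B'_def p_def by (intro polyb_add polyb_mult polyb_power polyb_const polyb_id B(1))
  moreover have "x \<in> L \<longleftrightarrow> (\<exists>us. length us = N \<and> fst ((sstep ^^ N) (np_prog M c d, sinit2 x us)) = [])"
    if N: "B' (length x) \<le> N" for x N
  proof
    assume "x \<in> L"
    then obtain w where w: "length w \<le> p (length x)" "enc_bits x @ enc_bits w \<in> V" using L by (auto simp: p_def)
    define us where "us = concat (map (\<lambda>b. [True, b]) w) @ False # replicate (N - (2 * length w + 1)) False"
    have "length (concat (map (\<lambda>b. [True, b]) w)) = 2 * length w" by (induction w) auto
    then have us: "length us = N" using w(1) N by (simp add: us_def B'_def)
    have "snd (guess (p (length x)) (map bsym us) []) = map bsym (rev w)"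
      using guess_any[OF w(1), of "replicate (N - (2 * length w + 1)) False" "[]"] unfolding us_def by simp
    then have g: "rev (map (\<lambda>s. s = 2) (snd (guess (c * length x ^ d + c) (map bsym us) []))) = w"
      using map_bsym_inv[of "rev w"] by (simp add: p_def del: map_map)
    obtain \<sigma>' where s: "ex (verify_prog M c d) (B (length x)) (sinit2 x us) \<sigma>'" "\<sigma>' 7 = [2]"
      using B(2)[of x us] w(2) unfolding g by (auto simp: bsym_def)
    have "ex [Case 7 (\<lambda>s. if s = 2 then [] else [Push 9 1, While 9 nonz []])] (Suc 0) \<sigma>' \<sigma>'"
      by (rule ex_Case) (simp add: s)
    from ex_append[OF s(1) this] obtain n where n: "n \<le> B (length x) + Suc 0" "exec (np_prog M c d) n (sinit2 x us) \<sigma>'"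
      unfolding np_prog_def ex_def by blast
    then have "fst ((sstep ^^ n) (np_prog M c d, sinit2 x us)) = []" unfolding exec_def by (metis append_Nil2 fst_conv)
    then have "fst ((sstep ^^ N) (np_prog M c d, sinit2 x us)) = []" by (rule halted_mono) (use n N in \<open>simp add: B'_def\<close>)
    then show "\<exists>us. length us = N \<and> fst ((sstep ^^ N) (np_prog M c d, sinit2 x us)) = []" using us by blast
  next
    assume "\<exists>us. length us = N \<and> fst ((sstep ^^ N) (np_prog M c d, sinit2 x us)) = []"
    then obtain us where us: "fst ((sstep ^^ N) (np_prog M c d, sinit2 x us)) = []" by blast
    let ?w = "rev (map (\<lambda>s. s = 2) (snd (guess (c * length x ^ d + c) (map bsym us) [])))"
    have len: "length ?w \<le> c * length x ^ d + c"
      using guess_result[of "c * length x ^ d + c" "map bsym us" "[]"] by auto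
    let ?last = "[Case 7 (\<lambda>s. if s = 2 then [] else [Push 9 1, While 9 nonz []])]"
    obtain \<sigma>' where s: "ex (verify_prog M c d) (B (length x)) (sinit2 x us) \<sigma>'" "\<sigma>' 7 = [bsym (enc_bits x @ enc_bits ?w \<in> V)]"
      using B(2) by blast
    then obtain n where n: "(sstep ^^ n) (np_prog M c d, sinit2 x us) = (?last, \<sigma>')"
      unfolding ex_def exec_def np_prog_def by blast
    have "enc_bits x @ enc_bits ?w \<in> V"
    proof (rule ccontr)
      assume "\<not> ?thesis"
      then have "\<sigma>' 7 = [1]" using s(2) by (simp add: bsym_def)
      then have two: "(sstep ^^ 2) (?last, \<sigma>') = ([While 9 nonz []], \<sigma>'(9 := 1 # \<sigma>' 9))"
        by (simp add: numeral_2_eq_2)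
      have stay: "(sstep ^^ j) ([While 9 nonz []], \<sigma>'(9 := 1 # \<sigma>' 9)) = ([While 9 nonz []], \<sigma>'(9 := 1 # \<sigma>' 9))" for j
        by (induction j) auto
      have "(sstep ^^ (N + (2 + n))) (np_prog M c d, sinit2 x us) = ([While 9 nonz []], \<sigma>'(9 := 1 # \<sigma>' 9))"
        by (simp only: funpow_add comp_apply n two stay)
      moreover have "fst ((sstep ^^ (N + (2 + n))) (np_prog M c d, sinit2 x us)) = []"
        by (rule halted_mono[OF us]) simp
      ultimately show False by simp
    qed
    then show "x \<in> L" using L len by blast
  qed
  ultimately show ?thesis by blast
qed

lemma wfp_np_prog:
  assumes "wf_tm M" shows "wfp (11 + 2 * ntapes M) (6 + nstates M + nsyms M) (np_prog M c d)"
proof -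
  have M: "2 \<le> ntapes M" "2 \<le> nstates M" "3 \<le> nsyms M" using assms by (auto simp: wf_tm_def)
  have "wfp (11 + 2 * ntapes M) (6 + nstates M + nsyms M) (upow d)"
    by (induction d) (use M in \<open>auto simp: times_def\<close>)
  then show ?thesis
    using M by (auto simp: np_prog_def verify_prog_def upoly_def guess_prog_def enc_input_def intro!: wfp_sim[OF assms])
qed

section \<open>Bit-string registers\<close>

lemma ex_copyI:
  assumes "length (\<sigma> i) \<le> Z" "0 \<notin> set (\<sigma> i)" "\<sigma> t = []" "distinct [i, j, t]" "\<sigma>' = \<sigma>(j := \<sigma> i @ \<sigma> j)"
  shows "ex (copy i j t) (9 * Z + 2) \<sigma> \<sigma>'"
  unfolding assms(5) by (rule ex_mono[OF ex_copy]) (use assms in auto)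

lemma ex_pourI:
  assumes "length (\<sigma> i) \<le> Z" "0 \<notin> set (\<sigma> i)" "i \<noteq> j" "\<sigma>' = \<sigma>(i := [], j := rev (\<sigma> i) @ \<sigma> j)"
  shows "ex (pour i j) (4 * Z + 1) \<sigma> \<sigma>'"
  unfolding assms(4) by (rule ex_mono[OF ex_pour]) (use assms in auto)

definition clear :: "nat \<Rightarrow> cmd list" where "clear i = conv i 0 (\<lambda>_. [])"

lemma ex_clearI:
  assumes "length (\<sigma> i) \<le> Z" "0 \<notin> set (\<sigma> i)" "i \<noteq> 0" "\<sigma>' = \<sigma>(i := [])"
  shows "ex (clear i) (3 * Z + 1) \<sigma> \<sigma>'"
proof -
  have "ex (conv i 0 (\<lambda>_. [])) (length (\<sigma> i) * (0 + 3) + 1) \<sigma> (\<sigma>(i := [], 0 := rev (concat (map (\<lambda>_. []) (\<sigma> i))) @ \<sigma> 0))"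
    by (rule ex_conv) (use assms in auto)
  moreover have "\<sigma>(i := [], 0 := rev (concat (map (\<lambda>_. []) (\<sigma> i))) @ \<sigma> 0) = \<sigma>'" using assms by auto
  ultimately show ?thesis unfolding clear_def by (metis (no_types) ex_mono add_le_mono1 mult.commute mult_le_mono2 assms(1) add_0)
qed

lemma wfp_clear [simp]: "wfp K S (clear i) \<longleftrightarrow> i < K \<and> i \<noteq> 1"
  by (auto simp: clear_def)

fun incb :: "bool list \<Rightarrow> bool list" where
  "incb [] = []"
| "incb (True # r) = False # incb r"
| "incb (False # r) = True # r"

lemma incb_bits: "incb (bits n i) = bits n (Suc i)"
proof (induction n arbitrary: i)
  case (Suc n)
  then show ?case by (cases "odd i") auto
qed simp

lemma bits_wrap: "bits n (2 ^ n) = replicate n False"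
  by (induction n) auto

lemma False_in_bits: "i < 2 ^ n \<Longrightarrow> False \<in> set (bits n i) \<longleftrightarrow> Suc i < 2 ^ n"
proof (induction n arbitrary: i)
  case (Suc n)
  then have IH: "False \<in> set (bits n (i div 2)) \<longleftrightarrow> Suc (i div 2) < 2 ^ n" by auto
  show ?case
  proof (cases "odd i")
    case True
    then obtain j where "i = 2 * j + 1" by (rule oddE)
    then show ?thesis using IH True by auto
  next
    case False
    then have "even i" by simp
    then obtain j where "i = 2 * j" by (rule evenE)
    then show ?thesis using Suc.prems by auto
  qed
qed simp

lemma incb_replicate: "incb (replicate m True @ s) = replicate m False @ incb s"
  by (induction m) auto

text \<open>Carried \<open>True\<close> bits are parked on \<open>t\<close> as the symbol 1, the
  code of \<open>False\<close>, so pouring them back already clears them. An overflow pops the flag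
  \<open>f\<close>.\<close>

definition inc :: "nat \<Rightarrow> nat \<Rightarrow> nat \<Rightarrow> cmd list" where
  "inc b t f = [While b (\<lambda>a. a = 2) [Pop b, Push t 1], Case b (\<lambda>s. if s = 0 then [Pop f] else [Pop b, Push b 2])] @ pour t b"

lemma ex_inc_carry:
  assumes "\<sigma> b = map bsym (replicate m True @ s)" "s = [] \<or> \<not> hd s" "b \<noteq> t"
  shows "ex [While b (\<lambda>a. a = 2) [Pop b, Push t 1]] (3 * m + 1) \<sigma> (\<sigma>(b := map bsym s, t := ones m @ \<sigma> t))"
  using assms
proof (induction m arbitrary: \<sigma>)
  case 0
  then have eq: "\<sigma>(b := map bsym s, t := ones 0 @ \<sigma> t) = \<sigma>" by auto
  have "top0 (\<sigma> b) \<noteq> 2" using 0 by (cases s) (auto simp: bsym_def)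
  then show ?case unfolding eq by (intro ex_mono[OF ex_While_False[where B = 0]]) auto
next
  case (Suc m)
  let ?\<sigma>1 = "\<sigma>(b := map bsym (replicate m True @ s), t := 1 # \<sigma> t)"
  have "ex [Pop b, Push t 1] (Suc (Suc 0)) \<sigma> ?\<sigma>1"
    by (rule ex_Pop, rule ex_Push) (use Suc.prems in auto)
  moreover have "ex [While b (\<lambda>a. a = 2) [Pop b, Push t 1]] (3 * m + 1) ?\<sigma>1 (?\<sigma>1(b := map bsym s, t := ones m @ ?\<sigma>1 t))"
    by (rule Suc.IH) (use Suc.prems in auto)
  moreover have "?\<sigma>1(b := map bsym s, t := ones m @ ?\<sigma>1 t) = \<sigma>(b := map bsym s, t := ones (Suc m) @ \<sigma> t)"
    using Suc.prems(3) by (auto simp: fun_eq_iff replicate_app_Cons_same)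
  moreover have "top0 (\<sigma> b) = 2" using Suc.prems by (simp add: bsym_def)
  ultimately have "ex [While b (\<lambda>a. a = 2) [Pop b, Push t 1]] (Suc (Suc (Suc 0) + (3 * m + 1))) \<sigma> (\<sigma>(b := map bsym s, t := ones (Suc m) @ \<sigma> t))"
    using ex_While_True[where P = "\<lambda>a. a = 2" and i = b] by metis
  then show ?case by (rule ex_mono) simp
qed

lemma ex_incI:
  assumes "\<sigma> b = map bsym bs" "\<sigma> t = []" "distinct [b, t, f]" "length bs \<le> Z"
    "\<sigma>' = \<sigma>(b := map bsym (incb bs), f := (if False \<in> set bs then \<sigma> f else tl (\<sigma> f)))"
  shows "ex (inc b t f) (7 * Z + 10) \<sigma> \<sigma>'"
proof -
  define m where "m = length (takeWhile (\<lambda>x. x) bs)"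
  define s where "s = dropWhile (\<lambda>x. x) bs"
  have "takeWhile (\<lambda>x. x) bs = replicate m True"
    unfolding m_def by (rule replicate_eqI[symmetric, THEN sym]) (auto dest: set_takeWhileD)
  then have bs: "bs = replicate m True @ s" unfolding s_def by (metis takeWhile_dropWhile_id)
  have s: "s = [] \<or> \<not> hd s" unfolding s_def using hd_dropWhile[of "\<lambda>x. x" bs] by auto
  have m: "m \<le> Z" using assms(4) bs by auto
  let ?\<sigma>1 = "\<sigma>(b := map bsym s, t := ones m)"
  let ?\<sigma>2 = "\<sigma>(b := map bsym (incb s), t := ones m, f := (if s = [] then tl (\<sigma> f) else \<sigma> f))"
  have 1: "ex [While b (\<lambda>a. a = 2) [Pop b, Push t 1]] (3 * m + 1) \<sigma> ?\<sigma>1"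
    using ex_inc_carry[of \<sigma> b m s t] assms bs s by simp
  have 2: "ex [Case b (\<lambda>s. if s = 0 then [Pop f] else [Pop b, Push b 2])] (Suc (Suc (Suc 0))) ?\<sigma>1 ?\<sigma>2"
  proof (cases s)
    case Nil
    then show ?thesis using assms(3) by (intro ex_Case) (auto intro!: ex_Pop simp: fun_eq_iff)
  next
    case (Cons a r)
    then have "a = False" using s by simp
    then show ?thesis using assms(3) Cons by (intro ex_Case) (auto intro!: ex_Pop ex_Push simp: fun_eq_iff bsym_def)
  qed
  have "incb bs = replicate m False @ incb s" unfolding bs by (rule incb_replicate)
  moreover have "False \<in> set bs \<longleftrightarrow> s \<noteq> []" using s unfolding bs by (cases s) auto
  ultimately have "\<sigma>' = ?\<sigma>2(t := [], b := rev (?\<sigma>2 t) @ ?\<sigma>2 b)"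
    unfolding assms(5) using assms(2,3) by (auto simp: fun_eq_iff bsym_def)
  then have 3: "ex (pour t b) (4 * m + 1) ?\<sigma>2 \<sigma>'"
    by (intro ex_pourI) (use assms(3) in auto)
  have "ex (inc b t f) (3 * m + 1 + (Suc (Suc (Suc 0)) + (4 * m + 1))) \<sigma> \<sigma>'"
    unfolding inc_def using ex_append[OF 1 ex_append[OF 2 3]] by simp
  then show ?thesis by (rule ex_mono) (use m in simp)
qed

lemma wfp_inc [simp]: "2 < S \<Longrightarrow> wfp K S (inc b t f) \<longleftrightarrow> b < K \<and> b \<noteq> 1 \<and> t < K \<and> t \<noteq> 1 \<and> f < K \<and> f \<noteq> 1"
  by (auto simp: inc_def)

text \<open>Since 1 codes \<open>False\<close>, the unary number \<open>ones n\<close> is at the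
  same time the zero counter of \<open>n\<close> bits, and the overflow that ends the loop restores
  it.\<close>

definition forbits :: "nat \<Rightarrow> nat \<Rightarrow> nat \<Rightarrow> cmd list \<Rightarrow> cmd list" where
  "forbits b t f body = Push f 1 # [While f nonz (body @ inc b t f)]"

lemma ex_forbitsI:
  assumes "\<And>i. i < 2 ^ n \<Longrightarrow> ex body C ((st i)(b := map bsym (bits n i), f := [1])) ((st (Suc i))(b := map bsym (bits n i), f := [1]))"
    "\<And>i. st i t = []" "distinct [b, t, f]" "n \<le> Z"
    "\<sigma> = (st 0)(b := ones n, f := [])" "\<sigma>' = (st (2 ^ n))(b := ones n, f := [])"
  shows "ex (forbits b t f body) (2 ^ n * (C + 7 * Z + 11) + 2) \<sigma> \<sigma>'"
proof -
  let ?s = "\<lambda>j. (st j)(b := map bsym (bits n j), f := (if j < 2 ^ n then [1] else []))"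
  have "ex [While f nonz (body @ inc b t f)] (2 ^ n * Suc (C + (7 * Z + 10)) + 1) (?s 0) (?s (2 ^ n))"
  proof (rule ex_While_iter[where s = ?s])
    fix j :: nat assume j: "j < 2 ^ n"
    have "ex (inc b t f) (7 * Z + 10) ((st (Suc j))(b := map bsym (bits n j), f := [1])) (?s (Suc j))"
      by (rule ex_incI[of _ _ "bits n j"]) (use assms(2,3,4) False_in_bits[OF j] in \<open>auto simp: incb_bits fun_eq_iff\<close>)
    from ex_append[OF assms(1)[OF j] this] j
    show "nonz (top0 (?s j f)) \<and> ex (body @ inc b t f) (C + (7 * Z + 10)) (?s j) (?s (Suc j))" by simp
  qed simp
  moreover have "?s (2 ^ n) = \<sigma>'" unfolding assms(6) bits_wrap by (simp add: bsym_def)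
  moreover have "?s 0 = \<sigma>(f := (if 1 = (0::nat) then \<sigma> f else 1 # \<sigma> f))"
    unfolding assms(5) bits_zero using assms(3) by (simp add: bsym_def fun_eq_iff)
  ultimately have "ex [While f nonz (body @ inc b t f)] (2 ^ n * Suc (C + (7 * Z + 10)) + 1) (\<sigma>(f := (if 1 = (0::nat) then \<sigma> f else 1 # \<sigma> f))) \<sigma>'"
    by simp
  then have "ex (forbits b t f body) (Suc (2 ^ n * Suc (C + (7 * Z + 10)) + 1)) \<sigma> \<sigma>'"
    unfolding forbits_def by (rule ex_Push)
  then show ?thesis by (rule ex_mono) simp
qed

lemma wfp_forbits [simp]: "2 < S \<Longrightarrow> wfp K S (forbits b t f body) \<longleftrightarrow> wfp K S body \<and> b < K \<and> b \<noteq> 1 \<and> t < K \<and> t \<noteq> 1 \<and> f < K \<and> f \<noteq> 1"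
  by (auto simp: forbits_def)

section \<open>Writing the instance\<close>

text \<open>
  Use of the stacks: 0 the input, 2 the answer, 3 and 4 the numbers \<open>w\<close> and \<open>k\<close> in unary, 5 and 6
  scratch, 7 the instance (hence written in reverse), 8 the queue of literals to be checked, 9 and
  10 the counter running over all names or tuples, 11 a copy of the tuple, 12 and 13 the number of
  the copy and its complement, 14 to 19 the fields from which variable names are assembled in 21,
  20 the input symbol, 22 the surplus of literals, 23 to 25 scratch, 26 the computed tree, 27 the
  pattern searched in it, 28 the failed tuples, 29 a flag; the simulated tapes start at 30.
\<close>

abbreviation rsym :: "bool list \<Rightarrow> nat list" where "rsym z \<equiv> rev (map bsym z)"

definition emit :: "bool list \<Rightarrow> cmd list" where
  "emit z = pushes 7 (map bsym z)"

lemma ex_emitI: "\<sigma>' = \<sigma>(7 := rsym z @ \<sigma> 7) \<Longrightarrow> ex (emit z) (length z) \<sigma> \<sigma>'"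
  unfolding emit_def using ex_pushes[of "map bsym z" "length z" 7 \<sigma>] by simp

lemma bsym_less: "2 < S \<Longrightarrow> bsym b < S"
  by (simp add: bsym_def)

lemma wfp_emit [simp]: "7 < K \<Longrightarrow> 2 < S \<Longrightarrow> wfp K S (emit z)"
  by (auto simp: emit_def bsym_less)

text \<open>The suffix \<open>r\<close> selects the vertex: \<open>[True]\<close> gives
  \<open>va\<close>, \<open>[False, True]\<close> gives \<open>vb\<close>. The name on
  \<open>b\<close> is kept.\<close>

definition emitn :: "nat \<Rightarrow> bool list \<Rightarrow> cmd list" where
  "emitn b r = emit [True, False] @ consume b 5 (\<lambda>a. [a]) 7 (\<lambda>a. [1, a]) @ pour 5 b @
     emit (concat (map (\<lambda>b. [False, b]) r) @ [True, True])"

lemma ex_emitnI: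
  assumes "\<sigma> b = map bsym s" "\<sigma> 5 = []" "b \<noteq> 5" "b \<noteq> 7" "length s \<le> Z" "length r \<le> 2"
    "\<sigma>' = \<sigma>(7 := rsym (enc_bits (s @ r)) @ \<sigma> 7)"
  shows "ex (emitn b r) (10 * Z + 10) \<sigma> \<sigma>'"
proof -
  let ?\<sigma>1 = "\<sigma>(7 := rsym [True, False] @ \<sigma> 7)"
  let ?\<sigma>2 = "\<sigma>(b := [], 5 := rsym s, 7 := rsym ([True, False] @ concat (map (\<lambda>b. [False, b]) s)) @ \<sigma> 7)"
  let ?\<sigma>3 = "\<sigma>(7 := rsym ([True, False] @ concat (map (\<lambda>b. [False, b]) s)) @ \<sigma> 7)"
  let ?z = "concat (map (\<lambda>b. [False, b]) r) @ [True, True]"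
  have 1: "ex (emit [True, False]) (length [True, False]) \<sigma> ?\<sigma>1" by (rule ex_emitI) simp
  have "ex (consume b 5 (\<lambda>a. [a]) 7 (\<lambda>a. [1, a])) (length (map bsym s) * (3 + 3) + 1) ?\<sigma>1
     (?\<sigma>1(b := [], 5 := rev (concat (map (\<lambda>a. [a]) (map bsym s))) @ ?\<sigma>1 5, 7 := rev (concat (map (\<lambda>a. [1, a]) (map bsym s))) @ ?\<sigma>1 7))"
    by (rule ex_consume) (use assms in auto)
  moreover have "rev (concat (map (\<lambda>a. [1, a]) (map bsym s))) = rsym (concat (map (\<lambda>b. [False, b]) s))"
    by (induction s) (auto simp: bsym_def)
  then have "?\<sigma>1(b := [], 5 := rev (concat (map (\<lambda>a. [a]) (map bsym s))) @ ?\<sigma>1 5, 7 := rev (concat (map (\<lambda>a. [1, a]) (map bsym s))) @ ?\<sigma>1 7) = ?\<sigma>2"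
    using assms by (auto simp: fun_eq_iff comp_def)
  ultimately have 2: "ex (consume b 5 (\<lambda>a. [a]) 7 (\<lambda>a. [1, a])) (length (map bsym s) * (3 + 3) + 1) ?\<sigma>1 ?\<sigma>2" by simp
  have 3: "ex (pour 5 b) (4 * Z + 1) ?\<sigma>2 ?\<sigma>3" by (rule ex_pourI) (use assms in \<open>auto simp: fun_eq_iff\<close>)
  have 4: "ex (emit ?z) (length ?z) ?\<sigma>3 \<sigma>'" by (rule ex_emitI) (use assms in \<open>auto simp: fun_eq_iff enc_bits_def\<close>)
  have "length (concat (map (\<lambda>b. [False, b]) r)) = 2 * length r" by (induction r) auto
  then show ?thesis unfolding emitn_def
    by (intro ex_mono[OF ex_append[OF 1 ex_append[OF 2 ex_append[OF 3 4]]]]) (use assms(5,6) in simp)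
qed

lemma wfp_emitn [simp]: "7 < K \<Longrightarrow> 2 < S \<Longrightarrow> b < K \<Longrightarrow> b \<noteq> 1 \<Longrightarrow> wfp K S (emitn b r)"
  by (auto simp: emitn_def)

lemma enc_nat_va: "enc_nat (va s) = enc_bits (s @ [True])" and enc_nat_vb: "enc_nat (vb s) = enc_bits (s @ [False, True])"
  by (simp_all add: enc_nat_def binary_va binary_vb)

lemma enc_nat_0: "enc_nat 0 = [True, False, True, True]"
  by (simp add: enc_nat_def enc_bits_def)

definition cost0 :: "bool list" where "cost0 = enc_rat 0"

lemma length_cost0: "length cost0 = 10"
proof -
  have "binary 1 = [True]" by (subst binary.simps) simp
  then show ?thesis by (simp add: cost0_def enc_rat_def enc_nat_def enc_bits_def)
qed

lemma ex_emit_forbits: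
  assumes body: "\<And>i \<sigma>. i < 2 ^ n \<Longrightarrow> \<sigma> 9 = map bsym (bits n i) \<Longrightarrow> \<sigma> 5 = [] \<Longrightarrow> ex body C \<sigma> (\<sigma>(7 := rsym (g i) @ \<sigma> 7))"
    and \<sigma>: "\<sigma> 9 = ones n" "\<sigma> 5 = []" "\<sigma> 10 = []" "n \<le> Z"
    and \<sigma>': "\<sigma>' = \<sigma>(7 := rsym (concat (map g [0..<2 ^ n])) @ \<sigma> 7)"
  shows "ex (forbits 9 5 10 body) (2 ^ n * (C + 7 * Z + 11) + 2) \<sigma> \<sigma>'"
proof (rule ex_forbitsI[where st = "\<lambda>i. \<sigma>(7 := rsym (concat (map g [0..<i])) @ \<sigma> 7)" and n = n])
  fix i :: nat assume i: "i < 2 ^ n"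
  show "ex body C ((\<sigma>(7 := rsym (concat (map g [0..<i])) @ \<sigma> 7))(9 := map bsym (bits n i), 10 := [1]))
     ((\<sigma>(7 := rsym (concat (map g [0..<Suc i])) @ \<sigma> 7))(9 := map bsym (bits n i), 10 := [1]))"
    (is "ex body C ?a ?b")
  proof -
    have "ex body C ?a (?a(7 := rsym (g i) @ ?a 7))" by (rule body[OF i]) (use \<sigma> in auto)
    moreover have "?a(7 := rsym (g i) @ ?a 7) = ?b" by (auto simp: fun_eq_iff)
    ultimately show ?thesis by simp
  qed
qed (use \<sigma> \<sigma>' in \<open>auto simp: fun_eq_iff\<close>)

definition vs_prog :: "cmd list" where
  "vs_prog = emit [True, False] @ emit (enc_nat 0) @ forbits 9 5 10 (emitn 9 [True] @ emitn 9 [False, True]) @ emit [True, True]"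

lemma ex_vs_prog:
  assumes "\<sigma> 9 = ones W" "\<sigma> 5 = []" "\<sigma> 10 = []" "W \<le> Z"
    and \<sigma>': "\<sigma>' = \<sigma>(7 := rsym (enc_list enc_nat (enc_vs W)) @ \<sigma> 7)"
  shows "ex vs_prog (2 ^ W * (27 * Z + 31) + 10) \<sigma> \<sigma>'"
proof -
  let ?g = "\<lambda>i. enc_nat (va (bits W i)) @ enc_nat (vb (bits W i))"
  let ?\<sigma>1 = "\<sigma>(7 := rsym [True, False] @ \<sigma> 7)"
  let ?\<sigma>2 = "?\<sigma>1(7 := rsym (enc_nat 0) @ ?\<sigma>1 7)"
  let ?\<sigma>3 = "?\<sigma>2(7 := rsym (concat (map ?g [0..<2 ^ W])) @ ?\<sigma>2 7)"
  have 1: "ex (emit [True, False]) (length [True, False]) \<sigma> ?\<sigma>1" by (rule ex_emitI) simp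
  have 2: "ex (emit (enc_nat 0)) (length (enc_nat 0)) ?\<sigma>1 ?\<sigma>2" by (rule ex_emitI) simp
  have 3: "ex (forbits 9 5 10 (emitn 9 [True] @ emitn 9 [False, True])) (2 ^ W * ((10 * Z + 10 + (10 * Z + 10)) + 7 * Z + 11) + 2) ?\<sigma>2 ?\<sigma>3"
  proof (rule ex_emit_forbits[where g = ?g])
    fix i and \<rho> :: store assume r: "\<rho> 9 = map bsym (bits W i)" "\<rho> 5 = []"
    let ?\<rho>1 = "\<rho>(7 := rsym (enc_bits (bits W i @ [True])) @ \<rho> 7)"
    show "ex (emitn 9 [True] @ emitn 9 [False, True]) (10 * Z + 10 + (10 * Z + 10)) \<rho> (\<rho>(7 := rsym (?g i) @ \<rho> 7))"
      by (rule ex_append[of _ _ _ ?\<rho>1]; rule ex_emitnI) (use r assms in \<open>auto simp: enc_nat_va enc_nat_vb\<close>)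
  qed (use assms in auto)
  have 4: "ex (emit [True, True]) (length [True, True]) ?\<sigma>3 \<sigma>'"
  proof (rule ex_emitI)
    have "concat (map enc_nat (concat (map (\<lambda>i. [va (bits W i), vb (bits W i)]) xs))) = concat (map ?g xs)" for xs
      by (induction xs) auto
    then show "\<sigma>' = ?\<sigma>3(7 := rsym [True, True] @ ?\<sigma>3 7)" unfolding \<sigma>' by (simp add: enc_list_def enc_vs_def)
  qed
  show ?thesis unfolding vs_prog_def
    by (rule ex_mono[OF ex_append[OF 1 ex_append[OF 2 ex_append[OF 3 4]]]]) (simp add: enc_nat_0)
qed

definition es_prog :: "cmd list" where
  "es_prog = emit [True, False] @ forbits 9 5 10
     (emit (enc_nat 0) @ emitn 9 [True] @ emit cost0 @ emit (enc_nat 0) @ emitn 9 [False, True] @ emit cost0 @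
      emitn 9 [True] @ emitn 9 [False, True] @ emit cost0) @ emit [True, True]"

lemma ex_es_prog:
  assumes "\<sigma> 9 = ones W" "\<sigma> 5 = []" "\<sigma> 10 = []" "W \<le> Z"
    and \<sigma>': "\<sigma>' = \<sigma>(7 := rsym (enc_list (\<lambda>e. enc_edge e @ enc_rat 0) (enc_es W)) @ \<sigma> 7)"
  shows "ex es_prog (2 ^ W * (47 * Z + 89) + 10) \<sigma> \<sigma>'"
proof -
  let ?a = "\<lambda>i. enc_nat (va (bits W i))" and ?b = "\<lambda>i. enc_nat (vb (bits W i))"
  let ?g = "\<lambda>i. enc_nat 0 @ ?a i @ cost0 @ enc_nat 0 @ ?b i @ cost0 @ ?a i @ ?b i @ cost0"
  let ?\<sigma>1 = "\<sigma>(7 := rsym [True, False] @ \<sigma> 7)"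
  let ?\<sigma>3 = "?\<sigma>1(7 := rsym (concat (map ?g [0..<2 ^ W])) @ ?\<sigma>1 7)"
  have 1: "ex (emit [True, False]) (length [True, False]) \<sigma> ?\<sigma>1" by (rule ex_emitI) simp
  have 3: "ex (forbits 9 5 10
     (emit (enc_nat 0) @ emitn 9 [True] @ emit cost0 @ emit (enc_nat 0) @ emitn 9 [False, True] @ emit cost0 @
      emitn 9 [True] @ emitn 9 [False, True] @ emit cost0)) (2 ^ W * ((40 * Z + 78) + 7 * Z + 11) + 2) ?\<sigma>1 ?\<sigma>3"
  proof (rule ex_emit_forbits[where g = ?g])
    fix i and \<rho> :: store assume r: "\<rho> 9 = map bsym (bits W i)" "\<rho> 5 = []"
    have e: "ex (emit z) (length z) (\<rho>(7 := u)) (\<rho>(7 := rsym z @ u))" for z u by (rule ex_emitI) simp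
    have a: "ex (emitn 9 [True]) (10 * Z + 10) (\<rho>(7 := u)) (\<rho>(7 := rsym (?a i) @ u))" for u
      by (rule ex_emitnI) (use r assms in \<open>auto simp: enc_nat_va\<close>)
    have b: "ex (emitn 9 [False, True]) (10 * Z + 10) (\<rho>(7 := u)) (\<rho>(7 := rsym (?b i) @ u))" for u
      by (rule ex_emitnI) (use r assms in \<open>auto simp: enc_nat_vb\<close>)
    have "ex (emit (enc_nat 0) @ emitn 9 [True] @ emit cost0 @ emit (enc_nat 0) @ emitn 9 [False, True] @ emit cost0 @
      emitn 9 [True] @ emitn 9 [False, True] @ emit cost0) (length (enc_nat 0) + (10 * Z + 10 + (length cost0 +
       (length (enc_nat 0) + (10 * Z + 10 + (length cost0 + (10 * Z + 10 + (10 * Z + 10 + length cost0)))))))) (\<rho>(7 := \<rho> 7)) (\<rho>(7 := rsym cost0 @ rsym (?b i) @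
        rsym (?a i) @ rsym cost0 @ rsym (?b i) @ rsym (enc_nat 0) @ rsym cost0 @ rsym (?a i) @ rsym (enc_nat 0) @ \<rho> 7))"
      by (intro ex_append[OF e] ex_append[OF a] ex_append[OF b] e)
    then show "ex (emit (enc_nat 0) @ emitn 9 [True] @ emit cost0 @ emit (enc_nat 0) @ emitn 9 [False, True] @ emit cost0 @
      emitn 9 [True] @ emitn 9 [False, True] @ emit cost0) (40 * Z + 78) \<rho> (\<rho>(7 := rsym (?g i) @ \<rho> 7))"
      by (simp add: enc_nat_0 length_cost0 add.commute)
  qed (use assms in auto)
  have 4: "ex (emit [True, True]) (length [True, True]) ?\<sigma>3 \<sigma>'"
  proof (rule ex_emitI)
    have e: "enc_edge {0, va s} = enc_nat 0 @ enc_nat (va s)" "enc_edge {0, vb s} = enc_nat 0 @ enc_nat (vb s)"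
      "enc_edge {va s, vb s} = enc_nat (va s) @ enc_nat (vb s)" for s
      using va_vb_simps(7)[of s] by (auto simp: enc_edge_def)
    have "concat (map (\<lambda>e. enc_edge e @ enc_rat 0) (concat (map (\<lambda>i. [{0, va (bits W i)}, {0, vb (bits W i)}, {va (bits W i), vb (bits W i)}]) xs)))
       = concat (map ?g xs)" for xs
      by (induction xs) (auto simp: e cost0_def)
    then show "\<sigma>' = ?\<sigma>3(7 := rsym [True, True] @ ?\<sigma>3 7)" unfolding \<sigma>' by (simp add: enc_list_def enc_es_def)
  qed
  show ?thesis unfolding es_prog_def
    by (rule ex_mono[OF ex_append[OF 1 ex_append[OF 3 4]]]) (simp add: algebra_simps)
qed

section \<open>Binary counters and block registers\<close>

text \<open>Units are removed in pairs, one unit of each pair going to stack 24; a single unit left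
  over changes the parity symbol on stack 25 from 1 to 2.\<close>

definition halve :: "cmd list" where
  "halve = [Push 25 1, While 22 nonz [Pop 22, Case 22 (\<lambda>s. if s = 0 then [Pop 25, Push 25 2] else [Pop 22, Push 24 1])],
     Case 25 (\<lambda>p. [Push 23 p]), Pop 25] @ pour 24 22"

lemma ex_halve_loop:
  "\<sigma> 22 = ones m \<Longrightarrow> \<sigma> 25 = [1] \<Longrightarrow>
   ex [While 22 nonz [Pop 22, Case 22 (\<lambda>s. if s = 0 then [Pop 25, Push 25 2] else [Pop 22, Push 24 1])]] (5 * m + 1) \<sigma>
     (\<sigma>(22 := [], 25 := [bsym (odd m)], 24 := ones (m div 2) @ \<sigma> 24))"
proof (induction m arbitrary: \<sigma> rule: less_induct)
  case (less m)
  let ?body = "[Pop 22, Case 22 (\<lambda>s. if s = 0 then [Pop 25, Push 25 2] else [Pop 22, Push 24 1])]"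
  consider "m = 0" | "m = 1" | j where "m = Suc (Suc j)" by (metis One_nat_def not0_implies_Suc)
  then show ?case
  proof cases
    case 1
    then have eq: "\<sigma>(22 := [], 25 := [bsym (odd m)], 24 := ones (m div 2) @ \<sigma> 24) = \<sigma>" using less.prems by (auto simp: fun_eq_iff bsym_def)
    show ?thesis unfolding eq by (rule ex_mono[OF ex_While_False[where B = 0]]) (use less.prems 1 in auto)
  next
    case 2
    let ?\<sigma>1 = "\<sigma>(22 := [], 25 := [2])"
    have "ex ?body (Suc (Suc (Suc (Suc 0)))) \<sigma> ?\<sigma>1"
      by (rule ex_Pop, rule ex_Case) (use less.prems 2 in \<open>auto intro!: ex_Pop ex_Push simp: fun_eq_iff\<close>)
    moreover have "ex [While 22 nonz ?body] (Suc 0) ?\<sigma>1 ?\<sigma>1" by (rule ex_While_False) simp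
    moreover have "nonz (top0 (\<sigma> 22))" using less.prems 2 by simp
    moreover have "?\<sigma>1 = \<sigma>(22 := [], 25 := [bsym (odd m)], 24 := ones (m div 2) @ \<sigma> 24)" using 2 by (auto simp: fun_eq_iff bsym_def)
    ultimately have "ex [While 22 nonz ?body] (Suc (Suc (Suc (Suc (Suc 0))) + Suc 0)) \<sigma> (\<sigma>(22 := [], 25 := [bsym (odd m)], 24 := ones (m div 2) @ \<sigma> 24))"
      using ex_While_True[where P = nonz and i = 22] by metis
    then show ?thesis by (rule ex_mono) (use 2 in simp)
  next
    case 3
    let ?\<sigma>1 = "\<sigma>(22 := ones j, 24 := 1 # \<sigma> 24)"
    have "ex ?body (Suc (Suc (Suc (Suc 0)))) \<sigma> ?\<sigma>1"
      by (rule ex_Pop, rule ex_Case) (use less.prems 3 in \<open>auto intro!: ex_Pop ex_Push simp: fun_eq_iff\<close>)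
    moreover have "ex [While 22 nonz ?body] (5 * j + 1) ?\<sigma>1 (?\<sigma>1(22 := [], 25 := [bsym (odd j)], 24 := ones (j div 2) @ ?\<sigma>1 24))"
      by (rule less.IH) (use 3 less.prems in auto)
    moreover have "nonz (top0 (\<sigma> 22))" using less.prems 3 by simp
    moreover have "?\<sigma>1(22 := [], 25 := [bsym (odd j)], 24 := ones (j div 2) @ ?\<sigma>1 24) = \<sigma>(22 := [], 25 := [bsym (odd m)], 24 := ones (m div 2) @ \<sigma> 24)"
      using 3 by (auto simp: fun_eq_iff replicate_app_Cons_same)
    ultimately have "ex [While 22 nonz ?body] (Suc (Suc (Suc (Suc (Suc 0))) + (5 * j + 1))) \<sigma> (\<sigma>(22 := [], 25 := [bsym (odd m)], 24 := ones (m div 2) @ \<sigma> 24))"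
      using ex_While_True[where P = nonz and i = 22] by metis
    then show ?thesis by (rule ex_mono) (use 3 in simp)
  qed
qed

lemma ex_halve:
  assumes "\<sigma> 22 = ones m" "\<sigma> 24 = []" "\<sigma> 25 = []" "m \<le> Z" "\<sigma>' = \<sigma>(22 := ones (m div 2), 23 := bsym (odd m) # \<sigma> 23)"
  shows "ex halve (9 * Z + 10) \<sigma> \<sigma>'"
proof -
  let ?\<sigma>1 = "\<sigma>(25 := [1])"
  let ?\<sigma>2 = "\<sigma>(22 := [], 25 := [bsym (odd m)], 24 := ones (m div 2))"
  let ?\<sigma>3 = "\<sigma>(22 := [], 24 := ones (m div 2), 23 := bsym (odd m) # \<sigma> 23)"
  have 2: "ex [While 22 nonz [Pop 22, Case 22 (\<lambda>s. if s = 0 then [Pop 25, Push 25 2] else [Pop 22, Push 24 1])]] (5 * m + 1) ?\<sigma>1 ?\<sigma>2"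
    using ex_halve_loop[of ?\<sigma>1 m] assms by (simp add: fun_upd_twist)
  have 3: "ex [Case 25 (\<lambda>p. [Push 23 p]), Pop 25] (Suc (Suc (Suc 0))) ?\<sigma>2 ?\<sigma>3"
    by (rule ex_Case) (use assms in \<open>auto intro!: ex_Pop ex_Push simp: fun_eq_iff\<close>)
  have 4: "ex (pour 24 22) (4 * Z + 1) ?\<sigma>3 \<sigma>'"
    by (rule ex_pourI) (use assms in \<open>auto simp: fun_eq_iff\<close>)
  have "ex halve (Suc (5 * m + 1 + (Suc (Suc (Suc 0)) + (4 * Z + 1)))) \<sigma> \<sigma>'"
    unfolding halve_def append_Cons append_Nil
    by (rule ex_Push) (use ex_append[OF 2 ex_append[OF 3 4]] assms in simp)
  then show ?thesis by (rule ex_mono) (use assms(4) in simp)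
qed

definition binprog :: "cmd list" where
  "binprog = [While 22 nonz halve]"

lemma ex_binprog:
  assumes "\<sigma> 22 = ones m" "\<sigma> 24 = []" "\<sigma> 25 = []" "m \<le> Z"
  shows "ex binprog (m * (9 * Z + 11) + 1) \<sigma> (\<sigma>(22 := [], 23 := rsym (binary m) @ \<sigma> 23))"
  using assms
proof (induction m arbitrary: \<sigma> rule: less_induct)
  case (less m)
  show ?case
  proof (cases "m = 0")
    case True
    then have eq: "\<sigma>(22 := [], 23 := rsym (binary m) @ \<sigma> 23) = \<sigma>" using less.prems by (auto simp: fun_eq_iff)
    show ?thesis unfolding eq binprog_def by (rule ex_mono[OF ex_While_False[where B = 0]]) (use less.prems True in auto)
  next
    case False
    let ?\<sigma>1 = "\<sigma>(22 := ones (m div 2), 23 := bsym (odd m) # \<sigma> 23)"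
    have "ex halve (9 * Z + 10) \<sigma> ?\<sigma>1" by (rule ex_halve) (use less.prems in auto)
    moreover have "ex [While 22 nonz halve] (m div 2 * (9 * Z + 11) + 1) ?\<sigma>1 (?\<sigma>1(22 := [], 23 := rsym (binary (m div 2)) @ ?\<sigma>1 23))"
      unfolding binprog_def[symmetric] by (rule less.IH) (use False less.prems in auto)
    moreover have "binary m = odd m # binary (m div 2)" using False by (subst binary.simps) simp
    then have "?\<sigma>1(22 := [], 23 := rsym (binary (m div 2)) @ ?\<sigma>1 23) = \<sigma>(22 := [], 23 := rsym (binary m) @ \<sigma> 23)"
      by (auto simp: fun_eq_iff)
    moreover have "nonz (top0 (\<sigma> 22))" using less.prems False by (cases m) auto
    ultimately have "ex [While 22 nonz halve] (Suc (9 * Z + 10 + (m div 2 * (9 * Z + 11) + 1))) \<sigma> (\<sigma>(22 := [], 23 := rsym (binary m) @ \<sigma> 23))"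
      using ex_While_True[where P = nonz and i = 22] by metis
    moreover have "Suc (m div 2) * (9 * Z + 11) \<le> m * (9 * Z + 11)" using False by (intro mult_right_mono) auto
    ultimately show ?thesis unfolding binprog_def by (elim ex_mono) simp
  qed
qed

text \<open>The width \<open>w + e\<close> of a field has a part depending on the input, counted in
  unary on stack 3, and a constant part that is unrolled.\<close>

definition movebits :: "nat \<Rightarrow> cmd list" where
  "movebits e = copy 3 23 5 @ [While 23 nonz [Pop 23, Case 11 (\<lambda>s. [Push 6 s]), Pop 11]] @
     concat (replicate e [Case 11 (\<lambda>s. [Push 6 s]), Pop 11])"

lemma ex_move1:
  assumes "\<sigma> 11 = a # xs" "a \<noteq> 0" "\<sigma>' = \<sigma>(11 := xs, 6 := a # \<sigma> 6)"
  shows "ex [Case 11 (\<lambda>s. [Push 6 s]), Pop 11] 3 \<sigma> \<sigma>'"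
  unfolding numeral_3_eq_3 by (rule ex_Case) (use assms in \<open>auto intro!: ex_Pop ex_Push simp: fun_eq_iff\<close>)

lemma ex_move_extra:
  assumes "\<sigma> 11 = xs" "e \<le> length xs" "0 \<notin> set xs"
  shows "ex (concat (replicate e [Case 11 (\<lambda>s. [Push 6 s]), Pop 11])) (3 * e) \<sigma> (\<sigma>(11 := drop e xs, 6 := rev (take e xs) @ \<sigma> 6))"
  using assms
proof (induction e arbitrary: \<sigma> xs)
  case 0
  then show ?case by (auto simp: fun_eq_iff)
next
  case (Suc e)
  then obtain a r where xs: "xs = a # r" "a \<noteq> 0" by (cases xs) auto
  let ?\<sigma>1 = "\<sigma>(11 := r, 6 := a # \<sigma> 6)"
  have 1: "ex [Case 11 (\<lambda>s. [Push 6 s]), Pop 11] 3 \<sigma> ?\<sigma>1" by (rule ex_move1) (use Suc.prems xs in auto)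
  have 2: "ex (concat (replicate e [Case 11 (\<lambda>s. [Push 6 s]), Pop 11])) (3 * e) ?\<sigma>1 (?\<sigma>1(11 := drop e r, 6 := rev (take e r) @ ?\<sigma>1 6))"
    by (rule Suc.IH) (use Suc.prems xs in auto)
  have eq: "?\<sigma>1(11 := drop e r, 6 := rev (take e r) @ ?\<sigma>1 6) = \<sigma>(11 := drop (Suc e) xs, 6 := rev (take (Suc e) xs) @ \<sigma> 6)"
    using xs by (auto simp: fun_eq_iff)
  show ?case using ex_append[OF 1 2] unfolding eq replicate_Suc concat.simps mult_Suc_right .
qed

lemma ex_movebits:
  assumes "\<sigma> 3 = ones w" "\<sigma> 23 = []" "\<sigma> 5 = []" "\<sigma> 6 = []" "\<sigma> 11 = xs" "w + e \<le> length xs" "0 \<notin> set xs" "w \<le> Z"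
    "\<sigma>' = \<sigma>(11 := drop (w + e) xs, 6 := rev (take (w + e) xs))"
  shows "ex (movebits e) (14 * Z + 3 + 3 * e) \<sigma> \<sigma>'"
proof -
  let ?\<sigma>1 = "\<sigma>(23 := ones w)"
  let ?s = "\<lambda>j. \<sigma>(23 := ones (w - j), 11 := drop j xs, 6 := rev (take j xs))"
  have 1: "ex (copy 3 23 5) (9 * Z + 2) \<sigma> ?\<sigma>1" by (rule ex_copyI) (use assms in auto)
  have "ex [While 23 nonz [Pop 23, Case 11 (\<lambda>s. [Push 6 s]), Pop 11]] (w * Suc 4 + 1) (?s 0) (?s w)"
  proof (rule ex_While_iter[where s = ?s])
    fix j assume j: "j < w"
    then have xj: "drop j xs = xs ! j # drop (Suc j) xs" "take (Suc j) xs = take j xs @ [xs ! j]" "xs ! j \<in> set xs"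
      using assms(6) by (auto simp: Cons_nth_drop_Suc take_Suc_conv_app_nth)
    then have "xs ! j \<noteq> 0" using assms(7) by metis
    note xj = this xj
    have o: "ones (w - j) = 1 # ones (w - Suc j)" using j by (metis Suc_diff_Suc replicate_Suc)
    have "ex [Pop 23, Case 11 (\<lambda>s. [Push 6 s]), Pop 11] (Suc 3) (?s j) (?s (Suc j))"
      by (rule ex_Pop, rule ex_move1[where a = "xs ! j" and xs = "drop (Suc j) xs"]) (use xj o in \<open>auto simp: fun_eq_iff\<close>)
    then show "nonz (top0 (?s j 23)) \<and> ex [Pop 23, Case 11 (\<lambda>s. [Push 6 s]), Pop 11] 4 (?s j) (?s (Suc j))"
      using o by simp
  qed simp
  moreover have "?s 0 = ?\<sigma>1" using assms by (auto simp: fun_eq_iff)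
  ultimately have 2: "ex [While 23 nonz [Pop 23, Case 11 (\<lambda>s. [Push 6 s]), Pop 11]] (w * Suc 4 + 1) ?\<sigma>1 (?s w)" by simp
  have 3: "ex (concat (replicate e [Case 11 (\<lambda>s. [Push 6 s]), Pop 11])) (3 * e) (?s w) ((?s w)(11 := drop e (drop w xs), 6 := rev (take e (drop w xs)) @ (?s w) 6))"
    by (rule ex_move_extra) (use assms in \<open>auto dest: in_set_dropD\<close>)
  have d: "drop e (drop w xs) = drop (w + e) xs" by (simp add: add.commute)
  have eqs: "(?s w)(11 := drop e (drop w xs), 6 := rev (take e (drop w xs)) @ (?s w) 6) = \<sigma>'"
    unfolding assms(9) using assms(2) d by (auto simp: fun_eq_iff take_add simp del: drop_drop)
  show ?thesis using ex_append[OF 1 ex_append[OF 2 3]]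
    unfolding eqs movebits_def by (elim ex_mono) (use assms(8) in simp)
qed

lemma wfp_movebits [simp]: "23 < K \<Longrightarrow> wfp K S (movebits e)"
  by (induction e) (auto simp: movebits_def)

section \<open>Writing the constraints\<close>

text \<open>\<open>Push 14 1\<close> puts an additional most significant \<open>False\<close> below
  the \<open>w\<close> bits of the time. The increment that produces \<open>t + 1\<close> therefore
  never overflows.\<close>

definition load :: "cmd list" where
  "load = Push 14 1 # movebits 0 @ pour 6 14 @ copy 14 15 5 @ inc 15 5 29 @
     movebits 3 @ pour 6 16 @ movebits 3 @ pour 6 17"

lemma bits_take_snoc: "length s = w \<Longrightarrow> bits (Suc w) (unbits s) = s @ [False]"
  using bits_Suc_snoc[OF unbits_less[of s]] bits_unbits[of s] by simp

lemma ex_load: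
  assumes "\<sigma> 3 = ones w" "\<sigma> 11 = map bsym \<beta>" "3 * w + 6 \<le> length \<beta>" "w + 3 \<le> Z"
    "\<sigma> 5 = []" "\<sigma> 6 = []" "\<sigma> 14 = []" "\<sigma> 15 = []" "\<sigma> 16 = []" "\<sigma> 17 = []" "\<sigma> 23 = []" "\<sigma> 29 = []"
    "t = unbits (take w \<beta>)"
    "\<sigma>' = \<sigma>(11 := map bsym (drop (3 * w + 6) \<beta>), 14 := map bsym (bits (Suc w) t), 15 := map bsym (bits (Suc w) (Suc t)),
      16 := map bsym (take (w + 3) (drop w \<beta>)), 17 := map bsym (take (w + 3) (drop (2 * w + 3) \<beta>)))"
  shows "ex load (70 * Z + 50) \<sigma> \<sigma>'"
proof -
  let ?T = "map bsym (bits (Suc w) t)" and ?n = "map bsym (take (w + 3) (drop w \<beta>))" and ?m = "map bsym (take (w + 3) (drop (2 * w + 3) \<beta>))"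
  have T: "?T = map bsym (take w \<beta>) @ [1]" using assms(3,13) by (simp add: bits_take_snoc bsym_def del: bits.simps)
  let ?d = "\<lambda>j. map bsym (drop j \<beta>)"
  let ?\<sigma>0 = "\<sigma>(14 := [1])"
  let ?\<sigma>1 = "?\<sigma>0(11 := ?d w, 6 := rev (map bsym (take w \<beta>)))"
  let ?\<sigma>2 = "\<sigma>(11 := ?d w, 14 := ?T)"
  let ?\<sigma>3 = "\<sigma>(11 := ?d w, 14 := ?T, 15 := ?T)"
  let ?\<sigma>4 = "\<sigma>(11 := ?d w, 14 := ?T, 15 := map bsym (bits (Suc w) (Suc t)))"
  let ?\<sigma>5 = "?\<sigma>4(11 := ?d (2 * w + 3), 6 := rev ?n)"
  let ?\<sigma>6 = "?\<sigma>4(11 := ?d (2 * w + 3), 16 := ?n)"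
  let ?\<sigma>7 = "?\<sigma>6(11 := ?d (3 * w + 6), 6 := rev ?m)"
  have t: "t < 2 ^ w" using unbits_less[of "take w \<beta>"] assms(3,13) by simp
  have 1: "ex (movebits 0) (14 * Z + 3 + 3 * 0) ?\<sigma>0 ?\<sigma>1"
    by (rule ex_movebits[where w = w and xs = "map bsym \<beta>"]) (use assms in \<open>auto simp: fun_eq_iff take_map drop_map\<close>)
  have 2: "ex (pour 6 14) (4 * Z + 1) ?\<sigma>1 ?\<sigma>2"
    unfolding T by (rule ex_pourI) (use assms in \<open>auto simp: fun_eq_iff\<close>)
  have 3: "ex (copy 14 15 5) (9 * Z + 2) ?\<sigma>2 ?\<sigma>3"
    by (rule ex_copyI) (use assms in \<open>auto simp: fun_eq_iff\<close>)
  have "False \<in> set (bits (Suc w) t)" using False_in_bits[of t "Suc w"] t by auto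
  then have 4: "ex (inc 15 5 29) (7 * Z + 10) ?\<sigma>3 ?\<sigma>4"
    by (intro ex_incI[of _ _ "bits (Suc w) t"]) (use assms in \<open>auto simp: fun_eq_iff incb_bits simp del: bits.simps\<close>)
  have 5: "ex (movebits 3) (14 * Z + 3 + 3 * 3) ?\<sigma>4 ?\<sigma>5"
    by (rule ex_movebits[where w = w and xs = "?d w"]) (use assms in \<open>auto simp: fun_eq_iff take_map drop_map algebra_simps simp del: bits.simps\<close>)
  have 6: "ex (pour 6 16) (4 * Z + 1) ?\<sigma>5 ?\<sigma>6"
    by (rule ex_pourI) (use assms in \<open>auto simp: fun_eq_iff\<close>)
  have 7: "ex (movebits 3) (14 * Z + 3 + 3 * 3) ?\<sigma>6 ?\<sigma>7"
    by (rule ex_movebits[where w = w and xs = "?d (2 * w + 3)"]) (use assms in \<open>auto simp: fun_eq_iff take_map drop_map algebra_simps simp del: bits.simps\<close>)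
  have 8: "ex (pour 6 17) (4 * Z + 1) ?\<sigma>7 \<sigma>'"
    by (rule ex_pourI) (use assms in \<open>auto simp: fun_eq_iff\<close>)
  from ex_append[OF 1 ex_append[OF 2 ex_append[OF 3 ex_append[OF 4 ex_append[OF 5 ex_append[OF 6 ex_append[OF 7 8]]]]]]]
  have "ex load (Suc (14 * Z + 3 + 3 * 0 + (4 * Z + 1 + (9 * Z + 2 + (7 * Z + 10 + (14 * Z + 3 + 3 * 3 + (4 * Z + 1 + (14 * Z + 3 + 3 * 3 + (4 * Z + 1))))))))) \<sigma> \<sigma>'"
    unfolding load_def by (intro ex_Push) (use assms(7) in simp)
  then show ?thesis by (rule ex_mono) simp
qed

text \<open>Counters only count upwards, so the loop runs on the complement of \<open>t\<close> in
  \<open>w + 1\<close> bits, which overflows after \<open>t + 1\<close> increments. Each round moves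
  one input symbol to stack 24 and keeps it on stack 20; the last one is at position
  \<open>t\<close>, and beyond the end stack 20 stays empty, which reads as 0.\<close>

definition lookup :: "cmd list" where
  "lookup = pour 14 5 @ consume 5 14 (\<lambda>a. [a]) 25 (\<lambda>a. [if a = 2 then 1 else 2]) @
     [Push 29 1, While 29 nonz ([Pop 20, Case 0 (\<lambda>s. [Push 20 s]), Case 0 (\<lambda>s. [Push 24 s]), Pop 0] @ inc 25 5 29)] @
     clear 25 @ pour 24 0"

lemma flip_bits: "i < 2 ^ n \<Longrightarrow> map Not (bits n i) = bits n (2 ^ n - 1 - i)"
proof (induction n arbitrary: i)
  case (Suc n)
  have *: "(2 * 2 ^ n - 1 - i) div 2 = 2 ^ n - 1 - i div 2" "odd (2 * 2 ^ n - 1 - i) = even i" using Suc.prems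
    by (cases "even i"; auto elim!: evenE oddE)+
  have "map Not (bits n (i div 2)) = bits n (2 ^ n - 1 - i div 2)" using Suc by auto
  then show ?case using * by simp
qed simp

lemma map_bsym_Not: "map bsym (map Not s) = map (\<lambda>a. if a = 2 then 1 else 2) (map bsym s)"
  by (induction s) (auto simp: bsym_def)

lemma ex_lookup:
  assumes "\<sigma> 14 = map bsym (bits (Suc w) t)" "t < 2 ^ w" "\<sigma> 0 = map bsym x" "2 ^ w \<le> Z"
    "\<sigma> 5 = []" "\<sigma> 20 = []" "\<sigma> 24 = []" "\<sigma> 25 = []" "\<sigma> 29 = []"
    "u = nth0 (map bsym x) t" "\<sigma>' = \<sigma>(20 := (if u = 0 then [] else [u]))"
  shows "ex lookup (Z * (7 * Z + 20) + 50 * Z + 50) \<sigma> \<sigma>'"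
proof -
  let ?T = "map bsym (bits (Suc w) t)" and ?xs = "map bsym x"
  define v where "v j = 2 ^ Suc w - 1 - t + j" for j
  have wZ: "w < Z" using assms(4) less_exp[of w] by linarith
  have top: "(case drop j ?xs of [] \<Rightarrow> [] | a # _ \<Rightarrow> [a]) = (if nth0 ?xs j = 0 then [] else [nth0 ?xs j])" for j
    by (cases "j < length x") (auto simp: nth0_def Cons_nth_drop_Suc[symmetric] simp del: Cons_nth_drop_Suc)
  let ?\<sigma>1 = "\<sigma>(14 := [], 5 := rev ?T)"
  let ?s = "\<lambda>j. \<sigma>(25 := map bsym (bits (Suc w) (v j)), 29 := (if j < Suc t then [1] else []),
     0 := drop j ?xs, 24 := rev (take j ?xs), 20 := (if j = 0 then [] else if nth0 ?xs (j - 1) = 0 then [] else [nth0 ?xs (j - 1)]))"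
  let ?\<sigma>2 = "\<sigma>(25 := map bsym (bits (Suc w) (v 0)))"
  have 1: "ex (pour 14 5) (4 * Suc Z + 1) \<sigma> ?\<sigma>1"
    by (rule ex_pourI) (use assms wZ in \<open>auto simp: fun_eq_iff simp del: bits.simps\<close>)
  have "ex (consume 5 14 (\<lambda>a. [a]) 25 (\<lambda>a. [if a = 2 then 1 else 2])) (length (rev ?T) * (2 + 3) + 1) ?\<sigma>1
    (?\<sigma>1(5 := [], 14 := rev (concat (map (\<lambda>a. [a]) (rev ?T))) @ ?\<sigma>1 14, 25 := rev (concat (map (\<lambda>a. [if a = 2 then 1 else 2]) (rev ?T))) @ ?\<sigma>1 25))"
    by (rule ex_consume) (auto simp del: bits.simps simp: bsym_def)
  moreover have "t < 2 ^ Suc w" using assms(2) by simp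
  from flip_bits[OF this] have "map bsym (bits (Suc w) (v 0)) = map (\<lambda>a. if a = 2 then 1 else 2) ?T"
    by (simp only: v_def add_0_right flip: map_bsym_Not)
  then have "?\<sigma>1(5 := [], 14 := rev (concat (map (\<lambda>a. [a]) (rev ?T))) @ ?\<sigma>1 14, 25 := rev (concat (map (\<lambda>a. [if a = 2 then 1 else 2]) (rev ?T))) @ ?\<sigma>1 25) = ?\<sigma>2"
    using assms(1,5,8) by (simp add: fun_eq_iff rev_map comp_def del: bits.simps)
  ultimately have 2: "ex (consume 5 14 (\<lambda>a. [a]) 25 (\<lambda>a. [if a = 2 then 1 else 2])) (length (rev ?T) * (2 + 3) + 1) ?\<sigma>1 ?\<sigma>2" by simp
  have "ex [While 29 nonz ([Pop 20, Case 0 (\<lambda>s. [Push 20 s]), Case 0 (\<lambda>s. [Push 24 s]), Pop 0] @ inc 25 5 29)]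
     (Suc t * Suc (7 * Suc Z + 18) + 1) (?s 0) (?s (Suc t))"
  proof (rule ex_While_iter[where s = ?s])
    fix j assume j: "j < Suc t"
    let ?a = "(?s j)(20 := (if nth0 ?xs j = 0 then [] else [nth0 ?xs j]), 24 := rev (take (Suc j) ?xs), 0 := drop (Suc j) ?xs)"
    have tp: "top0 (drop j ?xs) = nth0 ?xs j" by (rule top0_drop)
    have tk: "rev (take (Suc j) ?xs) = (if nth0 ?xs j = 0 then rev (take j ?xs) else nth0 ?xs j # rev (take j ?xs))"
      by (cases "j < length x") (auto simp: nth0_def take_Suc_conv_app_nth)
    have b: "ex [Pop 20, Case 0 (\<lambda>s. [Push 20 s]), Case 0 (\<lambda>s. [Push 24 s]), Pop 0] (Suc (Suc (Suc (Suc (Suc (Suc 0)))))) (?s j) ?a"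
      by (rule ex_Pop, rule ex_Case, unfold append_Cons append_Nil, rule ex_Push, rule ex_Case, unfold append_Cons append_Nil, rule ex_Push, rule ex_Pop)
        (simp add: tp tk fun_eq_iff tl_drop' nth0_0)
    have lt: "v j < 2 ^ Suc w" using j assms(2) by (simp add: v_def)
    have vS: "v (Suc j) = Suc (v j)" by (simp add: v_def)
    have F: "False \<in> set (bits (Suc w) (v j)) \<longleftrightarrow> Suc j < Suc t"
      unfolding False_in_bits[OF lt] using j assms(2) by (simp add: v_def) linarith
    have "ex (inc 25 5 29) (7 * Suc Z + 10) ?a (?s (Suc j))"
      by (rule ex_incI[of _ _ "bits (Suc w) (v j)"]) (use assms(5) wZ vS in \<open>auto simp: fun_eq_iff F incb_bits simp del: bits.simps\<close>)
    from ex_append[OF b this] have e: "ex ([Pop 20, Case 0 (\<lambda>s. [Push 20 s]), Case 0 (\<lambda>s. [Push 24 s]), Pop 0] @ inc 25 5 29) (7 * Suc Z + 18) (?s j) (?s (Suc j))"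
      by (rule ex_mono) simp
    show "nonz (top0 (?s j 29)) \<and> ex ([Pop 20, Case 0 (\<lambda>s. [Push 20 s]), Case 0 (\<lambda>s. [Push 24 s]), Pop 0] @ inc 25 5 29) (7 * Suc Z + 18) (?s j) (?s (Suc j))"
      by (rule conjI[OF _ e]) (use j in simp)
  qed simp
  moreover have "?s 0 = ?\<sigma>2(29 := (if 1 = (0::nat) then ?\<sigma>2 29 else 1 # ?\<sigma>2 29))" using assms by (simp add: fun_eq_iff)
  ultimately have 3: "ex ([Push 29 1, While 29 nonz ([Pop 20, Case 0 (\<lambda>s. [Push 20 s]), Case 0 (\<lambda>s. [Push 24 s]), Pop 0] @ inc 25 5 29)])
     (Suc (Suc t * Suc (7 * Suc Z + 18) + 1)) ?\<sigma>2 (?s (Suc t))"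
    by (intro ex_Push) simp
  let ?\<sigma>4 = "(?s (Suc t))(25 := [])"
  have 4: "ex (clear 25) (3 * Suc Z + 1) (?s (Suc t)) ?\<sigma>4"
    by (rule ex_clearI) (use wZ in \<open>auto simp del: bits.simps\<close>)
  have 5: "ex (pour 24 0) (4 * Z + 1) ?\<sigma>4 \<sigma>'"
    by (rule ex_pourI) (use assms in \<open>auto simp: fun_eq_iff dest: in_set_takeD\<close>)
  have tZ: "Suc t \<le> Z" using assms by simp
  then have "Suc t * Suc (7 * Suc Z + 18) \<le> Z * (7 * Z + 26)" by (intro mult_mono) auto
  then show ?thesis
    unfolding lookup_def
    by (intro ex_mono[OF ex_append[OF 1 ex_append[OF 2 ex_append[OF 3 ex_append[OF 4 5]]]]])
      (use wZ in \<open>simp add: algebra_simps\<close>)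
qed

text \<open>The schema number has constantly many bits and is read into the control state, with
  \<open>p\<close> the weight of the next bit; which clause to write is then known when the program
  is built.\<close>

fun rdb :: "nat \<Rightarrow> nat \<Rightarrow> nat \<Rightarrow> (nat \<Rightarrow> cmd list) \<Rightarrow> cmd list" where
  "rdb 0 p v f = f v"
| "rdb (Suc a) p v f = [Case 11 (\<lambda>s. Pop 11 # rdb a (2 * p) (if s = 2 then v + p else v) f)]"

lemma ex_rdb:
  assumes "\<sigma> 11 = map bsym (s @ r)" "length s = a" "ex (f (v + p * unbits s)) B (\<sigma>(11 := map bsym r)) \<sigma>'"
  shows "ex (rdb a p v f) (2 * a + B) \<sigma> \<sigma>'"
  using assms
proof (induction a arbitrary: \<sigma> s p v)
  case 0
  then have "\<sigma>(11 := map bsym r) = \<sigma>" by auto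
  then show ?case using 0 by simp
next
  case (Suc a)
  then obtain b s' where s: "s = b # s'" by (cases s) auto
  have "ex (rdb a (2 * p) (if bsym b = 2 then v + p else v) f) (2 * a + B) (\<sigma>(11 := map bsym (s' @ r))) \<sigma>'"
  proof (rule Suc.IH[of "\<sigma>(11 := map bsym (s' @ r))" s'])
    have e: "(if bsym b = 2 then v + p else v) + 2 * p * unbits s' = v + p * unbits s"
      by (simp add: s bsym_def algebra_simps)
    show "ex (f ((if bsym b = 2 then v + p else v) + 2 * p * unbits s')) B ((\<sigma>(11 := map bsym (s' @ r)))(11 := map bsym r)) \<sigma>'"
      unfolding e fun_upd_upd by (rule Suc.prems(3))
  qed (use Suc.prems(2) s in auto)
  then have "ex [Case 11 (\<lambda>s. Pop 11 # rdb a (2 * p) (if s = 2 then v + p else v) f)] (Suc (Suc (2 * a + B))) \<sigma> \<sigma>'"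
    by (intro ex_Case) (use Suc.prems s in \<open>auto intro!: ex_Pop\<close>)
  then show ?case by simp
qed

fun ref_prog :: "fref \<Rightarrow> cmd list" where
  "ref_prog (RZ a b) = pushes 21 [bsym b, bsym a] @ copy 18 21 5"
| "ref_prog (RT a b) = pushes 21 [bsym b, bsym a] @ copy 14 21 5"
| "ref_prog (RT1 a b) = pushes 21 [bsym b, bsym a] @ copy 15 21 5"
| "ref_prog (RL a b) = pushes 21 [bsym b, bsym a] @ copy 19 21 5"
| "ref_prog RN = copy 16 21 5"
| "ref_prog RM = copy 17 21 5"

definition regs :: "store \<Rightarrow> nat \<Rightarrow> nat \<Rightarrow> nat \<Rightarrow> bool list \<Rightarrow> bool list \<Rightarrow> nat \<Rightarrow> nat \<Rightarrow> bool" where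
  "regs \<sigma> Z w t n m k j \<longleftrightarrow> \<sigma> 14 = map bsym (bits (Suc w) t) \<and> \<sigma> 15 = map bsym (bits (Suc w) (Suc t)) \<and>
     \<sigma> 16 = map bsym n \<and> \<sigma> 17 = map bsym m \<and> \<sigma> 18 = map bsym (bits (Suc w) 0) \<and> \<sigma> 19 = map bsym (bits (Suc w) (2 ^ w)) \<and>
     \<sigma> 12 = ones j \<and> \<sigma> 13 = ones (k - 1 - j) \<and> \<sigma> 5 = [] \<and> length n \<le> Z \<and> length m \<le> Z \<and> Suc w \<le> Z \<and> k \<le> Z \<and> j < k"

lemma regs_upd: "i \<notin> {5, 12, 13, 14, 15, 16, 17, 18, 19} \<Longrightarrow> regs (\<sigma>(i := y)) Z w t n m k j = regs \<sigma> Z w t n m k j"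
  by (simp add: regs_def)

lemma ex_ref_prog:
  assumes "regs \<sigma> Z w t n m k j" "\<sigma>' = \<sigma>(21 := map bsym (ev w t n m r) @ \<sigma> 21)"
  shows "ex (ref_prog r) (9 * Z + 4) \<sigma> \<sigma>'"
proof -
  have p: "ex (pushes 21 [bsym b, bsym a]) 2 \<sigma> (\<sigma>(21 := bsym a # bsym b # \<sigma> 21))" for a b
    using ex_pushes[of "[bsym b, bsym a]" 2 21 \<sigma>] by simp
  have c: "ex (pushes 21 [bsym b, bsym a] @ copy i 21 5) (9 * Z + 4) \<sigma> (\<sigma>(21 := \<sigma> i @ bsym a # bsym b # \<sigma> 21))"
    if "\<sigma> i = map bsym s" "length s \<le> Z" "i \<notin> {5, 21}" for i s a b
    by (rule ex_mono[OF ex_append[OF p ex_copyI[where Z = Z]]]) (use that assms(1) in \<open>auto simp: regs_def\<close>)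
  have c': "ex (copy i 21 5) (9 * Z + 4) \<sigma> (\<sigma>(21 := \<sigma> i @ \<sigma> 21))" if "\<sigma> i = map bsym s" "length s \<le> Z" "i \<notin> {5, 21}" for i s
    by (rule ex_mono[OF ex_copyI[where Z = Z]]) (use that assms(1) in \<open>auto simp: regs_def\<close>)
  note r = assms(1)[unfolded regs_def]
  show ?thesis
  proof (cases r)
    case (RZ a b)
    have "ex (pushes 21 [bsym b, bsym a] @ copy 18 21 5) (9 * Z + 4) \<sigma> (\<sigma>(21 := \<sigma> 18 @ bsym a # bsym b # \<sigma> 21))"
      by (rule c[where s = "bits (Suc w) 0"]) (use r in simp_all)
    then show ?thesis using assms(2) RZ r by (simp add: fld_def del: bits.simps)
  next
    case (RT a b)
    have "ex (pushes 21 [bsym b, bsym a] @ copy 14 21 5) (9 * Z + 4) \<sigma> (\<sigma>(21 := \<sigma> 14 @ bsym a # bsym b # \<sigma> 21))"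
      by (rule c[where s = "bits (Suc w) t"]) (use r in simp_all)
    then show ?thesis using assms(2) RT r by (simp add: fld_def del: bits.simps)
  next
    case (RT1 a b)
    have "ex (pushes 21 [bsym b, bsym a] @ copy 15 21 5) (9 * Z + 4) \<sigma> (\<sigma>(21 := \<sigma> 15 @ bsym a # bsym b # \<sigma> 21))"
      by (rule c[where s = "bits (Suc w) (Suc t)"]) (use r in simp_all)
    then show ?thesis using assms(2) RT1 r by (simp add: fld_def del: bits.simps)
  next
    case (RL a b)
    have "ex (pushes 21 [bsym b, bsym a] @ copy 19 21 5) (9 * Z + 4) \<sigma> (\<sigma>(21 := \<sigma> 19 @ bsym a # bsym b # \<sigma> 21))"
      by (rule c[where s = "bits (Suc w) (2 ^ w)"]) (use r in simp_all)
    then show ?thesis using assms(2) RL r by (simp add: fld_def del: bits.simps)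
  next
    case RN
    have "ex (copy 16 21 5) (9 * Z + 4) \<sigma> (\<sigma>(21 := \<sigma> 16 @ \<sigma> 21))" by (rule c'[where s = n]) (use r in simp_all)
    then show ?thesis using assms(2) RN r by simp
  next
    case RM
    have "ex (copy 17 21 5) (9 * Z + 4) \<sigma> (\<sigma>(21 := \<sigma> 17 @ \<sigma> 21))" by (rule c'[where s = m]) (use r in simp_all)
    then show ?thesis using assms(2) RM r by simp
  qed
qed

text \<open>Besides the instance, the literals are queued on stack 8 for the final check.\<close>

definition lq :: "lit \<Rightarrow> nat list" where
  "lq l = (if fst l then 4 else 3) # rsym (snd l)"

text \<open>The name is assembled back to front. Its one-hot prefix comes directly from the unary
  stacks 12 and 13, with the mark 2, the code of \<open>True\<close>, between them.\<close>

definition lit_prog :: "nat \<Rightarrow> slit \<Rightarrow> cmd list" where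
  "lit_prog \<kappa> l = (case l of (g, c, r, r') \<Rightarrow>
     ref_prog r' @ ref_prog r @ pushes 21 (rsym (bits \<kappa> c)) @ copy 13 21 5 @ [Push 21 2] @ copy 12 21 5 @
     emit (enc_nat 0) @ emitn 21 (if g then [True] else [False, True]) @ pour 21 8 @ [Push 8 (if g then 4 else 3)])"

definition eedge :: "lit \<Rightarrow> bool list" where "eedge l = enc_edge (ledge l)"

lemma eedge: "eedge (g, s) = enc_nat 0 @ enc_bits (s @ (if g then [True] else [False, True]))"
  by (auto simp: eedge_def ledge_def enc_edge_def enc_nat_va enc_nat_vb)

lemma ex_lit_prog:
  assumes "regs \<sigma> Z w t n m k j" "\<sigma> 21 = []" "l = (g, c, r, r')"
    "L = (g, onehot k j @ lit_name \<kappa> c (ev w t n m r) (ev w t n m r'))" "length (snd L) \<le> Z"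
    "\<sigma>' = \<sigma>(7 := rsym (eedge L) @ \<sigma> 7, 8 := lq L @ \<sigma> 8)"
  shows "ex (lit_prog \<kappa> l) (51 * Z + 50) \<sigma> \<sigma>'"
proof -
  note rg = assms(1)[unfolded regs_def]
  let ?r = "map bsym (ev w t n m r)" and ?r' = "map bsym (ev w t n m r')" and ?c = "map bsym (bits \<kappa> c)"
  have oh: "map bsym (onehot k j) = ones j @ 2 # ones (k - 1 - j)" by (simp add: onehot_def bsym_def)
  let ?N = "onehot k j @ lit_name \<kappa> c (ev w t n m r) (ev w t n m r')"
  have N: "map bsym ?N = ones j @ 2 # ones (k - 1 - j) @ ?c @ ?r @ ?r'" by (simp add: oh lit_name_def)
  have 1: "ex (ref_prog r') (9 * Z + 4) \<sigma> (\<sigma>(21 := ?r'))"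
    by (rule ex_ref_prog) (use assms in auto)
  have 2: "ex (ref_prog r) (9 * Z + 4) (\<sigma>(21 := ?r')) (\<sigma>(21 := ?r @ ?r'))"
    by (rule ex_ref_prog[where Z = Z]) (use assms(1) in \<open>auto simp: regs_upd\<close>)
  have \<kappa>: "\<kappa> \<le> Z" using assms(4,5) by (simp add: lit_name_def)
  have 3: "ex (pushes 21 (rsym (bits \<kappa> c))) Z (\<sigma>(21 := ?r @ ?r')) (\<sigma>(21 := ?c @ ?r @ ?r'))"
    using ex_pushes[of "rsym (bits \<kappa> c)" Z 21 "\<sigma>(21 := ?r @ ?r')"] \<kappa> by simp
  have 4: "ex (copy 13 21 5) (9 * Z + 2) (\<sigma>(21 := ?c @ ?r @ ?r')) (\<sigma>(21 := ones (k - 1 - j) @ ?c @ ?r @ ?r'))"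
    by (rule ex_copyI) (use rg in auto)
  have 5: "ex [Push 21 2] (Suc 0) (\<sigma>(21 := ones (k - 1 - j) @ ?c @ ?r @ ?r')) (\<sigma>(21 := 2 # ones (k - 1 - j) @ ?c @ ?r @ ?r'))"
    by (rule ex_Push) simp
  have 6: "ex (copy 12 21 5) (9 * Z + 2) (\<sigma>(21 := 2 # ones (k - 1 - j) @ ?c @ ?r @ ?r')) (\<sigma>(21 := map bsym ?N))"
    unfolding N by (rule ex_copyI) (use rg in auto)
  have 7: "ex (emit (enc_nat 0)) (length (enc_nat 0)) (\<sigma>(21 := map bsym ?N)) (\<sigma>(21 := map bsym ?N, 7 := rsym (enc_nat 0) @ \<sigma> 7))"
    by (rule ex_emitI) simp
  have 8: "ex (emitn 21 (if g then [True] else [False, True])) (10 * Z + 10) (\<sigma>(21 := map bsym ?N, 7 := rsym (enc_nat 0) @ \<sigma> 7))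
     (\<sigma>(21 := map bsym ?N, 7 := rsym (eedge L) @ \<sigma> 7))"
    by (rule ex_emitnI[where s = ?N]) (use rg assms(4,5) in \<open>auto simp: eedge\<close>)
  have 9: "ex (pour 21 8) (4 * Z + 1) (\<sigma>(21 := map bsym ?N, 7 := rsym (eedge L) @ \<sigma> 7)) (\<sigma>(7 := rsym (eedge L) @ \<sigma> 7, 8 := rsym ?N @ \<sigma> 8))"
    by (rule ex_pourI) (use assms(2,4,5) in \<open>auto simp: fun_eq_iff\<close>)
  have 10: "ex [Push 8 (if g then 4 else 3)] (Suc 0) (\<sigma>(7 := rsym (eedge L) @ \<sigma> 7, 8 := rsym ?N @ \<sigma> 8)) \<sigma>'"
    by (rule ex_Push) (use assms(4,6) in \<open>auto simp: fun_eq_iff lq_def\<close>)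
  show ?thesis
    unfolding lit_prog_def assms(3) prod.case
    by (rule ex_mono[OF ex_append[OF 1 ex_append[OF 2 ex_append[OF 3 ex_append[OF 4 ex_append[OF 5 ex_append[OF 6 ex_append[OF 7 ex_append[OF 8 ex_append[OF 9 10]]]]]]]]]])
      (simp add: enc_nat_0)
qed

text \<open>A clause of length r adds r - 1 to the surplus, so \<open>k\<close> clauses sum up to
  \<open>length ls - k\<close>, the degree bound.\<close>

definition clause_prog :: "nat \<Rightarrow> slit list \<Rightarrow> cmd list" where
  "clause_prog \<kappa> sch = concat (map (lit_prog \<kappa>) sch) @ pushes 22 (ones (length sch - 1))"

lemma ex_lits:
  assumes "regs \<sigma> Z w t n m k j" "\<sigma> 21 = []" "ls = copy_lits k j (inst \<kappa> w t n m sch)" "\<forall>l\<in>set ls. length (snd l) \<le> Z"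
  shows "ex (concat (map (lit_prog \<kappa>) sch)) (length sch * (51 * Z + 50)) \<sigma>
    (\<sigma>(7 := rsym (concat (map eedge ls)) @ \<sigma> 7, 8 := concat (map lq (rev ls)) @ \<sigma> 8))"
  using assms
proof (induction sch arbitrary: \<sigma> ls)
  case Nil
  then show ?case by (simp add: inst_def copy_lits_def)
next
  case (Cons l sch)
  obtain g c r r' where l: "l = (g, c, r, r')" by (cases l)
  define L where "L = (g, onehot k j @ lit_name \<kappa> c (ev w t n m r) (ev w t n m r'))"
  define ls' where "ls' = copy_lits k j (inst \<kappa> w t n m sch)"
  have ls: "ls = L # ls'" using Cons.prems(3) l by (simp add: L_def ls'_def inst_def copy_lits_def)
  let ?\<sigma>1 = "\<sigma>(7 := rsym (eedge L) @ \<sigma> 7, 8 := lq L @ \<sigma> 8)"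
  let ?\<sigma>2 = "?\<sigma>1(7 := rsym (concat (map eedge ls')) @ ?\<sigma>1 7, 8 := concat (map lq (rev ls')) @ ?\<sigma>1 8)"
  have 1: "ex (lit_prog \<kappa> l) (51 * Z + 50) \<sigma> ?\<sigma>1"
    by (rule ex_lit_prog[OF Cons.prems(1,2) l L_def]) (use Cons.prems(4) ls in auto)
  have 2: "ex (concat (map (lit_prog \<kappa>) sch)) (length sch * (51 * Z + 50)) ?\<sigma>1 ?\<sigma>2"
  proof (rule Cons.IH[of ?\<sigma>1, OF _ _ ls'_def])
    show "\<forall>l\<in>set ls'. length (snd l) \<le> Z" using Cons.prems(4) unfolding ls by simp
    show "regs ?\<sigma>1 Z w t n m k j" using Cons.prems(1) by (simp add: regs_upd)
    show "?\<sigma>1 21 = []" using Cons.prems(2) by simp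
  qed
  have eq: "?\<sigma>2 = \<sigma>(7 := rsym (concat (map eedge ls)) @ \<sigma> 7, 8 := concat (map lq (rev ls)) @ \<sigma> 8)"
    unfolding ls by (simp add: fun_eq_iff)
  show "ex (concat (map (lit_prog \<kappa>) (l # sch))) (length (l # sch) * (51 * Z + 50)) \<sigma>
      (\<sigma>(7 := rsym (concat (map eedge ls)) @ \<sigma> 7, 8 := concat (map lq (rev ls)) @ \<sigma> 8))"
    using ex_append[OF 1 2] unfolding eq by simp
qed

lemma ex_clause_prog:
  assumes "regs \<sigma> Z w t n m k j" "\<sigma> 21 = []" "ls = copy_lits k j (inst \<kappa> w t n m sch)" "\<forall>l\<in>set ls. length (snd l) \<le> Z" "length sch \<le> 5"
    "\<sigma>' = \<sigma>(7 := rsym (concat (map eedge ls)) @ \<sigma> 7, 8 := concat (map lq (rev ls)) @ \<sigma> 8, 22 := ones (length ls - 1) @ \<sigma> 22)"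
  shows "ex (clause_prog \<kappa> sch) (255 * Z + 255) \<sigma> \<sigma>'"
proof -
  let ?\<sigma>1 = "\<sigma>(7 := rsym (concat (map eedge ls)) @ \<sigma> 7, 8 := concat (map lq (rev ls)) @ \<sigma> 8)"
  have "length ls = length sch" using assms(3) by (simp add: copy_lits_def inst_def)
  then have 2: "ex (pushes 22 (ones (length sch - 1))) 5 ?\<sigma>1 \<sigma>'"
    using ex_pushes[of "ones (length sch - 1)" 5 22 ?\<sigma>1] assms(5,6) by simp
  have "length sch * (51 * Z + 50) \<le> 5 * (51 * Z + 50)" using assms(5) by (intro mult_right_mono) auto
  then show ?thesis unfolding clause_prog_def
    by (intro ex_mono[OF ex_append[OF ex_lits[OF assms(1-4)] 2]]) simp
qed

text \<open>A selector may exceed the number of schemas; falling back to the first schema makes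
  every address name a clause and only repeats clauses.\<close>

definition sel :: "'a list \<Rightarrow> nat \<Rightarrow> 'a" where
  "sel xs v = (if v < length xs then xs ! v else xs ! 0)"

lemma sel_in: "xs \<noteq> [] \<Longrightarrow> sel xs v \<in> set xs"
  by (auto simp: sel_def)

text \<open>A clause is addressed by a bit string listing a time, two nodes and the number of a schema.\<close>

definition block_cl :: "(nat \<Rightarrow> slit list list) \<Rightarrow> nat \<Rightarrow> nat \<Rightarrow> bool list \<Rightarrow> bool list \<Rightarrow> lit list" where
  "block_cl schs \<kappa> w x \<beta> = (let t = unbits (take w \<beta>) in
     inst \<kappa> w t (take (w + 3) (drop w \<beta>)) (take (w + 3) (drop (2 * w + 3) \<beta>))
       (sel (schs (nth0 (map bsym x) t)) (unbits (drop (3 * w + 6) \<beta>))))"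

definition block_prog :: "(nat \<Rightarrow> slit list list) \<Rightarrow> nat \<Rightarrow> nat \<Rightarrow> cmd list" where
  "block_prog schs \<kappa> a = load @ lookup @ rdb a 1 0 (\<lambda>v. [Case 20 (\<lambda>u. clause_prog \<kappa> (sel (schs u) v))]) @
     clear 14 @ clear 15 @ clear 16 @ clear 17 @ clear 20"

definition blk_pre :: "store \<Rightarrow> nat \<Rightarrow> bool list \<Rightarrow> bool" where
  "blk_pre \<sigma> w x \<longleftrightarrow> \<sigma> 0 = map bsym x \<and> \<sigma> 3 = ones w \<and> \<sigma> 18 = map bsym (bits (Suc w) 0) \<and> \<sigma> 19 = map bsym (bits (Suc w) (2 ^ w)) \<and>
     (\<forall>i\<in>{5, 6, 14, 15, 16, 17, 20, 21, 23, 24, 25, 29}. \<sigma> i = [])"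

lemma ex_block_prog:
  assumes pre: "blk_pre \<sigma> w x" and \<beta>: "\<sigma> 11 = map bsym (\<beta> @ rest)" "length \<beta> = 3 * w + 6 + a"
    and j: "\<sigma> 12 = ones j" "\<sigma> 13 = ones (k - 1 - j)" "j < k"
    and Z: "2 ^ w + 3 \<le> Z" "a \<le> Z" "k + \<kappa> + 2 * (w + 3) \<le> Z"
    and schs: "\<And>u v. length (sel (schs u) v) \<le> 5"
    and ls: "ls = copy_lits k j (block_cl schs \<kappa> w x \<beta>)"
    and \<sigma>': "\<sigma>' = \<sigma>(11 := map bsym rest, 7 := rsym (concat (map eedge ls)) @ \<sigma> 7, 8 := concat (map lq (rev ls)) @ \<sigma> 8, 22 := ones (length ls - 1) @ \<sigma> 22)"
  shows "ex (block_prog schs \<kappa> a) (Z * (7 * Z + 20) + 400 * Z + 400) \<sigma> \<sigma>'"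
proof -
  define t where "t = unbits (take w \<beta>)"
  define n where "n = take (w + 3) (drop w \<beta>)"
  define m where "m = take (w + 3) (drop (2 * w + 3) \<beta>)"
  define v where "v = unbits (drop (3 * w + 6) \<beta>)"
  define u where "u = nth0 (map bsym x) t"
  have wZ: "w + 3 \<le> Z" using Z(1) less_exp[of w] by linarith
  have t: "t < 2 ^ w" using unbits_less[of "take w \<beta>"] \<beta>(2) by (simp add: t_def)
  have nm: "length n = w + 3" "length m = w + 3" using \<beta>(2) by (auto simp: n_def m_def)
  note p = pre[unfolded blk_pre_def]
  let ?\<sigma>1 = "\<sigma>(11 := map bsym (drop (3 * w + 6) \<beta> @ rest), 14 := map bsym (bits (Suc w) t), 15 := map bsym (bits (Suc w) (Suc t)),
      16 := map bsym n, 17 := map bsym m)"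
  let ?\<sigma>2 = "?\<sigma>1(20 := (if u = 0 then [] else [u]))"
  let ?\<sigma>2b = "?\<sigma>2(11 := map bsym rest)"
  let ?\<sigma>3 = "?\<sigma>2b(7 := rsym (concat (map eedge ls)) @ ?\<sigma>2b 7, 8 := concat (map lq (rev ls)) @ ?\<sigma>2b 8, 22 := ones (length ls - 1) @ ?\<sigma>2b 22)"
  have 1: "ex load (70 * Z + 50) \<sigma> ?\<sigma>1"
    by (rule ex_load[where \<beta> = "\<beta> @ rest" and w = w and t = t]) (use p \<beta> wZ in \<open>auto simp: t_def n_def m_def simp del: bits.simps\<close>)
  have 2: "ex lookup (Z * (7 * Z + 20) + 50 * Z + 50) ?\<sigma>1 ?\<sigma>2"
    by (rule ex_lookup[where w = w and t = t and x = x and u = u]) (use p t Z(1) in \<open>auto simp: u_def simp del: bits.simps\<close>)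
  have ls': "ls = copy_lits k j (inst \<kappa> w t n m (sel (schs u) v))"
    by (simp add: ls block_cl_def Let_def t_def n_def m_def u_def v_def)
  have evl: "length (ev w t n m r) = w + 3" for r by (cases r) (auto simp: nm)
  have lenl: "\<forall>l\<in>set ls. length (snd l) \<le> Z"
    using Z(3) j(3) evl unfolding ls' copy_lits_def inst_def lit_name_def by (auto simp: algebra_simps)
  have "regs ?\<sigma>2b Z w t n m k j" using p j nm wZ Z by (auto simp: regs_def simp del: bits.simps)
  then have c: "ex (clause_prog \<kappa> (sel (schs u) v)) (255 * Z + 255) ?\<sigma>2b ?\<sigma>3"
    by (rule ex_clause_prog[OF _ _ ls' lenl schs]) (use p in auto)
  have tu: "top0 (?\<sigma>2b 20) = u" by simp
  have "ex [Case 20 (\<lambda>u. clause_prog \<kappa> (sel (schs u) v))] (Suc (255 * Z + 255)) ?\<sigma>2b ?\<sigma>3"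
    by (rule ex_Case, unfold tu append_Nil2, rule c)
  then have 3: "ex (rdb a 1 0 (\<lambda>v. [Case 20 (\<lambda>u. clause_prog \<kappa> (sel (schs u) v))])) (2 * a + Suc (255 * Z + 255)) ?\<sigma>2 ?\<sigma>3"
    by (intro ex_rdb[where s = "drop (3 * w + 6) \<beta>" and r = rest]) (use \<beta>(2) in \<open>auto simp: v_def simp del: bits.simps\<close>)
  have u2: "u = 0 \<or> u = 1 \<or> u = 2" by (auto simp: u_def nth0_def bsym_def)
  have 4: "ex (clear 14 @ clear 15 @ clear 16 @ clear 17 @ clear 20) (3 * Z + 1 + (3 * Z + 1 + (3 * Z + 1 + (3 * Z + 1 + (3 * Z + 1))))) ?\<sigma>3 \<sigma>'"
    by (rule ex_append[OF ex_clearI[OF _ _ _ refl] ex_append[OF ex_clearI[OF _ _ _ refl] ex_append[OF ex_clearI[OF _ _ _ refl] ex_append[OF ex_clearI[OF _ _ _ refl] ex_clearI]]]])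
      (use p wZ nm u2 in \<open>auto simp: \<sigma>' fun_eq_iff simp del: bits.simps\<close>)
  show ?thesis unfolding block_prog_def
    by (rule ex_mono[OF ex_append[OF 1 ex_append[OF 2 ex_append[OF 3 4]]]]) (use Z(2) in simp)
qed

definition chunks :: "nat \<Rightarrow> nat \<Rightarrow> bool list \<Rightarrow> bool list list" where
  "chunks L k \<tau> = map (\<lambda>j. take L (drop (j * L) \<tau>)) [0..<k]"

text \<open>The end mark 5 is pushed before the literals and hence lies below them: it is met when
  the tuple has been processed.\<close>

definition seg :: "lit list \<Rightarrow> nat list" where
  "seg ls = concat (map lq (rev ls)) @ [5]"

definition con_enc :: "nat \<Rightarrow> lit list \<Rightarrow> bool list" where
  "con_enc k ls = enc_list enc_edge (map ledge ls) @ enc_nat (length ls - k)"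

text \<open>The four bits emitted after the loop close the edge list and open the number that
  follows it, the degree bound.\<close>

definition tuple_prog :: "(nat \<Rightarrow> slit list list) \<Rightarrow> nat \<Rightarrow> nat \<Rightarrow> cmd list" where
  "tuple_prog schs \<kappa> a = [Push 8 5] @ emit [True, False] @ copy 9 11 5 @ copy 4 13 5 @
     [While 13 nonz (Pop 13 # block_prog schs \<kappa> a @ [Push 12 1])] @ clear 12 @ emit [True, True, True, False] @
     binprog @ pour 23 5 @ conv 5 7 (\<lambda>a. [1, a]) @ emit [True, True]"

lemma length_binary_le_self: "length (binary m) \<le> m"
proof (induction m rule: less_induct)
  case (less m)
  show ?case
  proof (cases "m = 0")
    case False
    then have "length (binary m) = Suc (length (binary (m div 2)))" by (subst binary.simps) simp
    also have "\<dots> \<le> Suc (m div 2)" using less False by simp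
    also have "\<dots> \<le> m" using False by simp
    finally show ?thesis .
  qed simp
qed

lemma ex_tuple_prog:
  assumes pre: "blk_pre \<sigma> w x" "\<sigma> 4 = ones k" "\<sigma> 11 = []" "\<sigma> 12 = []" "\<sigma> 13 = []" "\<sigma> 22 = []"
    and \<tau>: "\<sigma> 9 = map bsym \<tau>" "length \<tau> = L * k" "L = 3 * w + 6 + a" "L * k \<le> Z"
    and Z: "2 ^ w + 3 \<le> Z" "a \<le> Z" "k + \<kappa> + 2 * (w + 3) \<le> Z"
    and schs: "\<And>u v. length (sel (schs u) v) \<le> 5" "\<And>u v. sel (schs u) v \<noteq> []"
    and ls: "ls = tuple_lits k (block_cl schs \<kappa> w x) (chunks L k \<tau>)"
    and \<sigma>': "\<sigma>' = \<sigma>(7 := rsym (con_enc k ls) @ \<sigma> 7, 8 := seg ls @ \<sigma> 8)"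
  shows "ex (tuple_prog schs \<kappa> a) (Z * (Z * (7 * Z + 20) + 400 * Z + 403) + 5 * Z * (45 * Z + 11) + 200 * Z + 200) \<sigma> \<sigma>'"
proof -
  \<comment> \<open>\<open>pl j\<close> collects the literals of the first \<open>j\<close> blocks.
    Subtracting \<open>j\<close> from its length gives the surplus on stack 22; the subtraction is
    exact because clauses are nonempty.\<close>
  define pl where "pl j = concat (map (\<lambda>i. copy_lits k i (block_cl schs \<kappa> w x (chunks L k \<tau> ! i))) [0..<j])" for j
  define cl where "cl j = copy_lits k j (block_cl schs \<kappa> w x (chunks L k \<tau> ! j))" for j
  have pS: "pl (Suc j) = pl j @ cl j" for j by (simp add: pl_def cl_def)
  have cl1: "1 \<le> length (cl j)" "length (cl j) \<le> 5" for j
    using schs by (auto simp: cl_def copy_lits_def block_cl_def inst_def Let_def Suc_le_eq)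
  have pj: "j \<le> length (pl j) \<and> length (pl j) \<le> 5 * j" for j
  proof (induction j)
    case (Suc j)
    then show ?case using cl1[of j] by (simp add: pS)
  qed (simp add: pl_def)
  have kZ: "k \<le> Z" using Z(3) by simp
  let ?\<sigma>0 = "\<sigma>(8 := 5 # \<sigma> 8)"
  let ?\<sigma>1 = "?\<sigma>0(7 := rsym [True, False] @ \<sigma> 7)"
  let ?\<sigma>2 = "?\<sigma>1(11 := map bsym \<tau>)"
  let ?s = "\<lambda>j. ?\<sigma>1(13 := ones (k - j), 12 := ones j, 11 := map bsym (drop (j * L) \<tau>),
     7 := rsym (concat (map eedge (pl j))) @ ?\<sigma>1 7, 8 := concat (map lq (rev (pl j))) @ ?\<sigma>1 8, 22 := ones (length (pl j) - j))"
  have 0: "ex [Push 8 5] (Suc 0) \<sigma> ?\<sigma>0" by (rule ex_Push) simp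
  have 1: "ex (emit [True, False]) (length [True, False]) ?\<sigma>0 ?\<sigma>1" by (rule ex_emitI) simp
  have 2: "ex (copy 9 11 5) (9 * Z + 2) ?\<sigma>1 ?\<sigma>2" by (rule ex_copyI) (use pre \<tau> in \<open>auto simp: blk_pre_def\<close>)
  have s0: "?s 0 = ?\<sigma>2(13 := ones k)" using pre by (auto simp: fun_eq_iff pl_def)
  have 3: "ex (copy 4 13 5) (9 * Z + 2) ?\<sigma>2 (?s 0)" unfolding s0 by (rule ex_copyI) (use pre kZ in \<open>auto simp: blk_pre_def\<close>)
  have 4: "ex [While 13 nonz (Pop 13 # block_prog schs \<kappa> a @ [Push 12 1])] (k * Suc (Z * (7 * Z + 20) + 400 * Z + 402) + 1) (?s 0) (?s k)"
  proof (rule ex_While_iter[where s = ?s])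
    fix j assume j: "j < k"
    let ?a = "(?s j)(13 := ones (k - 1 - j))"
    let ?b = "?a(11 := map bsym (drop (Suc j * L) \<tau>), 7 := rsym (concat (map eedge (cl j))) @ ?a 7, 8 := concat (map lq (rev (cl j))) @ ?a 8, 22 := ones (length (cl j) - 1) @ ?a 22)"
    have ch: "chunks L k \<tau> ! j = take L (drop (j * L) \<tau>)" using j by (simp add: chunks_def)
    have "Suc j * L \<le> k * L" using j by (intro mult_right_mono) auto
    then have le: "j * L + L \<le> length \<tau>" using \<tau>(2) by (simp add: mult.commute)
    then have chl: "length (chunks L k \<tau> ! j) = L" unfolding ch by simp
    have dr: "drop (j * L) \<tau> = chunks L k \<tau> ! j @ drop (Suc j * L) \<tau>" unfolding ch
      by (metis append_take_drop_id drop_drop mult_Suc)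
    have "ex (block_prog schs \<kappa> a) (Z * (7 * Z + 20) + 400 * Z + 400) ?a ?b"
      by (rule ex_block_prog[where \<beta> = "chunks L k \<tau> ! j" and w = w and x = x and j = j and k = k and \<kappa> = \<kappa>, OF _ _ _ _ _ j Z schs(1) cl_def])
        (use pre \<tau>(3) dr chl in \<open>auto simp: blk_pre_def simp del: bits.simps\<close>)
    moreover have "ex [Push 12 1] (Suc 0) ?b (?s (Suc j))"
      by (rule ex_Push) (use j pj[of j] cl1[of j] in \<open>auto simp: fun_eq_iff pS replicate_add[symmetric]\<close>)
    ultimately have bp: "ex (block_prog schs \<kappa> a @ [Push 12 1]) (Z * (7 * Z + 20) + 400 * Z + 400 + Suc 0) ?a (?s (Suc j))"
      by (rule ex_append)
    have on: "ones (k - j) = 1 # ones (k - 1 - j)" using j by (metis Suc_diff_Suc diff_Suc_eq_diff_pred replicate_Suc)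
    then have p: "(?s j)(13 := tl ((?s j) 13)) = ?a" by (simp add: fun_eq_iff)
    have "ex (Pop 13 # block_prog schs \<kappa> a @ [Push 12 1]) (Suc (Z * (7 * Z + 20) + 400 * Z + 400 + Suc 0)) (?s j) (?s (Suc j))"
      by (rule ex_Pop, unfold p, rule bp)
    then have "ex (Pop 13 # block_prog schs \<kappa> a @ [Push 12 1]) (Z * (7 * Z + 20) + 400 * Z + 402) (?s j) (?s (Suc j))"
      by (rule ex_mono) simp
    then show "nonz (top0 (?s j 13)) \<and> ex (Pop 13 # block_prog schs \<kappa> a @ [Push 12 1]) (Z * (7 * Z + 20) + 400 * Z + 402) (?s j) (?s (Suc j))"
      using on by simp
  qed simp
  have ls_pl: "ls = pl k" unfolding ls tuple_lits_def pl_def by simp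
  define b where "b = length ls - k"
  have bZ: "b \<le> 5 * Z" using pj[of k] kZ unfolding b_def ls_pl by linarith
  let ?\<sigma>5 = "?\<sigma>1(7 := rsym (concat (map eedge ls)) @ ?\<sigma>1 7, 8 := concat (map lq (rev ls)) @ ?\<sigma>1 8, 22 := ones b)"
  have 5: "ex (clear 12) (3 * Z + 1) (?s k) ?\<sigma>5"
    by (rule ex_clearI) (use kZ pre \<tau>(2) in \<open>auto simp: fun_eq_iff ls_pl b_def mult.commute\<close>)
  let ?\<sigma>6 = "?\<sigma>5(7 := rsym [True, True, True, False] @ ?\<sigma>5 7)"
  have 6: "ex (emit [True, True, True, False]) (length [True, True, True, False]) ?\<sigma>5 ?\<sigma>6" by (rule ex_emitI) simp
  let ?\<sigma>7 = "?\<sigma>6(22 := [], 23 := rsym (binary b) @ ?\<sigma>6 23)"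
  have 7: "ex binprog (b * (9 * (5 * Z) + 11) + 1) ?\<sigma>6 ?\<sigma>7"
    by (rule ex_binprog) (use pre bZ in \<open>auto simp: blk_pre_def\<close>)
  let ?\<sigma>8 = "?\<sigma>6(22 := [], 5 := map bsym (binary b))"
  have 8: "ex (pour 23 5) (4 * (5 * Z) + 1) ?\<sigma>7 ?\<sigma>8"
    by (rule ex_pourI) (use pre bZ length_binary_le_self[of b] in \<open>auto simp: blk_pre_def fun_eq_iff\<close>)
  have "ex (conv 5 7 (\<lambda>a. [1, a])) (length (map bsym (binary b)) * (2 + 3) + 1) ?\<sigma>8 (?\<sigma>8(5 := [], 7 := rev (concat (map (\<lambda>a. [1, a]) (map bsym (binary b)))) @ ?\<sigma>8 7))"
    by (rule ex_conv) auto
  moreover have "rev (concat (map (\<lambda>a. [1, a]) (map bsym s))) = rsym (concat (map (\<lambda>b. [False, b]) s))" for s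
    by (induction s) (auto simp: bsym_def)
  then have "?\<sigma>8(5 := [], 7 := rev (concat (map (\<lambda>a. [1, a]) (map bsym (binary b)))) @ ?\<sigma>8 7) = ?\<sigma>6(22 := [], 7 := rsym (concat (map (\<lambda>b. [False, b]) (binary b))) @ ?\<sigma>6 7)"
    using pre by (simp add: fun_eq_iff blk_pre_def)
  ultimately have 9: "ex (conv 5 7 (\<lambda>a. [1, a])) (length (map bsym (binary b)) * (2 + 3) + 1) ?\<sigma>8 (?\<sigma>6(22 := [], 7 := rsym (concat (map (\<lambda>b. [False, b]) (binary b))) @ ?\<sigma>6 7))" by simp
  have 10: "ex (emit [True, True]) (length [True, True]) (?\<sigma>6(22 := [], 7 := rsym (concat (map (\<lambda>b. [False, b]) (binary b))) @ ?\<sigma>6 7)) \<sigma>'"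
    by (rule ex_emitI)
      (use pre in \<open>auto simp: fun_eq_iff \<sigma>' con_enc_def enc_list_def enc_nat_def enc_bits_def seg_def b_def eedge_def[abs_def] comp_def\<close>)
  have A: "k * Suc (Z * (7 * Z + 20) + 400 * Z + 402) \<le> Z * (Z * (7 * Z + 20) + 400 * Z + 403)" using kZ by (intro mult_mono) auto
  have B: "b * (9 * (5 * Z) + 11) \<le> 5 * Z * (45 * Z + 11)" using mult_right_mono[OF bZ, of "9 * (5 * Z) + 11"] by simp
  have C: "length (map bsym (binary b)) * (2 + 3) \<le> 25 * Z" using length_binary_le_self[of b] bZ by simp
  have sum: "p + q + C' \<le> P + Q + R" if "p \<le> P" "q \<le> Q" "C' \<le> R" for p q C' P Q R :: nat using that by simp
  show ?thesis unfolding tuple_prog_def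
    by (rule ex_mono[OF ex_append[OF 0 ex_append[OF 1 ex_append[OF 2 ex_append[OF 3 ex_append[OF 4 ex_append[OF 5 ex_append[OF 6 ex_append[OF 7 ex_append[OF 8 ex_append[OF 9 10]]]]]]]]]]])
      (rule order_trans[OF _ sum[OF A B, of "length (map bsym (binary b)) * (2 + 3) + 41 * Z + 40" "200 * Z + 200", simplified add.assoc[symmetric]]], simp, use C in simp)
qed

section \<open>Checking the tree\<close>

definition match_loop :: "cmd list" where
  "match_loop = [While 27 nonz [Case 27 (\<lambda>p. [Case 26 (\<lambda>q. (if p = q then [] else [Push 12 1]) @ [Push 23 q]), Pop 26, Push 25 p, Pop 27])]]"

text \<open>An exhausted text reads as 0, which no pattern symbol equals, so a text that is too
  short counts as a mismatch.\<close>

fun mismatches :: "nat list \<Rightarrow> nat list \<Rightarrow> nat" where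
  "mismatches [] Y = 0"
| "mismatches (p # P) Y = (if p = top0 Y then 0 else 1) + mismatches P (tl Y)"

lemma mismatches_0: "0 \<notin> set P \<Longrightarrow> mismatches P Y = 0 \<longleftrightarrow> (\<exists>v. Y = P @ v)"
proof (induction P arbitrary: Y)
  case (Cons p P)
  then show ?case by (cases Y) auto
qed simp

lemma mismatches_le: "mismatches P Y \<le> length P"
  by (induction P arbitrary: Y) (auto simp: le_SucI)

lemma ex_match_loop:
  assumes "\<sigma> 27 = P" "\<sigma> 26 = Y" "0 \<notin> set P" "0 \<notin> set Y"
  shows "ex match_loop (8 * length P + 1) \<sigma> (\<sigma>(27 := [], 25 := rev P @ \<sigma> 25, 26 := drop (length P) Y,
     23 := rev (take (length P) Y) @ \<sigma> 23, 12 := ones (mismatches P Y) @ \<sigma> 12))"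
  using assms
proof (induction P arbitrary: \<sigma> Y)
  case Nil
  then have eq: "\<sigma>(27 := [], 25 := rev [] @ \<sigma> 25, 26 := drop (length []) Y,
     23 := rev (take (length []) Y) @ \<sigma> 23, 12 := ones (mismatches [] Y) @ \<sigma> 12) = \<sigma>" by auto
  show ?case unfolding eq match_loop_def by (rule ex_mono[OF ex_While_False[where B = 0]]) (use Nil in auto)
next
  case (Cons p P)
  let ?body = "[Case 27 (\<lambda>p. [Case 26 (\<lambda>q. (if p = q then [] else [Push 12 1]) @ [Push 23 q]), Pop 26, Push 25 p, Pop 27])]"
  let ?\<sigma>1 = "\<sigma>(27 := P, 25 := p # \<sigma> 25, 26 := tl Y, 23 := rev (take 1 Y) @ \<sigma> 23, 12 := (if p = top0 Y then \<sigma> 12 else 1 # \<sigma> 12))"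
  let ?\<sigma>2 = "?\<sigma>1(27 := [], 25 := rev P @ ?\<sigma>1 25, 26 := drop (length P) (tl Y),
     23 := rev (take (length P) (tl Y)) @ ?\<sigma>1 23, 12 := ones (mismatches P (tl Y)) @ ?\<sigma>1 12)"
  have tops: "top0 (\<sigma> 27) = p" "top0 (\<sigma> 26) = top0 Y" using Cons.prems by auto
  have 1: "ex ?body (Suc (Suc (Suc (Suc (Suc (Suc (Suc 0))))))) \<sigma> ?\<sigma>1"
  proof (rule ex_Case, unfold tops append_Nil2, rule ex_Case, unfold tops, cases "p = top0 Y")
    case True
    show "ex (((if p = top0 Y then [] else [Push 12 1]) @ [Push 23 (top0 Y)]) @ [Pop 26, Push 25 p, Pop 27]) (Suc (Suc (Suc (Suc (Suc 0))))) \<sigma> ?\<sigma>1"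
      using True Cons.prems by (cases Y) (auto intro!: ex_Push ex_Pop simp: fun_eq_iff)
  next
    case False
    show "ex (((if p = top0 Y then [] else [Push 12 1]) @ [Push 23 (top0 Y)]) @ [Pop 26, Push 25 p, Pop 27]) (Suc (Suc (Suc (Suc (Suc 0))))) \<sigma> ?\<sigma>1"
      using False Cons.prems by (cases Y) (auto intro!: ex_Push ex_Pop simp: fun_eq_iff)
  qed
  have 2: "ex match_loop (8 * length P + 1) ?\<sigma>1 ?\<sigma>2"
  proof (rule Cons.IH)
    show "0 \<notin> set (tl Y)" using Cons.prems by (cases Y) auto
  qed (use Cons.prems in auto)
  have e: "?\<sigma>2 = \<sigma>(27 := [], 25 := rev (p # P) @ \<sigma> 25, 26 := drop (length (p # P)) Y,
     23 := rev (take (length (p # P)) Y) @ \<sigma> 23, 12 := ones (mismatches (p # P) Y) @ \<sigma> 12)"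
    by (cases Y) (auto simp: fun_eq_iff replicate_app_Cons_same)
  have "nonz (top0 (\<sigma> 27))" using Cons.prems by simp
  from ex_While_True[where P = nonz, OF this 1 2[unfolded match_loop_def]]
  show ?case unfolding e match_loop_def by (rule ex_mono) simp
qed

definition match_prog :: "cmd list" where
  "match_prog = match_loop @ pour 25 27 @ pour 23 26 @ [Case 12 (\<lambda>f. if f = 0 then [Push 20 1] else [])] @ clear 12"

lemma ex_match_prog:
  assumes "\<sigma> 27 = P" "\<sigma> 26 = Y" "0 \<notin> set P" "0 \<notin> set Y" "\<sigma> 25 = []" "\<sigma> 23 = []" "\<sigma> 12 = []" "length P \<le> Z"
    "\<sigma>' = \<sigma>(20 := (if \<exists>v. Y = P @ v then 1 # \<sigma> 20 else \<sigma> 20))"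
  shows "ex match_prog (20 * Z + 10) \<sigma> \<sigma>'"
proof -
  let ?m = "mismatches P Y"
  let ?\<sigma>1 = "\<sigma>(27 := [], 25 := rev P @ \<sigma> 25, 26 := drop (length P) Y, 23 := rev (take (length P) Y) @ \<sigma> 23, 12 := ones ?m @ \<sigma> 12)"
  let ?\<sigma>2 = "?\<sigma>1(25 := [], 27 := P)"
  let ?\<sigma>3 = "\<sigma>(12 := ones ?m)"
  let ?\<sigma>4 = "?\<sigma>3(20 := (if ?m = 0 then 1 # \<sigma> 20 else \<sigma> 20))"
  have 1: "ex match_loop (8 * length P + 1) \<sigma> ?\<sigma>1" by (rule ex_match_loop) (use assms in auto)
  have 2: "ex (pour 25 27) (4 * Z + 1) ?\<sigma>1 ?\<sigma>2" by (rule ex_pourI) (use assms in \<open>auto simp: fun_eq_iff\<close>)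
  have 3: "ex (pour 23 26) (4 * Z + 1) ?\<sigma>2 ?\<sigma>3" by (rule ex_pourI) (use assms in \<open>auto simp: fun_eq_iff dest: in_set_takeD\<close>)
  have 4: "ex [Case 12 (\<lambda>f. if f = 0 then [Push 20 1] else [])] (Suc (Suc 0)) ?\<sigma>3 ?\<sigma>4"
    by (rule ex_Case) (use assms in \<open>cases ?m; auto intro!: ex_Push simp: fun_eq_iff\<close>)
  have 5: "ex (clear 12) (3 * Z + 1) ?\<sigma>4 \<sigma>'"
    by (rule ex_clearI) (use assms mismatches_le[of P Y] in \<open>auto simp: fun_eq_iff mismatches_0\<close>)
  show ?thesis unfolding match_prog_def
    by (rule ex_mono[OF ex_append[OF 1 ex_append[OF 2 ex_append[OF 3 ex_append[OF 4 5]]]]]) (use assms(8) in simp)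
qed

definition shift1 :: "cmd list" where
  "shift1 = [Case 26 (\<lambda>q. [Push 24 q]), Pop 26]"

lemma ex_shift1:
  assumes "\<sigma> 26 = Y" "0 \<notin> set Y" "\<sigma>' = \<sigma>(26 := tl Y, 24 := rev (take 1 Y) @ \<sigma> 24)"
  shows "ex shift1 3 \<sigma> \<sigma>'"
  unfolding shift1_def numeral_3_eq_3
  by (rule ex_Case, unfold append_Cons append_Nil, rule ex_Push, rule ex_Pop)
    (use assms in \<open>cases Y; auto simp: fun_eq_iff\<close>)

text \<open>Two shifts per round keep the search on token boundaries. The text is collected in
  reverse on stack 24, from which it can be restored for the next literal.\<close>

definition search_loop :: "cmd list" where
  "search_loop = [While 26 nonz (match_prog @ shift1 @ shift1)]"

lemma occ_Nil: "P \<noteq> [] \<Longrightarrow> \<not> occ P []"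
  by (auto simp: occ_def)

lemma occ_step:
  assumes "P \<noteq> []" "Y \<noteq> []"
  shows "occ P Y \<longleftrightarrow> (\<exists>v. Y = P @ v) \<or> occ P (drop 2 Y)"
proof
  assume "occ P Y"
  then obtain u v where uv: "Y = u @ P @ v" "even (length u)" by (auto simp: occ_def)
  show "(\<exists>v. Y = P @ v) \<or> occ P (drop 2 Y)"
  proof (cases u)
    case Nil
    then show ?thesis using uv by auto
  next
    case (Cons a u')
    then obtain b u'' where "u' = b # u''" using uv(2) by (cases u') auto
    then show ?thesis using uv Cons unfolding occ_def by auto
  qed
next
  assume *: "(\<exists>v. Y = P @ v) \<or> occ P (drop 2 Y)"
  show "occ P Y"
  proof (cases "\<exists>v. Y = P @ v")
    case True
    then show ?thesis unfolding occ_def by (metis append_Nil even_zero list.size(3))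
  next
    case False
    then obtain u v where uv: "drop 2 Y = u @ P @ v" "even (length u)" using * by (auto simp: occ_def)
    then have "2 < length Y" using assms(1) by (metis append_is_Nil_conv drop_all not_le)
    then have "length (take 2 Y @ u) = 2 + length u" by simp
    then have "even (length (take 2 Y @ u))" using uv(2) by simp
    moreover have "Y = (take 2 Y @ u) @ P @ v" using uv(1) by (metis append.assoc append_take_drop_id)
    ultimately show ?thesis unfolding occ_def by blast
  qed
qed

lemma ex_search_loop:
  assumes "\<sigma> 27 = P" "\<sigma> 26 = Y" "0 \<notin> set P" "0 \<notin> set Y" "\<sigma> 25 = []" "\<sigma> 23 = []" "\<sigma> 12 = []" "length P \<le> Z" "P \<noteq> []"
  shows "\<exists>c. (c = 0 \<longleftrightarrow> \<not> occ P Y) \<and> c \<le> length Y \<and> ex search_loop (length Y * (20 * Z + 17) + 1) \<sigma> (\<sigma>(26 := [], 24 := rev Y @ \<sigma> 24, 20 := ones c @ \<sigma> 20))"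
  using assms
proof (induction "length Y" arbitrary: \<sigma> Y rule: less_induct)
  case less
  show ?case
  proof (cases "Y = []")
    case True
    then have eq: "\<sigma>(26 := [], 24 := rev Y @ \<sigma> 24, 20 := ones 0 @ \<sigma> 20) = \<sigma>" using less.prems by auto
    have "ex search_loop (length Y * (20 * Z + 17) + 1) \<sigma> (\<sigma>(26 := [], 24 := rev Y @ \<sigma> 24, 20 := ones 0 @ \<sigma> 20))"
      unfolding eq search_loop_def by (rule ex_mono[OF ex_While_False[where B = 0]]) (use True less.prems in auto)
    then show ?thesis using True less.prems(9) occ_Nil[of P] by (intro exI[of _ 0]) simp
  next
    case False
    let ?b = "\<exists>v. Y = P @ v"
    let ?\<sigma>1 = "\<sigma>(20 := (if ?b then 1 # \<sigma> 20 else \<sigma> 20))"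
    let ?\<sigma>2 = "?\<sigma>1(26 := drop 2 Y, 24 := rev (take 2 Y) @ \<sigma> 24)"
    have 1: "ex match_prog (20 * Z + 10) \<sigma> ?\<sigma>1" by (rule ex_match_prog) (use less.prems in auto)
    have nz2: "0 \<notin> set (tl Y)" using less.prems(4) False by (cases Y) auto
    have 2: "ex shift1 3 (?\<sigma>1(26 := tl Y, 24 := rev (take 1 Y) @ ?\<sigma>1 24)) ?\<sigma>2"
    proof (rule ex_shift1)
      have "rev (take 2 Y) = rev (take 1 (tl Y)) @ rev (take 1 Y)" "drop 2 Y = tl (tl Y)"
        using False by (cases Y; cases "tl Y"; simp)+
      then show "?\<sigma>2 = (?\<sigma>1(26 := tl Y, 24 := rev (take 1 Y) @ ?\<sigma>1 24))(26 := tl (tl Y), 24 := rev (take 1 (tl Y)) @ (?\<sigma>1(26 := tl Y, 24 := rev (take 1 Y) @ ?\<sigma>1 24)) 24)"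
        by (simp only: append_assoc) (simp add: fun_eq_iff)
    qed (use nz2 in auto)
    have 3: "ex shift1 3 ?\<sigma>1 (?\<sigma>1(26 := tl Y, 24 := rev (take 1 Y) @ ?\<sigma>1 24))"
      by (rule ex_shift1) (use less.prems(2,4) in auto)
    have "\<exists>c. (c = 0 \<longleftrightarrow> \<not> occ P (drop 2 Y)) \<and> c \<le> length (drop 2 Y) \<and> ex search_loop (length (drop 2 Y) * (20 * Z + 17) + 1) ?\<sigma>2
       (?\<sigma>2(26 := [], 24 := rev (drop 2 Y) @ ?\<sigma>2 24, 20 := ones c @ ?\<sigma>2 20))"
    proof (rule less.hyps[of "drop 2 Y" ?\<sigma>2])
      show "length (drop 2 Y) < length Y" using False by simp
      show "0 \<notin> set (drop 2 Y)" using less.prems(4) by (meson in_set_dropD)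
      show "?\<sigma>2 26 = drop 2 Y" by simp
      show "?\<sigma>2 27 = P" "?\<sigma>2 25 = []" "?\<sigma>2 23 = []" "?\<sigma>2 12 = []" using less.prems(1,5,6,7) by simp_all
    qed (fact less.prems(3,8,9))+
    then obtain c where c: "c = 0 \<longleftrightarrow> \<not> occ P (drop 2 Y)" "c \<le> length (drop 2 Y)" "ex search_loop (length (drop 2 Y) * (20 * Z + 17) + 1) ?\<sigma>2
       (?\<sigma>2(26 := [], 24 := rev (drop 2 Y) @ ?\<sigma>2 24, 20 := ones c @ ?\<sigma>2 20))" by (elim exE conjE) (rule that)
    define c' where "c' = (if ?b then Suc c else c)"
    have "rev (drop 2 Y) @ rev (take 2 Y) = rev Y" unfolding rev_append[symmetric] append_take_drop_id ..
    then have rv: "rev (drop 2 Y) @ rev (take 2 Y) @ v = rev Y @ v" for v by (simp only: append_assoc[symmetric])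
    have e: "?\<sigma>2(26 := [], 24 := rev (drop 2 Y) @ ?\<sigma>2 24, 20 := ones c @ ?\<sigma>2 20) = \<sigma>(26 := [], 24 := rev Y @ \<sigma> 24, 20 := ones c' @ \<sigma> 20)"
      using rv by (cases ?b) (simp_all only: c'_def if_True if_False replicate_Suc append_Cons replicate_app_Cons_same, auto simp: fun_eq_iff replicate_app_Cons_same)
    have nz: "nonz (top0 (\<sigma> 26))" using less.prems False by (cases Y) auto
    from ex_While_True[where P = nonz, OF nz ex_append[OF 1 ex_append[OF 3 2]] c(3)[unfolded e search_loop_def]]
    have "ex search_loop (Suc (20 * Z + 10 + (3 + 3) + (length (drop 2 Y) * (20 * Z + 17) + 1))) \<sigma> (\<sigma>(26 := [], 24 := rev Y @ \<sigma> 24, 20 := ones c' @ \<sigma> 20))"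
      unfolding search_loop_def .
    moreover have "Suc (length (drop 2 Y)) * (20 * Z + 17) \<le> length Y * (20 * Z + 17)" using False by (intro mult_right_mono) (cases Y, auto)
    ultimately have "ex search_loop (length Y * (20 * Z + 17) + 1) \<sigma> (\<sigma>(26 := [], 24 := rev Y @ \<sigma> 24, 20 := ones c' @ \<sigma> 20))"
      by (elim ex_mono) simp
    moreover have "c' = 0 \<longleftrightarrow> \<not> occ P Y" using c(1) occ_step[OF less.prems(9) False] by (simp add: c'_def)
    moreover have "c' \<le> length Y" using c(2) False by (cases Y) (auto simp: c'_def)
    ultimately show ?thesis by (intro exI[of _ c'] conjI)
  qed
qed

text \<open>For both polarities the pattern is the edge to \<open>va s\<close>, and its absence
  means that \<open>s\<close> is true. Literals of opposite polarity are thus evaluated under one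
  and the same assignment, even if the text searched is not the code of a tree.\<close>

definition lit_check :: "bool \<Rightarrow> cmd list" where
  "lit_check g = [While 8 (\<lambda>a. a = 1 \<or> a = 2) [Case 8 (\<lambda>a. [Push 21 a]), Pop 8]] @
     pushes 27 (rsym [False, True, True, True]) @ pour 21 5 @ conv 5 27 (\<lambda>a. [a, 1]) @
     pushes 27 (rsym [True, False, True, True, True, False]) @ search_loop @ pour 24 26 @
     [Case 20 (\<lambda>f. if (f = 0) = g then [Push 29 1] else [])] @ clear 20 @ clear 27"

lemma ex_pop_name:
  assumes "\<sigma> 8 = map bsym s @ r" "top0 r \<noteq> 1" "top0 r \<noteq> 2"
  shows "ex [While 8 (\<lambda>a. a = 1 \<or> a = 2) [Case 8 (\<lambda>a. [Push 21 a]), Pop 8]] (4 * length s + 1) \<sigma> (\<sigma>(8 := r, 21 := rsym s @ \<sigma> 21))"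
  using assms
proof (induction s arbitrary: \<sigma>)
  case Nil
  then have eq: "\<sigma>(8 := r, 21 := rsym [] @ \<sigma> 21) = \<sigma>" by auto
  show ?case unfolding eq by (rule ex_mono[OF ex_While_False[where B = 0]]) (use Nil in auto)
next
  case (Cons a s)
  let ?\<sigma>1 = "\<sigma>(8 := map bsym s @ r, 21 := bsym a # \<sigma> 21)"
  let ?W = "[While 8 (\<lambda>a. a = 1 \<or> a = 2) [Case 8 (\<lambda>a. [Push 21 a]), Pop 8]]"
  have t: "top0 (\<sigma> 8) = 1 \<or> top0 (\<sigma> 8) = 2" using Cons.prems by (auto simp: bsym_def)
  have 1: "ex [Case 8 (\<lambda>a. [Push 21 a]), Pop 8] (Suc (Suc (Suc 0))) \<sigma> ?\<sigma>1"
    by (rule ex_Case, unfold append_Cons append_Nil, rule ex_Push, rule ex_Pop) (use Cons.prems in \<open>auto simp: fun_eq_iff\<close>)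
  have 2: "ex ?W (4 * length s + 1) ?\<sigma>1 (?\<sigma>1(8 := r, 21 := rsym s @ ?\<sigma>1 21))" by (rule Cons.IH) (use Cons.prems in auto)
  have e: "?\<sigma>1(8 := r, 21 := rsym s @ ?\<sigma>1 21) = \<sigma>(8 := r, 21 := rsym (a # s) @ \<sigma> 21)" by (auto simp: fun_eq_iff)
  from ex_While_True[where P = "\<lambda>a. a = 1 \<or> a = 2", OF t 1 2] show ?case unfolding e by (rule ex_mono) simp
qed

definition found :: "bool list \<Rightarrow> bool list \<Rightarrow> bool" where
  "found z s \<longleftrightarrow> occ (enc_edge {0, va s}) z"

lemma occ_map_bsym: "occ (map bsym P) (map bsym Y) \<longleftrightarrow> occ P Y"
proof
  assume "occ (map bsym P) (map bsym Y)"
  then obtain u v where uv: "map bsym Y = u @ map bsym P @ v" "even (length u)" by (auto simp: occ_def)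
  let ?d = "map (\<lambda>s. s = 2)"
  have "Y = ?d u @ P @ ?d v" using arg_cong[OF uv(1), of ?d] unfolding map_append map_bsym_inv .
  then show "occ P Y" using uv(2) unfolding occ_def by (metis length_map)
next
  assume "occ P Y"
  then obtain u v where "Y = u @ P @ v" "even (length u)" by (auto simp: occ_def)
  then have "map bsym Y = map bsym u @ map bsym P @ map bsym v" "even (length (map bsym u))" by auto
  then show "occ (map bsym P) (map bsym Y)" unfolding occ_def by blast
qed

lemma ex_lit_check:
  assumes s8: "\<sigma> 8 = rsym s @ r" "top0 r \<noteq> 1" "top0 r \<noteq> 2"
    and e: "\<And>i. i \<in> {5, 12, 20, 21, 23, 24, 25, 27} \<Longrightarrow> \<sigma> i = []" "\<sigma> 26 = map bsym z"
    and Z: "2 * length s + 10 \<le> Z" "length z \<le> Z"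
    and \<sigma>': "\<sigma>' = \<sigma>(8 := r, 29 := (if holds (\<lambda>s. \<not> found z s) (g, s) then 1 # \<sigma> 29 else \<sigma> 29))"
  shows "ex (lit_check g) (Z * (40 * Z + 17) + 100 * Z + 100) \<sigma> \<sigma>'"
proof -
  have e0: "\<sigma> 5 = []" "\<sigma> 12 = []" "\<sigma> 20 = []" "\<sigma> 21 = []" "\<sigma> 23 = []" "\<sigma> 24 = []" "\<sigma> 25 = []" "\<sigma> 27 = []"
    by (rule e(1), simp)+
  let ?\<sigma>1 = "\<sigma>(8 := r, 21 := map bsym s)"
  let ?\<sigma>2 = "?\<sigma>1(27 := map bsym [False, True, True, True])"
  let ?\<sigma>3 = "\<sigma>(8 := r, 27 := map bsym [False, True, True, True], 5 := rsym s)"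
  let ?q = "concat (map (\<lambda>b. [False, b]) s) @ [False, True, True, True]"
  let ?\<sigma>4 = "\<sigma>(8 := r, 27 := map bsym ?q)"
  let ?p = "enc_edge {0, va s}"
  let ?\<sigma>5 = "\<sigma>(8 := r, 27 := map bsym ?p)"
  have p: "?p = [True, False, True, True, True, False] @ ?q"
    using eedge[of True s] by (simp add: eedge_def ledge_def enc_nat_0 enc_bits_def)
  have lp: "length ?p \<le> 2 * Z"
  proof -
    have "length (concat (map (\<lambda>b. [False, b]) s)) = 2 * length s" by (induction s) auto
    then show ?thesis unfolding p using Z(1) by simp
  qed
  have 1: "ex [While 8 (\<lambda>a. a = 1 \<or> a = 2) [Case 8 (\<lambda>a. [Push 21 a]), Pop 8]] (4 * length s + 1) \<sigma> ?\<sigma>1"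
    using ex_pop_name[of \<sigma> "rev s" r] s8 e0 by (simp add: rev_map)
  have 2: "ex (pushes 27 (rsym [False, True, True, True])) 4 ?\<sigma>1 ?\<sigma>2"
    using ex_pushes[of "rsym [False, True, True, True]" 4 27 ?\<sigma>1] e0 by simp
  have 3: "ex (pour 21 5) (4 * Z + 1) ?\<sigma>2 ?\<sigma>3" by (rule ex_pourI) (use Z e0 in \<open>auto simp: fun_eq_iff\<close>)
  have "ex (conv 5 27 (\<lambda>a. [a, 1])) (length (rsym s) * (2 + 3) + 1) ?\<sigma>3 (?\<sigma>3(5 := [], 27 := rev (concat (map (\<lambda>a. [a, 1]) (rsym s))) @ ?\<sigma>3 27))"
    by (rule ex_conv) (auto intro: gr0I)
  moreover have "rev (concat (map (\<lambda>a. [a, 1]) (rsym s))) = map bsym (concat (map (\<lambda>b. [False, b]) s))"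
    by (induction s) (auto simp: bsym_def)
  then have "?\<sigma>3(5 := [], 27 := rev (concat (map (\<lambda>a. [a, 1]) (rsym s))) @ ?\<sigma>3 27) = ?\<sigma>4"
    using e0 by (auto simp: fun_eq_iff)
  ultimately have 4: "ex (conv 5 27 (\<lambda>a. [a, 1])) (length (rsym s) * (2 + 3) + 1) ?\<sigma>3 ?\<sigma>4" by simp
  have 5: "ex (pushes 27 (rsym [True, False, True, True, True, False])) 6 ?\<sigma>4 ?\<sigma>5"
    using ex_pushes[of "rsym [True, False, True, True, True, False]" 6 27 ?\<sigma>4] by (simp add: p)
  have "\<exists>c. (c = 0 \<longleftrightarrow> \<not> occ (map bsym ?p) (map bsym z)) \<and> c \<le> length (map bsym z) \<and> ex search_loop (length (map bsym z) * (20 * (2 * Z) + 17) + 1) ?\<sigma>5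
     (?\<sigma>5(26 := [], 24 := rev (map bsym z) @ ?\<sigma>5 24, 20 := ones c @ ?\<sigma>5 20))"
    by (rule ex_search_loop) (use e0 e(2) lp in \<open>simp_all add: p\<close>)
  moreover define X where "X = length z * (20 * (2 * Z) + 17)"
  ultimately obtain c where c: "c = 0 \<longleftrightarrow> \<not> found z s" "c \<le> length z" "ex search_loop (X + 1) ?\<sigma>5 (?\<sigma>5(26 := [], 24 := rsym z, 20 := ones c))"
    using e0 e0 by (auto simp: occ_map_bsym found_def)
  let ?\<sigma>6 = "?\<sigma>5(26 := [], 24 := rsym z, 20 := ones c)"
  let ?\<sigma>7 = "?\<sigma>5(20 := ones c)"
  let ?\<sigma>8 = "?\<sigma>7(29 := (if holds (\<lambda>s. \<not> found z s) (g, s) then 1 # \<sigma> 29 else \<sigma> 29))"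
  let ?\<sigma>9 = "?\<sigma>5(29 := (if holds (\<lambda>s. \<not> found z s) (g, s) then 1 # \<sigma> 29 else \<sigma> 29))"
  have 7: "ex (pour 24 26) (4 * Z + 1) ?\<sigma>6 ?\<sigma>7" by (rule ex_pourI) (use Z e(2) e0 in \<open>auto simp: fun_eq_iff\<close>)
  have 8: "ex [Case 20 (\<lambda>f. if (f = 0) = g then [Push 29 1] else [])] (Suc (Suc 0)) ?\<sigma>7 ?\<sigma>8"
    by (rule ex_Case) (use c(1) in \<open>cases c; auto intro!: ex_Push simp: fun_eq_iff holds_def\<close>)
  have 9: "ex (clear 20) (3 * Z + 1) ?\<sigma>8 ?\<sigma>9" by (rule ex_clearI) (use c(2) Z e0 in \<open>auto simp: fun_eq_iff\<close>)
  have 10: "ex (clear 27) (3 * (2 * Z) + 1) ?\<sigma>9 \<sigma>'" by (rule ex_clearI) (use lp e0 in \<open>auto simp: fun_eq_iff \<sigma>'\<close>)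
  have "X \<le> Z * (40 * Z + 17)" using mult_right_mono[OF Z(2), of "20 * (2 * Z) + 17"] by (simp add: X_def)
  moreover have "length (rsym s) * (2 + 3) \<le> 5 * Z" using Z(1) by simp
  ultimately have "4 * length s + 1 + (4 + (4 * Z + 1 + (length (rsym s) * (2 + 3) + 1 + (6 + (X + 1 + (4 * Z + 1 + (Suc (Suc 0) + (3 * Z + 1 + (3 * (2 * Z) + 1)))))))))
     \<le> Z * (40 * Z + 17) + 100 * Z + 100" using Z(1) by linarith
  with ex_append[OF 1 ex_append[OF 2 ex_append[OF 3 ex_append[OF 4 ex_append[OF 5 ex_append[OF c(3) ex_append[OF 7 ex_append[OF 8 ex_append[OF 9 10]]]]]]]]]
  show ?thesis unfolding lit_check_def by (elim ex_mono)
qed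

text \<open>Symbols 3 and 4 announce a literal and give its polarity, 5 ends a tuple. A tuple fails
  when stack 29 is still empty at its end.\<close>

definition check_prog :: "cmd list" where
  "check_prog = [While 8 nonz [Case 8 (\<lambda>s. Pop 8 # (if s = 5 then Case 29 (\<lambda>f. if f = 0 then [Push 28 1] else []) # clear 29 else lit_check (s = 4)))]]"

definition lit_cost :: "nat \<Rightarrow> nat" where
  "lit_cost Z = Z * (40 * Z + 17) + 100 * Z + 110"

lemma ex_check_lits:
  assumes "\<sigma> 8 = concat (map lq ls) @ 5 # r"
    "\<forall>i\<in>{5, 12, 20, 21, 23, 24, 25, 27}. \<sigma> i = []" "\<sigma> 26 = map bsym z"
    "\<forall>l\<in>set ls. 2 * length (snd l) + 10 \<le> Z" "length z \<le> Z"
    "ex check_prog B (\<sigma>(8 := 5 # r, 29 := ones (length (filter (holds (\<lambda>s. \<not> found z s)) ls)) @ \<sigma> 29)) \<sigma>'"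
  shows "ex check_prog (length ls * lit_cost Z + B) \<sigma> \<sigma>'"
  using assms
proof (induction ls arbitrary: \<sigma>)
  case Nil
  then have eq: "\<sigma>(8 := 5 # r, 29 := ones (length (filter (holds (\<lambda>s. \<not> found z s)) [])) @ \<sigma> 29) = \<sigma>" by auto
  have "ex check_prog B \<sigma> \<sigma>'" using Nil.prems(6) unfolding eq .
  then show ?case by simp
next
  case (Cons l ls)
  obtain g s where l: "l = (g, s)" by (cases l)
  let ?r = "concat (map lq ls) @ 5 # r"
  let ?b = "holds (\<lambda>s. \<not> found z s) (g, s)"
  let ?\<sigma>0 = "\<sigma>(8 := rsym s @ ?r)"
  let ?\<sigma>1 = "\<sigma>(8 := ?r, 29 := (if ?b then 1 # \<sigma> 29 else \<sigma> 29))"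
  have s8: "\<sigma> 8 = (if g then 4 else 3) # rsym s @ ?r"
  proof -
    have "lq (g, s) = (if g then 4 else 3) # rsym s" by (simp add: lq_def)
    with Cons.prems(1) l show ?thesis by simp
  qed
  have rt: "top0 ?r \<noteq> 1" "top0 ?r \<noteq> 2" by (cases ls; simp add: lq_def)+
  have 1: "ex (lit_check g) (Z * (40 * Z + 17) + 100 * Z + 100) ?\<sigma>0 ?\<sigma>1"
  proof (rule ex_lit_check[where r = ?r and s = s and z = z, OF _ rt])
    show "2 * length s + 10 \<le> Z" using Cons.prems(4) l by simp
    show "?\<sigma>0 8 = rsym s @ ?r" by simp
    show "?\<sigma>0 26 = map bsym z" using Cons.prems(3) by simp
    show "length z \<le> Z" by (rule Cons.prems(5))
    have "\<forall>i\<in>{5, 12, 20, 21, 23, 24, 25, 27}. ?\<sigma>0 i = []" using Cons.prems(2) by simp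
    then show "?\<sigma>0 i = []" if "i \<in> {5, 12, 20, 21, 23, 24, 25, 27}" for i using that by blast
    show "?\<sigma>1 = ?\<sigma>0(8 := ?r, 29 := (if ?b then 1 # ?\<sigma>0 29 else ?\<sigma>0 29))" by simp
  qed
  have t: "top0 (\<sigma> 8) = (if g then 4 else 3)" using s8 by simp
  have tl: "\<sigma>(8 := tl (\<sigma> 8)) = ?\<sigma>0" using s8 by simp
  have g: "((if g then 4 else 3) = (5::nat)) = False" "((if g then 4 else 3) = (4::nat)) = g" by auto
  have 2: "ex [Case 8 (\<lambda>s. Pop 8 # (if s = 5 then Case 29 (\<lambda>f. if f = 0 then [Push 28 1] else []) # clear 29 else lit_check (s = 4)))]
     (Suc (Suc (Z * (40 * Z + 17) + 100 * Z + 100))) \<sigma> ?\<sigma>1"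
    by (rule ex_Case, unfold append_Nil2 t, rule ex_Pop, unfold tl g if_False, rule 1)
  have 3: "ex check_prog (length ls * lit_cost Z + B) ?\<sigma>1 \<sigma>'"
  proof (rule Cons.IH)
    show "?\<sigma>1 8 = concat (map lq ls) @ 5 # r" by simp
    show "\<forall>l\<in>set ls. 2 * length (snd l) + 10 \<le> Z" using Cons.prems(4) by simp
    show "length z \<le> Z" by (rule Cons.prems(5))
    show "?\<sigma>1 26 = map bsym z" using Cons.prems(3) by simp
    show "\<forall>i\<in>{5, 12, 20, 21, 23, 24, 25, 27}. ?\<sigma>1 i = []" using Cons.prems(2) by simp
    have "?\<sigma>1(8 := 5 # r, 29 := ones (length (filter (holds (\<lambda>s. \<not> found z s)) ls)) @ ?\<sigma>1 29)
       = \<sigma>(8 := 5 # r, 29 := ones (length (filter (holds (\<lambda>s. \<not> found z s)) (l # ls))) @ \<sigma> 29)"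
      by (auto simp: fun_eq_iff l replicate_app_Cons_same)
    then show "ex check_prog B (?\<sigma>1(8 := 5 # r, 29 := ones (length (filter (holds (\<lambda>s. \<not> found z s)) ls)) @ ?\<sigma>1 29)) \<sigma>'"
      using Cons.prems(6) by (simp only:)
  qed
  have nz: "nonz (top0 (\<sigma> 8))" using t by simp
  have "ex check_prog (Suc (Suc (Suc (Z * (40 * Z + 17) + 100 * Z + 100)) + (length ls * lit_cost Z + B))) \<sigma> \<sigma>'"
    unfolding check_prog_def by (rule ex_While_True[where P = nonz, OF nz 2 3[unfolded check_prog_def]])
  then show ?case by (rule ex_mono) (simp add: lit_cost_def)
qed

lemma ex_check_segs:
  assumes "\<sigma> 8 = concat (map seg LS)" "\<sigma> 29 = []"
    "\<forall>i\<in>{5, 12, 20, 21, 23, 24, 25, 27}. \<sigma> i = []" "\<sigma> 26 = map bsym z" "length z \<le> Z"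
    "\<forall>ls\<in>set LS. length ls \<le> Z \<and> (\<forall>l\<in>set ls. 2 * length (snd l) + 10 \<le> Z)"
  shows "\<exists>c. (c = 0 \<longleftrightarrow> (\<forall>ls\<in>set LS. \<exists>l\<in>set ls. holds (\<lambda>s. \<not> found z s) l)) \<and>
     ex check_prog (length LS * (Z * lit_cost Z + 4 * Z + 10) + 1) \<sigma> (\<sigma>(8 := [], 28 := ones c @ \<sigma> 28))"
  using assms
proof (induction LS arbitrary: \<sigma>)
  case Nil
  then have eq: "\<sigma>(8 := [], 28 := ones 0 @ \<sigma> 28) = \<sigma>" by auto
  have h: "ex check_prog (length [] * (Z * lit_cost Z + 4 * Z + 10) + 1) \<sigma> (\<sigma>(8 := [], 28 := ones 0 @ \<sigma> 28))"
    unfolding eq check_prog_def by (rule ex_mono[OF ex_While_False[where B = 0]]) (use Nil in auto)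
  show ?case by (intro exI[of _ 0] conjI) (simp, rule h)
next
  case (Cons ls LS)
  let ?r = "concat (map seg LS)"
  let ?h = "holds (\<lambda>s. \<not> found z s)"
  define m where "m = length (filter ?h (rev ls))"
  have m0: "m = 0 \<longleftrightarrow> \<not> (\<exists>l\<in>set ls. ?h l)" by (simp add: m_def filter_empty_conv)
  have lsZ: "length ls \<le> Z" using Cons.prems(6) by simp
  have mZ: "m \<le> Z" using lsZ length_filter_le[of ?h "rev ls"] by (simp add: m_def)
  let ?\<sigma>1 = "\<sigma>(8 := 5 # ?r, 29 := ones m)"
  let ?\<sigma>2 = "\<sigma>(8 := ?r, 28 := (if m = 0 then 1 # \<sigma> 28 else \<sigma> 28))"
  have "\<exists>c. (c = 0 \<longleftrightarrow> (\<forall>ls\<in>set LS. \<exists>l\<in>set ls. ?h l)) \<and> ex check_prog (length LS * (Z * lit_cost Z + 4 * Z + 10) + 1) ?\<sigma>2 (?\<sigma>2(8 := [], 28 := ones c @ ?\<sigma>2 28))"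
  proof (rule Cons.IH[of ?\<sigma>2])
    show "?\<sigma>2 8 = concat (map seg LS)" by simp
    show "?\<sigma>2 29 = []" "?\<sigma>2 26 = map bsym z" "\<forall>i\<in>{5, 12, 20, 21, 23, 24, 25, 27}. ?\<sigma>2 i = []" using Cons.prems(2,3,4) by simp_all
    show "\<forall>ls\<in>set LS. length ls \<le> Z \<and> (\<forall>l\<in>set ls. 2 * length (snd l) + 10 \<le> Z)" using Cons.prems(6) by simp
  qed (rule Cons.prems(5))
  then obtain c where c: "c = 0 \<longleftrightarrow> (\<forall>ls\<in>set LS. \<exists>l\<in>set ls. ?h l)" "ex check_prog (length LS * (Z * lit_cost Z + 4 * Z + 10) + 1) ?\<sigma>2 (?\<sigma>2(8 := [], 28 := ones c @ ?\<sigma>2 28))" by (elim exE conjE) (rule that)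
  define c' where "c' = (if m = 0 then Suc c else c)"
  have e: "?\<sigma>2(8 := [], 28 := ones c @ ?\<sigma>2 28) = \<sigma>(8 := [], 28 := ones c' @ \<sigma> 28)"
    by (auto simp: fun_eq_iff c'_def replicate_app_Cons_same)
  let ?\<sigma>1a = "\<sigma>(8 := ?r, 29 := ones m)"
  let ?\<sigma>1b = "\<sigma>(8 := ?r, 29 := ones m, 28 := (if m = 0 then 1 # \<sigma> 28 else \<sigma> 28))"
  have a: "ex [Case 29 (\<lambda>f. if f = 0 then [Push 28 1] else [])] (Suc (Suc 0)) ?\<sigma>1a ?\<sigma>1b"
    by (rule ex_Case) (cases m; auto intro!: ex_Push simp: fun_eq_iff)
  have b: "ex (clear 29) (3 * Z + 1) ?\<sigma>1b ?\<sigma>2"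
    by (rule ex_clearI) (use mZ Cons.prems(2) in \<open>auto simp: fun_eq_iff\<close>)
  have t: "top0 (?\<sigma>1 8) = 5" by simp
  have tl: "?\<sigma>1(8 := tl (?\<sigma>1 8)) = ?\<sigma>1a" by (simp add: fun_eq_iff)
  have "ex [Case 8 (\<lambda>s. Pop 8 # (if s = 5 then Case 29 (\<lambda>f. if f = 0 then [Push 28 1] else []) # clear 29 else lit_check (s = 4)))]
     (Suc (Suc (Suc (Suc 0) + (3 * Z + 1)))) ?\<sigma>1 ?\<sigma>2"
    by (rule ex_Case, unfold append_Nil2 t, rule ex_Pop, unfold tl) (use ex_append[OF a b] in simp)
  from ex_While_True[where P = nonz, OF _ this c(2)[unfolded check_prog_def e]] t
  have "ex check_prog (Suc (Suc (Suc (Suc (Suc 0) + (3 * Z + 1))) + (length LS * (Z * lit_cost Z + 4 * Z + 10) + 1))) ?\<sigma>1 (\<sigma>(8 := [], 28 := ones c' @ \<sigma> 28))"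
    unfolding check_prog_def by simp
  then have k: "ex check_prog (length LS * (Z * lit_cost Z + 4 * Z + 10) + 3 * Z + 10) ?\<sigma>1 (\<sigma>(8 := [], 28 := ones c' @ \<sigma> 28))"
    by (rule ex_mono) simp
  have "ex check_prog (length (rev ls) * lit_cost Z + (length LS * (Z * lit_cost Z + 4 * Z + 10) + 3 * Z + 10)) \<sigma> (\<sigma>(8 := [], 28 := ones c' @ \<sigma> 28))"
  proof (rule ex_check_lits[where r = ?r])
    show "\<sigma> 8 = concat (map lq (rev ls)) @ 5 # ?r" using Cons.prems(1) by (simp add: seg_def[of ls])
    have "\<sigma>(8 := 5 # ?r, 29 := ones (length (filter ?h (rev ls))) @ \<sigma> 29) = ?\<sigma>1" using Cons.prems(2) by (simp add: m_def)
    then show "ex check_prog (length LS * (Z * lit_cost Z + 4 * Z + 10) + 3 * Z + 10) (\<sigma>(8 := 5 # ?r, 29 := ones (length (filter ?h (rev ls))) @ \<sigma> 29)) (\<sigma>(8 := [], 28 := ones c' @ \<sigma> 28))"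
      using k by (simp only:)
  qed (use Cons.prems in auto)
  moreover have "length (rev ls) * lit_cost Z \<le> Z * lit_cost Z" using lsZ by (intro mult_right_mono) auto
  moreover have "length (ls # LS) * (Z * lit_cost Z + 4 * Z + 10) = (Z * lit_cost Z + 4 * Z + 10) + length LS * (Z * lit_cost Z + 4 * Z + 10)" by simp
  ultimately have "ex check_prog (length (ls # LS) * (Z * lit_cost Z + 4 * Z + 10) + 1) \<sigma> (\<sigma>(8 := [], 28 := ones c' @ \<sigma> 28))"
    by (elim ex_mono) linarith
  moreover have "c' = 0 \<longleftrightarrow> (\<forall>ls\<in>set (ls # LS). \<exists>l\<in>set ls. ?h l)" using c(1) m0 by (auto simp: c'_def)
  ultimately show ?case by (intro exI[of _ c'] conjI)
qed

section \<open>The decision program\<close>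

text \<open>A step lengthens a stack by at most one, so the running time bounds the size of all that
  is written, in particular of the instance.\<close>

lemma ex_length: "ex p B \<sigma> \<sigma>' \<Longrightarrow> length (\<sigma>' i) \<le> length (\<sigma> i) + B"
proof -
  assume "ex p B \<sigma> \<sigma>'"
  then obtain n where n: "n \<le> B" "(sstep ^^ n) (p @ [], \<sigma>) = ([], \<sigma>')" unfolding ex_def exec_def by blast
  have "length (snd ((sstep ^^ n) (c, \<sigma>)) i) \<le> length (\<sigma> i) + n" for c
  proof (induction n)
    case (Suc n)
    obtain d \<rho> where z: "(sstep ^^ n) (c, \<sigma>) = (d, \<rho>)" by fastforce
    have "length (snd (sstep (d, \<rho>)) i) \<le> Suc (length (\<rho> i))"
    proof -
      have "length (apply_sop r xs) \<le> Suc (length xs)" for r xs by (cases r) auto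
      then show ?thesis unfolding sstep_def by (auto simp: Let_def)
    qed
    then show ?case using Suc z by simp
  qed simp
  from this[of "p @ []"] n show ?thesis by simp
qed

text \<open>As 1 codes \<open>False\<close>, one more 1 on \<open>ones w\<close> is the number 0 in
  \<open>w + 1\<close> bits, and \<open>ones w\<close> on top of a 2 is \<open>2 ^ w\<close>. Stack
  9 receives the length of a variable name, which is also the zero counter over all names.\<close>

definition param_prog :: "nat \<Rightarrow> nat \<Rightarrow> nat \<Rightarrow> cmd list" where
  "param_prog D1 D2 c = pour 0 5 @ consume 5 0 (\<lambda>a. [a]) 22 (\<lambda>_. [1]) @ binprog @ conv 23 3 (\<lambda>_. ones D1) @ pushes 3 (ones D1) @
     pour 3 5 @ consume 5 3 (\<lambda>a. [a]) 4 (\<lambda>_. ones D2) @ copy 3 18 5 @ [Push 18 1] @ [Push 19 2] @ copy 3 19 5 @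
     copy 4 9 5 @ copy 3 9 5 @ copy 3 9 5 @ pushes 9 (ones c)"

lemma concat_ones: "concat (map (\<lambda>_. ones d) xs) = ones (d * length xs)"
  by (induction xs) (auto simp: replicate_add)

lemma concat_map_single: "concat (map (\<lambda>a. [a]) xs) = xs"
  by (induction xs) auto

abbreviation (input) nil_store :: store where "nil_store \<equiv> \<lambda>_. []"

definition param_store :: "bool list \<Rightarrow> nat \<Rightarrow> nat \<Rightarrow> store" where
  "param_store x w k = nil_store(0 := map bsym x, 3 := ones w, 4 := ones k, 18 := map bsym (bits (Suc w) 0), 19 := map bsym (bits (Suc w) (2 ^ w)))"

lemma ex_param_prog:
  assumes w: "w = D1 * (length (binary (length x)) + 1)" and k: "k = D2 * w"
    and Z: "length x \<le> Z" "k + 2 * w + c \<le> Z" "D1 \<le> Z" "D2 \<le> Z" "length (binary (length x)) \<le> Z" "w \<le> Z"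
  shows "ex (param_prog D1 D2 c) (Z * (9 * Z + 11) + 2 * Z * Z + 100 * Z + 100) (sinit x) ((param_store x w k)(9 := ones (k + 2 * w + c)))"
proof -
  let ?n = "length x"
  let ?b = "length (binary ?n)"
  let ?\<sigma>1 = "nil_store(5 := rsym x)"
  let ?\<sigma>2 = "nil_store(0 := map bsym x, 22 := ones ?n)"
  let ?\<sigma>3 = "nil_store(0 := map bsym x, 23 := rsym (binary ?n))"
  let ?\<sigma>4 = "nil_store(0 := map bsym x, 3 := ones (D1 * ?b))"
  let ?\<sigma>5 = "nil_store(0 := map bsym x, 3 := ones w)"
  let ?\<sigma>6 = "nil_store(0 := map bsym x, 5 := ones w)"
  let ?\<sigma>7 = "nil_store(0 := map bsym x, 3 := ones w, 4 := ones k)"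
  let ?\<sigma>8 = "?\<sigma>7(18 := ones w)"
  let ?\<sigma>9 = "?\<sigma>7(18 := map bsym (bits (Suc w) 0))"
  let ?\<sigma>10 = "?\<sigma>9(19 := [2])"
  let ?\<sigma>11 = "param_store x w k"
  let ?\<sigma>12 = "?\<sigma>11(9 := ones k)"
  let ?\<sigma>13 = "?\<sigma>11(9 := ones (w + k))"
  let ?\<sigma>14 = "?\<sigma>11(9 := ones (w + (w + k)))"
  have 1: "ex (pour 0 5) (4 * Z + 1) (sinit x) ?\<sigma>1"
    by (rule ex_pourI) (use Z in \<open>auto simp: sinit_def fun_eq_iff bsym_def\<close>)
  have "ex (consume 5 0 (\<lambda>a. [a]) 22 (\<lambda>_. [1])) (length (rsym x) * (2 + 3) + 1) ?\<sigma>1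
    (?\<sigma>1(5 := [], 0 := rev (concat (map (\<lambda>a. [a]) (rsym x))) @ ?\<sigma>1 0, 22 := rev (concat (map (\<lambda>_. [1]) (rsym x))) @ ?\<sigma>1 22))"
    by (rule ex_consume) (auto simp: bsym_def)
  moreover have "?\<sigma>1(5 := [], 0 := rev (concat (map (\<lambda>a. [a]) (rsym x))) @ ?\<sigma>1 0, 22 := rev (concat (map (\<lambda>_. [1]) (rsym x))) @ ?\<sigma>1 22) = ?\<sigma>2"
    using concat_ones[of 1 "rsym x"] by (simp add: fun_eq_iff concat_map_single)
  ultimately have 2: "ex (consume 5 0 (\<lambda>a. [a]) 22 (\<lambda>_. [1])) (length (rsym x) * (2 + 3) + 1) ?\<sigma>1 ?\<sigma>2" by (simp only:)
  have "ex binprog (?n * (9 * Z + 11) + 1) ?\<sigma>2 (?\<sigma>2(22 := [], 23 := rsym (binary ?n) @ ?\<sigma>2 23))"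
    by (rule ex_binprog) (use Z in simp_all)
  moreover have "?\<sigma>2(22 := [], 23 := rsym (binary ?n) @ ?\<sigma>2 23) = ?\<sigma>3" by (simp add: fun_eq_iff)
  ultimately have 3: "ex binprog (?n * (9 * Z + 11) + 1) ?\<sigma>2 ?\<sigma>3" by (simp only:)
  have "ex (conv 23 3 (\<lambda>_. ones D1)) (length (rsym (binary ?n)) * (D1 + 3) + 1) ?\<sigma>3
     (?\<sigma>3(23 := [], 3 := rev (concat (map (\<lambda>_. ones D1) (rsym (binary ?n)))) @ ?\<sigma>3 3))"
    by (rule ex_conv) (auto simp: bsym_def)
  moreover have "?\<sigma>3(23 := [], 3 := rev (concat (map (\<lambda>_. ones D1) (rsym (binary ?n)))) @ ?\<sigma>3 3) = ?\<sigma>4"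
    unfolding concat_ones by (simp add: fun_eq_iff)
  ultimately have 4: "ex (conv 23 3 (\<lambda>_. ones D1)) (length (rsym (binary ?n)) * (D1 + 3) + 1) ?\<sigma>3 ?\<sigma>4" by (simp only:)
  have "ex (pushes 3 (ones D1)) D1 ?\<sigma>4 (?\<sigma>4(3 := rev (ones D1) @ ?\<sigma>4 3))" by (rule ex_pushes) auto
  moreover have "?\<sigma>4(3 := rev (ones D1) @ ?\<sigma>4 3) = ?\<sigma>5" by (simp add: fun_eq_iff w replicate_add)
  ultimately have 5: "ex (pushes 3 (ones D1)) D1 ?\<sigma>4 ?\<sigma>5" by (simp only:)
  have 6: "ex (pour 3 5) (4 * Z + 1) ?\<sigma>5 ?\<sigma>6" by (rule ex_pourI) (use Z in \<open>auto simp: fun_eq_iff\<close>)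
  have "ex (consume 5 3 (\<lambda>a. [a]) 4 (\<lambda>_. ones D2)) (length (ones w) * ((D2 + 1) + 3) + 1) ?\<sigma>6
    (?\<sigma>6(5 := [], 3 := rev (concat (map (\<lambda>a. [a]) (ones w))) @ ?\<sigma>6 3, 4 := rev (concat (map (\<lambda>_. ones D2) (ones w))) @ ?\<sigma>6 4))"
    by (rule ex_consume) auto
  moreover have "?\<sigma>6(5 := [], 3 := rev (concat (map (\<lambda>a. [a]) (ones w))) @ ?\<sigma>6 3, 4 := rev (concat (map (\<lambda>_. ones D2) (ones w))) @ ?\<sigma>6 4) = ?\<sigma>7"
    unfolding concat_ones concat_map_single by (simp add: fun_eq_iff k)
  ultimately have 7: "ex (consume 5 3 (\<lambda>a. [a]) 4 (\<lambda>_. ones D2)) (length (ones w) * ((D2 + 1) + 3) + 1) ?\<sigma>6 ?\<sigma>7" by (simp only:)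
  have 8: "ex (copy 3 18 5) (9 * Z + 2) ?\<sigma>7 ?\<sigma>8" by (rule ex_copyI) (use Z in auto)
  have b0: "map bsym (bits (Suc w) 0) = 1 # ones w" by (simp add: bits_zero bsym_def del: bits.simps)
  have bp: "map bsym (bits (Suc w) (2 ^ w)) = ones w @ [2]" by (simp add: bits_pow bsym_def del: bits.simps)
  have 9: "ex [Push 18 1] (Suc 0) ?\<sigma>8 ?\<sigma>9" by (rule ex_Push) (simp add: b0 fun_eq_iff del: bits.simps)
  have 10: "ex [Push 19 2] (Suc 0) ?\<sigma>9 ?\<sigma>10" by (rule ex_Push) (simp add: fun_eq_iff del: bits.simps)
  have 11: "ex (copy 3 19 5) (9 * Z + 2) ?\<sigma>10 ?\<sigma>11"
    by (rule ex_copyI) (use Z in \<open>auto simp: param_store_def bp fun_eq_iff simp del: bits.simps\<close>)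
  have 12: "ex (copy 4 9 5) (9 * Z + 2) ?\<sigma>11 ?\<sigma>12"
    by (rule ex_copyI) (use Z in \<open>auto simp: param_store_def fun_eq_iff simp del: bits.simps\<close>)
  have 13: "ex (copy 3 9 5) (9 * Z + 2) ?\<sigma>12 ?\<sigma>13"
    by (rule ex_copyI) (use Z in \<open>auto simp: param_store_def fun_eq_iff replicate_add simp del: bits.simps\<close>)
  have 14: "ex (copy 3 9 5) (9 * Z + 2) ?\<sigma>13 ?\<sigma>14"
    by (rule ex_copyI) (use Z in \<open>auto simp: param_store_def fun_eq_iff replicate_add simp del: bits.simps\<close>)
  have "ex (pushes 9 (ones c)) Z ?\<sigma>14 (?\<sigma>14(9 := rev (ones c) @ ?\<sigma>14 9))" by (rule ex_pushes) (use Z in auto)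
  moreover have "?\<sigma>14(9 := rev (ones c) @ ?\<sigma>14 9) = ?\<sigma>11(9 := ones (k + 2 * w + c))"
  proof -
    have "k + 2 * w + c = c + (w + (w + k))" by simp
    then show ?thesis by (simp only: replicate_add) (simp add: fun_eq_iff)
  qed
  ultimately have 15: "ex (pushes 9 (ones c)) Z ?\<sigma>14 (?\<sigma>11(9 := ones (k + 2 * w + c)))" by (simp only:)
  have c1: "?n * (9 * Z + 11) \<le> Z * (9 * Z + 11)" "length (rsym (binary ?n)) * (D1 + 3) \<le> Z * (Z + 3)"
    "length (ones w) * ((D2 + 1) + 3) \<le> Z * (Z + 4)" using Z by (auto intro!: mult_mono)
  define X1 where "X1 = ?n * (9 * Z + 11)"
  define X2 where "X2 = length (rsym (binary ?n)) * (D1 + 3)"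
  define X3 where "X3 = length (ones w) * ((D2 + 1) + 3)"
  define Y1 where "Y1 = Z * (9 * Z + 11)"
  define Y2 where "Y2 = Z * Z"
  have "X1 \<le> Y1" "X2 \<le> Y2 + 3 * Z" "X3 \<le> Y2 + 4 * Z" using c1 by (simp_all add: X1_def X2_def X3_def Y1_def Y2_def distrib_left)
  then have "4 * Z + 1 + (length (rsym x) * (2 + 3) + 1 + (X1 + 1 + (X2 + 1 + (D1 + (4 * Z + 1 + (X3 + 1 +
    (9 * Z + 2 + (Suc 0 + (Suc 0 + (9 * Z + 2 + (9 * Z + 2 + (9 * Z + 2 + (9 * Z + 2 + Z)))))))))))))
    \<le> Y1 + 2 * Y2 + 100 * Z + 100" using Z by simp
  with ex_append[OF 1 ex_append[OF 2 ex_append[OF 3[folded X1_def] ex_append[OF 4[folded X2_def] ex_append[OF 5 ex_append[OF 6 ex_append[OF 7[folded X3_def] ex_append[OF 8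
     ex_append[OF 9 ex_append[OF 10 ex_append[OF 11 ex_append[OF 12 ex_append[OF 13 ex_append[OF 14 15]]]]]]]]]]]]]]
  have "ex (param_prog D1 D2 c) (Y1 + 2 * Y2 + 100 * Z + 100) (sinit x) (?\<sigma>11(9 := ones (k + 2 * w + c)))"
    unfolding param_prog_def by (elim ex_mono)
  then show ?thesis by (simp add: Y1_def Y2_def mult.assoc)
qed

definition width_prog :: "nat \<Rightarrow> cmd list" where
  "width_prog c = copy 3 21 5 @ copy 3 21 5 @ copy 3 21 5 @ pushes 21 (ones c) @ copy 4 13 5 @ times 13 21 9 5 @ clear 21"

lemma ex_width_prog:
  assumes Z: "3 * w + c \<le> Z" "k \<le> Z" and \<sigma>: "\<sigma> = (param_store x w k)(7 := y)"
  shows "ex (width_prog c) (Z * (9 * Z + 4) + 50 * Z + 50) \<sigma> (\<sigma>(9 := ones (k * (3 * w + c))))"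
proof -
  let ?\<sigma>1 = "\<sigma>(21 := ones w)"
  let ?\<sigma>2 = "\<sigma>(21 := ones (w + w))"
  let ?\<sigma>3 = "\<sigma>(21 := ones (w + (w + w)))"
  let ?\<sigma>4 = "\<sigma>(21 := ones (3 * w + c))"
  let ?\<sigma>5 = "?\<sigma>4(13 := ones k)"
  let ?\<sigma>6 = "?\<sigma>4(9 := ones (k * (3 * w + c)))"
  have s: "\<sigma> 3 = ones w" "\<sigma> 4 = ones k" "\<sigma> 21 = []" "\<sigma> 5 = []" "\<sigma> 13 = []" "\<sigma> 9 = []"
    by (simp_all add: \<sigma> param_store_def)
  have 1: "ex (copy 3 21 5) (9 * Z + 2) \<sigma> ?\<sigma>1" by (rule ex_copyI) (use Z s in auto)
  have 2: "ex (copy 3 21 5) (9 * Z + 2) ?\<sigma>1 ?\<sigma>2" by (rule ex_copyI) (use Z s in \<open>auto simp: replicate_add\<close>)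
  have 3: "ex (copy 3 21 5) (9 * Z + 2) ?\<sigma>2 ?\<sigma>3" by (rule ex_copyI) (use Z s in \<open>auto simp: replicate_add\<close>)
  have "ex (pushes 21 (ones c)) Z ?\<sigma>3 (?\<sigma>3(21 := rev (ones c) @ ?\<sigma>3 21))" by (rule ex_pushes) (use Z in auto)
  moreover have "?\<sigma>3(21 := rev (ones c) @ ?\<sigma>3 21) = ?\<sigma>4"
  proof -
    have "3 * w + c = c + (w + (w + w))" by simp
    then show ?thesis by (simp only: replicate_add) simp
  qed
  ultimately have 4: "ex (pushes 21 (ones c)) Z ?\<sigma>3 ?\<sigma>4" by (simp only:)
  have 5: "ex (copy 4 13 5) (9 * Z + 2) ?\<sigma>4 ?\<sigma>5" by (rule ex_copyI) (use Z s in auto)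
  have "ex (times 13 21 9 5) (k * (9 * length (ones (3 * w + c)) + 4) + 1) ?\<sigma>5
     (?\<sigma>5(13 := [], 9 := ones (k * length (ones (3 * w + c))) @ ?\<sigma>5 9))"
    by (rule ex_times) (use s in auto)
  moreover have "?\<sigma>5(13 := [], 9 := ones (k * length (ones (3 * w + c))) @ ?\<sigma>5 9) = ?\<sigma>6"
    using s by (simp add: fun_eq_iff)
  ultimately have 6: "ex (times 13 21 9 5) (k * (9 * length (ones (3 * w + c)) + 4) + 1) ?\<sigma>5 ?\<sigma>6" by (simp only:)
  have 7: "ex (clear 21) (3 * Z + 1) ?\<sigma>6 (\<sigma>(9 := ones (k * (3 * w + c))))"
    by (rule ex_clearI) (use Z s in \<open>auto simp: fun_eq_iff\<close>)
  have "k * (9 * length (ones (3 * w + c)) + 4) \<le> Z * (9 * Z + 4)" using Z by (intro mult_mono) auto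
  then show ?thesis unfolding width_prog_def
    by (intro ex_mono[OF ex_append[OF 1 ex_append[OF 2 ex_append[OF 3 ex_append[OF 4 ex_append[OF 5 ex_append[OF 6 7]]]]]]]) linarith
qed

definition tuple_cl :: "(nat \<Rightarrow> slit list list) \<Rightarrow> nat \<Rightarrow> nat \<Rightarrow> nat \<Rightarrow> nat \<Rightarrow> bool list \<Rightarrow> nat \<Rightarrow> lit list" where
  "tuple_cl schs \<kappa> w k L x i = tuple_lits k (block_cl schs \<kappa> w x) (chunks L k (bits (L * k) i))"

definition tuple_cls :: "(nat \<Rightarrow> slit list list) \<Rightarrow> nat \<Rightarrow> nat \<Rightarrow> nat \<Rightarrow> nat \<Rightarrow> bool list \<Rightarrow> lit list list" where
  "tuple_cls schs \<kappa> w k L x = map (tuple_cl schs \<kappa> w k L x) [0..<2 ^ (L * k)]"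

definition write_prog :: "(nat \<Rightarrow> slit list list) \<Rightarrow> nat \<Rightarrow> nat \<Rightarrow> nat \<Rightarrow> nat \<Rightarrow> cmd list" where
  "write_prog schs \<kappa> a D1 D2 = param_prog D1 D2 (\<kappa> + 6) @ vs_prog @ es_prog @ clear 9 @ emit [True, False] @
     width_prog (6 + a) @ forbits 9 5 10 (tuple_prog schs \<kappa> a) @ emit [True, True] @ clear 9"

definition tuple_cost :: "nat \<Rightarrow> nat" where
  "tuple_cost Z = Z * (Z * (7 * Z + 20) + 400 * Z + 403) + 5 * Z * (45 * Z + 11) + 200 * Z + 200"

text \<open>All costs are expressed through a single bound \<open>Z\<close> on every size and every
  number of rounds, so that polynomiality in \<open>Z\<close> is the only thing to be shown about
  them.\<close>

definition write_cost :: "nat \<Rightarrow> nat" where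
  "write_cost Z = (Z * (9 * Z + 11) + 2 * Z * Z + 100 * Z + 100) + ((Z * (27 * Z + 31) + 10) + ((Z * (47 * Z + 89) + 10) +
     ((3 * Z + 1) + (2 + ((Z * (9 * Z + 4) + 50 * Z + 50) + ((Z * (tuple_cost Z + 7 * Z + 11) + 2) + (2 + (3 * Z + 1))))))))"

lemma polyb_write_cost: "polyb write_cost"
proof -
  have "polyb tuple_cost" unfolding tuple_cost_def by (intro polyb_add polyb_mult polyb_const polyb_id)
  then have "polyb (\<lambda>Z. (Z * (9 * Z + 11) + 2 * Z * Z + 100 * Z + 100) + ((Z * (27 * Z + 31) + 10) + ((Z * (47 * Z + 89) + 10) +
     ((3 * Z + 1) + (2 + ((Z * (9 * Z + 4) + 50 * Z + 50) + ((Z * (tuple_cost Z + 7 * Z + 11) + 2) + (2 + (3 * Z + 1)))))))))"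
    by (intro polyb_add polyb_mult polyb_const polyb_id)
  then show ?thesis unfolding write_cost_def[abs_def] .
qed

lemma enc_tri_con: "enc_tri W k LS = enc_list enc_nat (enc_vs W) @ enc_list (\<lambda>e. enc_edge e @ enc_rat 0) (enc_es W) @ enc_list (con_enc k) LS"
proof -
  have "(\<lambda>(fs, b). enc_list enc_edge fs @ enc_nat b) \<circ> (\<lambda>ls. (map ledge ls, length ls - k)) = con_enc k"
    by (auto simp: fun_eq_iff con_enc_def)
  then have "enc_list (\<lambda>(fs, b). enc_list enc_edge fs @ enc_nat b) (map (\<lambda>ls. (map ledge ls, length ls - k)) LS) = enc_list (con_enc k) LS"
    unfolding enc_list_def map_map by (simp only:)
  then show ?thesis unfolding enc_tri_def by (simp only:)
qed

lemma ex_write_prog: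
  assumes w: "w = D1 * (length (binary (length x)) + 1)" and k: "k = D2 * w" and L: "L = 3 * w + 6 + a" and W: "W = k + (\<kappa> + 2 * (w + 3))"
    and Z: "length x \<le> Z" "D1 \<le> Z" "D2 \<le> Z" "length (binary (length x)) \<le> Z" "L * k \<le> Z" "L \<le> Z" "2 ^ w + 3 \<le> Z" "W \<le> Z"
      "2 ^ W \<le> Z" "2 ^ (L * k) \<le> Z"
    and schs: "\<And>u v. length (sel (schs u) v) \<le> 5" "\<And>u v. sel (schs u) v \<noteq> []"
    and LS: "LS = tuple_cls schs \<kappa> w k L x"
  shows "ex (write_prog schs \<kappa> a D1 D2) (write_cost Z) (sinit x)
    ((param_store x w k)(7 := rsym (enc_tri W k LS), 8 := concat (map seg (rev LS))))"
proof -
  let ?P = "param_store x w k"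
  let ?n = "L * k"
  let ?y1 = "enc_list enc_nat (enc_vs W)"
  let ?y2 = "enc_list (\<lambda>e. enc_edge e @ enc_rat 0) (enc_es W)"
  let ?pre = "?y1 @ ?y2 @ [True, False]"
  let ?l = "tuple_cl schs \<kappa> w k L x"
  let ?c = "\<lambda>i. concat (map (con_enc k) (map ?l [0..<i]))"
  let ?q = "\<lambda>i. concat (map seg (rev (map ?l [0..<i])))"
  let ?st = "\<lambda>i. ?P(7 := rsym (?pre @ ?c i), 8 := ?q i)"
  have Ps: "?P 9 = []" "?P 5 = []" "?P 7 = []" "?P 10 = []" "?P 8 = []" by (simp_all add: param_store_def)
  have W': "k + 2 * w + (\<kappa> + 6) = W" by (simp add: W)
  have 1: "ex (param_prog D1 D2 (\<kappa> + 6)) (Z * (9 * Z + 11) + 2 * Z * Z + 100 * Z + 100) (sinit x) (?P(9 := ones W))"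
    using ex_param_prog[OF w k, of Z "\<kappa> + 6"] Z W' by (simp add: L)
  have "ex vs_prog (2 ^ W * (27 * Z + 31) + 10) (?P(9 := ones W)) (?P(9 := ones W, 7 := rsym ?y1))"
    by (rule ex_vs_prog) (use Ps Z in \<open>auto simp: fun_eq_iff\<close>)
  moreover have "2 ^ W * (27 * Z + 31) \<le> Z * (27 * Z + 31)" using Z by (intro mult_right_mono) auto
  ultimately have 2: "ex vs_prog (Z * (27 * Z + 31) + 10) (?P(9 := ones W)) (?P(9 := ones W, 7 := rsym ?y1))" by (elim ex_mono) simp
  have "ex es_prog (2 ^ W * (47 * Z + 89) + 10) (?P(9 := ones W, 7 := rsym ?y1)) (?P(9 := ones W, 7 := rsym (?y1 @ ?y2)))"
    by (rule ex_es_prog) (use Ps Z in \<open>auto simp: fun_eq_iff\<close>)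
  moreover have "2 ^ W * (47 * Z + 89) \<le> Z * (47 * Z + 89)" using Z by (intro mult_right_mono) auto
  ultimately have 3: "ex es_prog (Z * (47 * Z + 89) + 10) (?P(9 := ones W, 7 := rsym ?y1)) (?P(9 := ones W, 7 := rsym (?y1 @ ?y2)))" by (elim ex_mono) simp
  have 4: "ex (clear 9) (3 * Z + 1) (?P(9 := ones W, 7 := rsym (?y1 @ ?y2))) (?P(7 := rsym (?y1 @ ?y2)))"
    by (rule ex_clearI) (use Ps Z in \<open>auto simp: fun_eq_iff\<close>)
  have 5: "ex (emit [True, False]) 2 (?P(7 := rsym (?y1 @ ?y2))) (?P(7 := rsym ?pre))"
    using ex_emitI[of "?P(7 := rsym ?pre)" "?P(7 := rsym (?y1 @ ?y2))" "[True, False]"] by (simp add: fun_eq_iff numeral_2_eq_2)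
  have kL: "k * (3 * w + (6 + a)) = ?n" by (simp add: L)
  have kZ: "k \<le> Z" using Z(8) by (simp add: W)
  have 6: "ex (width_prog (6 + a)) (Z * (9 * Z + 4) + 50 * Z + 50) (?P(7 := rsym ?pre)) (?P(7 := rsym ?pre, 9 := ones ?n))"
    using ex_width_prog[of w "6 + a" Z k "?P(7 := rsym ?pre)" x "rsym ?pre"] Z(6) kZ unfolding kL by (simp add: L)
  have 7: "ex (forbits 9 5 10 (tuple_prog schs \<kappa> a)) (2 ^ ?n * (tuple_cost Z + 7 * Z + 11) + 2) (?P(7 := rsym ?pre, 9 := ones ?n)) ((?st (2 ^ ?n))(9 := ones ?n))"
  proof (rule ex_forbitsI[where st = ?st and n = ?n])
    fix i :: nat assume i: "i < 2 ^ ?n"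
    show "ex (tuple_prog schs \<kappa> a) (tuple_cost Z) ((?st i)(9 := map bsym (bits ?n i), 10 := [1])) ((?st (Suc i))(9 := map bsym (bits ?n i), 10 := [1]))"
      unfolding tuple_cost_def
    proof (rule ex_tuple_prog[where w = w and x = x and k = k and \<tau> = "bits ?n i" and L = L and ls = "?l i"])
      show "blk_pre ((?st i)(9 := map bsym (bits ?n i), 10 := [1])) w x"
        by (simp add: blk_pre_def param_store_def del: bits.simps)
      show "(?st (Suc i))(9 := map bsym (bits ?n i), 10 := [1]) = ((?st i)(9 := map bsym (bits ?n i), 10 := [1]))
          (7 := rsym (con_enc k (?l i)) @ ((?st i)(9 := map bsym (bits ?n i), 10 := [1])) 7,
           8 := seg (?l i) @ ((?st i)(9 := map bsym (bits ?n i), 10 := [1])) 8)"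
        by (simp add: fun_eq_iff)
      show "?l i = tuple_lits k (block_cl schs \<kappa> w x) (chunks L k (bits ?n i))" by (simp add: tuple_cl_def)
    qed (use Z schs in \<open>simp_all add: param_store_def L W\<close>)
  next
    show "?P(7 := rsym ?pre, 9 := ones ?n) = (?st 0)(9 := ones ?n, 10 := [])" using Ps by (simp add: fun_eq_iff)
    show "(?st (2 ^ ?n))(9 := ones ?n) = (?st (2 ^ ?n))(9 := ones ?n, 10 := [])" using Ps by (simp add: fun_eq_iff)
  qed (use Ps Z in \<open>simp_all\<close>)
  have "2 ^ ?n * (tuple_cost Z + 7 * Z + 11) \<le> Z * (tuple_cost Z + 7 * Z + 11)" using Z by (intro mult_right_mono) auto
  with 7 have 7: "ex (forbits 9 5 10 (tuple_prog schs \<kappa> a)) (Z * (tuple_cost Z + 7 * Z + 11) + 2) (?P(7 := rsym ?pre, 9 := ones ?n)) ((?st (2 ^ ?n))(9 := ones ?n))"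
    by (elim ex_mono) simp
  let ?F = "?P(7 := rsym (enc_tri W k LS), 8 := concat (map seg (rev LS)))"
  have y: "enc_tri W k LS = ?pre @ ?c (2 ^ ?n) @ [True, True]"
    unfolding enc_tri_con LS tuple_cls_def enc_list_def[of "con_enc k"] by simp
  have 8: "ex (emit [True, True]) 2 ((?st (2 ^ ?n))(9 := ones ?n)) (?F(9 := ones ?n))"
  proof -
    have "?F(9 := ones ?n) = ((?st (2 ^ ?n))(9 := ones ?n))(7 := rsym [True, True] @ ((?st (2 ^ ?n))(9 := ones ?n)) 7)"
      unfolding y by (simp add: fun_eq_iff LS tuple_cls_def)
    from ex_emitI[OF this] show ?thesis by (simp add: numeral_2_eq_2)
  qed
  have 9: "ex (clear 9) (3 * Z + 1) (?F(9 := ones ?n)) ?F"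
    by (rule ex_clearI) (use Ps Z in \<open>auto simp: fun_eq_iff\<close>)
  from ex_append[OF 1 ex_append[OF 2 ex_append[OF 3 ex_append[OF 4 ex_append[OF 5 ex_append[OF 6 ex_append[OF 7 ex_append[OF 8 9]]]]]]]]
  show ?thesis unfolding write_prog_def write_cost_def .
qed

text \<open>Stack 7 holds the instance in reverse. Moving it to stack 31, the right half of tape 0
  of the simulated machine, restores the order and shifts the symbols to their stored form.\<close>

definition main_prog :: "tm \<Rightarrow> (nat \<Rightarrow> slit list list) \<Rightarrow> nat \<Rightarrow> nat \<Rightarrow> nat \<Rightarrow> nat \<Rightarrow> cmd list" where
  "main_prog M schs \<kappa> a D1 D2 = write_prog schs \<kappa> a D1 D2 @ conv 7 31 (\<lambda>a. [if a = 2 then 3 else 2]) @ sim M 30 26 5 @ check_prog @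
     [Case 28 (\<lambda>b. [Push 2 (if b = 0 then 2 else 1)])]"

lemma ex_main_prog:
  assumes out: "ex (write_prog schs \<kappa> a D1 D2) B (sinit x) ((param_store x w k)(7 := rsym y, 8 := concat (map seg (rev LS))))"
    and M: "wf_tm M" "fst (run M y t) = 1" "fst (snd (run M y t) ! 1) = bit_tape z"
    and Z: "4 * t + B \<le> Z" "\<forall>ls\<in>set LS. length ls \<le> Z \<and> (\<forall>l\<in>set ls. 2 * length (snd l) + 10 \<le> Z)" "length LS \<le> Z"
  shows "\<exists>\<sigma>'. ex (main_prog M schs \<kappa> a D1 D2) (Z * (6 * ntapes M + 60) + Z * (Z * lit_cost Z + 4 * Z + 10) + 6 * ntapes M + 60) (sinit x) \<sigma>' \<and> \<sigma>' 1 = [] \<and>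
    top0 (\<sigma>' 2) = bsym (\<forall>ls\<in>set LS. \<exists>l\<in>set ls. holds (\<lambda>s. \<not> found z s) l)"
proof -
  let ?P = "param_store x w k"
  let ?q = "concat (map seg (rev LS))"
  let ?\<sigma>1 = "?P(7 := rsym y, 8 := ?q)"
  let ?\<sigma>2 = "?P(8 := ?q, 31 := map (\<lambda>a. Suc (bsym a)) y)"
  have yB: "length y \<le> B" using ex_length[OF out, of 7] by (simp add: sinit_def)
  have "ex (conv 7 31 (\<lambda>a. [if a = 2 then 3 else 2])) (length (rsym y) * (1 + 3) + 1) ?\<sigma>1
    (?\<sigma>1(7 := [], 31 := rev (concat (map (\<lambda>a. [if a = 2 then 3 else 2]) (rsym y))) @ ?\<sigma>1 31))"
    by (rule ex_conv) (auto simp: bsym_def)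
  moreover have "?\<sigma>1(7 := [], 31 := rev (concat (map (\<lambda>a. [if a = 2 then 3 else 2]) (rsym y))) @ ?\<sigma>1 31) = ?\<sigma>2"
  proof -
    have "rev (concat (map (\<lambda>a. [if a = 2 then 3 else 2]) (rsym y))) = map (\<lambda>a. Suc (bsym a)) y"
      by (induction y) (auto simp: bsym_def)
    then show ?thesis by (simp add: fun_eq_iff param_store_def)
  qed
  ultimately have 2: "ex (conv 7 31 (\<lambda>a. [if a = 2 then 3 else 2])) (length (rsym y) * (1 + 3) + 1) ?\<sigma>1 ?\<sigma>2" by (simp only:)
  have "\<exists>\<sigma>'. ex (sim M 30 26 5) ((t + length y + 1) * (6 * ntapes M + 50)) ?\<sigma>2 \<sigma>' \<and> \<sigma>' 26 = map bsym z @ ?\<sigma>2 26 \<and>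
    (\<forall>i. i < 30 \<and> i \<noteq> 26 \<or> 30 + 2 * ntapes M < i \<longrightarrow> \<sigma>' i = ?\<sigma>2 i) \<and> length z \<le> 4 * t + length y"
  proof (rule ex_sim[OF M])
    fix i :: nat assume "30 \<le> i" "i \<le> 30 + 2 * ntapes M"
    then show "?\<sigma>2 i = (if i = 30 + 1 then map (\<lambda>x. Suc (bsym x)) y else [])" by (simp add: param_store_def)
  qed (simp_all add: param_store_def)
  then obtain \<sigma>3 where s3: "ex (sim M 30 26 5) ((t + length y + 1) * (6 * ntapes M + 50)) ?\<sigma>2 \<sigma>3" "\<sigma>3 26 = map bsym z @ ?\<sigma>2 26"
    "\<forall>i. i < 30 \<and> i \<noteq> 26 \<or> 30 + 2 * ntapes M < i \<longrightarrow> \<sigma>3 i = ?\<sigma>2 i" "length z \<le> 4 * t + length y"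
    by (elim exE conjE) (rule that)
  have fr: "\<sigma>3 i = ?\<sigma>2 i" if "i < 30" "i \<noteq> 26" for i using s3(3) that by blast
  have "\<exists>c. (c = 0 \<longleftrightarrow> (\<forall>ls\<in>set (rev LS). \<exists>l\<in>set ls. holds (\<lambda>s. \<not> found z s) l)) \<and>
     ex check_prog (length (rev LS) * (Z * lit_cost Z + 4 * Z + 10) + 1) \<sigma>3 (\<sigma>3(8 := [], 28 := ones c @ \<sigma>3 28))"
  proof (rule ex_check_segs)
    show "\<sigma>3 8 = concat (map seg (rev LS))" by (simp add: fr)
    show "\<sigma>3 29 = []" by (simp add: fr param_store_def)
    show "\<forall>i\<in>{5, 12, 20, 21, 23, 24, 25, 27}. \<sigma>3 i = []" by (simp add: fr param_store_def)
    show "\<sigma>3 26 = map bsym z" by (simp add: s3(2) param_store_def)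
    show "length z \<le> Z" using s3(4) yB Z(1) by simp
    show "\<forall>ls\<in>set (rev LS). length ls \<le> Z \<and> (\<forall>l\<in>set ls. 2 * length (snd l) + 10 \<le> Z)" using Z(2) by simp
  qed
  then obtain c where c: "c = 0 \<longleftrightarrow> (\<forall>ls\<in>set (rev LS). \<exists>l\<in>set ls. holds (\<lambda>s. \<not> found z s) l)"
     "ex check_prog (length (rev LS) * (Z * lit_cost Z + 4 * Z + 10) + 1) \<sigma>3 (\<sigma>3(8 := [], 28 := ones c @ \<sigma>3 28))"
    by (elim exE conjE) (rule that)
  let ?\<sigma>4 = "\<sigma>3(8 := [], 28 := ones c @ \<sigma>3 28)"
  let ?\<sigma>5 = "?\<sigma>4(2 := [if c = 0 then 2 else 1])"
  have f: "\<sigma>3 28 = []" "\<sigma>3 2 = []" "\<sigma>3 1 = []" by (simp_all add: fr param_store_def)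
  have 5: "ex [Case 28 (\<lambda>b. [Push 2 (if b = 0 then 2 else 1)])] (Suc (Suc 0)) ?\<sigma>4 ?\<sigma>5"
  proof (rule ex_Case, unfold append_Nil2, rule ex_Push)
    show "ex [] 0 (?\<sigma>4(2 := if (if top0 (?\<sigma>4 28) = 0 then 2 else 1) = (0::nat) then ?\<sigma>4 2 else (if top0 (?\<sigma>4 28) = 0 then 2 else 1) # ?\<sigma>4 2)) ?\<sigma>5"
      using f by (cases c) (simp_all add: fun_eq_iff)
  qed
  have "(t + length y + 1) * (6 * ntapes M + 50) \<le> (Z + 1) * (6 * ntapes M + 50)" using yB Z(1) by (intro mult_right_mono) auto
  moreover have "length (rev LS) * (Z * lit_cost Z + 4 * Z + 10) \<le> Z * (Z * lit_cost Z + 4 * Z + 10)"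
    using Z(3) unfolding length_rev by (rule mult_right_mono) simp
  moreover have "(Z + 1) * (6 * ntapes M + 50) + 10 * Z = Z * (6 * ntapes M + 60) + 6 * ntapes M + 50" by (simp add: algebra_simps)
  moreover have "length (rsym y) * (1 + 3) + B \<le> 5 * Z" using yB Z(1) by simp
  ultimately have "B + (length (rsym y) * (1 + 3) + 1 + ((t + length y + 1) * (6 * ntapes M + 50) + (length (rev LS) * (Z * lit_cost Z + 4 * Z + 10) + 1 + Suc (Suc 0))))
    \<le> Z * (6 * ntapes M + 60) + Z * (Z * lit_cost Z + 4 * Z + 10) + 6 * ntapes M + 60" by linarith
  with ex_append[OF out ex_append[OF 2 ex_append[OF s3(1) ex_append[OF c(2) 5]]]]
  have "ex (main_prog M schs \<kappa> a D1 D2) (Z * (6 * ntapes M + 60) + Z * (Z * lit_cost Z + 4 * Z + 10) + 6 * ntapes M + 60) (sinit x) ?\<sigma>5"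
    unfolding main_prog_def by (elim ex_mono)
  moreover have "?\<sigma>5 1 = []" using f by simp
  moreover have "top0 (?\<sigma>5 2) = bsym (\<forall>ls\<in>set LS. \<exists>l\<in>set ls. holds (\<lambda>s. \<not> found z s) l)"
    using c(1) by (simp add: bsym_def)
  ultimately show ?thesis by (intro exI[of _ ?\<sigma>5] conjI)
qed

section \<open>Well-formedness of the decision program\<close>

lemma wfp_concat: "\<forall>p\<in>set ps. wfp K S p \<Longrightarrow> wfp K S (concat ps)"
  by (induction ps) auto

lemma wfp_rdb: "11 < K \<Longrightarrow> \<forall>v. wfp K S (f v) \<Longrightarrow> wfp K S (rdb a p v f)"
  by (induction a p v f rule: rdb.induct) auto

lemma wfp_times: "i < K \<Longrightarrow> i \<noteq> 1 \<Longrightarrow> x < K \<Longrightarrow> x \<noteq> 1 \<Longrightarrow> t < K \<Longrightarrow> t \<noteq> 1 \<Longrightarrow> b < K \<Longrightarrow> b \<noteq> 1 \<Longrightarrow> 1 < S \<Longrightarrow> wfp K S (times i x b t)"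
  by (simp add: times_def)

context
  fixes K S :: nat
  assumes K: "31 < K" and S: "5 < S"
begin

lemma wfp_load: "wfp K S load"
  using K S by (simp add: load_def)

lemma wfp_lookup: "wfp K S lookup"
  using K S by (simp add: lookup_def)

lemma wfp_ref_prog: "wfp K S (ref_prog r)"
  using K S by (cases r) (simp_all add: bsym_less)

lemma wfp_lit_prog: "wfp K S (lit_prog \<kappa> l)"
  using K S by (auto simp: lit_prog_def wfp_ref_prog bsym_less split: prod.split)

lemma wfp_clause_prog: "wfp K S (clause_prog \<kappa> sch)"
  using K S by (auto simp: clause_prog_def intro!: wfp_concat wfp_lit_prog)

lemma wfp_block_prog: "wfp K S (block_prog schs \<kappa> a)"
  using K S by (auto simp: block_prog_def wfp_load wfp_lookup wfp_clause_prog intro!: wfp_rdb)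

lemma wfp_binprog: "wfp K S binprog"
  using K S by (simp add: binprog_def halve_def)

lemma wfp_tuple_prog: "wfp K S (tuple_prog schs \<kappa> a)"
  using K S by (simp add: tuple_prog_def wfp_block_prog wfp_binprog)

lemma wfp_write_prog: "wfp K S (write_prog schs \<kappa> a D1 D2)"
  using K S by (auto simp: write_prog_def param_prog_def width_prog_def vs_prog_def es_prog_def wfp_tuple_prog wfp_binprog intro!: wfp_times)

lemma wfp_lit_check: "wfp K S (lit_check g)"
  using K S by (auto simp: lit_check_def search_loop_def match_prog_def match_loop_def shift1_def bsym_less)

lemma wfp_check_prog: "wfp K S check_prog"
  using K S by (auto simp: check_prog_def wfp_lit_check)

lemma wfp_main_prog:
  assumes "wf_tm M" "30 + 2 * ntapes M < K" "nstates M + nsyms M < S"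
  shows "wfp K S (main_prog M schs \<kappa> a D1 D2)"
  using K S assms by (auto simp: main_prog_def wfp_write_prog wfp_check_prog intro!: wfp_sim)

end

section \<open>Correctness of the decision program\<close>

lemma schema_length_le:
  assumes "sch \<in> set (schemas Q K S p u)" shows "length sch \<le> 5"
  using assms
proof (cases rule: schemas_cases)
  case (step c s)
  obtain r c' where "cact c s = (r, c')" by fastforce
  then show ?thesis using step(3) by (cases r) (auto simp: step_schemas_def Let_def)
next
  case heap
  then show ?thesis by (auto simp: heap_schemas_def)
qed auto

text \<open>Blocks only select schemas for input symbols, which are smaller than \<open>S\<close>; the cutoff makes the family of lists total.\<close>

definition sym_schemas :: "cmd list list \<Rightarrow> nat \<Rightarrow> nat \<Rightarrow> cmd list \<Rightarrow> nat \<Rightarrow> slit list list" where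
  "sym_schemas Q K S p u = schemas Q K S p (if u < S then u else 0)"

text \<open>The number of schemas, the same for every input symbol, doubles as the number of
  selector bits; again \<open>n < 2 ^ n\<close> makes this enough.\<close>

definition schema_bits :: "cmd list list \<Rightarrow> nat \<Rightarrow> nat \<Rightarrow> cmd list \<Rightarrow> nat" where
  "schema_bits Q K S p = length (schemas Q K S p 0)"

lemma chunks_all:
  assumes "length \<tau> = L * k" "\<beta> \<in> set (chunks L k \<tau>)"
  shows "length \<beta> = L"
proof -
  obtain j where j: "j < k" "\<beta> = take L (drop (j * L) \<tau>)" using assms(2) by (auto simp: chunks_def)
  have "Suc j * L \<le> k * L" using j(1) by (intro mult_right_mono) auto
  then show ?thesis using j assms(1) by (simp add: mult.commute)
qed

lemma chunks_concat:
  assumes "\<forall>\<beta>\<in>set \<beta>s. length \<beta> = L"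
  shows "chunks L (length \<beta>s) (concat \<beta>s) = \<beta>s"
proof (rule nth_equalityI)
  have *: "j < length \<beta>s \<Longrightarrow> take L (drop (j * L) (concat \<beta>s)) = \<beta>s ! j" for j
    using assms
  proof (induction \<beta>s arbitrary: j)
    case (Cons \<beta> \<beta>s)
    show ?case
    proof (cases j)
      case 0
      then show ?thesis using Cons.prems by simp
    next
      case (Suc j')
      have "drop (L + j' * L) (\<beta> @ concat \<beta>s) = drop (j' * L) (concat \<beta>s)" using Cons.prems by simp
      then show ?thesis using Cons.IH[of j'] Cons.prems Suc by simp
    qed
  qed simp
  fix j assume "j < length (chunks L (length \<beta>s) (concat \<beta>s))"
  then show "chunks L (length \<beta>s) (concat \<beta>s) ! j = \<beta>s ! j" using * by (simp add: chunks_def)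
qed (simp add: chunks_def)

lemma length_tuple_lits:
  assumes "\<And>\<beta>. length (cl \<beta>) \<le> b" shows "length (tuple_lits k cl \<tau>) \<le> b * k"
proof -
  have "length (tuple_lits k cl \<tau>) = (\<Sum>j\<leftarrow>[0..<k]. length (cl (\<tau> ! j)))"
    by (simp add: tuple_lits_def copy_lits_def length_concat comp_def)
  also have "\<dots> \<le> (\<Sum>j\<leftarrow>[0..<k]. b)" using assms by (intro sum_list_mono) auto
  finally show ?thesis by (simp add: sum_list_triv mult.commute)
qed

context
  fixes Q :: "cmd list list" and K S :: nat and p :: "cmd list" and schs \<kappa> a
  assumes good: "good_states K S (set Q)" and p: "p \<in> set Q" and K: "3 \<le> K" and S: "3 \<le> S"
  defines "schs \<equiv> sym_schemas Q K S p" and "\<kappa> \<equiv> kwidth Q K S" and "a \<equiv> schema_bits Q K S p"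
begin

lemma schs_ne: "schs u \<noteq> []"
  by (simp add: schs_def sym_schemas_def schemas_def heap_schemas_def)

lemma schs_in: "sel (schs u) v \<in> set (schemas Q K S p (if u < S then u else 0))"
  using sel_in[OF schs_ne] by (simp add: schs_def sym_schemas_def)

lemma sel_schs: "length (sel (schs u) v) \<le> 5" "sel (schs u) v \<noteq> []"
  "distinct (map (\<lambda>(g, k, r, r'). (g, k)) (sel (schs u) v))" "\<forall>(g, k, r, r')\<in>set (sel (schs u) v). k < \<kappa>"
proof -
  have "(if u < S then u else 0) < S" using S by simp
  note schema_literals_distinct[OF schs_in refl good p this S K]
  then show "sel (schs u) v \<noteq> []" "distinct (map (\<lambda>(g, k, r, r'). (g, k)) (sel (schs u) v))"
    "\<forall>(g, k, r, r')\<in>set (sel (schs u) v). k < \<kappa>" unfolding \<kappa>_def by blast+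
  show "length (sel (schs u) v) \<le> 5" using schema_length_le[OF schs_in] .
qed

lemma symbol_less: "nth0 (map bsym x) t < S"
  using S by (auto simp: nth0_def bsym_def)

lemma schs_symbol: "schs (nth0 (map bsym x) t) = schemas Q K S p (nth0 (map bsym x) t)"
  using symbol_less by (simp add: schs_def sym_schemas_def)

lemma length_schs: "length (schs u) < 2 ^ a"
proof -
  have "length (schs u) = a" by (simp add: schs_def sym_schemas_def a_def schema_bits_def schemas_def heap_schemas_def)
  then show ?thesis by simp
qed

lemma block_cl_good:
  assumes "length \<beta> = 3 * w + 6 + a"
  shows "block_cl schs \<kappa> w x \<beta> \<noteq> [] \<and> distinct (block_cl schs \<kappa> w x \<beta>) \<and> (\<forall>l\<in>set (block_cl schs \<kappa> w x \<beta>). length (snd l) = \<kappa> + 2 * (w + 3))"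
proof -
  define t where "t = unbits (take w \<beta>)"
  define n where "n = take (w + 3) (drop w \<beta>)"
  define m where "m = take (w + 3) (drop (2 * w + 3) \<beta>)"
  define sch where "sch = sel (schs (nth0 (map bsym x) t)) (unbits (drop (3 * w + 6) \<beta>))"
  have b: "block_cl schs \<kappa> w x \<beta> = inst \<kappa> w t n m sch" by (simp add: block_cl_def t_def n_def m_def sch_def Let_def)
  have len: "length n = w + 3" "length m = w + 3" using assms by (auto simp: n_def m_def)
  have ev: "length (ev w t n m r) = w + 3" for r using len by (cases r) auto
  have sch: "sch \<noteq> []" "distinct (map (\<lambda>(g, k, r, r'). (g, k)) sch)" "\<forall>(g, k, r, r')\<in>set sch. k < \<kappa>"
    unfolding sch_def using sel_schs by blast+
  have inj: "bits \<kappa> i = bits \<kappa> j \<longleftrightarrow> i = j" if "i < \<kappa>" "j < \<kappa>" for i j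
    using that by (intro bits_inj) (auto intro: less_trans[OF _ less_exp])
  have "distinct (map (\<lambda>(g, c, r, r'). (g, lit_name \<kappa> c (ev w t n m r) (ev w t n m r'))) sch)"
    using sch(2,3)
  proof (induction sch)
    case (Cons l sch)
    obtain g c r r' where l: "l = (g, c, r, r')" by (cases l)
    have "(g, lit_name \<kappa> c (ev w t n m r) (ev w t n m r')) \<noteq> (g', lit_name \<kappa> c' (ev w t n m q) (ev w t n m q'))"
      if "(g', c', q, q') \<in> set sch" for g' c' q q'
    proof
      assume e: "(g, lit_name \<kappa> c (ev w t n m r) (ev w t n m r')) = (g', lit_name \<kappa> c' (ev w t n m q) (ev w t n m q'))"
      then have "take \<kappa> (lit_name \<kappa> c (ev w t n m r) (ev w t n m r')) = take \<kappa> (lit_name \<kappa> c' (ev w t n m q) (ev w t n m q'))" by simp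
      then have "bits \<kappa> c = bits \<kappa> c'" by (simp add: lit_name_def)
      moreover have "c < \<kappa>" "c' < \<kappa>" using Cons.prems(2) that l by auto
      ultimately have "c = c'" using inj by blast
      then have "(g, c) \<in> (\<lambda>(g, k, r, r'). (g, k)) ` set sch" using e that by force
      then show False using Cons.prems(1) unfolding l list.map distinct.simps set_map prod.case by blast
    qed
    then show ?case using Cons l by (auto split: prod.splits)
  qed simp
  then have "distinct (inst \<kappa> w t n m sch)" by (simp add: inst_def)
  moreover have "\<forall>l\<in>set (inst \<kappa> w t n m sch). length (snd l) = \<kappa> + 2 * (w + 3)"
    by (auto simp: inst_def lit_name_def ev)
  moreover have "inst \<kappa> w t n m sch \<noteq> []" using sch(1) by (simp add: inst_def)
  ultimately show ?thesis unfolding b by blast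
qed

lemma length_block_cl: "length (block_cl schs \<kappa> w x \<beta>) \<le> 5"
  using sel_schs(1) by (simp add: block_cl_def inst_def Let_def)

text \<open>Every time, pair of nodes and schema has an address, and every address decodes to such a
  combination; so quantifying over strings of length \<open>3 * w + 6 + a\<close> means quantifying
  over all clauses.\<close>

lemma blocks_sat:
  "(\<forall>\<beta>. length \<beta> = 3 * w + 6 + a \<longrightarrow> (\<exists>l\<in>set (block_cl schs \<kappa> w x \<beta>). holds A l)) \<longleftrightarrow> tableau_sat Q K S p w x A"
proof
  assume sat: "\<forall>\<beta>. length \<beta> = 3 * w + 6 + a \<longrightarrow> (\<exists>l\<in>set (block_cl schs \<kappa> w x \<beta>). holds A l)"
  show "tableau_sat Q K S p w x A"
    unfolding tableau_sat_def
  proof (intro allI impI ballI)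
    fix t :: nat and n m :: "bool list" and sch
    assume t: "t < 2 ^ w" and n: "length n = w + 3" and m: "length m = w + 3"
      and "sch \<in> set (schemas Q K S p (nth0 (map bsym x) t))"
    then obtain v where v: "v < length (schs (nth0 (map bsym x) t))" "sch = schs (nth0 (map bsym x) t) ! v"
      unfolding schs_symbol by (metis in_set_conv_nth)
    let ?\<beta> = "bits w t @ n @ m @ bits a v"
    have "v < 2 ^ a" using v(1) length_schs less_trans by blast
    then have "sel (schs (nth0 (map bsym x) t)) (unbits (bits a v)) = sch" using v by (simp add: sel_def)
    moreover have "take w ?\<beta> = bits w t" "take (w + 3) (drop w ?\<beta>) = n" "take (w + 3) (drop (2 * w + 3) ?\<beta>) = m" "drop (3 * w + 6) ?\<beta> = bits a v"
      using n m by auto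
    ultimately have "block_cl schs \<kappa> w x ?\<beta> = inst \<kappa> w t n m sch"
      unfolding block_cl_def using t by (simp add: Let_def)
    moreover have "length ?\<beta> = 3 * w + 6 + a" using n m by simp
    ultimately show "\<exists>l\<in>set (inst (kwidth Q K S) w t n m sch). holds A l" using sat unfolding \<kappa>_def by metis
  qed
next
  assume sat: "tableau_sat Q K S p w x A"
  show "\<forall>\<beta>. length \<beta> = 3 * w + 6 + a \<longrightarrow> (\<exists>l\<in>set (block_cl schs \<kappa> w x \<beta>). holds A l)"
  proof (intro allI impI)
    fix \<beta> :: "bool list" assume len: "length \<beta> = 3 * w + 6 + a"
    define t where "t = unbits (take w \<beta>)"
    have "length (take w \<beta>) = w" using len by simp
    then have "t < 2 ^ w" using unbits_less[of "take w \<beta>"] by (simp add: t_def)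
    moreover have "length (take (w + 3) (drop w \<beta>)) = w + 3" "length (take (w + 3) (drop (2 * w + 3) \<beta>)) = w + 3" using len by auto
    moreover have "sel (schs (nth0 (map bsym x) t)) (unbits (drop (3 * w + 6) \<beta>)) \<in> set (schemas Q K S p (nth0 (map bsym x) t))"
      using sel_in[OF schs_ne] unfolding schs_symbol[symmetric] .
    ultimately show "\<exists>l\<in>set (block_cl schs \<kappa> w x \<beta>). holds A l"
      using sat unfolding tableau_sat_def block_cl_def t_def[symmetric] Let_def \<kappa>_def by blast
  qed
qed

context
  fixes w k L :: nat and x :: "bool list" and LS
  assumes L: "L = 3 * w + 6 + a" and LS: "LS = tuple_cls schs \<kappa> w k L x"
begin

lemma tuple_cls_good: "ls \<in> set LS \<Longrightarrow> good_lits (k + (\<kappa> + 2 * (w + 3))) k ls"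
proof -
  assume "ls \<in> set LS"
  then obtain i where ls: "ls = tuple_lits k (block_cl schs \<kappa> w x) (chunks L k (bits (L * k) i))"
    by (auto simp: LS tuple_cls_def tuple_cl_def)
  show ?thesis unfolding ls
  proof (rule good_tuple_lits)
    show "block_cl schs \<kappa> w x \<beta> \<noteq> [] \<and> distinct (block_cl schs \<kappa> w x \<beta>) \<and> (\<forall>l\<in>set (block_cl schs \<kappa> w x \<beta>). length (snd l) = \<kappa> + 2 * (w + 3))"
      if "\<beta> \<in> set (chunks L k (bits (L * k) i))" for \<beta>
    proof (rule block_cl_good)
      show "length \<beta> = 3 * w + 6 + a" using chunks_all[OF _ that] L by simp
    qed
  qed (simp add: chunks_def)
qed

lemma tuple_cls_length: "ls \<in> set LS \<Longrightarrow> length ls \<le> 5 * k"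
  using length_tuple_lits[of "block_cl schs \<kappa> w x" 5, OF length_block_cl] by (auto simp: LS tuple_cls_def tuple_cl_def)

text \<open>If the check passes, absence of the pattern defines an assignment under which some copy
  satisfies all its clauses, and the tableau yields an accepting run. Conversely an accepting run
  makes the instance feasible, so the approximation guarantee applies, and violation below
  \<open>k\<close> leaves a true literal in every tuple.\<close>

lemma decides:
  assumes f: "additive_approx zero_cost f g" and g: "g (2 ^ (L * k)) < real k"
  shows "(\<forall>ls\<in>set LS. \<exists>l\<in>set ls. holds (\<lambda>s. \<not> found (f (enc_tri (k + (\<kappa> + 2 * (w + 3))) k LS)) s) l) \<longleftrightarrow>
    (\<exists>us. length us = 2 ^ w \<and> fst ((sstep ^^ (2 ^ w)) (p, sinit2 x us)) = [])"
    (is "?check \<longleftrightarrow> ?acc")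
proof
  let ?W = "k + (\<kappa> + 2 * (w + 3))"
  let ?y = "enc_tri ?W k LS"
  let ?cl = "block_cl schs \<kappa> w x"
  assume ?check
  have "\<exists>j<k. \<forall>\<beta>\<in>{\<beta>. length \<beta> = L}. \<exists>l\<in>set (?cl \<beta>). holds (\<lambda>v. \<not> found (f ?y) (onehot k j @ v)) l"
  proof (rule tuple_lits_some_copy)
    fix \<tau> :: "bool list list" assume \<tau>: "length \<tau> = k" "set \<tau> \<subseteq> {\<beta>. length \<beta> = L}"
    then have lc: "length (concat \<tau>) = L * k"
    proof (induction \<tau> arbitrary: k)
      case (Cons b \<tau>)
      then have "length (concat \<tau>) = L * (k - 1)" by (intro Cons.IH) auto
      then show ?case using Cons.prems by (cases k) auto
    qed simp
    \<comment> \<open>A tuple of addresses is the number whose bits are their concatenation, so each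
      tuple is among the \<open>2 ^ (L * k)\<close> enumerated ones.\<close>
    have "chunks L k (bits (L * k) (unbits (concat \<tau>))) = \<tau>"
      using chunks_concat[of \<tau> L] \<tau> bits_unbits[of "concat \<tau>"] unfolding lc by auto
    moreover have "unbits (concat \<tau>) < 2 ^ (L * k)" using unbits_less[of "concat \<tau>"] unfolding lc .
    ultimately have "tuple_lits k ?cl \<tau> \<in> set LS" unfolding LS tuple_cls_def tuple_cl_def by force
    then show "\<exists>l\<in>set (tuple_lits k ?cl \<tau>). holds (\<lambda>s. \<not> found (f ?y) s) l" using \<open>?check\<close> by blast
  qed
  then obtain j where "\<forall>\<beta>. length \<beta> = 3 * w + 6 + a \<longrightarrow> (\<exists>l\<in>set (?cl \<beta>). holds (\<lambda>v. \<not> found (f ?y) (onehot k j @ v)) l)"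
    unfolding L by blast
  then show ?acc unfolding blocks_sat using tableau_sound[OF good p K S] by blast
next
  let ?W = "k + (\<kappa> + 2 * (w + 3))"
  let ?y = "enc_tri ?W k LS"
  let ?cl = "block_cl schs \<kappa> w x"
  let ?I = "tri_mcst ?W k LS"
  assume ?acc
  then obtain us where us: "length us = 2 ^ w" "fst ((sstep ^^ (2 ^ w)) (p, sinit2 x us)) = []" by blast
  from tableau_complete[OF good p K S us(2,1)] obtain A where A: "tableau_sat Q K S p w x A" by blast
  have "k \<le> length (filter (holds (\<lambda>s. A (drop k s))) ls)" if ls_in: "ls \<in> set LS" for ls
  proof -
    obtain i where ls: "ls = tuple_lits k ?cl (chunks L k (bits (L * k) i))"
      using ls_in by (auto simp: LS tuple_cls_def tuple_cl_def)
    show ?thesis unfolding ls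
    proof (rule tuple_lits_satisfied)
      show "\<exists>l\<in>set (?cl \<beta>). holds A l" if "\<beta> \<in> set (chunks L k (bits (L * k) i))" for \<beta>
        using A chunks_all[OF _ that] L unfolding blocks_sat[symmetric] by simp
    qed (simp add: chunks_def)
  qed
  then have "feasible ?I" using tuple_cls_good by (intro satisfied_feasible) auto
  moreover have "wf_mcst ?I" "encodes_instance ?y ?I" using tuple_cls_good by (auto intro!: wf_tri_mcst encodes_tri)
  moreover have "zero_cost ?I" by (simp add: zero_cost_def tri_mcst_def)
  ultimately obtain T where T: "encodes_edges (f ?y) T" "spanning_tree ?I T" "meets_bounds ?I T (g (length (constraints ?I)))"
    using f unfolding additive_approx_def by blast
  have "length (constraints ?I) = 2 ^ (L * k)" by (simp add: tri_mcst_def LS tuple_cls_def)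
  then have mb: "meets_bounds ?I T (g (2 ^ (L * k)))" using T(3) by simp
  obtain ts where ts: "set ts = T" "f ?y = enc_list enc_edge ts" using T(1) by (auto simp: encodes_edges_def lists_set_def)
  have "set ts \<subseteq> tri_edges ?W" using T(2) ts(1) by (simp add: spanning_tree_def tri_mcst_def)
  then have found: "found (f ?y) s \<longleftrightarrow> {0, va s} \<in> T" if "s \<in> names ?W" for s
    using occ_edge_iff[of ts ?W s] that ts unfolding found_def by simp
  show ?check
  proof
    fix ls assume ls: "ls \<in> set LS"
    from violation_small_satisfies[OF T(2) mb g ls tuple_cls_good[OF ls]]
    obtain l where l: "l \<in> set ls" "holds (\<lambda>s. {0, va s} \<notin> T) l" by blast
    have "snd l \<in> names ?W" using tuple_cls_good[OF ls] l(1) by (auto simp: good_lits_def)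
    then have "holds (\<lambda>s. \<not> found (f ?y) s) l" using l(2) found unfolding holds_def by simp
    then show "\<exists>l\<in>set ls. holds (\<lambda>s. \<not> found (f ?y) s) l" using l(1) by blast
  qed
qed

end

end

section \<open>Choice of the parameters\<close>

lemma computes_within_mono:
  "computes_within M f T \<Longrightarrow> (\<And>n. T n \<le> T' n) \<Longrightarrow> computes_within M f T'"
  unfolding computes_within_def by (meson order_trans)

lemma length_binary_log: "real (length (binary n)) \<le> log 2 (real n) + 1" if "n \<noteq> 0"
proof -
  have "(2::real) ^ length (binary n) \<le> 2 * real n"
    using length_binary_le[OF that] of_nat_mono[of "2 ^ length (binary n)" "2 * n"] by simp
  then have "log 2 (2 ^ length (binary n)) \<le> log 2 (2 * real n)" using that by (subst log_le_cancel_iff) auto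
  then show ?thesis using that by (simp add: log_mult log_nat_power)
qed

text \<open>A polynomial in \<open>2 ^ E n\<close> is \<open>2\<close> to the power of a linear
  function of \<open>E n\<close>, and \<open>E n\<close> is quadratic in the bit length of
  \<open>n\<close>. So the exponent 2 of the logarithm suffices.\<close>

lemma quasi_poly_bound:
  fixes E :: "nat \<Rightarrow> nat"
  assumes P: "polyb P" and E: "\<And>n. E n \<le> e * (D * (length (binary n) + 1))\<^sup>2"
  shows "\<exists>c. \<forall>n. real (2 * P (2 ^ E n) + 1) \<le> 2 powr (c * log 2 (real n) ^ 2 + c)"
proof -
  obtain C d where C: "\<And>n. P n \<le> C * Suc n ^ d" using P unfolding polyb_def by blast
  define c where "c = real (e * D\<^sup>2 * d) * 8 + real (2 * C + 1 + d)"
  have "real (2 * P (2 ^ E n) + 1) \<le> 2 powr (c * log 2 (real n) ^ 2 + c)" for n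
  proof -
    define l where "l = log 2 (real n)"
    have l0: "0 \<le> l" by (cases "n = 0") (simp add: l_def log_def, simp add: l_def)
    have len: "real (length (binary n)) + 1 \<le> l + 2"
      using length_binary_log[of n] l0 by (cases "n = 0") (auto simp: l_def)
    have "(real (length (binary n)) + 1)\<^sup>2 \<le> (l + 2)\<^sup>2" using len by (intro power_mono) auto
    also have "\<dots> \<le> 2 * l\<^sup>2 + 8"
    proof -
      \<comment> \<open>Expanding this square bounds the cross term \<open>4 * l\<close> by
        \<open>l\<close> squared plus 4, which leaves an exponent without a linear part.\<close>
      have "0 \<le> (l - 2)\<^sup>2" by simp
      then show ?thesis by (simp add: power2_eq_square algebra_simps)
    qed
    finally have sq: "(real (length (binary n)) + 1)\<^sup>2 \<le> 2 * l\<^sup>2 + 8" .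
    have "real (E n) \<le> real (e * (D * (length (binary n) + 1))\<^sup>2)" using E of_nat_mono by blast
    also have "\<dots> = real (e * D\<^sup>2) * (real (length (binary n)) + 1)\<^sup>2"
      by (simp only: of_nat_mult of_nat_power of_nat_add of_nat_1 power_mult_distrib mult.assoc)
    also have "\<dots> \<le> real (e * D\<^sup>2) * (2 * l\<^sup>2 + 8)" using sq by (intro mult_left_mono) auto
    finally have En: "real (E n) \<le> real (e * D\<^sup>2) * (2 * l\<^sup>2 + 8)" .
    let ?G = "2 * C + 1 + (E n + 1) * d"
    have "Suc (2 ^ E n) \<le> 2 ^ (E n + 1)" by simp
    then have "Suc (2 ^ E n) ^ d \<le> 2 ^ ((E n + 1) * d)" unfolding power_mult by (rule power_mono) simp
    then have "P (2 ^ E n) \<le> C * 2 ^ ((E n + 1) * d)" using C[of "2 ^ E n"] by (meson mult_le_mono2 order_trans)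
    then have "2 * P (2 ^ E n) + 1 \<le> 2 * C * 2 ^ ((E n + 1) * d) + 1" by simp
    also have "\<dots> \<le> 2 ^ (2 * C) * 2 ^ ((E n + 1) * d) + 2 ^ (2 * C) * 2 ^ ((E n + 1) * d)"
      using less_exp[of "2 * C"] by (intro add_mono mult_right_mono) (auto simp: Suc_le_eq)
    also have "\<dots> = 2 ^ ?G" by (simp add: power_add)
    finally have "real (2 * P (2 ^ E n) + 1) \<le> real (2 ^ ?G)" using of_nat_mono by blast
    also have "\<dots> = 2 powr real ?G" by (subst powr_realpow) simp_all
    also have "\<dots> \<le> 2 powr (c * l ^ 2 + c)"
    proof (rule powr_mono)
      have "real ?G = real (2 * C + 1 + d) + real d * real (E n)" by (simp add: algebra_simps)
      also have "\<dots> \<le> real (2 * C + 1 + d) + real d * (real (e * D\<^sup>2) * (2 * l\<^sup>2 + 8))"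
        using En by (intro add_left_mono mult_left_mono) auto
      also have "\<dots> = real (2 * C + 1 + d) + real (e * D\<^sup>2 * d) * 8 + real (e * D\<^sup>2 * d) * 2 * l\<^sup>2" by (simp add: algebra_simps)
      also have "\<dots> \<le> c + c * l\<^sup>2"
      proof -
        have "real (e * D\<^sup>2 * d) * 2 \<le> c" by (simp add: c_def)
        then have "real (e * D\<^sup>2 * d) * 2 * l\<^sup>2 \<le> c * l\<^sup>2" by (intro mult_right_mono) auto
        then show ?thesis by (simp add: c_def)
      qed
      finally show "real ?G \<le> c * l ^ 2 + c" by simp
    qed simp
    finally show ?thesis unfolding l_def .
  qed
  then show ?thesis by blast
qed

text \<open>Up to the factor \<open>ln 2\<close>, \<open>ln m\<close> is \<open>L * k\<close>, at
  most \<open>(9 + a) * w * k\<close> for \<open>w > 0\<close>, whereas \<open>k\<close> squared is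
  \<open>D * w * k\<close>. Both are of the same order, which is what the exponent 1/2 allows, and
  \<open>D\<close> decides the comparison.\<close>

lemma sqrt_log_bound:
  assumes g: "g \<in> O(\<lambda>m. ln (real m) powr (1 / 2))"
  shows "\<exists>D>0. \<forall>w k L. 0 < w \<and> k = D * w \<and> L = 3 * w + 6 + a \<longrightarrow> g (2 ^ (L * k)) < real k"
proof -
  obtain C where C: "C > 0" "eventually (\<lambda>m. norm (g m) \<le> C * norm (ln (real m) powr (1 / 2))) at_top"
    using g by (elim landau_o.bigE)
  then obtain m0 where m0: "\<And>m. m0 \<le> m \<Longrightarrow> norm (g m) \<le> C * norm (ln (real m) powr (1 / 2))"
    unfolding eventually_at_top_linorder by blast
  \<comment> \<open>The threshold for \<open>D\<close>: the constant of the O-bound squared, times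
    the bound \<open>9 + a\<close> on \<open>L / w\<close>.\<close>
  define q where "q = C\<^sup>2 * real (9 + a)"
  \<comment> \<open>Adding \<open>m0\<close> guarantees that the number of constraints, at least
    \<open>L * k\<close>, lies in the range where the O-bound is valid.\<close>
  define D where "D = nat \<lceil>q\<rceil> + m0 + 1"
  have qD: "q < real D" unfolding D_def by linarith
  have "g (2 ^ (L * k)) < real k" if w: "0 < w" and k: "k = D * w" and L: "L = 3 * w + 6 + a" for w k L
  proof -
    have "D * 1 \<le> D * w" using w by (intro mult_left_mono) auto
    then have k0: "0 < k" "D \<le> k" "0 < L" using w k L by (auto simp: D_def)
    have "m0 \<le> L * k"
    proof -
      have "1 * D \<le> L * k" using k0 by (intro mult_mono) auto
      then show ?thesis by (simp add: D_def)
    qed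
    also have "\<dots> \<le> 2 ^ (L * k)" using less_exp[of "L * k"] by simp
    finally have "norm (g (2 ^ (L * k))) \<le> C * norm (ln (real (2 ^ (L * k))) powr (1 / 2))" by (rule m0)
    also have "\<dots> = C * sqrt (real (L * k) * ln 2)"
      by (simp add: powr_half_sqrt ln_realpow)
    also have "\<dots> \<le> C * sqrt (real (L * k))"
    proof -
      have "ln 2 \<le> (1::real)" using ln_le_minus_one[of 2] by simp
      then have "real (L * k) * ln 2 \<le> real (L * k) * 1" by (intro mult_left_mono) auto
      then show ?thesis using C(1) by simp
    qed
    also have "\<dots> < real k"
    proof -
      have "L \<le> (9 + a) * w" using w unfolding L by (cases w) auto
      then have "real L \<le> real (9 + a) * real w" by (metis of_nat_mono of_nat_mult)
      then have "C\<^sup>2 * real (L * k) \<le> C\<^sup>2 * ((real (9 + a) * real w) * real k)"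
        unfolding of_nat_mult by (intro mult_left_mono mult_right_mono) auto
      also have "\<dots> = q * (real w * real k)" by (simp add: q_def)
      also have "\<dots> < real D * (real w * real k)" using qD w k0 by (intro mult_strict_right_mono) auto
      also have "\<dots> = (real k)\<^sup>2" by (simp add: k power2_eq_square)
      finally have "sqrt (C\<^sup>2 * real (L * k)) < sqrt ((real k)\<^sup>2)" by (rule real_sqrt_less_mono)
      then show ?thesis using C(1) by (simp add: real_sqrt_mult)
    qed
    finally show ?thesis by simp
  qed
  moreover have "0 < D" by (simp add: D_def)
  ultimately show ?thesis by blast
qed

text \<open>With \<open>l\<close> the bit length of the input length, \<open>Suc (length x)\<close>
  is at most \<open>2 ^ l\<close>. So \<open>C + b + 1\<close> times \<open>l + 1\<close> is an
  exponent large enough to dominate the polynomial \<open>C * Suc n ^ b\<close>, while the width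
  remains logarithmic.\<close>

lemma NP_width:
  assumes "L \<in> NP"
  shows "\<exists>K S p D. 3 \<le> K \<and> 3 \<le> S \<and> wfp K S p \<and> 0 < D \<and> (\<forall>x. x \<in> L \<longleftrightarrow>
    (\<exists>us. length us = 2 ^ (D * (length (binary (length x)) + 1)) \<and>
      fst ((sstep ^^ (2 ^ (D * (length (binary (length x)) + 1)))) (p, sinit2 x us)) = []))"
proof -
  obtain V c d where Vc: "poly_time (decider V) \<and> (\<forall>x. x \<in> L \<longleftrightarrow> (\<exists>w. length w \<le> c * length x ^ d + c \<and> enc_bits x @ enc_bits w \<in> V))"
    using assms unfolding NP_def mem_Collect_eq by (elim exE) (rule that)
  note V = conjunct1[OF Vc] and L = spec[OF conjunct2[OF Vc]]
  obtain M a e where M: "wf_tm M" "computes_within M (decider V) (\<lambda>n. a * real n ^ e + a)"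
    using V unfolding poly_time_def by blast
  from np_prog_correct[OF M L] obtain B where B0: "polyb B \<and>
    (\<forall>x N. B (length x) \<le> N \<longrightarrow> (x \<in> L \<longleftrightarrow> (\<exists>us. length us = N \<and> fst ((sstep ^^ N) (np_prog M c d, sinit2 x us)) = [])))"
    by (elim exE) (rule that)
  note B = conjunct1[OF B0] conjunct2[OF B0, rule_format]
  obtain C b where C: "\<And>n. B n \<le> C * Suc n ^ b" using B(1) unfolding polyb_def by blast
  let ?D = "C + b + 1"
  have "B (length x) \<le> 2 ^ (?D * (length (binary (length x)) + 1))" for x :: "bool list"
  proof -
    let ?l = "length (binary (length x))"
    have "Suc (length x) \<le> 2 ^ ?l" using le_pow2_length_binary[of "length x"] by simp
    then have "Suc (length x) ^ b \<le> 2 ^ (?l * b)" unfolding power_mult by (rule power_mono) simp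
    then have "C * Suc (length x) ^ b \<le> 2 ^ C * 2 ^ (?l * b)" using less_exp[of C] by (intro mult_mono) auto
    also have "\<dots> = 2 ^ (C + ?l * b)" by (simp add: power_add)
    also have "\<dots> \<le> 2 ^ (?D * (?l + 1))" by (intro power_increasing) (auto simp: algebra_simps)
    finally show ?thesis using C[of "length x"] by simp
  qed
  note * = B(2)[OF this]
  show ?thesis
    by (intro exI[of _ "11 + 2 * ntapes M"] exI[of _ "6 + nstates M + nsyms M"] exI[of _ "np_prog M c d"] exI[of _ ?D] conjI allI
        wfp_np_prog[OF M(1)] *) simp_all
qed

lemma approx_decides_NP:
  assumes f: "poly_time f" and approx: "additive_approx zero_cost f g" and g: "g \<in> O(\<lambda>m. ln (real m) powr (1 / 2))"
    and NP: "A \<in> NP"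
  shows "A \<in> QP"
proof -
  obtain K S p D1 where K: "3 \<le> K" and S: "3 \<le> S" and p: "wfp K S p" and D1: "0 < D1"
    and A': "\<forall>x. x \<in> A \<longleftrightarrow> (\<exists>us. length us = 2 ^ (D1 * (length (binary (length x)) + 1)) \<and>
      fst ((sstep ^^ (2 ^ (D1 * (length (binary (length x)) + 1)))) (p, sinit2 x us)) = [])"
    using NP_width[OF NP] by (elim exE conjE) (rule that)
  note A = spec[OF A']
  obtain R where R: "good_states K S R" "p \<in> R" using good_states_exist[OF p] by blast
  have "finite R" using R(1) by (simp add: good_states_def)
  then obtain Q where Q: "set Q = R" using finite_list by blast
  have good: "good_states K S (set Q)" "p \<in> set Q" using R Q by auto
  define schs where "schs = sym_schemas Q K S p"
  define \<kappa> where "\<kappa> = kwidth Q K S"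
  define a where "a = schema_bits Q K S p"
  obtain D2 where D2: "0 < D2" "\<forall>w k L. 0 < w \<and> k = D2 * w \<and> L = 3 * w + 6 + a \<longrightarrow> g (2 ^ (L * k)) < real k"
    using sqrt_log_bound[OF g, of a] by (elim exE conjE) (rule that)
  obtain M cf d where M: "wf_tm M" "computes_within M f (\<lambda>n. cf * real n ^ d + cf)"
    using f unfolding poly_time_def by blast
  define F where "F n = 2 * nat \<lceil>\<bar>cf\<bar>\<rceil> * Suc n ^ d" for n
  \<comment> \<open>The bound for simulation and check: the factor 4 comes from the output length in
    \<open>ex_sim\<close>, \<open>5 * Z\<close> covers tuples with at most five literals per clause,
    and both together with 10 cover the length of the search pattern.\<close>
  define Z2 where "Z2 Z = 4 * F (write_cost Z) + write_cost Z + 5 * Z + 10" for Z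
  define P where "P Z = Z2 Z * (6 * ntapes M + 60) + Z2 Z * (Z2 Z * lit_cost (Z2 Z) + 4 * Z2 Z + 10) + 6 * ntapes M + 60" for Z
  have "polyb (\<lambda>Z. F (write_cost Z))" unfolding F_def
    by (intro polyb_mult polyb_power polyb_const polyb_Suc polyb_write_cost)
  then have "polyb Z2" unfolding Z2_def[abs_def]
    by (intro polyb_add polyb_mult polyb_const polyb_write_cost polyb_id)
  then have polyP: "polyb P" unfolding P_def[abs_def] lit_cost_def
    by (intro polyb_add polyb_mult polyb_const)
  define w where "w n = D1 * (length (binary n) + 1)" for n
  define k where "k n = D2 * w n" for n
  define L where "L n = 3 * w n + 6 + a" for n
  define W where "W n = k n + (\<kappa> + 2 * (w n + 3))" for n
  \<comment> \<open>\<open>2 ^ E n\<close> will be the common bound \<open>Z\<close>: it dominates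
    the number \<open>2 ^ (L n * k n)\<close> of tuples, the number \<open>2 ^ W n\<close> of names,
    and the parameters themselves, while \<open>E n\<close> is only quadratic in
    \<open>w n\<close>.\<close>
  define E where "E n = L n * k n + W n + D1 + D2 + 4" for n
  have w1: "1 \<le> w n" for n using D1 by (simp add: w_def)
  have "E n \<le> ((9 + a) * D2 + D2 + \<kappa> + 8 + D1 + D2 + 4) * (D1 * (length (binary n) + 1))\<^sup>2" for n
  proof -
    have w2: "w n \<le> (w n)\<^sup>2" "1 \<le> (w n)\<^sup>2" using w1[of n] by (auto simp: power2_eq_square)
    have "L n \<le> (9 + a) * w n" using w1[of n] unfolding L_def by (cases "w n") auto
    then have "L n * k n \<le> ((9 + a) * w n) * k n" by (rule mult_right_mono) simp
    also have "\<dots> = (9 + a) * D2 * (w n)\<^sup>2" by (simp add: k_def power2_eq_square)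
    finally have 1: "L n * k n \<le> (9 + a) * D2 * (w n)\<^sup>2" .
    have 2: "k n \<le> D2 * (w n)\<^sup>2" unfolding k_def using w2 by (intro mult_left_mono) auto
    have 3: "\<kappa> + 6 + D1 + D2 + 4 \<le> (\<kappa> + 6 + D1 + D2 + 4) * (w n)\<^sup>2" using mult_le_mono2[OF w2(2)] by (metis mult.right_neutral)
    have "E n = L n * k n + k n + 2 * w n + (\<kappa> + 6 + D1 + D2 + 4)" by (simp add: E_def W_def)
    also have "\<dots> \<le> (9 + a) * D2 * (w n)\<^sup>2 + D2 * (w n)\<^sup>2 + 2 * (w n)\<^sup>2 + (\<kappa> + 6 + D1 + D2 + 4) * (w n)\<^sup>2"
      using 1 2 3 w2(1) by (intro add_mono) auto
    also have "\<dots> = ((9 + a) * D2 + D2 + 2 + (\<kappa> + 6 + D1 + D2 + 4)) * (w n)\<^sup>2" by (simp only: add_mult_distrib)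
    also have "(9 + a) * D2 + D2 + 2 + (\<kappa> + 6 + D1 + D2 + 4) = (9 + a) * D2 + D2 + \<kappa> + 8 + D1 + D2 + 4" by simp
    finally show ?thesis unfolding w_def .
  qed
  from quasi_poly_bound[OF polyP this] obtain c where c: "\<And>n. real (2 * P (2 ^ E n) + 1) \<le> 2 powr (c * log 2 (real n) ^ 2 + c)"
    by (elim exE) (rule that, rule spec)
  let ?prog = "main_prog M schs \<kappa> a D1 D2"
  have "\<exists>\<sigma>'. ex ?prog (P (2 ^ E (length x))) (sinit x) \<sigma>' \<and> \<sigma>' 1 = [] \<and> top0 (\<sigma>' 2) = bsym (x \<in> A)" for x
  proof -
    let ?n = "length x"
    let ?w = "w ?n" and ?k = "k ?n" and ?L = "L ?n" and ?W = "W ?n"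
    define Z :: nat where "Z = 2 ^ E ?n"
    define LS where "LS = tuple_cls schs \<kappa> ?w ?k ?L x"
    define y where "y = enc_tri ?W ?k LS"
    have k1: "1 \<le> ?k" using w1[of ?n] D2(1) by (simp add: k_def)
    have le: "i \<le> Z" if "i \<le> E ?n" for i unfolding Z_def by (rule order_trans[OF that less_imp_le[OF less_exp]])
    have pw: "2 ^ i \<le> Z" if "i \<le> E ?n" for i using that by (simp add: Z_def)
    have "?L \<le> ?L * ?k" using k1 by simp
    moreover have LkE: "?L * ?k \<le> E ?n" by (simp add: E_def)
    ultimately have "?L \<le> E ?n" by linarith
    moreover have "?k \<le> E ?n" "?W \<le> E ?n" "?w + 2 \<le> E ?n" "D1 \<le> E ?n" "D2 \<le> E ?n" by (simp_all add: E_def W_def)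
    ultimately have LE: "?L * ?k \<le> E ?n" "?L \<le> E ?n" "?k \<le> E ?n" "?W \<le> E ?n" "?w + 2 \<le> E ?n" "D1 \<le> E ?n" "D2 \<le> E ?n"
      using LkE by blast+
    have "?w = D1 * length (binary ?n) + D1" by (simp add: w_def)
    moreover have "1 * length (binary ?n) \<le> D1 * length (binary ?n)" using D1 by (intro mult_right_mono) auto
    ultimately have bw: "length (binary ?n) \<le> ?w" by linarith
    have nZ: "?n \<le> Z"
    proof -
      have "?n < 2 ^ length (binary ?n)" by (rule le_pow2_length_binary)
      also have "\<dots> \<le> Z" using bw LE(5) by (intro pw) simp
      finally show ?thesis by simp
    qed
    have w3: "2 ^ ?w + 3 \<le> Z"
    proof -
      have "2 ^ ?w + 3 \<le> (2::nat) ^ (?w + 2)" by simp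
      also have "\<dots> \<le> Z" using LE(5) by (rule pw)
      finally show ?thesis .
    qed
    note sel_schs = sel_schs[OF good K S, folded schs_def]
    have out: "ex (write_prog schs \<kappa> a D1 D2) (write_cost Z) (sinit x)
        ((param_store x ?w ?k)(7 := rsym y, 8 := concat (map seg (rev LS))))"
      unfolding y_def
      by (rule ex_write_prog[where L = ?L])
        (use nZ w3 le pw LE bw sel_schs(1,2) in \<open>simp_all add: w_def k_def L_def W_def LS_def\<close>)
    obtain t where t: "real t \<le> cf * real (length y) ^ d + cf" "fst (run M y t) = 1" "fst (snd (run M y t) ! 1) = bit_tape (f y)"
      using M(2) unfolding computes_within_def by blast
    have "length y \<le> write_cost Z" using ex_length[OF out, of 7] by (simp add: sinit_def)
    from real_poly_bound[OF t(1) this] have tF: "t \<le> F (write_cost Z)" by (simp add: F_def)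
    note tcl = tuple_cls_length[OF good K S, folded schs_def \<kappa>_def a_def, OF L_def[of ?n] LS_def]
    note tcg = tuple_cls_good[OF good K S, folded schs_def \<kappa>_def a_def, OF L_def[of ?n] LS_def]
    have gk: "g (2 ^ (?L * ?k)) < real ?k"
      by (rule D2(2)[rule_format, of ?w]) (use w1[of ?n] in \<open>simp add: k_def L_def\<close>)
    have dec: "(\<forall>ls\<in>set LS. \<exists>l\<in>set ls. holds (\<lambda>s. \<not> found (f y) s) l) \<longleftrightarrow> x \<in> A"
      unfolding y_def W_def A w_def[symmetric]
      by (rule decides[OF good K S, folded schs_def \<kappa>_def a_def, OF L_def[of ?n] LS_def approx gk])
    have "\<exists>\<sigma>'. ex ?prog (P Z) (sinit x) \<sigma>' \<and> \<sigma>' 1 = [] \<and> top0 (\<sigma>' 2) = bsym (\<forall>ls\<in>set LS. \<exists>l\<in>set ls. holds (\<lambda>s. \<not> found (f y) s) l)"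
      unfolding P_def
    proof (rule ex_main_prog[OF out M(1) t(2,3)])
      show "4 * t + write_cost Z \<le> Z2 Z" using tF by (simp add: Z2_def)
      have kZ: "?k \<le> Z" "?W \<le> Z" using le LE by auto
      show "\<forall>ls\<in>set LS. length ls \<le> Z2 Z \<and> (\<forall>l\<in>set ls. 2 * length (snd l) + 10 \<le> Z2 Z)"
      proof (intro ballI conjI)
        fix ls assume ls: "ls \<in> set LS"
        show "length ls \<le> Z2 Z" using tcl[OF ls] kZ by (simp add: Z2_def)
        fix l assume "l \<in> set ls"
        then have "length (snd l) = ?W" using tcg[OF ls] by (auto simp: good_lits_def names_def W_def)
        then show "2 * length (snd l) + 10 \<le> Z2 Z" using kZ by (simp add: Z2_def)
      qed
      have "length LS \<le> Z" using pw[OF LE(1)] by (simp add: LS_def tuple_cls_def)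
      then show "length LS \<le> Z2 Z" by (simp add: Z2_def)
    qed
    then show ?thesis unfolding dec unfolding Z_def .
  qed
  moreover have "wfp (32 + 2 * ntapes M) (6 + nstates M + nsyms M) ?prog"
    by (rule wfp_main_prog) (use M(1) in auto)
  ultimately obtain N where N: "wf_tm N" "computes_within N (decider A) (\<lambda>n. real (2 * P (2 ^ E n) + 1))"
    using compile_program[of "32 + 2 * ntapes M" "6 + nstates M + nsyms M" ?prog "\<lambda>n. P (2 ^ E n)" A] by auto
  have "computes_within N (decider A) (\<lambda>n. 2 powr (c * log 2 (real n) ^ 2 + c))"
    by (rule computes_within_mono[OF N(2) c])
  with N(1) show ?thesis unfolding QP_def quasi_poly_time_def by blast
qed

theorem theorem2:
  shows "\<exists>\<alpha>::real. \<alpha> > 0 \<and>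
    (\<not> NP \<subseteq> QP \<longrightarrow>
       \<not> has_poly_time_approx (\<lambda>I. True) (\<lambda>m. ln (real m) powr \<alpha>) \<and>
       \<not> has_poly_time_approx zero_cost (\<lambda>m. ln (real m) powr \<alpha>))"
proof (intro exI[of _ "1 / 2"] conjI impI)
  assume not_QP: "\<not> NP \<subseteq> QP"
  show zero: "\<not> has_poly_time_approx zero_cost (\<lambda>m. ln (real m) powr (1 / 2))"
    using not_QP approx_decides_NP unfolding has_poly_time_approx_def by blast
  \<comment> \<open>An algorithm for all instances also handles those without costs, so the
    restricted statement is the stronger one.\<close>
  show "\<not> has_poly_time_approx (\<lambda>I. True) (\<lambda>m. ln (real m) powr (1 / 2))"
    using zero unfolding has_poly_time_approx_def additive_approx_def by blast
qed simp

end
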